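(* Let $n\ge3$ and let $F:M^n\to\mathbb{A}^{n+1}$ be a strictly locally convex improper affine sphere having a pointwise $SO(n-1)$ symmetry whose function $r$ (see context) vanishes nowhere. Then, locally and in suitable local coordinates $(t,\vec u)$, with $t$ in an open interval and $\vec u$ in an open subset of $\mathbb{R}^{n-1}$, $F$ is affine congruent to one of the following: 1. $F(t,\vec u)=(\gamma_1(t)\phi(\vec u),\gamma_2(t))$, where $\phi$ is the immersion of an $\epsilon$-quadric in $\mathbb{R}^n$ with $\epsilon\neq0$, and $\gamma=(\gamma_1,\gamma_2)$ satisfies $$c\,\dot\gamma_1^{n+2}\gamma_1^{n-1}=\dot\gamma_2^{n-1}(\ddot\gamma_1\dot\gamma_2-\ddot\gamma_2\dot\gamma_1)$$ for some constant $c\in\mathbb{R}\setminus\{0\}$. 2. $F(t,\vec u)=\left(\gamma_1(t)\vec u,\ \gamma_1(t)\frac{\|\vec u\|^2}{2}+\gamma_2(t),\ \gamma_1(t)\right)$ with $(\gamma_1(t),\gamma_2(t))=(t,ct^{n+1})$ for some $c\in\mathbb{R}\setminus\{0\}$. 3. $F(t,\vec u)=\left(\vec u,\ \frac{\|\vec u\|^2}{2}+\gamma_1(t),\ \gamma_2(t)\right)$ with $(\gamma_1(t),\gamma_2(t))=(ct^n,t^{n+1})$ for some $c\in\mathbb{R}\setminus\{0\}$.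
   Context: $\mathbb{A}^{n+1}$ is $\mathbb{R}^{n+1}$ with its flat connection $D$ and the determinant as volume form. For an immersed hypersurface with transversal vector field $\xi$ write $D_XY=\nabla_XY+h(X,Y)\xi$, $D_X\xi=-SX+\tau(X)\xi$, and $\omega(X_1,\dots,X_n)=\det(X_1,\dots,X_n,\xi)$. If $h$ is non-degenerate, the affine normal is the transversal field $\xi$, unique up to sign, with $\nabla\omega=0$ (equivalently $\tau=0$) and $\omega(X_1,\dots,X_n)^2=|\det(h(X_i,X_j))|$ for tangent frames. The hypersurface is strictly locally convex when $h$ is definite, and the sign of $\xi$ is then chosen so that $h$ is positive definite. With this $\xi$, $h$ is the affine metric, $S$ the shape operator, $\nabla$ the Blaschke connection, $\hat\nabla$ the Levi-Civita connection of $h$, and $K(X,Y)=\nabla_XY-\hat\nabla_XY$ the difference tensor. An affine sphere is a hypersurface with $S=\lambda\,\mathrm{Id}$; it is improper when $S=0$ (the affine normals are parallel). Pointwise $SO(n-1)$ symmetry: at every $p\in M$ there is an $h$-unit vector $X_1\in T_pM$ such that every linear $g:T_pM\to T_pM$ with $gX_1=X_1$ which restricts to an element of $SO(\langle X_1\rangle^\perp)$ satisfies $S(gX)=gS(X)$ and $K(gX,gY)=gK(X,Y)$ for all $X,Y\in T_pM$. The function $r$: in an $h$-orthonormal frame $X_1,\dots,X_n$ with $X_1$ the axis of symmetry, $K(X_1,X_1)=(n-1)rX_1$, $K(X_1,X_i)=-rX_i$, $K(X_i,X_j)=-r\delta_{ij}X_1$ for $i,j\ge2$. It is a standing assumption that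 $r$ vanishes nowhere, with $X_1$ chosen so that $r>0$; then $X_1$ and $r$ are smooth. For $\epsilon=\pm1$, an $\epsilon$-quadric in $\mathbb{R}^n$ is a convex quadratic hypersurface of affine mean curvature $\epsilon$, centred at the origin: up to an equi-affine linear transformation it is an open part of the unit sphere ($\epsilon=1$), or of one sheet of $x_1^2+\dots+x_{n-1}^2-x_n^2=-1$ ($\epsilon=-1$). Affine congruent means equal up to an affine transformation of $\mathbb{A}^{n+1}$. Dots denote derivatives with respect to $t$. *)

theory Defs
  imports "HOL-Analysis.Analysis"
begin

text \<open>
  If n is the cardinality of the finite type 'n, then R^n is the type (real, 'n) vec, and R^(n+1)
  is the type of real vectors indexed by 'n option, where None is the index of the last coordinate.
  The function \<open>snoc\<close> appends a last entry; its entries may themselves be vectors, so that it also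
  appends a last row to a matrix.
\<close>

definition snoc :: "'a ^ 'n \<Rightarrow> 'a \<Rightarrow> 'a ^ 'n option" where
  "snoc v a = (\<chi> i. case i of None \<Rightarrow> a | Some j \<Rightarrow> v $ j)"


subsection \<open>Smooth maps and smooth manifolds\<close>

text \<open>The set \<open>S\<close> is meant to be open: all iterated directional derivatives exist and are
  (Frechet) differentiable, hence continuous, on \<open>S\<close>.\<close>

primrec Ck_on :: "nat \<Rightarrow> 'a::euclidean_space set \<Rightarrow> ('a \<Rightarrow> 'b::real_normed_vector) \<Rightarrow> bool" where
  "Ck_on 0 S f \<longleftrightarrow> continuous_on S f"
| "Ck_on (Suc k) S f \<longleftrightarrow> (\<forall>x\<in>S. f differentiable (at x)) \<and>
     (\<forall>v. Ck_on k S (\<lambda>x. frechet_derivative f (at x) v))"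

definition smooth_on :: "'a::euclidean_space set \<Rightarrow> ('a \<Rightarrow> 'b::real_normed_vector) \<Rightarrow> bool" where
  "smooth_on S f \<longleftrightarrow> (\<forall>k. Ck_on k S f)"

definition immersion_on :: "'a::euclidean_space set \<Rightarrow> ('a \<Rightarrow> 'b::real_normed_vector) \<Rightarrow> bool" where
  "immersion_on S f \<longleftrightarrow> smooth_on S f \<and> (\<forall>x\<in>S. inj (frechet_derivative f (at x)))"

text \<open>A chart is a pair of its domain and its coordinate map. The manifold is the whole type 'm;
  the atlas need not be maximal.\<close>

type_synonym ('m, 'n) chart = "'m set \<times> ('m \<Rightarrow> real ^ 'n)"

definition smooth_atlas ::
  "('m::{t2_space,second_countable_topology}, 'n::finite) chart set \<Rightarrow> bool" where
  "smooth_atlas A \<longleftrightarrow>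
     (\<Union>(U, \<phi>)\<in>A. U) = UNIV \<and>
     (\<forall>(U, \<phi>)\<in>A. open U \<and> open (\<phi> ` U) \<and> homeomorphism U (\<phi> ` U) \<phi> (inv_into U \<phi>)) \<and>
     (\<forall>(U, \<phi>)\<in>A. \<forall>(V, \<psi>)\<in>A. smooth_on (\<phi> ` (U \<inter> V)) (\<psi> \<circ> inv_into U \<phi>))"

text \<open>\<open>\<psi>\<close> is (the inverse of) a local coordinate system on the manifold, with coordinates ranging
  over the open set \<open>D\<close>.\<close>

definition local_coordinates ::
  "('m::{t2_space,second_countable_topology}, 'n::finite) chart set \<Rightarrow>
   'd::euclidean_space set \<Rightarrow> ('d \<Rightarrow> 'm) \<Rightarrow> bool" where
  "local_coordinates A D \<psi> \<longleftrightarrow>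
     open D \<and> open (\<psi> ` D) \<and> homeomorphism D (\<psi> ` D) \<psi> (inv_into D \<psi>) \<and>
     (\<forall>(U, \<phi>)\<in>A. smooth_on (D \<inter> \<psi> -` U) (\<phi> \<circ> \<psi>) \<and>
                 smooth_on (\<phi> ` (U \<inter> \<psi> ` D)) (inv_into D \<psi> \<circ> inv_into U \<phi>))"


subsection \<open>Hypersurfaces in a chart\<close>

text \<open>
  In this section \<open>f\<close> is an immersion of an open subset of R^n into affine (n+1)-space, \<open>\<xi>\<close> a
  transversal field along \<open>f\<close>, and \<open>x\<close> a point of the domain; tangent vectors at \<open>x\<close> are elements
  of R^n, and \<open>frechet_derivative f (at x)\<close> identifies them with vectors of the affine space.
  A tangent vector is also regarded as the constant vector field with that value. Connections are
  given by their Christoffel symbols, i.e. by their values on pairs of constant vector fields;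
  the difference of two of them is the difference tensor.
\<close>

text \<open>\<open>flat_D f x X Y\<close> is \<open>D\<^sub>X Y\<close> at \<open>x\<close>.\<close>

definition flat_D :: "(real ^ 'n \<Rightarrow> real ^ 'n option) \<Rightarrow> real ^ 'n \<Rightarrow> real ^ 'n \<Rightarrow> real ^ 'n \<Rightarrow>
    real ^ ('n::finite) option" where
  "flat_D f x X Y = frechet_derivative (\<lambda>y. frechet_derivative f (at y) Y) (at x) X"

definition transversal_on :: "(real ^ 'n) set \<Rightarrow> (real ^ 'n \<Rightarrow> real ^ 'n option) \<Rightarrow>
    (real ^ 'n \<Rightarrow> real ^ ('n::finite) option) \<Rightarrow> bool" where
  "transversal_on \<Omega> f \<xi> \<longleftrightarrow>
     smooth_on \<Omega> \<xi> \<and> (\<forall>x\<in>\<Omega>. \<xi> x \<notin> range (frechet_derivative f (at x)))"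

text \<open>The components in \<open>D\<^sub>X Y = \<nabla>\<^sub>X Y + h(X, Y) \<xi>\<close> and \<open>D\<^sub>X \<xi> = - S X + \<tau>(X) \<xi>\<close>, well defined
  because \<open>f\<close> is an immersion and \<open>\<xi>\<close> is transversal.\<close>

definition induced_conn :: "(real ^ 'n \<Rightarrow> real ^ 'n option) \<Rightarrow> (real ^ 'n \<Rightarrow> real ^ 'n option) \<Rightarrow>
    real ^ 'n \<Rightarrow> real ^ 'n \<Rightarrow> real ^ 'n \<Rightarrow> real ^ ('n::finite)" where
  "induced_conn f \<xi> x X Y =
     (THE Z. \<exists>a. flat_D f x X Y = frechet_derivative f (at x) Z + a *\<^sub>R \<xi> x)"

definition affine_form :: "(real ^ 'n \<Rightarrow> real ^ 'n option) \<Rightarrow> (real ^ 'n \<Rightarrow> real ^ 'n option) \<Rightarrow>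
    real ^ 'n \<Rightarrow> real ^ 'n \<Rightarrow> real ^ ('n::finite) \<Rightarrow> real" where
  "affine_form f \<xi> x X Y =
     (THE a. \<exists>Z. flat_D f x X Y = frechet_derivative f (at x) Z + a *\<^sub>R \<xi> x)"

definition shape_op :: "(real ^ 'n \<Rightarrow> real ^ 'n option) \<Rightarrow> (real ^ 'n \<Rightarrow> real ^ 'n option) \<Rightarrow>
    real ^ 'n \<Rightarrow> real ^ 'n \<Rightarrow> real ^ ('n::finite)" where
  "shape_op f \<xi> x X =
     (THE Z. \<exists>a. frechet_derivative \<xi> (at x) X = - frechet_derivative f (at x) Z + a *\<^sub>R \<xi> x)"

text \<open>\<open>\<omega>(X\<^sub>1, \<dots>, X\<^sub>n) = det (X\<^sub>1, \<dots>, X\<^sub>n, \<xi>)\<close>; the rows of \<open>X\<close> are the \<open>X\<^sub>i\<close>.\<close>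

definition induced_vol :: "(real ^ 'n \<Rightarrow> real ^ 'n option) \<Rightarrow> (real ^ 'n \<Rightarrow> real ^ 'n option) \<Rightarrow>
    real ^ 'n \<Rightarrow> real ^ 'n ^ 'n \<Rightarrow> real" where
  "induced_vol f \<xi> x X = det (snoc (\<chi> i. frechet_derivative f (at x) (X $ i)) (\<xi> x))"

text \<open>The second conjunct is \<open>\<nabla>\<omega> = 0\<close>:
  \<open>Y(\<omega>(X\<^sub>1, \<dots>, X\<^sub>n)) = \<Sum>\<^sub>i \<omega>(X\<^sub>1, \<dots>, \<nabla>\<^sub>Y X\<^sub>i, \<dots>, X\<^sub>n)\<close>.\<close>

definition affine_normal_on :: "(real ^ 'n) set \<Rightarrow> (real ^ 'n \<Rightarrow> real ^ 'n option) \<Rightarrow>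
    (real ^ 'n \<Rightarrow> real ^ ('n::finite) option) \<Rightarrow> bool" where
  "affine_normal_on \<Omega> f \<xi> \<longleftrightarrow>
     transversal_on \<Omega> f \<xi> \<and>
     (\<forall>x\<in>\<Omega>. \<forall>X Y. frechet_derivative (\<lambda>y. induced_vol f \<xi> y X) (at x) Y =
        (\<Sum>i\<in>UNIV. induced_vol f \<xi> x
           (\<chi> j. if j = i then induced_conn f \<xi> x Y (X $ i) else X $ j))) \<and>
     (\<forall>x\<in>\<Omega>. \<forall>X. (induced_vol f \<xi> x X)\<^sup>2 = \<bar>det (\<chi> i j. affine_form f \<xi> x (X $ i) (X $ j))\<bar>)"

text \<open>The Levi-Civita connection of a metric \<open>h\<close>: torsion free (for constant vector fields, whose
  brackets vanish, this means symmetric) and metric.\<close>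

definition levi_civita :: "(real ^ 'n \<Rightarrow> real ^ 'n \<Rightarrow> real ^ 'n \<Rightarrow> real) \<Rightarrow>
    real ^ 'n \<Rightarrow> real ^ 'n \<Rightarrow> real ^ 'n \<Rightarrow> real ^ ('n::finite)" where
  "levi_civita h x = (THE B. bilinear B \<and> (\<forall>X Y. B X Y = B Y X) \<and>
     (\<forall>X Y Z. frechet_derivative (\<lambda>y. h y X Y) (at x) Z = h x (B Z X) Y + h x X (B Z Y)))"

definition diff_tensor :: "(real ^ 'n \<Rightarrow> real ^ 'n option) \<Rightarrow> (real ^ 'n \<Rightarrow> real ^ 'n option) \<Rightarrow>
    real ^ 'n \<Rightarrow> real ^ 'n \<Rightarrow> real ^ 'n \<Rightarrow> real ^ ('n::finite)" where
  "diff_tensor f \<xi> x X Y = induced_conn f \<xi> x X Y - levi_civita (affine_form f \<xi>) x X Y"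

text \<open>\<open>g\<close> fixes \<open>X\<^sub>1\<close> and restricts to an element of SO of the orthogonal complement of \<open>X\<^sub>1\<close>, for the
  scalar product \<open>h\<close> (with \<open>h(X\<^sub>1, X\<^sub>1) = 1\<close>). As \<open>g\<close> fixes \<open>X\<^sub>1\<close> and preserves the complement, the
  determinant of \<open>g\<close> is that of its restriction.\<close>

definition axis_rotation :: "(real ^ 'n \<Rightarrow> real ^ 'n \<Rightarrow> real) \<Rightarrow> real ^ 'n \<Rightarrow>
    (real ^ 'n \<Rightarrow> real ^ ('n::finite)) \<Rightarrow> bool" where
  "axis_rotation h X\<^sub>1 g \<longleftrightarrow> linear g \<and> g X\<^sub>1 = X\<^sub>1 \<and>
     (\<forall>Y. h X\<^sub>1 Y = 0 \<longrightarrow> h X\<^sub>1 (g Y) = 0) \<and>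
     (\<forall>Y Z. h X\<^sub>1 Y = 0 \<longrightarrow> h X\<^sub>1 Z = 0 \<longrightarrow> h (g Y) (g Z) = h Y Z) \<and>
     det (matrix g) = 1"

definition symmetry_axis :: "(real ^ 'n \<Rightarrow> real ^ 'n option) \<Rightarrow> (real ^ 'n \<Rightarrow> real ^ 'n option) \<Rightarrow>
    real ^ 'n \<Rightarrow> real ^ ('n::finite) \<Rightarrow> bool" where
  "symmetry_axis f \<xi> x X\<^sub>1 \<longleftrightarrow> affine_form f \<xi> x X\<^sub>1 X\<^sub>1 = 1 \<and>
     (\<forall>g. axis_rotation (affine_form f \<xi> x) X\<^sub>1 g \<longrightarrow>
        (\<forall>X. shape_op f \<xi> x (g X) = g (shape_op f \<xi> x X)) \<and>
        (\<forall>X Y. diff_tensor f \<xi> x (g X) (g Y) = g (diff_tensor f \<xi> x X Y)))"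

text \<open>The value of \<open>r\<close> at \<open>x\<close> for the axis \<open>X\<^sub>1\<close> (it changes sign with \<open>X\<^sub>1\<close>). The equations are the
  frame equations \<open>K(X\<^sub>1, X\<^sub>1) = (n - 1) r X\<^sub>1\<close>, \<open>K(X\<^sub>1, X\<^sub>i) = - r X\<^sub>i\<close>, \<open>K(X\<^sub>i, X\<^sub>j) = - r \<delta>\<^sub>i\<^sub>j X\<^sub>1\<close>,
  extended bilinearly to the orthogonal complement of \<open>X\<^sub>1\<close>.\<close>

definition r_at :: "(real ^ 'n \<Rightarrow> real ^ 'n option) \<Rightarrow> (real ^ 'n \<Rightarrow> real ^ 'n option) \<Rightarrow>
    real ^ 'n \<Rightarrow> real ^ ('n::finite) \<Rightarrow> real" where
  "r_at f \<xi> x X\<^sub>1 = (THE r.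
     diff_tensor f \<xi> x X\<^sub>1 X\<^sub>1 = ((real CARD('n) - 1) * r) *\<^sub>R X\<^sub>1 \<and>
     (\<forall>Y. affine_form f \<xi> x X\<^sub>1 Y = 0 \<longrightarrow> diff_tensor f \<xi> x X\<^sub>1 Y = (- r) *\<^sub>R Y) \<and>
     (\<forall>Y Z. affine_form f \<xi> x X\<^sub>1 Y = 0 \<longrightarrow> affine_form f \<xi> x X\<^sub>1 Z = 0 \<longrightarrow>
        diff_tensor f \<xi> x Y Z = (- r * affine_form f \<xi> x Y Z) *\<^sub>R X\<^sub>1))"


subsection \<open>Hypersurfaces\<close>

text \<open>
  \<open>F\<close> is the immersion and \<open>\<xi>\<close> its affine normal. All the conditions are invariant under changes of
  coordinates and are imposed in every chart of the atlas.
\<close>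

definition immersed_hypersurface ::
  "('m::{t2_space,second_countable_topology}, 'n::finite) chart set \<Rightarrow>
   ('m \<Rightarrow> real ^ 'n option) \<Rightarrow> bool" where
  "immersed_hypersurface A F \<longleftrightarrow> smooth_atlas A \<and>
     (\<forall>(U, \<phi>)\<in>A. immersion_on (\<phi> ` U) (F \<circ> inv_into U \<phi>))"

definition affine_normal ::
  "('m::{t2_space,second_countable_topology}, 'n::finite) chart set \<Rightarrow>
   ('m \<Rightarrow> real ^ 'n option) \<Rightarrow> ('m \<Rightarrow> real ^ 'n option) \<Rightarrow> bool" where
  "affine_normal A F \<xi> \<longleftrightarrow>
     (\<forall>(U, \<phi>)\<in>A. affine_normal_on (\<phi> ` U) (F \<circ> inv_into U \<phi>) (\<xi> \<circ> inv_into U \<phi>))"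

text \<open>Strict local convexity (\<open>h\<close> is definite), together with the resulting choice of the sign of
  \<open>\<xi>\<close> for which \<open>h\<close> is positive definite.\<close>

definition strictly_locally_convex ::
  "('m::{t2_space,second_countable_topology}, 'n::finite) chart set \<Rightarrow>
   ('m \<Rightarrow> real ^ 'n option) \<Rightarrow> ('m \<Rightarrow> real ^ 'n option) \<Rightarrow> bool" where
  "strictly_locally_convex A F \<xi> \<longleftrightarrow>
     (\<forall>(U, \<phi>)\<in>A. \<forall>x\<in>\<phi> ` U. \<forall>X. X \<noteq> 0 \<longrightarrow>
        affine_form (F \<circ> inv_into U \<phi>) (\<xi> \<circ> inv_into U \<phi>) x X X > 0)"

definition improper_affine_sphere ::
  "('m::{t2_space,second_countable_topology}, 'n::finite) chart set \<Rightarrow>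
   ('m \<Rightarrow> real ^ 'n option) \<Rightarrow> ('m \<Rightarrow> real ^ 'n option) \<Rightarrow> bool" where
  "improper_affine_sphere A F \<xi> \<longleftrightarrow>
     (\<forall>(U, \<phi>)\<in>A. \<forall>x\<in>\<phi> ` U. \<forall>X.
        shape_op (F \<circ> inv_into U \<phi>) (\<xi> \<circ> inv_into U \<phi>) x X = 0)"

definition pointwise_SO_symmetry ::
  "('m::{t2_space,second_countable_topology}, 'n::finite) chart set \<Rightarrow>
   ('m \<Rightarrow> real ^ 'n option) \<Rightarrow> ('m \<Rightarrow> real ^ 'n option) \<Rightarrow> bool" where
  "pointwise_SO_symmetry A F \<xi> \<longleftrightarrow>
     (\<forall>(U, \<phi>)\<in>A. \<forall>x\<in>\<phi> ` U. \<exists>X\<^sub>1.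
        symmetry_axis (F \<circ> inv_into U \<phi>) (\<xi> \<circ> inv_into U \<phi>) x X\<^sub>1)"

text \<open>At a point, \<open>r\<close> vanishes for one axis iff \<open>K\<close> vanishes there iff \<open>r\<close> vanishes for every axis.
  Since \<open>-X\<^sub>1\<close> is an axis if \<open>X\<^sub>1\<close> is, a non-zero \<open>r\<close> can be made positive.\<close>

definition r_nowhere_zero ::
  "('m::{t2_space,second_countable_topology}, 'n::finite) chart set \<Rightarrow>
   ('m \<Rightarrow> real ^ 'n option) \<Rightarrow> ('m \<Rightarrow> real ^ 'n option) \<Rightarrow> bool" where
  "r_nowhere_zero A F \<xi> \<longleftrightarrow>
     (\<forall>(U, \<phi>)\<in>A. \<forall>x\<in>\<phi> ` U. \<forall>X\<^sub>1.
        symmetry_axis (F \<circ> inv_into U \<phi>) (\<xi> \<circ> inv_into U \<phi>) x X\<^sub>1 \<longrightarrow>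
        r_at (F \<circ> inv_into U \<phi>) (\<xi> \<circ> inv_into U \<phi>) x X\<^sub>1 \<noteq> 0)"


subsection \<open>Quadrics\<close>

definition model_quadric :: "real \<Rightarrow> (real ^ ('k::finite) option) set" where
  "model_quadric \<epsilon> =
     (if \<epsilon> = 1 then sphere 0 1
      else {x. (\<Sum>j\<in>UNIV. (x $ Some j)\<^sup>2) - (x $ None)\<^sup>2 = -1 \<and> x $ None > 0})"

text \<open>\<open>\<phi>\<close> immerses \<open>W\<close> as an open part of the image of the model quadric under an equi-affine linear
  map. (Both models are invariant under a linear reflection, and the two sheets of the hyperboloid
  are exchanged by another one, so neither the choice of the sheet nor the sign of the determinant
  matters.)\<close>

definition quadric_immersion ::
  "real \<Rightarrow> (real ^ 'k) set \<Rightarrow> (real ^ 'k \<Rightarrow> real ^ ('k::finite) option) \<Rightarrow> bool" where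
  "quadric_immersion \<epsilon> W \<phi> \<longleftrightarrow> \<epsilon> \<in> {1, -1} \<and> immersion_on W \<phi> \<and>
     (\<exists>B :: real ^ 'k option ^ 'k option. det B = 1 \<and>
        openin (top_of_set ((\<lambda>x. B *v x) ` model_quadric \<epsilon>)) (\<phi> ` W))"

end

theory Submission
  imports Defs
begin

text \<open>
  As \<open>S = 0\<close> and \<open>\<tau> = 0\<close>, the affine normal is constant, so that locally the hypersurface is the graph of
  a function \<open>\<phi>\<close> with \<open>h = D\<^sup>2\<phi>\<close>, and \<open>K\<close> is determined by \<open>D\<^sup>3\<phi>\<close>. Apolarity and the rotational symmetry
  force
  \<open>D\<^sup>3\<phi>(u,v,w) = \<alpha>(u) h(v,w) + \<alpha>(v) h(u,w) + \<alpha>(w) h(u,v) - (n + 2)/N \<alpha>(u) \<alpha>(v) \<alpha>(w)\<close>,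
  where \<open>\<alpha> = h(Z, -)\<close>, \<open>N = h(Z, Z)\<close> and \<open>Z = 2 r X\<^sub>1\<close>. By the symmetry of the fourth derivatives of \<open>\<phi>\<close>
  there is a function \<open>\<mu>\<close> with \<open>D\<alpha> = \<mu> h + (1 - (n + 2) \<mu>/N) \<alpha> \<otimes> \<alpha>\<close>, and then
  \<open>dN = (n + 1) (N - 2 \<mu>) \<alpha>\<close> and \<open>d\<mu> = \<mu> (1 - (n + 2) \<mu>/N) \<alpha>\<close>.

  Where \<open>\<mu> \<noteq> 0\<close>, the form \<open>h - \<alpha> \<otimes> \<alpha>/\<mu>\<close> is a multiple \<open>\<kappa> B\<close> of a constant form \<open>B\<close>, and the level sets of
  \<open>\<kappa>\<close> are quadrics of \<open>B\<close>: they have a common centre if \<open>N \<noteq> \<mu>\<close> and are translated paraboloids if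
  \<open>N = \<mu>\<close>. These are the cases 1 and 3. If \<open>\<mu>\<close> vanishes at a point, then it does so in a neighbourhood;
  the leaves then lie in parallel hyperplanes on which an affine function \<open>\<tau>\<close> is constant, and they
  are paraboloids that depend on \<open>t = \<tau>\<close> as in case 2.
\<close>

section \<open>Calculus of smooth maps\<close>

text \<open>The axis and \<open>r\<close> are given point by point, by mere existence, so
  \<open>Z\<close>, \<open>\<alpha>\<close>, \<open>N\<close> and \<open>\<mu>\<close> begin as
  arbitrary choices. Their smoothness has to be recovered from expressions known to be smooth:
  traces of operators made from the third derivative, and quotients with nonvanishing denominators.
  The constant n + 2 comes from apolarity: the three mixed terms have trace (n + 2)
  \<open>\<alpha>(w)\<close> over two slots, and the last term must cancel it; \<open>N\<close>
  appears there because \<open>Z\<close> is not a unit vector. Since \<open>dN\<close> and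
  \<open>d\<mu>\<close> are multiples of \<open>\<alpha>\<close>, everything changes in one
  direction only, so that the geometry of the leaves follows from first integrals and from linear
  algebra in one frame at \<open>p\<close>. On the axis direction the form \<open>B\<close> has the
  value \<open>1 - N p / \<mu> p\<close>; it degenerates for \<open>N = \<mu>\<close>, and then the
  quadrics lose their centre. For \<open>\<mu> = 0\<close> the correction
  \<open>\<alpha> \<otimes> \<alpha> / \<mu>\<close> does not exist, and \<open>N\<close> takes the
  place of \<open>\<mu>\<close> in the denominator.\<close>

lemma Ck_on_cong:
  assumes "open S" "\<And>x. x \<in> S \<Longrightarrow> f x = g x" "Ck_on k S f"
  shows "Ck_on k S g"
  using assms(2,3)
proof (induction k arbitrary: f g)
  case 0
  then show ?case using continuous_on_eq by (metis Ck_on.simps(1))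
next
  case (Suc k)
  have d: "(g has_derivative frechet_derivative f (at x)) (at x)" if "x \<in> S" for x
  proof -
    have "(f has_derivative frechet_derivative f (at x)) (at x)"
      using Suc.prems(2) that frechet_derivative_works by auto
    then show ?thesis
      by (rule has_derivative_transform_within_open[OF _ assms(1) that]) (rule Suc.prems(1))
  qed
  then have eq: "frechet_derivative g (at x) = frechet_derivative f (at x)" if "x \<in> S" for x
    using frechet_derivative_at[OF d[OF that]] by simp
  show ?case
  proof (simp, intro conjI ballI allI)
    fix x assume "x \<in> S" then show "g differentiable at x"
      using d by (auto intro: differentiableI)
  next
    fix v
    show "Ck_on k S (\<lambda>x. frechet_derivative g (at x) v)"
      by (rule Suc.IH[of "\<lambda>x. frechet_derivative f (at x) v"]) (simp add: eq, use Suc.prems(2) in simp)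
  qed
qed

lemma Ck_on_subset: "Ck_on k S f \<Longrightarrow> T \<subseteq> S \<Longrightarrow> Ck_on k T f"
  by (induction k arbitrary: f) (auto intro: continuous_on_subset)

text \<open>\<open>frechet_derivative\<close> is a choice operator; this rule lets any explicit
  formula for the derivative replace it. Openness of \<open>S\<close> makes derivatives at its
  points depend on \<open>S\<close> alone, and the closure properties that follow carry it
  along.\<close>

lemma Ck_on_SucI:
  assumes "open S" "\<And>x. x \<in> S \<Longrightarrow> (f has_derivative f' x) (at x)"
    "\<And>v. Ck_on k S (\<lambda>x. f' x v)"
  shows "Ck_on (Suc k) S f"
proof (simp, intro conjI ballI allI)
  fix x assume "x \<in> S" then show "f differentiable at x"
    using assms(2) by (auto intro: differentiableI)
next
  fix v
  have eq: "f' x v = frechet_derivative f (at x) v" if "x \<in> S" for x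
    using frechet_derivative_at[OF assms(2)[OF that]] by simp
  show "Ck_on k S (\<lambda>x. frechet_derivative f (at x) v)"
    by (rule Ck_on_cong[OF assms(1) _ assms(3)[of v]]) (rule eq)
qed

lemma Ck_on_SucD: "Ck_on (Suc k) S f \<Longrightarrow> Ck_on k S f"
proof (induction k arbitrary: f)
  case 0
  then show ?case
    by (metis Ck_on.simps continuous_at_imp_continuous_on differentiable_imp_continuous_within)
next
  case (Suc k)
  show ?case
    using Suc.prems Suc.IH by simp
qed

lemma Ck_on_has_derivative:
  "Ck_on (Suc k) S f \<Longrightarrow> x \<in> S \<Longrightarrow> (f has_derivative frechet_derivative f (at x)) (at x)"
  using frechet_derivative_works by auto

lemma Ck_on_const: "open S \<Longrightarrow> Ck_on k S (\<lambda>x. c)"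
proof (induction k arbitrary: c)
  case (Suc k)
  show ?case
    by (rule Ck_on_SucI[where f'="\<lambda>x v. 0"]) (use Suc in auto)
qed auto

lemma Ck_on_linear:
  assumes "open S" "bounded_linear L"
  shows "Ck_on k S L"
proof (cases k)
  case 0
  then show ?thesis
    using assms linear_continuous_on by auto
next
  case (Suc j)
  show ?thesis unfolding Suc
    by (rule Ck_on_SucI[where f'="\<lambda>x. L"])
       (use assms in \<open>auto intro: bounded_linear_imp_has_derivative Ck_on_const\<close>)
qed

lemma Ck_on_bounded_linear:
  assumes "open S" "bounded_linear L" "Ck_on k S f"
  shows "Ck_on k S (\<lambda>x. L (f x))"
  using assms(3)
proof (induction k arbitrary: f)
  case 0
  then show ?case
    using assms bounded_linear.continuous_on by auto
next
  case (Suc k)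
  show ?case
  proof (rule Ck_on_SucI[where f'="\<lambda>x v. L (frechet_derivative f (at x) v)"])
    fix x assume "x \<in> S"
    then show "((\<lambda>x. L (f x)) has_derivative (\<lambda>v. L (frechet_derivative f (at x) v))) (at x)"
      using bounded_linear.has_derivative[OF assms(2)] Ck_on_has_derivative[OF Suc.prems] by blast
  qed (use assms(1,2) Suc in simp_all)
qed

lemma Ck_on_add:
  assumes "open S" "Ck_on k S f" "Ck_on k S g"
  shows "Ck_on k S (\<lambda>x. f x + g x)"
  using assms(2,3)
proof (induction k arbitrary: f g)
  case 0
  then show ?case by (auto intro: continuous_on_add)
next
  case (Suc k)
  show ?case
  proof (rule Ck_on_SucI[where f'="\<lambda>x v. frechet_derivative f (at x) v + frechet_derivative g (at x) v"])
    fix x assume "x \<in> S"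
    then show "((\<lambda>x. f x + g x) has_derivative
        (\<lambda>v. frechet_derivative f (at x) v + frechet_derivative g (at x) v)) (at x)"
      using Ck_on_has_derivative[OF Suc.prems(1)] Ck_on_has_derivative[OF Suc.prems(2)]
      by (intro has_derivative_add) auto
  qed (use assms(1,2) Suc in simp_all)
qed

lemma Ck_on_sum:
  assumes "open S" "\<And>i. i \<in> I \<Longrightarrow> Ck_on k S (f i)"
  shows "Ck_on k S (\<lambda>x. \<Sum>i\<in>I. f i x)"
  using assms(2)
  by (induction I rule: infinite_finite_induct) (auto intro: Ck_on_const Ck_on_add assms(1))

lemma Ck_on_bilinear:
  assumes "open S" "bounded_bilinear B" "Ck_on k S f" "Ck_on k S g"
  shows "Ck_on k S (\<lambda>x. B (f x) (g x))"
  using assms(3,4)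
proof (induction k arbitrary: f g)
  case 0
  then show ?case using bounded_bilinear.continuous_on[OF assms(2)] by auto
next
  case (Suc k)
  show ?case
  proof (rule Ck_on_SucI[where f'="\<lambda>x v. B (f x) (frechet_derivative g (at x) v)
        + B (frechet_derivative f (at x) v) (g x)"])
    fix x assume "x \<in> S"
    then show "((\<lambda>x. B (f x) (g x)) has_derivative
        (\<lambda>v. B (f x) (frechet_derivative g (at x) v) + B (frechet_derivative f (at x) v) (g x))) (at x)"
      using Ck_on_has_derivative[OF Suc.prems(1)] Ck_on_has_derivative[OF Suc.prems(2)]
      by (intro bounded_bilinear.FDERIV[OF assms(2)]) auto
  next
    fix v
    have "Ck_on k S f" "Ck_on k S g"
      using Suc.prems Ck_on_SucD by auto
    then show "Ck_on k S (\<lambda>x. B (f x) (frechet_derivative g (at x) v)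
        + B (frechet_derivative f (at x) v) (g x))"
      using Suc.prems by (intro Ck_on_add Suc.IH assms) auto
  qed (use assms(1,2) Suc in simp_all)
qed

lemma Ck_on_compose:
  fixes f :: "'b::euclidean_space \<Rightarrow> 'c::real_normed_vector" and g :: "'a::euclidean_space \<Rightarrow> 'b"
  assumes "open S" "open T" "Ck_on k T f" "Ck_on k S g" "\<And>x. x \<in> S \<Longrightarrow> g x \<in> T"
  shows "Ck_on k S (\<lambda>x. f (g x))"
  using assms(3,4)
proof (induction k arbitrary: f)
  case 0
  then show ?case using assms(5) continuous_on_compose2 by (metis Ck_on.simps(1) image_subsetI)
next
  case (Suc k)
  have df: "(f has_derivative frechet_derivative f (at (g x))) (at (g x))" if "x \<in> S" for x
    using Ck_on_has_derivative[OF Suc.prems(1)] assms(5) that by blast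
  show ?case
  \<comment> \<open>The chain rule applies the derivative of \<open>f\<close> at a moving point to a
    moving vector. Expanding the vector in \<open>Basis\<close> separates the two: each summand is a
    scalar function times the composition of \<open>g\<close> with a partial derivative of
    \<open>f\<close>, to which the induction hypothesis applies.\<close>
  proof (rule Ck_on_SucI[where f'="\<lambda>x v. \<Sum>b\<in>Basis. (frechet_derivative g (at x) v \<bullet> b) *\<^sub>R
        frechet_derivative f (at (g x)) b"])
    fix x assume x: "x \<in> S"
    let ?f = "frechet_derivative f (at (g x))"
    have "((\<lambda>x. f (g x)) has_derivative (\<lambda>v. ?f (frechet_derivative g (at x) v))) (at x)"
      using has_derivative_compose[OF Ck_on_has_derivative[OF Suc.prems(2) x] df[OF x]] by simp
    moreover have "?f w = (\<Sum>b\<in>Basis. (w \<bullet> b) *\<^sub>R ?f b)" for w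
    proof -
      interpret linear ?f using df[OF x] has_derivative_linear by blast
      have "?f w = ?f (\<Sum>b\<in>Basis. (w \<bullet> b) *\<^sub>R b)" by (simp add: euclidean_representation)
      then show ?thesis by (simp add: sum scale)
    qed
    then have "(\<lambda>v. ?f (frechet_derivative g (at x) v)) =
        (\<lambda>v. \<Sum>b\<in>Basis. (frechet_derivative g (at x) v \<bullet> b) *\<^sub>R ?f b)"
      by blast
    ultimately show "((\<lambda>x. f (g x)) has_derivative
        (\<lambda>v. \<Sum>b\<in>Basis. (frechet_derivative g (at x) v \<bullet> b) *\<^sub>R ?f b)) (at x)"
      by metis
  next
    fix v
    have "Ck_on k S g" using Suc.prems Ck_on_SucD by auto
    then have 1: "Ck_on k S (\<lambda>x. frechet_derivative f (at (g x)) b)" for b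
      using Suc.prems Suc.IH by auto
    have 2: "Ck_on k S (\<lambda>x. frechet_derivative g (at x) v \<bullet> b)" for b
      using Suc.prems by (intro Ck_on_bounded_linear[OF assms(1) bounded_linear_inner_left]) auto
    show "Ck_on k S (\<lambda>x. \<Sum>b\<in>Basis. (frechet_derivative g (at x) v \<bullet> b) *\<^sub>R
        frechet_derivative f (at (g x)) b)"
      using 1 2 by (intro Ck_on_sum assms Ck_on_bilinear[OF _ bounded_bilinear_scaleR])
  qed (use assms in auto)
qed

lemma Ck_on_inverse:
  fixes f :: "'a::euclidean_space \<Rightarrow> real"
  assumes "open S" "Ck_on k S f" "\<And>x. x \<in> S \<Longrightarrow> f x \<noteq> 0"
  shows "Ck_on k S (\<lambda>x. inverse (f x))"
  using assms(2)
proof (induction k)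
  case 0
  then show ?case using assms(3) by (simp add: continuous_on_inverse)
next
  case (Suc k)
  show ?case
  proof (rule Ck_on_SucI[where f'="\<lambda>x v. - (inverse (f x) * frechet_derivative f (at x) v * inverse (f x))"])
    fix x assume "x \<in> S"
    then show "((\<lambda>x. inverse (f x)) has_derivative
        (\<lambda>v. - (inverse (f x) * frechet_derivative f (at x) v * inverse (f x)))) (at x)"
      using Ck_on_has_derivative[OF Suc.prems(1)] assms(3)
      by (intro Deriv.has_derivative_inverse) auto
  next
    fix v
    have "Ck_on k S (\<lambda>x. inverse (f x))" using Suc Ck_on_SucD by blast
    moreover have "Ck_on k S (\<lambda>x. frechet_derivative f (at x) v)"
      using Suc.prems by simp
    ultimately have "Ck_on k S (\<lambda>x. inverse (f x) * frechet_derivative f (at x) v * inverse (f x))"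
      by (intro Ck_on_bilinear[OF assms(1) bounded_bilinear_mult])
    then show "Ck_on k S (\<lambda>x. - (inverse (f x) * frechet_derivative f (at x) v * inverse (f x)))"
      by (rule Ck_on_bounded_linear[OF assms(1) bounded_linear_minus[OF bounded_linear_ident]])
  qed (rule assms(1))
qed

lemma Ck_on_sqrt:
  fixes f :: "'a::euclidean_space \<Rightarrow> real"
  assumes "open S" "Ck_on k S f" "\<And>x. x \<in> S \<Longrightarrow> f x > 0"
  shows "Ck_on k S (\<lambda>x. sqrt (f x))"
  using assms(2)
proof (induction k)
  case 0
  then show ?case unfolding Ck_on.simps(1) by (rule continuous_on_real_sqrt)
next
  case (Suc k)
  show ?case
  proof (rule Ck_on_SucI[where f'="\<lambda>x v. frechet_derivative f (at x) v * (inverse (sqrt (f x)) / 2)"])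
    fix x assume x: "x \<in> S"
    show "((\<lambda>x. sqrt (f x)) has_derivative
        (\<lambda>v. frechet_derivative f (at x) v * (inverse (sqrt (f x)) / 2))) (at x)"
      by (rule has_derivative_real_sqrt[OF assms(3)[OF x] Ck_on_has_derivative[OF Suc.prems x]])
  next
    fix v
    have "Ck_on k S (\<lambda>x. sqrt (f x))" using Suc Ck_on_SucD by blast
    moreover have "sqrt (f x) \<noteq> 0" if "x \<in> S" for x using assms(3)[OF that] by simp
    ultimately have "Ck_on k S (\<lambda>x. inverse (sqrt (f x)))"
      by (rule Ck_on_inverse[OF assms(1)])
    then have "Ck_on k S (\<lambda>x. inverse (sqrt (f x)) / 2)"
      by (rule Ck_on_bounded_linear[OF assms(1) bounded_linear_divide])
    moreover have "Ck_on k S (\<lambda>x. frechet_derivative f (at x) v)"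
      using Suc.prems by simp
    ultimately show "Ck_on k S (\<lambda>x. frechet_derivative f (at x) v * (inverse (sqrt (f x)) / 2))"
      by (intro Ck_on_bilinear[OF assms(1) bounded_bilinear_mult])
  qed (rule assms(1))
qed

lemma smooth_onI: "(\<And>k. Ck_on k S f) \<Longrightarrow> smooth_on S f"
  by (simp add: smooth_on_def)

lemma smooth_onD: "smooth_on S f \<Longrightarrow> Ck_on k S f"
  by (simp add: smooth_on_def)

lemma smooth_on_open_cong:
  assumes "smooth_on S f" "open S" "\<And>x. x \<in> S \<Longrightarrow> f x = g x"
  shows "smooth_on S g"
  using Ck_on_cong[OF assms(2,3) smooth_onD[OF assms(1)]] by (rule smooth_onI)

lemma smooth_on_subset: "smooth_on S f \<Longrightarrow> T \<subseteq> S \<Longrightarrow> smooth_on T f"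
  by (rule smooth_onI, rule Ck_on_subset, erule smooth_onD)

lemma smooth_on_continuous: "smooth_on S f \<Longrightarrow> continuous_on S f"
  using smooth_onD[of S f 0] by simp

lemma smooth_on_has_derivative:
  "smooth_on S f \<Longrightarrow> x \<in> S \<Longrightarrow> (f has_derivative frechet_derivative f (at x)) (at x)"
  using Ck_on_has_derivative[OF smooth_onD] .

lemma smooth_on_frechet_derivative:
  assumes "smooth_on S f"
  shows "smooth_on S (\<lambda>x. frechet_derivative f (at x) v)"
proof (rule smooth_onI)
  fix k show "Ck_on k S (\<lambda>x. frechet_derivative f (at x) v)"
    using smooth_onD[OF assms, of "Suc k"] by simp
qed

lemma smooth_on_const: "open S \<Longrightarrow> smooth_on S (\<lambda>x. c)"
  by (rule smooth_onI, rule Ck_on_const)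

lemma smooth_on_bounded_linear:
  "\<lbrakk>open S; bounded_linear L; smooth_on S f\<rbrakk> \<Longrightarrow> smooth_on S (\<lambda>x. L (f x))"
  by (rule smooth_onI, rule Ck_on_bounded_linear, assumption, assumption, erule smooth_onD)

lemma smooth_on_linear:
  fixes L :: "'b::euclidean_space \<Rightarrow> 'c::real_normed_vector"
  assumes "open S" "linear L" "smooth_on S f"
  shows "smooth_on S (\<lambda>x. L (f x))"
  by (rule smooth_on_bounded_linear[OF assms(1) _ assms(3)])
     (rule assms(2)[unfolded linear_conv_bounded_linear])

lemma smooth_on_id: "open S \<Longrightarrow> smooth_on S (\<lambda>x. x)"
  by (rule smooth_onI, rule Ck_on_linear, assumption, rule bounded_linear_ident)

lemma smooth_on_add:
  "\<lbrakk>open S; smooth_on S f; smooth_on S g\<rbrakk> \<Longrightarrow> smooth_on S (\<lambda>x. f x + g x)"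
  by (rule smooth_onI, rule Ck_on_add, assumption, erule smooth_onD, erule smooth_onD)

lemma smooth_on_sum:
  assumes "open S" "\<And>i. i \<in> I \<Longrightarrow> smooth_on S (f i)"
  shows "smooth_on S (\<lambda>x. \<Sum>i\<in>I. f i x)"
  by (rule smooth_onI, rule Ck_on_sum, rule assms(1), rule smooth_onD, erule assms(2))

lemma smooth_on_bilinear:
  "\<lbrakk>open S; bounded_bilinear B; smooth_on S f; smooth_on S g\<rbrakk> \<Longrightarrow> smooth_on S (\<lambda>x. B (f x) (g x))"
  by (rule smooth_onI, rule Ck_on_bilinear, assumption, assumption, erule smooth_onD, erule smooth_onD)

lemma smooth_on_scaleR:
  "\<lbrakk>open S; smooth_on S f; smooth_on S g\<rbrakk> \<Longrightarrow> smooth_on S (\<lambda>x. f x *\<^sub>R g x)"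
  by (rule smooth_on_bilinear[OF _ bounded_bilinear_scaleR])

lemma smooth_on_mult:
  fixes f g :: "'a::euclidean_space \<Rightarrow> real"
  shows "\<lbrakk>open S; smooth_on S f; smooth_on S g\<rbrakk> \<Longrightarrow> smooth_on S (\<lambda>x. f x * g x)"
  by (rule smooth_on_bilinear[OF _ bounded_bilinear_mult])

lemma smooth_on_uminus: "\<lbrakk>open S; smooth_on S f\<rbrakk> \<Longrightarrow> smooth_on S (\<lambda>x. - f x)"
  by (rule smooth_on_bounded_linear[where L=uminus])
     (simp_all add: bounded_linear_minus[OF bounded_linear_ident])

lemma smooth_on_diff:
  "\<lbrakk>open S; smooth_on S f; smooth_on S g\<rbrakk> \<Longrightarrow> smooth_on S (\<lambda>x. f x - g x)"
  using smooth_on_add[of S f "\<lambda>x. - g x"] smooth_on_uminus[of S g] by simp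

lemma smooth_on_divide:
  fixes f g :: "'a::euclidean_space \<Rightarrow> real"
  assumes "open S" "smooth_on S f" "smooth_on S g" "\<And>x. x \<in> S \<Longrightarrow> g x \<noteq> 0"
  shows "smooth_on S (\<lambda>x. f x / g x)"
proof -
  have "smooth_on S (\<lambda>x. inverse (g x))"
    by (rule smooth_onI, rule Ck_on_inverse[OF assms(1) smooth_onD[OF assms(3)] assms(4)])
  then show ?thesis
    unfolding divide_inverse by (rule smooth_on_mult[OF assms(1,2)])
qed

lemma smooth_on_prod:
  fixes f :: "'i \<Rightarrow> 'a::euclidean_space \<Rightarrow> real"
  assumes "open S" "\<And>i. i \<in> I \<Longrightarrow> smooth_on S (f i)"
  shows "smooth_on S (\<lambda>x. \<Prod>i\<in>I. f i x)"
  using assms(2)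
proof (induction I rule: infinite_finite_induct)
  case (insert i I)
  then have "smooth_on S (\<lambda>x. f i x * (\<Prod>i\<in>I. f i x))"
    by (intro smooth_on_mult[OF assms(1)]) simp_all
  then show ?case using insert by simp
qed (simp_all add: smooth_on_const[OF assms(1)])

lemma smooth_on_power:
  fixes f :: "'a::euclidean_space \<Rightarrow> real"
  assumes "open S" "smooth_on S f"
  shows "smooth_on S (\<lambda>x. f x ^ k)"
  using smooth_on_prod[OF assms(1), of "{..<k}" "\<lambda>_. f"] assms(2) by simp

lemma smooth_on_sqrt:
  fixes f :: "'a::euclidean_space \<Rightarrow> real"
  assumes "open S" "smooth_on S f" "\<And>x. x \<in> S \<Longrightarrow> f x > 0"
  shows "smooth_on S (\<lambda>x. sqrt (f x))"
  by (rule smooth_onI, rule Ck_on_sqrt[OF assms(1) smooth_onD[OF assms(2)] assms(3)])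

lemma smooth_on_compose:
  fixes f :: "'b::euclidean_space \<Rightarrow> 'c::real_normed_vector" and g :: "'a::euclidean_space \<Rightarrow> 'b"
  assumes "open S" "open T" "smooth_on T f" "smooth_on S g" "\<And>x. x \<in> S \<Longrightarrow> g x \<in> T"
  shows "smooth_on S (\<lambda>x. f (g x))"
  by (rule smooth_onI, rule Ck_on_compose[OF assms(1,2) smooth_onD[OF assms(3)] smooth_onD[OF assms(4)] assms(5)])

lemma smooth_on_Pair:
  fixes f :: "'a::euclidean_space \<Rightarrow> 'b::real_normed_vector" and g :: "'a \<Rightarrow> 'c::real_normed_vector"
  assumes "open S" "smooth_on S f" "smooth_on S g"
  shows "smooth_on S (\<lambda>x. (f x, g x))"
proof -
  have "bounded_linear (\<lambda>y::'b. (y, 0::'c))" "bounded_linear (\<lambda>y::'c. (0::'b, y))"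
    by (intro bounded_linear_Pair bounded_linear_ident bounded_linear_zero)+
  then have "smooth_on S (\<lambda>x. (f x, 0::'c))" "smooth_on S (\<lambda>x. (0::'b, g x))"
    using smooth_on_bounded_linear[OF assms(1) _ assms(2)]
      smooth_on_bounded_linear[OF assms(1) _ assms(3)] by blast+
  from smooth_on_add[OF assms(1) this] show ?thesis by simp
qed

lemma smooth_on_fst: "open S \<Longrightarrow> smooth_on S (fst :: 'a::euclidean_space \<times> 'b::euclidean_space \<Rightarrow> 'a)"
  by (rule smooth_onI, rule Ck_on_linear, assumption, rule bounded_linear_fst)

lemma smooth_on_snd: "open S \<Longrightarrow> smooth_on S (snd :: 'a::euclidean_space \<times> 'b::euclidean_space \<Rightarrow> 'b)"
  by (rule smooth_onI, rule Ck_on_linear, assumption, rule bounded_linear_snd)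

lemma smooth_on_vec_nth: "\<lbrakk>open S; smooth_on S f\<rbrakk> \<Longrightarrow> smooth_on S (\<lambda>x. f x $ i)"
  by (rule smooth_on_bounded_linear[OF _ bounded_linear_vec_nth])

lemma smooth_on_vecI:
  fixes f :: "'a::euclidean_space \<Rightarrow> real ^ 'n"
  assumes "open S" "\<And>i. smooth_on S (\<lambda>x. f x $ i)"
  shows "smooth_on S f"
proof -
  have sm: "smooth_on S (\<lambda>x. \<Sum>i\<in>UNIV. f x $ i *\<^sub>R axis i (1::real))"
    by (intro smooth_on_sum smooth_on_scaleR smooth_on_const assms)
  have eq: "(\<lambda>x. \<Sum>i\<in>UNIV. f x $ i *\<^sub>R axis i (1::real)) = f"
  proof (rule ext)
    fix x
    show "(\<Sum>i\<in>UNIV. f x $ i *\<^sub>R axis i (1::real)) = f x"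
      using basis_expansion[of "f x"] unfolding scalar_mult_eq_scaleR .
  qed
  show ?thesis using sm unfolding eq .
qed

lemma snoc_nth [simp]: "snoc u a $ Some i = u $ i" "snoc u a $ None = a"
  by (auto simp: snoc_def)

lemma smooth_on_snoc:
  fixes f :: "'a::euclidean_space \<Rightarrow> real ^ 'n"
  assumes "open S" "smooth_on S f" "smooth_on S g"
  shows "smooth_on S (\<lambda>x. snoc (f x) (g x))"
proof (rule smooth_on_vecI[OF assms(1)])
  fix i show "smooth_on S (\<lambda>x. snoc (f x) (g x) $ i)"
  proof (cases i)
    case None
    then show ?thesis using assms(3) by simp
  next
    case (Some j)
    then show ?thesis using smooth_on_vec_nth[OF assms(1,2), of j] by simp
  qed
qed

section \<open>Cramer's rule and the smooth local inverse\<close>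

text \<open>The solution is a quotient of polynomials in the data. The order \<open>k\<close> stays
  finite because \<open>smooth_local_inverse\<close> gains one derivative at a time.\<close>

lemma Ck_on_cramer:
  fixes M :: "'a::euclidean_space \<Rightarrow> real ^ 'n ^ 'n" and b :: "'a \<Rightarrow> real ^ 'n"
  assumes S: "open S" and M: "\<And>i j. Ck_on k S (\<lambda>x. M x $ i $ j)" and b: "\<And>i. Ck_on k S (\<lambda>x. b x $ i)"
    and inv: "\<And>x. x \<in> S \<Longrightarrow> det (M x) \<noteq> 0" and w: "\<And>x. x \<in> S \<Longrightarrow> M x *v w x = b x"
  shows "Ck_on k S w"
proof -
  have prod: "Ck_on k S (\<lambda>x. \<Prod>i\<in>I. f i x)" if "\<And>i. i \<in> I \<Longrightarrow> Ck_on k S (f i)"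
    for f :: "'n \<Rightarrow> 'a \<Rightarrow> real" and I
    using that
    by (induction I rule: infinite_finite_induct)
       (simp_all add: Ck_on_const[OF S] Ck_on_bilinear[OF S bounded_bilinear_mult])
  have det: "Ck_on k S (\<lambda>x. det (N x))" if "\<And>i j. Ck_on k S (\<lambda>x. N x $ i $ j)"
    for N :: "'a \<Rightarrow> real ^ 'n ^ 'n"
    unfolding det_def
  proof (rule Ck_on_sum[OF S])
    fix p :: "'n \<Rightarrow> 'n"
    have "Ck_on k S (\<lambda>x. \<Prod>i\<in>UNIV. N x $ i $ p i)"
      by (rule prod) (rule that)
    then show "Ck_on k S (\<lambda>x. of_int (sign p) * (\<Prod>i\<in>UNIV. N x $ i $ p i))"
      by (rule Ck_on_bilinear[OF S bounded_bilinear_mult Ck_on_const[OF S]])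
  qed
  have comp: "Ck_on k S (\<lambda>x. det (\<chi> i j. if j = m then b x $ i else M x $ i $ j) * inverse (det (M x)))" for m
  proof (intro Ck_on_bilinear[OF S bounded_bilinear_mult] Ck_on_inverse[OF S] det M inv)
    fix i j show "Ck_on k S (\<lambda>x. (\<chi> i j. if j = m then b x $ i else M x $ i $ j) $ i $ j)"
      by (cases "j = m") (simp_all add: M b)
  qed auto
  have "Ck_on k S (\<lambda>x. \<Sum>m\<in>UNIV. (det (\<chi> i j. if j = m then b x $ i else M x $ i $ j) * inverse (det (M x)))
      *\<^sub>R axis m 1)"
    by (intro Ck_on_sum[OF S] Ck_on_bilinear[OF S bounded_bilinear_scaleR] Ck_on_const[OF S] comp)
  then show ?thesis
  proof (rule Ck_on_cong[OF S, rotated])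
    fix x assume x: "x \<in> S"
    have "w x = (\<chi> m. det(\<chi> i j. if j=m then b x $ i else M x $ i $ j) / det (M x))"
      using cramer[OF inv[OF x]] w[OF x] by blast
    then show "(\<Sum>m\<in>UNIV. (det (\<chi> i j. if j = m then b x $ i else M x $ i $ j) * inverse (det (M x)))
      *\<^sub>R axis m 1) = w x"
      using basis_expansion[of "w x", unfolded scalar_mult_eq_scaleR] by (simp add: divide_inverse)
  qed
qed

lemma smooth_on_cramer:
  fixes M :: "'a::euclidean_space \<Rightarrow> real ^ 'n ^ 'n" and b :: "'a \<Rightarrow> real ^ 'n"
  assumes "open S" "\<And>i j. smooth_on S (\<lambda>x. M x $ i $ j)" "\<And>i. smooth_on S (\<lambda>x. b x $ i)"
    "\<And>x. x \<in> S \<Longrightarrow> det (M x) \<noteq> 0" "\<And>x. x \<in> S \<Longrightarrow> M x *v w x = b x"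
  shows "smooth_on S w"
  by (rule smooth_onI, rule Ck_on_cramer[OF assms(1) smooth_onD[OF assms(2)] smooth_onD[OF assms(3)] assms(4,5)])

text \<open>Bootstrapping: the derivative of \<open>g\<close> at \<open>y\<close> solves a linear
  system whose matrix is the derivative of \<open>f\<close> at \<open>g y\<close>. If
  \<open>g\<close> is of class k, so are the entries of this matrix, hence by Cramer's rule also the
  derivative of \<open>g\<close>, and \<open>g\<close> gains one order.\<close>

lemma smooth_local_inverse:
  fixes f :: "real ^ 'n \<Rightarrow> real ^ 'n"
  assumes U: "open U" and sm: "smooth_on U f" and inj: "\<And>x. x \<in> U \<Longrightarrow> inj (frechet_derivative f (at x))"
    and x0: "x0 \<in> U"
  obtains U' V g where "open U'" "U' \<subseteq> U" "x0 \<in> U'" "open V" "f x0 \<in> V" "homeomorphism U' V f g"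
    "smooth_on V g"
proof -
  let ?D = "\<lambda>x. frechet_derivative f (at x)"
  \<comment> \<open>The inverse function theorem wants the derivative as a continuous map into
    bounded linear operators, with an explicit left inverse at \<open>x0\<close>.\<close>
  define f' where "f' x = Blinfun (?D x)" for x
  have der: "(f has_derivative ?D x) (at x)" if "x \<in> U" for x
    using smooth_on_has_derivative[OF sm that] .
  have app: "blinfun_apply (f' x) = ?D x" if "x \<in> U" for x
    unfolding f'_def using der[OF that] has_derivative_bounded_linear bounded_linear_Blinfun_apply by blast
  have cont: "continuous_on U f'"
  proof (rule continuous_on_blinfun_componentwise)
    fix i :: "real ^ 'n"
    have "continuous_on U (\<lambda>x. ?D x i)"
      using smooth_on_continuous smooth_on_frechet_derivative sm by blast
    then show "continuous_on U (\<lambda>x. blinfun_apply (f' x) i)"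
      by (rule continuous_on_eq) (simp add: app)
  qed
  have lin: "linear (?D x)" if "x \<in> U" for x using der[OF that] has_derivative_linear by blast
  obtain k where k: "linear k" "k \<circ> ?D x0 = id"
    using linear_injective_left_inverse lin[OF x0] inj[OF x0] by blast
  have "Blinfun k o\<^sub>L f' x0 = id_blinfun"
  proof (rule blinfun_eqI)
    fix i
    have "bounded_linear k" using k linear_conv_bounded_linear by blast
    then show "(Blinfun k o\<^sub>L f' x0) i = id_blinfun i"
      using k(2) by (simp add: app[OF x0] bounded_linear_Blinfun_apply o_def fun_eq_iff)
  qed
  then obtain U' V g g' where ift: "open U'" "U' \<subseteq> U" "x0 \<in> U'" "open V" "f x0 \<in> V"
      "homeomorphism U' V f g" "\<And>y. y \<in> V \<Longrightarrow> (g has_derivative (g' y)) (at y)"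
      "\<And>y. y \<in> V \<Longrightarrow> g' y = inv (blinfun_apply (f' (g y)))"
      "\<And>y. y \<in> V \<Longrightarrow> bij (blinfun_apply (f' (g y)))"
    using inverse_function_theorem[OF U _ cont x0] der app by metis
  have gU: "g y \<in> U" if "y \<in> V" for y
    using ift(2,6) that unfolding homeomorphism_def by blast
  have g': "?D (g y) (g' y v) = v" if "y \<in> V" for y v
    using ift(8,9)[OF that] app[OF gU[OF that]] by (simp add: bij_is_surj surj_f_inv_f)
  have smD: "smooth_on U (\<lambda>x. ?D x v $ i)" for v i
    by (intro smooth_on_vec_nth U smooth_on_frechet_derivative sm)
  have "Ck_on k V g" for k
  proof (induction k)
    case 0
    then show ?case using ift(6) unfolding homeomorphism_def by simp
  next
    case (Suc k)
    show ?case
    proof (rule Ck_on_SucI[OF ift(4) ift(7)])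
      fix v
      show "Ck_on k V (\<lambda>x. g' x v)"
      proof (rule Ck_on_cramer[OF ift(4), where M="\<lambda>y. matrix (?D (g y))" and b="\<lambda>y. v"])
        fix i j
        have "Ck_on k V (\<lambda>y. ?D (g y) (axis j 1) $ i)"
          by (rule Ck_on_compose[OF ift(4) U smooth_onD[OF smD[of "axis j 1" i]] Suc gU])
        then show "Ck_on k V (\<lambda>y. matrix (?D (g y)) $ i $ j)"
          by (simp add: matrix_def)
      next
        fix y assume y: "y \<in> V"
        show "matrix (?D (g y)) *v g' y v = v"
          using g'[OF y] by (simp add: matrix_works[OF lin[OF gU[OF y], folded linear_matrix_vector_mul_eq]])
        show "det (matrix (?D (g y))) \<noteq> 0"
          using det_nz_iff_inj[OF lin[OF gU[OF y]]] inj[OF gU[OF y]] by blast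
      qed (auto intro: Ck_on_const ift)
    qed
  qed
  then show ?thesis
    using that[of U' V g] ift(1-6) smooth_onI[of V g] by blast
qed

section \<open>Symmetry of second derivatives\<close>

text \<open>The mean value theorem is applied twice to the second difference over a parallelogram,
  first along \<open>u\<close>, then along \<open>v\<close>. The second difference is symmetric in
  \<open>u\<close> and \<open>v\<close>, the mixed derivative not visibly so.\<close>

lemma second_difference_mvt:
  fixes f :: "'a::euclidean_space \<Rightarrow> real"
  assumes sm: "smooth_on S f" and s: "s > 0"
    and sub: "\<And>\<tau> \<sigma>. \<lbrakk>0 \<le> \<tau>; \<tau> \<le> s; 0 \<le> \<sigma>; \<sigma> \<le> s\<rbrakk> \<Longrightarrow> x + \<tau> *\<^sub>R u + \<sigma> *\<^sub>R v \<in> S"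
  obtains \<tau> \<sigma> where "0 < \<tau>" "\<tau> < s" "0 < \<sigma>" "\<sigma> < s"
    "f (x + s *\<^sub>R u + s *\<^sub>R v) - f (x + s *\<^sub>R u) - f (x + s *\<^sub>R v) + f x =
     s\<^sup>2 * frechet_derivative (\<lambda>y. frechet_derivative f (at y) u) (at (x + \<tau> *\<^sub>R u + \<sigma> *\<^sub>R v)) v"
proof -
  have der: "((\<lambda>t. F (a + t *\<^sub>R w)) has_real_derivative frechet_derivative F (at (a + t *\<^sub>R w)) w) (at t)"
    if "smooth_on S F" "a + t *\<^sub>R w \<in> S" for F :: "'a \<Rightarrow> real" and a w t
  proof -
    have "((\<lambda>t. a + t *\<^sub>R w) has_derivative (\<lambda>d. d *\<^sub>R w)) (at t)"
      by (auto intro!: derivative_eq_intros)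
    from has_derivative_compose[OF this smooth_on_has_derivative[OF that]]
    have "((\<lambda>t. F (a + t *\<^sub>R w)) has_derivative (\<lambda>d. frechet_derivative F (at (a + t *\<^sub>R w)) (d *\<^sub>R w))) (at t)" .
    moreover have "linear (frechet_derivative F (at (a + t *\<^sub>R w)))"
      using smooth_on_has_derivative[OF that] has_derivative_linear by blast
    then have "(\<lambda>d. frechet_derivative F (at (a + t *\<^sub>R w)) (d *\<^sub>R w)) =
        (*) (frechet_derivative F (at (a + t *\<^sub>R w)) w)"
      by (intro ext) (simp add: linear_cmul)
    ultimately show ?thesis
      unfolding has_field_derivative_def by (simp only:)
  qed
  define g where "g \<tau> = f ((x + s *\<^sub>R v) + \<tau> *\<^sub>R u) - f (x + \<tau> *\<^sub>R u)" for \<tau>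
  let ?Du = "\<lambda>y. frechet_derivative f (at y) u"
  have in1: "(x + s *\<^sub>R v) + \<tau> *\<^sub>R u \<in> S" "x + \<tau> *\<^sub>R u \<in> S" if "0 \<le> \<tau>" "\<tau> \<le> s" for \<tau>
    using sub[of \<tau> s] sub[of \<tau> 0] that s by (simp_all add: algebra_simps)
  have "\<exists>\<tau>. 0 < \<tau> \<and> \<tau> < s \<and> g s - g 0 = (s - 0) * (?Du ((x + s *\<^sub>R v) + \<tau> *\<^sub>R u) - ?Du (x + \<tau> *\<^sub>R u))"
  proof (rule MVT2[OF s])
    fix t assume t: "0 \<le> t" "t \<le> s"
    show "(g has_real_derivative ?Du ((x + s *\<^sub>R v) + t *\<^sub>R u) - ?Du (x + t *\<^sub>R u)) (at t)"
      unfolding g_def by (intro DERIV_diff der sm in1 t)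
  qed
  then obtain \<tau> where tau: "0 < \<tau>" "\<tau> < s"
    and g: "g s - g 0 = s * (?Du ((x + s *\<^sub>R v) + \<tau> *\<^sub>R u) - ?Du (x + \<tau> *\<^sub>R u))"
    by auto
  define k where "k \<sigma> = ?Du ((x + \<tau> *\<^sub>R u) + \<sigma> *\<^sub>R v)" for \<sigma>
  have "\<exists>\<sigma>. 0 < \<sigma> \<and> \<sigma> < s \<and> k s - k 0 = (s - 0) * frechet_derivative ?Du (at ((x + \<tau> *\<^sub>R u) + \<sigma> *\<^sub>R v)) v"
  proof (rule MVT2[OF s])
    fix t assume t: "0 \<le> t" "t \<le> s"
    show "(k has_real_derivative frechet_derivative ?Du (at ((x + \<tau> *\<^sub>R u) + t *\<^sub>R v)) v) (at t)"
      unfolding k_def by (intro der smooth_on_frechet_derivative sm sub) (use tau t in auto)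
  qed
  then obtain \<sigma> where sigma: "0 < \<sigma>" "\<sigma> < s"
    and k: "k s - k 0 = s * frechet_derivative ?Du (at ((x + \<tau> *\<^sub>R u) + \<sigma> *\<^sub>R v)) v"
    by auto
  have "f (x + s *\<^sub>R u + s *\<^sub>R v) - f (x + s *\<^sub>R u) - f (x + s *\<^sub>R v) + f x = g s - g 0"
    by (simp add: g_def algebra_simps)
  also have "\<dots> = s * (k s - k 0)"
    unfolding g k_def by (simp add: algebra_simps)
  also have "\<dots> = s\<^sup>2 * frechet_derivative ?Du (at (x + \<tau> *\<^sub>R u + \<sigma> *\<^sub>R v)) v"
    unfolding k by (simp add: power2_eq_square)
  finally show ?thesis
    using that tau sigma by blast
qed

text \<open>Both orders of differentiation, taken at suitable points of a small parallelogram at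
  \<open>x\<close>, equal the same second difference divided by \<open>s\<^sup>2\<close>. If they
  differed at \<open>x\<close>, continuity would keep them apart on a small ball.\<close>

lemma second_derivative_symmetric_real:
  fixes f :: "'a::euclidean_space \<Rightarrow> real"
  assumes S: "open S" and sm: "smooth_on S f" and x: "x \<in> S"
  shows "frechet_derivative (\<lambda>y. frechet_derivative f (at y) u) (at x) v =
    frechet_derivative (\<lambda>y. frechet_derivative f (at y) v) (at x) u"
    (is "?P x = ?Q x")
proof (rule ccontr)
  assume neq: "?P x \<noteq> ?Q x"
  define e where "e = \<bar>?P x - ?Q x\<bar> / 2"
  have e: "e > 0" using neq by (simp add: e_def)
  have "continuous_on S ?P" "continuous_on S ?Q"
    by (intro smooth_on_continuous smooth_on_frechet_derivative sm)+
  then have "isCont ?P x" "isCont ?Q x"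
    using continuous_on_interior x interior_open[OF S] by (metis (no_types, lifting))+
  then obtain d1 d2 where d: "d1 > 0" "\<And>y. dist y x < d1 \<Longrightarrow> dist (?P y) (?P x) < e"
      "d2 > 0" "\<And>y. dist y x < d2 \<Longrightarrow> dist (?Q y) (?Q x) < e"
    unfolding continuous_at_eps_delta using e by blast
  obtain d3 where d3: "d3 > 0" "ball x d3 \<subseteq> S"
    using S x openE by blast
  define r where "r = min d1 (min d2 d3)"
  have r: "r > 0" using d d3 by (simp add: r_def)
  \<comment> \<open>This side length keeps the parallelogram inside the ball of radius
    \<open>r\<close>; the summand 1 guards against \<open>u = v = 0\<close>.\<close>
  define s where "s = r / (2 * (norm u + norm v + 1))"
  have s: "s > 0" unfolding s_def by (intro divide_pos_pos r) (simp add: add_nonneg_pos)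
  have near: "dist (x + \<tau> *\<^sub>R u + \<sigma> *\<^sub>R v) x < r" "dist (x + \<tau> *\<^sub>R v + \<sigma> *\<^sub>R u) x < r"
    if "0 \<le> \<tau>" "\<tau> \<le> s" "0 \<le> \<sigma>" "\<sigma> \<le> s" for \<tau> \<sigma>
  proof -
    have *: "norm (\<tau> *\<^sub>R a + \<sigma> *\<^sub>R b) < r" if ab: "norm a + norm b = norm u + norm v" for a b :: 'a
    proof -
      have "norm (\<tau> *\<^sub>R a + \<sigma> *\<^sub>R b) \<le> \<tau> * norm a + \<sigma> * norm b"
        using norm_triangle_ineq[of "\<tau> *\<^sub>R a" "\<sigma> *\<^sub>R b"] \<open>0 \<le> \<tau>\<close> \<open>0 \<le> \<sigma>\<close> by simp
      also have "\<dots> \<le> s * norm a + s * norm b"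
        by (intro add_mono mult_right_mono) (use \<open>\<tau> \<le> s\<close> \<open>\<sigma> \<le> s\<close> in auto)
      also have "\<dots> = s * (norm u + norm v)" using ab by (simp add: distrib_left[symmetric])
      also have "\<dots> \<le> s * (norm u + norm v + 1)" using s by simp
      also have "\<dots> = r / 2"
      proof -
        have "norm u + norm v + 1 \<noteq> 0"
          using norm_ge_zero[of u] norm_ge_zero[of v] by linarith
        moreover have "r / (2 * c) * c = r / 2" if "c \<noteq> 0" for c :: real
          using that by simp
        ultimately show ?thesis unfolding s_def by blast
      qed
      also have "\<dots> < r" using r by simp
      finally show ?thesis .
    qed
    show "dist (x + \<tau> *\<^sub>R u + \<sigma> *\<^sub>R v) x < r"
      using *[of u v] by (simp add: dist_norm add.assoc)
    show "dist (x + \<tau> *\<^sub>R v + \<sigma> *\<^sub>R u) x < r"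
      using *[of v u] by (simp add: dist_norm add.assoc)
  qed
  have inS: "y \<in> S" if "dist y x < r" for y
    using that d3 by (auto simp: r_def dist_commute)
  obtain \<tau> \<sigma> where 1: "0 < \<tau>" "\<tau> < s" "0 < \<sigma>" "\<sigma> < s"
    "f (x + s *\<^sub>R u + s *\<^sub>R v) - f (x + s *\<^sub>R u) - f (x + s *\<^sub>R v) + f x =
     s\<^sup>2 * ?P (x + \<tau> *\<^sub>R u + \<sigma> *\<^sub>R v)"
    by (rule second_difference_mvt[OF sm s inS[OF near(1)]])
  obtain \<tau>' \<sigma>' where 2: "0 < \<tau>'" "\<tau>' < s" "0 < \<sigma>'" "\<sigma>' < s"
    "f (x + s *\<^sub>R v + s *\<^sub>R u) - f (x + s *\<^sub>R v) - f (x + s *\<^sub>R u) + f x =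
     s\<^sup>2 * ?Q (x + \<tau>' *\<^sub>R v + \<sigma>' *\<^sub>R u)"
    by (rule second_difference_mvt[OF sm s inS[OF near(2)]])
  have "s\<^sup>2 * ?P (x + \<tau> *\<^sub>R u + \<sigma> *\<^sub>R v) = s\<^sup>2 * ?Q (x + \<tau>' *\<^sub>R v + \<sigma>' *\<^sub>R u)"
    using 1(5) 2(5) by (simp add: algebra_simps)
  then have eq: "?P (x + \<tau> *\<^sub>R u + \<sigma> *\<^sub>R v) = ?Q (x + \<tau>' *\<^sub>R v + \<sigma>' *\<^sub>R u)"
    using s by simp
  have "dist (?P (x + \<tau> *\<^sub>R u + \<sigma> *\<^sub>R v)) (?P x) < e"
    using near(1)[of \<tau> \<sigma>] 1 by (intro d(2)) (auto simp: r_def)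
  moreover have "dist (?Q (x + \<tau>' *\<^sub>R v + \<sigma>' *\<^sub>R u)) (?Q x) < e"
    using near(2)[of \<tau>' \<sigma>'] 2 by (intro d(4)) (auto simp: r_def)
  ultimately have "\<bar>?P x - ?Q x\<bar> < 2 * e"
    unfolding eq dist_real_def by linarith
  then show False by (simp add: e_def)
qed

lemma second_derivative_symmetric:
  fixes f :: "'a::euclidean_space \<Rightarrow> 'b::euclidean_space"
  assumes S: "open S" and sm: "smooth_on S f" and x: "x \<in> S"
  shows "frechet_derivative (\<lambda>y. frechet_derivative f (at y) u) (at x) v =
    frechet_derivative (\<lambda>y. frechet_derivative f (at y) v) (at x) u"
proof (rule euclidean_eqI)
  fix b :: 'b
  have smb: "smooth_on S (\<lambda>y. F y \<bullet> b)" if "smooth_on S F" for F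
    by (rule smooth_on_bounded_linear[OF S bounded_linear_inner_left that])
  have comp: "frechet_derivative (\<lambda>y. F y \<bullet> b) (at y) = (\<lambda>w. frechet_derivative F (at y) w \<bullet> b)"
    if "smooth_on S F" "y \<in> S" for F y
    using bounded_linear.has_derivative[OF bounded_linear_inner_left smooth_on_has_derivative[OF that]]
    by (rule frechet_derivative_at[symmetric])
  have comp2: "frechet_derivative (\<lambda>y. frechet_derivative f (at y) u) (at x) v \<bullet> b =
      frechet_derivative (\<lambda>y. frechet_derivative (\<lambda>y. f y \<bullet> b) (at y) u) (at x) v" for u v
  proof -
    have "frechet_derivative (\<lambda>y. frechet_derivative (\<lambda>y. f y \<bullet> b) (at y) u) (at x) =
        frechet_derivative (\<lambda>y. frechet_derivative f (at y) u \<bullet> b) (at x)"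
    proof (rule sym, rule frechet_derivative_at)
      have "((\<lambda>y. frechet_derivative f (at y) u \<bullet> b) has_derivative
          frechet_derivative (\<lambda>y. frechet_derivative f (at y) u \<bullet> b) (at x)) (at x)"
        by (rule smooth_on_has_derivative[OF smb[OF smooth_on_frechet_derivative[OF sm]] x])
      then show "((\<lambda>y. frechet_derivative (\<lambda>y. f y \<bullet> b) (at y) u) has_derivative
          frechet_derivative (\<lambda>y. frechet_derivative f (at y) u \<bullet> b) (at x)) (at x)"
        by (rule has_derivative_transform_within_open[OF _ S x]) (simp only: comp[OF sm])
    qed
    then show ?thesis
      by (simp only: comp[OF smooth_on_frechet_derivative[OF sm] x])
  qed
  show "frechet_derivative (\<lambda>y. frechet_derivative f (at y) u) (at x) v \<bullet> b =
    frechet_derivative (\<lambda>y. frechet_derivative f (at y) v) (at x) u \<bullet> b"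
    using second_derivative_symmetric_real[OF S smb[OF sm] x] by (simp only: comp2)
qed

section \<open>Determinants, positive definite forms and frames\<close>

text \<open>The Leibniz formula is linear in each row, so differentiation replaces one row at a
  time. This is also the shape in which \<open>affine_normal_on\<close> expresses that the volume
  form is parallel.\<close>

lemma has_derivative_det:
  fixes M :: "'a::real_normed_vector \<Rightarrow> real ^ 'n ^ 'n"
  assumes M: "\<And>i j. ((\<lambda>x. M x $ i $ j) has_derivative (\<lambda>v. M' v $ i $ j)) (at x)"
  shows "((\<lambda>x. det (M x)) has_derivative
    (\<lambda>v. \<Sum>i\<in>UNIV. det (\<chi> k. if k = i then M' v $ i else M x $ k))) (at x)"
proof -
  let ?P = "{p. p permutes (UNIV :: 'n set)}"
  have "((\<lambda>x. det (M x)) has_derivative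
    (\<lambda>v. \<Sum>p\<in>?P. of_int (sign p) * (\<Sum>i\<in>UNIV. M' v $ i $ p i * (\<Prod>j\<in>UNIV - {i}. M x $ j $ p j)))) (at x)"
    unfolding det_def
    by (rule has_derivative_sum, rule has_derivative_mult_right, rule has_derivative_prod, rule M)
  moreover have "(\<lambda>v. \<Sum>p\<in>?P. of_int (sign p) * (\<Sum>i\<in>UNIV. M' v $ i $ p i * (\<Prod>j\<in>UNIV - {i}. M x $ j $ p j)))
     = (\<lambda>v. \<Sum>i\<in>UNIV. det (\<chi> k. if k = i then M' v $ i else M x $ k))"
  proof (rule ext)
    fix v
    have pr: "(\<Prod>k\<in>UNIV. (\<chi> k. if k = i then M' v $ i else M x $ k) $ k $ p k) =
        M' v $ i $ p i * (\<Prod>j\<in>UNIV - {i}. M x $ j $ p j)" for i p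
      by (subst prod.remove[of _ i]) (auto intro!: prod.cong)
    show "(\<Sum>p\<in>?P. of_int (sign p) * (\<Sum>i\<in>UNIV. M' v $ i $ p i * (\<Prod>j\<in>UNIV - {i}. M x $ j $ p j)))
     = (\<Sum>i\<in>UNIV. det (\<chi> k. if k = i then M' v $ i else M x $ k))"
      unfolding det_def pr sum_distrib_left by (rule sum.swap)
  qed
  ultimately show ?thesis by (simp only:)
qed

locale posdef_form =
  fixes h :: "'a::euclidean_space \<Rightarrow> 'a \<Rightarrow> real"
  assumes bilin: "bilinear h" and sym: "h u v = h v u" and pos: "u \<noteq> 0 \<Longrightarrow> 0 < h u u"
begin

lemma linear_right: "linear (h u)" and linear_left: "linear (\<lambda>u. h u v)"
  using bilin by (auto simp: bilinear_def)

lemma left_simps [simp]: "h (u + u') v = h u v + h u' v" "h (u - u') v = h u v - h u' v"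
    "h (- u) v = - h u v" "h (c *\<^sub>R u) v = c * h u v" "h 0 v = 0" "h (\<Sum>i\<in>I. g i) v = (\<Sum>i\<in>I. h (g i) v)"
  by (simp_all add: linear_add[OF linear_left] linear_diff[OF linear_left] linear_neg[OF linear_left]
      linear_cmul[OF linear_left] linear_0[OF linear_left] linear_sum[OF linear_left])

lemma right_simps [simp]: "h v (u + u') = h v u + h v u'" "h v (u - u') = h v u - h v u'"
    "h v (- u) = - h v u" "h v (c *\<^sub>R u) = c * h v u" "h v 0 = 0" "h v (\<Sum>i\<in>I. g i) = (\<Sum>i\<in>I. h v (g i))"
  by (simp_all add: linear_add[OF linear_right] linear_diff[OF linear_right] linear_neg[OF linear_right]
      linear_cmul[OF linear_right] linear_0[OF linear_right] linear_sum[OF linear_right])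

lemma nonneg: "0 \<le> h u u"
  using pos[of u] by (cases "u = 0") auto

lemma eq_0_iff: "h u u = 0 \<longleftrightarrow> u = 0"
  using pos[of u] by (cases "u = 0") auto

lemma eqI: "(\<And>w. h u w = h v w) \<Longrightarrow> u = v"
  using eq_0_iff[of "u - v"] by simp

end

text \<open>An induction over the index set as in the Gram-Schmidt process, except that the new
  vector comes from a dimension count and not from a projection.\<close>

lemma orthonormal_frame_exists:
  fixes h :: "real ^ 'n \<Rightarrow> real ^ 'n \<Rightarrow> real" and i0 :: 'n
  assumes "posdef_form h" "h e e = 1"
  obtains E where "E i0 = e" "\<And>i j. h (E i) (E j) = (if i = j then 1 else 0)"
proof -
  interpret posdef_form h by fact
  have "\<exists>E. E i0 = e \<and> (\<forall>i\<in>I. \<forall>j\<in>I. h (E i) (E j) = (if i = j then 1 else 0))" if "i0 \<in> I" for I :: "'n set"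
  proof -
    have "\<exists>E. E i0 = e \<and> (\<forall>i\<in>insert i0 J. \<forall>j\<in>insert i0 J. h (E i) (E j) = (if i = j then 1 else 0))"
      if "i0 \<notin> J" for J :: "'n set"
      using finite[of J] that
    proof (induction J rule: finite_induct)
      case empty
      show ?case by (rule exI[of _ "\<lambda>_. e"]) (simp add: assms)
    next
      case (insert m J)
      then have "i0 \<notin> J" by simp
      from insert.IH[OF this] obtain E where E: "E i0 = e"
        "\<And>i j. i \<in> insert i0 J \<Longrightarrow> j \<in> insert i0 J \<Longrightarrow> h (E i) (E j) = (if i = j then 1 else 0)"
        by blast
      \<comment> \<open>Pairing with the vectors already found misses the direction
        \<open>axis m 1\<close>. As an endomorphism of the whole space it is therefore not
        surjective, and so it has a kernel.\<close>
      let ?f = "\<lambda>v. \<chi> i. if i \<in> insert i0 J then h v (E i) else 0"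
      have lin: "linear ?f" by (rule linearI) (auto simp: vec_eq_iff)
      have "\<not> surj ?f"
      proof
        assume "surj ?f"
        then obtain v where "axis m 1 = ?f v" by (rule surjE)
        then have "axis m (1::real) $ m = ?f v $ m" by (rule arg_cong)
        then show False using insert.hyps insert.prems by (simp add: axis_def split: if_splits)
      qed
      then have "\<not> inj ?f"
        using linear_injective_imp_surjective[OF lin] by blast
      then obtain v where v: "v \<noteq> 0" "?f v = 0"
        using linear_injective_0[OF lin] by blast
      have ort: "h v (E i) = 0" if "i \<in> insert i0 J" for i
      proof -
        have "?f v $ i = 0" using v(2) by simp
        then show ?thesis using that by simp
      qed
      define w where "w = (1 / sqrt (h v v)) *\<^sub>R v"
      have ww: "h w w = 1"
        using pos[OF v(1)] by (simp add: w_def field_simps)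
      have wE: "h w (E i) = 0" "h (E i) w = 0" if "i \<in> insert i0 J" for i
        using ort[OF that] by (simp_all add: w_def sym[of "E i"])
      have mi: "m \<notin> insert i0 J" using insert by auto
      show ?case
      proof (rule exI[of _ "E(m := w)"], intro conjI ballI)
        show "(E(m := w)) i0 = e" using insert E by auto
        fix i j assume "i \<in> insert i0 (insert m J)" "j \<in> insert i0 (insert m J)"
        then show "h ((E(m := w)) i) ((E(m := w)) j) = (if i = j then 1 else 0)"
          using ww wE E(2) mi by (cases "i = m"; cases "j = m") auto
      qed
    qed
    from this[of "I - {i0}"] show ?thesis using that by (simp add: insert_absorb)
  qed
  from this[of UNIV] show ?thesis using that by auto
qed

locale orthonormal_frame = posdef_form h for h :: "real ^ 'n \<Rightarrow> real ^ 'n \<Rightarrow> real" +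
  fixes E :: "'n \<Rightarrow> real ^ 'n"
  assumes orthonormal: "h (E i) (E j) = (if i = j then 1 else 0)"
begin

lemma sum_orthonormal: "h (\<Sum>j\<in>UNIV. z j *\<^sub>R E j) (E i) = z i"
  by (simp add: orthonormal if_distrib cong: if_cong)

lemma linear_frame: "linear (\<lambda>z :: real ^ 'n. \<Sum>j\<in>UNIV. z $ j *\<^sub>R E j)"
  by (rule linearI) (simp_all add: scaleR_add_left sum.distrib scaleR_sum_right)

lemma bij_frame: "bij (\<lambda>z :: real ^ 'n. \<Sum>j\<in>UNIV. z $ j *\<^sub>R E j)" (is "bij ?L")
proof -
  have "inj ?L"
  proof (rule injI)
    fix z z' assume "?L z = ?L z'"
    then have "h (?L z) (E i) = h (?L z') (E i)" for i by metis
    then have "z $ i = z' $ i" for i unfolding sum_orthonormal .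
    then show "z = z'" by (simp add: vec_eq_iff)
  qed
  then show ?thesis
    using linear_injective_imp_surjective[OF linear_frame] by (simp add: bij_def)
qed

lemma expansion: "v = (\<Sum>j\<in>UNIV. h v (E j) *\<^sub>R E j)"
proof -
  obtain z :: "real ^ 'n" where z: "v = (\<Sum>j\<in>UNIV. z $ j *\<^sub>R E j)"
    using bij_is_surj[OF bij_frame] unfolding surj_def by blast
  have eq: "h v (E i) = z $ i" for i unfolding z by (rule sum_orthonormal)
  show ?thesis unfolding eq by (rule z)
qed

lemma linear_eq_0: "linear g \<Longrightarrow> (\<And>i. g (E i) = (0::real)) \<Longrightarrow> g u = 0"
  by (subst expansion[of u]) (simp add: linear_sum linear_cmul)

lemma riesz:
  assumes "linear g"
  shows "h (\<Sum>i\<in>UNIV. g (E i) *\<^sub>R E i) w = g w"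
proof -
  have "g w = g (\<Sum>i\<in>UNIV. h w (E i) *\<^sub>R E i)" by (subst expansion[of w]) (rule refl)
  then show ?thesis by (simp add: linear_sum[OF assms] linear_cmul[OF assms] sym[of w] mult.commute)
qed

end

text \<open>At an orthonormal frame the Gram matrix is the identity; together with
  \<open>has_derivative_det\<close> this makes the derivative of its determinant a trace.\<close>

lemma det_replace_row_mat_1:
  "det (\<chi> k. if k = i then r else mat 1 $ k) = (r :: real ^ 'n) $ i"
proof -
  have row: "row j A = A $ j" for j and A :: "real ^ 'n ^ 'n"
    by (simp add: row_def)
  have m: "mat 1 $ j = axis j (1 :: real)" for j :: 'n
    by (auto simp: mat_def axis_def vec_eq_iff)
  show ?thesis
    using cramer_lemma_transpose[of i r "mat 1"] unfolding row m basis_expansion by simp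
qed

section \<open>Rotations about an axis and invariant cubic forms\<close>

text \<open>The determinant is found without a matrix: that of \<open>J\<close> is nonnegative
  because \<open>J\<close> is the square of \<open>S\<close>, and its fourth power is 1.\<close>

lemma det_one_sqrt_power:
  fixes J S :: "real ^ 'n \<Rightarrow> real ^ 'n"
  assumes "linear S" "linear J" "J = S \<circ> S" "J \<circ> J \<circ> (J \<circ> J) = id"
  shows "det (matrix J) = 1"
proof -
  have d: "det (matrix (f \<circ> g)) = det (matrix f) * det (matrix g)"
    if "linear f" "linear g" for f g :: "real ^ 'n \<Rightarrow> real ^ 'n"
    using matrix_compose[OF that(2,1)] by (simp add: det_mul)
  have "linear (J \<circ> J)" by (rule linear_compose[OF assms(2,2)])
  then have "det (matrix (J \<circ> J \<circ> (J \<circ> J))) = det (matrix J) ^ 4"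
    by (simp add: d assms(2) power4_eq_xxxx)
  then have "det (matrix J) ^ 4 = 1"
    unfolding assms(4) by (simp add: matrix_id_mat_1)
  moreover have "det (matrix J) = (det (matrix S))\<^sup>2"
    unfolding assms(3) d[OF assms(1,1)] by (simp add: power2_eq_square)
  then have "det (matrix J) \<ge> 0" by simp
  ultimately show ?thesis
    using power_eq_imp_eq_base[of "det (matrix J)" 4 1] by simp
qed

text \<open>The rotation by the angle with cosine \<open>c\<close> and sine \<open>s\<close> in the \<open>h\<close>-orthonormal plane spanned by \<open>p\<close> and \<open>q\<close>.\<close>

definition plane_rotation ::
  "('a::real_vector \<Rightarrow> 'a \<Rightarrow> real) \<Rightarrow> 'a \<Rightarrow> 'a \<Rightarrow> real \<Rightarrow> real \<Rightarrow> 'a \<Rightarrow> 'a" where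
  "plane_rotation h p q c s u =
     u + ((c - 1) * h u p - s * h u q) *\<^sub>R p + (s * h u p + (c - 1) * h u q) *\<^sub>R q"

context posdef_form
begin

lemma linear_plane_rotation: "linear (plane_rotation h p q c s)"
proof -
  have "linear (\<lambda>u. a * h u v)" "linear (\<lambda>u::'a. u)" for a v
    by (rule linearI; simp add: distrib_left)+
  then show ?thesis
    unfolding plane_rotation_def
    by (intro linear_compose_add linear_compose_sub linear_compose[OF _ linear_scaleR_left, unfolded o_def])
qed

text \<open>The addition formulas of cosine and sine, as polynomial identities.\<close>

lemma plane_rotation_comp:
  assumes "h p p = 1" "h q q = 1" "h p q = 0"
  shows "plane_rotation h p q c s (plane_rotation h p q c' s' u) =
    plane_rotation h p q (c * c' - s * s') (s * c' + c * s') u"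
proof -
  have qp: "h q p = 0" using assms(3) sym[of q p] by simp
  let ?x = "h u p" and ?y = "h u q" and ?w = "plane_rotation h p q c' s' u"
  have wp: "h ?w p = c' * ?x - s' * ?y" and wq: "h ?w q = s' * ?x + c' * ?y"
    unfolding plane_rotation_def left_simps assms qp by algebra+
  have "plane_rotation h p q c s ?w =
      u + (((c' - 1) * ?x - s' * ?y) + ((c - 1) * h ?w p - s * h ?w q)) *\<^sub>R p
        + ((s' * ?x + (c' - 1) * ?y) + (s * h ?w p + (c - 1) * h ?w q)) *\<^sub>R q"
    unfolding plane_rotation_def[of h p q c s] unfolding scaleR_add_left
    by (simp add: plane_rotation_def[of h p q c' s' u] scaleR_add_left)
  also have "((c' - 1) * ?x - s' * ?y) + ((c - 1) * h ?w p - s * h ?w q) =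
      (c * c' - s * s' - 1) * ?x - (s * c' + c * s') * ?y"
    unfolding wp wq by algebra
  also have "(s' * ?x + (c' - 1) * ?y) + (s * h ?w p + (c - 1) * h ?w q) =
      (s * c' + c * s') * ?x + (c * c' - s * s' - 1) * ?y"
    unfolding wp wq by algebra
  finally show ?thesis unfolding plane_rotation_def .
qed

end

lemma axis_rotation_quarter_turn:
  assumes "posdef_form h" and pq: "h p p = 1" "h q q = 1" "h p q = 0" and e: "h e p = 0" "h e q = 0"
  shows "axis_rotation h e (plane_rotation h p q 0 1)"
proof -
  interpret posdef_form h by fact
  let ?R = "plane_rotation h p q"
  have qp: "h q p = 0" "h p e = 0" "h q e = 0" using pq e sym by auto
  have "det (matrix (?R 0 1)) = 1"
  proof (rule det_one_sqrt_power[OF linear_plane_rotation linear_plane_rotation])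
    \<comment> \<open>The rotation by an eighth turn is a square root of the quarter turn; this
      decides the sign of the determinant.\<close>
    let ?r = "1 / sqrt 2 :: real"
    have "?r * ?r = 1 / 2" by simp
    then show "?R 0 1 = ?R ?r ?r \<circ> ?R ?r ?r"
      by (simp add: fun_eq_iff plane_rotation_comp[OF pq])
    show "?R 0 1 \<circ> ?R 0 1 \<circ> (?R 0 1 \<circ> ?R 0 1) = id"
      by (simp add: fun_eq_iff plane_rotation_comp[OF pq]) (simp add: plane_rotation_def)
  qed
  moreover have "h (?R 0 1 Y) (?R 0 1 Z) = h Y Z" for Y Z
    by (simp add: plane_rotation_def pq qp sym[of p Y] sym[of q Y] sym[of p Z] sym[of q Z] algebra_simps)
  moreover have "?R 0 1 e = e" "h e (?R 0 1 Y) = h e Y" for Y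
    by (simp_all add: plane_rotation_def e)
  ultimately show ?thesis
    unfolding axis_rotation_def using linear_plane_rotation by simp
qed

locale symmetric_cubic_form =
  fixes C :: "'a::euclidean_space \<Rightarrow> 'a \<Rightarrow> 'a \<Rightarrow> real"
  assumes linear1: "linear (\<lambda>u. C u v w)"
    and swap12: "C u v w = C v u w" and swap23: "C u v w = C u w v"
begin

lemma linear2: "linear (\<lambda>v. C u v w)"
proof -
  have eq: "(\<lambda>v. C u v w) = (\<lambda>v. C v u w)" by (rule ext) (rule swap12)
  show ?thesis unfolding eq by (rule linear1)
qed

lemma linear3: "linear (C u v)"
proof -
  have eq: "C u v = (\<lambda>w. C u w v)" by (rule ext) (rule swap23)
  show ?thesis unfolding eq by (rule linear2)
qed

end

text \<open>Quarter turns in the planes orthogonal to \<open>e\<close> already determine \<open>C\<close> up to \<open>C e e e\<close> and the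
  common value of \<open>C e p p\<close>; apolarity relates these two numbers.\<close>

lemma axially_symmetric_cubic_form:
  fixes h :: "real ^ 'n \<Rightarrow> real ^ 'n \<Rightarrow> real"
  assumes h: "posdef_form h" and C: "symmetric_cubic_form C"
    and card: "CARD('n) \<ge> 3" and e: "h e e = 1"
    and inv: "\<And>g u v w. axis_rotation h e g \<Longrightarrow> C (g u) (g v) (g w) = C u v w"
    and apolar: "\<And>E w. orthonormal_frame h E \<Longrightarrow> (\<Sum>i\<in>UNIV. C (E i) (E i) w) = 0"
  obtains a where "\<And>u v w. C u v w = a * (h e u * h v w + h e v * h u w + h e w * h u v)
    - (real CARD('n) + 2) * a * h e u * h e v * h e w"
proof -
  interpret posdef_form h by fact
  interpret C: symmetric_cubic_form C by fact
  obtain i0 :: 'n where True by blast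
  obtain E where E0: "E i0 = e" and E: "\<And>i j. h (E i) (E j) = (if i = j then 1 else 0)"
    by (rule orthonormal_frame_exists[OF h e, of i0]) blast
  interpret orthonormal_frame h E by unfold_locales (rule E)
  have neg: "C (- u) v w = - C u v w" "C u (- v) w = - C u v w" "C u v (- w) = - C u v w" for u v w
    by (rule linear_neg[OF C.linear1], rule linear_neg[OF C.linear2], rule linear_neg[OF C.linear3])
  have quarter: "\<exists>g. g e = e \<and> g (E i) = E j \<and> g (E j) = - E i \<and> (\<forall>k. k \<noteq> i \<longrightarrow> k \<noteq> j \<longrightarrow> g (E k) = E k)
      \<and> (\<forall>u v w. C (g u) (g v) (g w) = C u v w)"
    if "i \<noteq> i0" "j \<noteq> i0" "i \<noteq> j" for i j
  proof (rule exI[of _ "plane_rotation h (E i) (E j) 0 1"], intro conjI allI impI)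
    have "axis_rotation h e (plane_rotation h (E i) (E j) 0 1)"
      by (rule axis_rotation_quarter_turn[OF h]) (use that E in \<open>auto simp: E0[symmetric]\<close>)
    then show "C (plane_rotation h (E i) (E j) 0 1 u) (plane_rotation h (E i) (E j) 0 1 v)
        (plane_rotation h (E i) (E j) 0 1 w) = C u v w" for u v w
      by (rule inv)
  qed (use that in \<open>auto simp: plane_rotation_def E E0[symmetric]\<close>)
  have other: "\<exists>j. j \<noteq> i0 \<and> j \<noteq> i" for i
  proof (rule ccontr)
    assume "\<not> ?thesis"
    then have "(UNIV :: 'n set) \<subseteq> {i0, i}" by auto
    then have "CARD('n) \<le> card {i0, i}" by (rule card_mono[rotated]) simp
    also have "\<dots> \<le> 2" by (simp add: card_insert_if)
    finally show False using card by simp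
  qed
  \<comment> \<open>The turn in the plane of \<open>E i\<close> and \<open>E j\<close> sends this
    entry to its negative.\<close>
  have off: "C e (E i) (E j) = 0" if ij: "i \<noteq> i0" "j \<noteq> i0" "i \<noteq> j" for i j
  proof -
    obtain g where "g e = e" "g (E i) = E j" "g (E j) = - E i"
      "C (g e) (g (E i)) (g (E j)) = C e (E i) (E j)"
      using quarter[OF ij] by blast
    then have "C e (E j) (- E i) = C e (E i) (E j)" by simp
    then show ?thesis using neg C.swap23[of e "E j" "E i"] by simp
  qed
  have diag: "C e (E i) (E i) = C e (E j) (E j)" if ij: "i \<noteq> i0" "j \<noteq> i0" for i j
  proof (cases "i = j")
    case False
    then obtain g where "g e = e" "g (E i) = E j"
      "C (g e) (g (E i)) (g (E i)) = C e (E i) (E i)"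
      using quarter[OF ij] by blast
    then show ?thesis by simp
  qed simp
  \<comment> \<open>Dimension at least 3 supplies a further index \<open>j\<close>. The turn
    exchanges the two entries up to a sign in one direction, which makes both vanish.\<close>
  have eeE: "C e e (E i) = 0" if i: "i \<noteq> i0" for i
  proof -
    obtain j where j: "j \<noteq> i0" "j \<noteq> i" using other by blast
    obtain g where "g e = e" "g (E i) = E j" "g (E j) = - E i"
      "C (g e) (g e) (g (E i)) = C e e (E i)" "C (g e) (g e) (g (E j)) = C e e (E j)"
      using quarter[OF i j(1) j(2)[symmetric]] by blast
    then have "C e e (E j) = C e e (E i)" "C e e (- E i) = C e e (E j)" by simp_all
    then show ?thesis using neg(3)[of e e "E i"] by linarith
  qed
  have EEE: "C (E i) (E j) (E k) = 0" if ijk: "i \<noteq> i0" "j \<noteq> i0" "k \<noteq> i0" for i j k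
  proof -
    have iij: "C (E i) (E i) (E j) = 0" if ij: "i \<noteq> i0" "j \<noteq> i0" "i \<noteq> j" for i j
    proof -
      obtain g where g: "g (E i) = E j" "g (E j) = - E i" "\<forall>u v w. C (g u) (g v) (g w) = C u v w"
        using quarter[OF ij] by blast
      have "C (E j) (E j) (- E i) = C (E i) (E i) (E j)" "C (- E i) (- E i) (E j) = C (E j) (E j) (E i)"
        using g(3)[rule_format, of "E i" "E i" "E j"] g(3)[rule_format, of "E j" "E j" "E i"]
        unfolding g(1,2) .
      then show ?thesis using neg by simp
    qed
    have iii: "C (E i) (E i) (E i) = 0" if i: "i \<noteq> i0" for i
    proof -
      obtain j where j: "j \<noteq> i0" "j \<noteq> i" using other by blast
      obtain g where g: "g (E i) = E j" "g (E j) = - E i" "\<forall>u v w. C (g u) (g v) (g w) = C u v w"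
        using quarter[OF i j(1) j(2)[symmetric]] by blast
      have "C (E j) (E j) (E j) = C (E i) (E i) (E i)" "C (- E i) (- E i) (- E i) = C (E j) (E j) (E j)"
        using g(3)[rule_format, of "E i" "E i" "E i"] g(3)[rule_format, of "E j" "E j" "E j"]
        unfolding g(1,2) .
      then show ?thesis using neg by simp
    qed
    have dist: "C (E i) (E j) (E k) = 0" if d: "i \<noteq> j" "j \<noteq> k" "i \<noteq> k"
    proof -
      obtain g where g: "g (E i) = E j" "g (E j) = - E i" "\<forall>k. k \<noteq> i \<longrightarrow> k \<noteq> j \<longrightarrow> g (E k) = E k"
          "\<forall>u v w. C (g u) (g v) (g w) = C u v w"
        using quarter[OF ijk(1,2) d(1)] by blast
      have "g (E k) = E k" using g(3) d by metis
      then have "C (E j) (- E i) (E k) = C (E i) (E j) (E k)"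
        using g(4)[rule_format, of "E i" "E j" "E k"] unfolding g(1,2) by simp
      then show ?thesis using neg(2)[of "E j" "E i" "E k"] C.swap12[of "E j" "E i" "E k"] by simp
    qed
    consider "i = j" "j = k" | "i = j" "j \<noteq> k" | "i = k" "j \<noteq> k" | "j = k" "i \<noteq> k" | "i \<noteq> j" "j \<noteq> k" "i \<noteq> k"
      by blast
    then show ?thesis
    proof cases
      case 1 then show ?thesis using iii ijk by simp
    next
      case 2 then show ?thesis using iij[of j k] ijk by simp
    next
      case 3 then show ?thesis using iij[of k j] ijk C.swap23[of "E k" "E j" "E k"] by simp
    next
      case 4
      then show ?thesis
        using iij[of k i] ijk C.swap12[of "E i" "E k" "E k"] C.swap23[of "E k" "E i" "E k"] by simp
    next
      case 5 then show ?thesis using dist by simp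
    qed
  qed
  obtain i1 where i1: "i1 \<noteq> i0" using other by blast
  define a where "a = C e (E i1) (E i1)"
  have ediag: "C e (E i) (E i) = a" if "i \<noteq> i0" for i
    unfolding a_def by (rule diag[OF that i1])
  \<comment> \<open>Apolarity contracted with \<open>e\<close>: the axis contributes this entry, and
    each of the other n - 1 frame vectors contributes \<open>a\<close>.\<close>
  have "C e e e = - (real CARD('n) - 1) * a"
  proof -
    have "0 = (\<Sum>i\<in>UNIV. C (E i) (E i) e)"
      using apolar[of E e] orthonormal_frame_axioms by simp
    also have "\<dots> = C e e e + (\<Sum>i\<in>UNIV - {i0}. C (E i) (E i) e)"
      by (subst sum.remove[of _ i0]) (simp_all add: E0)
    also have "(\<Sum>i\<in>UNIV - {i0}. C (E i) (E i) e) = (\<Sum>i\<in>UNIV - {i0}. a)"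
    proof (rule sum.cong)
      fix i assume "i \<in> UNIV - {i0}"
      then show "C (E i) (E i) e = a"
        using ediag[of i] C.swap23[of "E i" "E i" e] C.swap12[of "E i" e "E i"] by simp
    qed simp
    also have "\<dots> = (real CARD('n) - 1) * a"
      using card by (simp add: card_Diff_singleton of_nat_diff)
    finally show ?thesis by (simp add: algebra_simps)
  qed
  note eee = this
  \<comment> \<open>The difference of both sides is again a symmetric cubic form, so it suffices
    that it vanishes on the frame.\<close>
  define D where "D u v w = C u v w - (a * (h e u * h v w + h e v * h u w + h e w * h u v)
    - (real CARD('n) + 2) * a * h e u * h e v * h e w)" for u v w
  have lin1: "linear (\<lambda>u. D u v w)" for v w
  proof (rule linearI)
    show "D (b1 + b2) v w = D b1 v w + D b2 v w" for b1 b2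
      by (simp add: D_def linear_add[OF C.linear1] algebra_simps)
    show "D (r *\<^sub>R b) v w = r *\<^sub>R D b v w" for r b
      by (simp add: D_def linear_cmul[OF C.linear1] algebra_simps)
  qed
  have D12: "D u v w = D v u w" for u v w
    using C.swap12[of u v w] sym[of u v] by (simp add: D_def algebra_simps)
  have D23: "D u v w = D u w v" for u v w
    using C.swap23[of u v w] sym[of v w] by (simp add: D_def algebra_simps)
  interpret D: symmetric_cubic_form D
    by (rule symmetric_cubic_form.intro[OF lin1 D12 D23])
  have he: "h e (E i) = (if i = i0 then 1 else 0)" for i
    using E[of i0 i] by (auto simp: E0)
  have DE3: "D (E i) (E j) (E k) = 0" if "i \<noteq> i0" "j \<noteq> i0" "k \<noteq> i0" for i j k
    using EEE[OF that] that by (simp add: D_def he)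
  have DE2: "D e (E j) (E k) = 0" if "j \<noteq> i0" "k \<noteq> i0" for j k
    using ediag[OF that(1)] off[OF that] that by (cases "j = k") (simp_all add: D_def he E e)
  have DE1: "D e e (E k) = 0" for k
  proof (cases "k = i0")
    case True
    then show ?thesis using eee by (simp add: D_def E0 e algebra_simps)
  next
    case False
    then show ?thesis using eeE[OF False] by (simp add: D_def he)
  qed
  have DE: "D (E i) (E j) (E k) = 0" for i j k
  proof -
    have A: "D e (E j) (E k) = 0" for j k
    proof (cases "j = i0")
      case True then show ?thesis using DE1 E0 by simp
    next
      case False
      show ?thesis
      proof (cases "k = i0")
        case True then show ?thesis using DE1[of j] D23[of e "E j" e] E0 by simp
      qed (use False DE2 in simp)
    qed
    show ?thesis
    proof (cases "i = i0")
      case True then show ?thesis using A E0 by simp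
    next
      case i: False
      show ?thesis
      proof (cases "j = i0")
        case True then show ?thesis using A[of i k] D12[of "E i" e "E k"] E0 by simp
      next
        case j: False
        show ?thesis
        proof (cases "k = i0")
          case True
          then show ?thesis
            using A[of i j] D23[of "E i" "E j" e] D12[of "E i" e "E j"] E0 by simp
        qed (use i j DE3 in simp)
      qed
    qed
  qed
  have D1: "D u (E j) (E k) = 0" for u j k
    by (rule linear_eq_0[where g="\<lambda>u. D u (E j) (E k)"], rule D.linear1, rule DE)
  have D2: "D u v (E k) = 0" for u v k
    by (rule linear_eq_0[where g="\<lambda>v. D u v (E k)"], rule D.linear2, rule D1)
  have "D u v w = 0" for u v w
    by (rule linear_eq_0[where g="D u v"], rule D.linear3, rule D2)
  then have "C u v w = a * (h e u * h v w + h e v * h u w + h e w * h u v)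
    - (real CARD('n) + 2) * a * h e u * h e v * h e w" for u v w
    using eq_iff_diff_eq_0 unfolding D_def by blast
  then show ?thesis using that[of a] by blast
qed

section \<open>Graph coordinates\<close>

definition vec_init :: "'a ^ 'n option \<Rightarrow> 'a ^ 'n" where
  "vec_init w = (\<chi> i. w $ Some i)"

lemma vec_init_snoc [simp]: "vec_init (snoc u a) = u"
  by (simp add: vec_init_def vec_eq_iff)

lemma snoc_vec_init: "snoc (vec_init w) (w $ None) = w"
  by (simp add: vec_init_def vec_eq_iff snoc_def split: option.split)

lemma linear_vec_init: "linear (vec_init :: real ^ 'n option \<Rightarrow> real ^ 'n)"
  by (rule linearI) (simp_all add: vec_init_def vec_eq_iff)

lemma sum_UNIV_option: "(\<Sum>i\<in>(UNIV :: 'n::finite option set). g i) = g None + (\<Sum>i\<in>UNIV. g (Some i))"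
  by (simp add: UNIV_option_conv sum.reindex)

lemma linear_vec_nth: "linear (\<lambda>w :: real ^ 'n. w $ i)"
  by (rule linearI) simp_all

lemma linear_frechet_derivative:
  "smooth_on S f \<Longrightarrow> x \<in> S \<Longrightarrow> linear (frechet_derivative f (at x))"
  by (rule has_derivative_linear, rule smooth_on_has_derivative)

lemma has_derivative_linear_comp:
  fixes L :: "'b::euclidean_space \<Rightarrow> 'c::euclidean_space"
  assumes "linear L" "(f has_derivative f') F"
  shows "((\<lambda>x. L (f x)) has_derivative (\<lambda>v. L (f' v))) F"
  by (rule bounded_linear.has_derivative[OF _ assms(2)]) (rule assms(1)[unfolded linear_conv_bounded_linear])

text \<open>A product rule for a point-dependent functional applied to a moving vector.
  Differentiability of \<open>A\<close> is given for each fixed vector, and expanding the argument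
  in \<open>Basis\<close> reduces the claim to products of real functions.\<close>

lemma has_derivative_apply:
  fixes A :: "'b::real_normed_vector \<Rightarrow> 'c::euclidean_space \<Rightarrow> real"
    and y :: "'a::real_normed_vector \<Rightarrow> 'b"
  assumes N: "open N" "x \<in> N" "\<And>z. z \<in> N \<Longrightarrow> linear (A (y z))"
    and A: "\<And>u. ((\<lambda>z. A z u) has_derivative A' u) (at (y x))" and A': "\<And>w. linear (\<lambda>u. A' u w)"
    and y: "(y has_derivative y') (at x)" and U: "(U has_derivative U') (at x)"
  shows "((\<lambda>x. A (y x) (U x)) has_derivative (\<lambda>v. A' (U x) (y' v) + A (y x) (U' v))) (at x)"
proof -
  have rep: "g u = (\<Sum>b\<in>Basis. (u \<bullet> b) * g b)" if "linear g" for g :: "'c \<Rightarrow> real" and u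
  proof -
    have "g u = g (\<Sum>b\<in>Basis. (u \<bullet> b) *\<^sub>R b)" by (simp only: euclidean_representation)
    then show ?thesis by (simp add: linear_sum[OF that] linear_cmul[OF that])
  qed
  have Ac: "((\<lambda>x. A (y x) b) has_derivative (\<lambda>v. A' b (y' v))) (at x)" for b
    by (rule has_derivative_compose[OF y A])
  have Ub: "((\<lambda>x. U x \<bullet> b) has_derivative (\<lambda>v. U' v \<bullet> b)) (at x)" for b
    by (rule has_derivative_inner_left[OF U])
  have "((\<lambda>x. \<Sum>b\<in>Basis. (U x \<bullet> b) * A (y x) b) has_derivative
     (\<lambda>v. \<Sum>b\<in>Basis. (U x \<bullet> b) * A' b (y' v) + (U' v \<bullet> b) * A (y x) b)) (at x)"
    by (rule has_derivative_sum, rule has_derivative_mult[OF Ub Ac])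
  then have "((\<lambda>x. A (y x) (U x)) has_derivative
     (\<lambda>v. \<Sum>b\<in>Basis. (U x \<bullet> b) * A' b (y' v) + (U' v \<bullet> b) * A (y x) b)) (at x)"
  proof (rule has_derivative_transform_within_open[OF _ N(1,2)])
    fix z assume "z \<in> N"
    then show "(\<Sum>b\<in>Basis. (U z \<bullet> b) * A (y z) b) = A (y z) (U z)"
      using rep[OF N(3), of z "U z"] by simp
  qed
  moreover have "(\<lambda>v. \<Sum>b\<in>Basis. (U x \<bullet> b) * A' b (y' v) + (U' v \<bullet> b) * A (y x) b) =
      (\<lambda>v. A' (U x) (y' v) + A (y x) (U' v))"
  proof (rule ext)
    fix v
    have "A' (U x) (y' v) = (\<Sum>b\<in>Basis. (U x \<bullet> b) * A' b (y' v))"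
      by (rule rep[where g="\<lambda>u. A' u (y' v)"]) (rule A')
    moreover have "A (y x) (U' v) = (\<Sum>b\<in>Basis. (U' v \<bullet> b) * A (y x) b)"
      by (rule rep[OF N(3)[OF N(2)]])
    ultimately show "(\<Sum>b\<in>Basis. (U x \<bullet> b) * A' b (y' v) + (U' v \<bullet> b) * A (y x) b) =
      A' (U x) (y' v) + A (y x) (U' v)"
      by (simp only: sum.distrib)
  qed
  ultimately show ?thesis by (simp only:)
qed

section \<open>Second and third derivatives\<close>

definition d2 :: "('a::euclidean_space \<Rightarrow> real) \<Rightarrow> 'a \<Rightarrow> 'a \<Rightarrow> 'a \<Rightarrow> real" where
  "d2 f x u v = frechet_derivative (\<lambda>y. frechet_derivative f (at y) v) (at x) u"

definition d3 :: "('a::euclidean_space \<Rightarrow> real) \<Rightarrow> 'a \<Rightarrow> 'a \<Rightarrow> 'a \<Rightarrow> 'a \<Rightarrow> real" where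
  "d3 f x u v w = frechet_derivative (\<lambda>y. d2 f y u v) (at x) w"

context
  fixes V :: "'a::euclidean_space set" and f :: "'a \<Rightarrow> real"
  assumes V: "open V" and f: "smooth_on V f"
begin

lemma smooth_on_d2: "smooth_on V (\<lambda>y. d2 f y u v)"
  unfolding d2_def by (intro smooth_on_frechet_derivative f)

lemma smooth_on_d3: "smooth_on V (\<lambda>y. d3 f y u v w)"
  unfolding d3_def by (intro smooth_on_frechet_derivative smooth_on_d2)

lemma has_derivative_d1:
  "x \<in> V \<Longrightarrow> ((\<lambda>y. frechet_derivative f (at y) v) has_derivative (\<lambda>u. d2 f x u v)) (at x)"
  unfolding d2_def by (rule smooth_on_has_derivative[OF smooth_on_frechet_derivative[OF f]])

lemma has_derivative_d2: "x \<in> V \<Longrightarrow> ((\<lambda>y. d2 f y u v) has_derivative d3 f x u v) (at x)"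
  unfolding d3_def using smooth_on_has_derivative[OF smooth_on_d2] by simp

lemma d2_sym: "x \<in> V \<Longrightarrow> d2 f x u v = d2 f x v u"
  unfolding d2_def by (rule second_derivative_symmetric[OF V f])

lemma linear_d2_left: "x \<in> V \<Longrightarrow> linear (\<lambda>u. d2 f x u v)"
  by (rule has_derivative_linear[OF has_derivative_d1])

lemma linear_d2_right: "x \<in> V \<Longrightarrow> linear (d2 f x u)"
proof -
  assume x: "x \<in> V"
  have eq: "d2 f x u = (\<lambda>v. d2 f x v u)" by (rule ext) (rule d2_sym[OF x])
  show ?thesis unfolding eq by (rule linear_d2_left[OF x])
qed

text \<open>Symmetry of the second derivatives of \<open>f\<close> exchanges the first two
  arguments, that of the derivative of \<open>f\<close> along \<open>v\<close> exchanges the outer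
  two; these transpositions generate all permutations.\<close>

lemma d3_cubic: 
  assumes x: "x \<in> V" 
  shows "symmetric_cubic_form (d3 f x)"
proof -
  have lin3: "linear (d3 f x u v)" for u v
    by (rule has_derivative_linear[OF has_derivative_d2[OF x]])
  have s12: "d3 f x u v w = d3 f x v u w" for u v w
  proof -
    have "((\<lambda>y. d2 f y u v) has_derivative d3 f x v u) (at x)"
      by (rule has_derivative_transform_within_open[OF has_derivative_d2[OF x] V x]) (rule d2_sym)
    then have "d3 f x v u = d3 f x u v"
      using has_derivative_d2[OF x] by (rule has_derivative_unique)
    then show ?thesis by simp
  qed
  have s13: "d3 f x u v w = d3 f x w v u" for u v w
    unfolding d3_def d2_def
    by (rule second_derivative_symmetric[OF V smooth_on_frechet_derivative[OF f] x])
  have s23: "d3 f x u v w = d3 f x u w v" for u v w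
    using s12[of u v w] s13[of v u w] s12[of w u v] by simp
  have lin1: "linear (\<lambda>u. d3 f x u v w)" for v w
  proof -
    have eq: "(\<lambda>u. d3 f x u v w) = d3 f x w v" by (rule ext) (rule s13)
    show ?thesis unfolding eq by (rule lin3)
  qed
  show ?thesis by (rule symmetric_cubic_form.intro[OF lin1 s12 s23])
qed

end

lemma orthonormal_frame_exists':
  assumes h: "posdef_form (h :: real ^ 'n \<Rightarrow> real ^ 'n \<Rightarrow> real)"
  obtains E where "orthonormal_frame h E"
proof -
  interpret posdef_form h by fact
  obtain i0 :: 'n where True by blast
  define v :: "real ^ 'n" where "v = axis i0 1"
  have v: "h v v > 0" by (rule pos) (simp add: v_def)
  define e where "e = (1 / sqrt (h v v)) *\<^sub>R v"
  have e: "h e e = 1" using v by (simp add: e_def field_simps)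
  obtain E where E: "E i0 = e" "\<And>i j. h (E i) (E j) = (if i = j then 1 else 0)"
    by (rule orthonormal_frame_exists[OF h e, of i0]) blast
  have "orthonormal_frame h E"
    by (rule orthonormal_frame.intro[OF h]) (rule orthonormal_frame_axioms.intro, rule E(2))
  then show ?thesis by (rule that)
qed

section \<open>Gauss formula, affine normal and apolarity in a chart\<close>

locale convex_improper_chart =
  fixes \<Omega> :: "(real ^ 'n) set" and f \<xi> :: "real ^ 'n \<Rightarrow> real ^ 'n option"
  assumes open_dom: "open \<Omega>" and immersion: "immersion_on \<Omega> f" and normal: "affine_normal_on \<Omega> f \<xi>"
    and convex: "x \<in> \<Omega> \<Longrightarrow> X \<noteq> 0 \<Longrightarrow> affine_form f \<xi> x X X > 0"
    and improper: "x \<in> \<Omega> \<Longrightarrow> shape_op f \<xi> x X = 0"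
begin

abbreviation "df x \<equiv> frechet_derivative f (at x)"
abbreviation "h \<equiv> affine_form f \<xi>"
abbreviation "conn \<equiv> induced_conn f \<xi>"

lemma smooth_f: "smooth_on \<Omega> f"
  using immersion by (simp add: immersion_on_def)

lemma smooth_normal: "smooth_on \<Omega> \<xi>"
  using normal by (simp add: affine_normal_on_def transversal_on_def)

lemma linear_df: "x \<in> \<Omega> \<Longrightarrow> linear (df x)"
  by (rule linear_frechet_derivative[OF smooth_f])

lemma inj_df: "x \<in> \<Omega> \<Longrightarrow> inj (df x)"
  using immersion by (simp add: immersion_on_def)

lemma transversal: "x \<in> \<Omega> \<Longrightarrow> \<xi> x \<notin> range (df x)"
  using normal by (simp add: affine_normal_on_def transversal_on_def)

lemma decomposition_unique:
  assumes x: "x \<in> \<Omega>" and eq: "df x Z + a *\<^sub>R \<xi> x = df x Z' + a' *\<^sub>R \<xi> x"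
  shows "Z = Z'" "a = a'"
proof -
  have d: "(a' - a) *\<^sub>R \<xi> x = df x (Z - Z')"
    using eq by (simp add: linear_diff[OF linear_df[OF x]] scaleR_diff_left algebra_simps)
  show "a = a'"
  proof (rule ccontr)
    assume "a \<noteq> a'"
    then have "\<xi> x = (1 / (a' - a)) *\<^sub>R ((a' - a) *\<^sub>R \<xi> x)" by simp
    also have "\<dots> = df x ((1 / (a' - a)) *\<^sub>R (Z - Z'))"
      unfolding d by (simp add: linear_cmul[OF linear_df[OF x]])
    finally show False using transversal[OF x] by blast
  qed
  then have "df x Z = df x Z'" using eq by simp
  then show "Z = Z'" using inj_df[OF x] by (simp add: inj_eq)
qed

text \<open>A dimension count: tangent vectors and multiples of the normal combine to an injective
  linear endomorphism of the ambient space.\<close>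

lemma decomposition_exists:
  assumes x: "x \<in> \<Omega>"
  obtains Z a where "w = df x Z + a *\<^sub>R \<xi> x"
proof -
  let ?T = "\<lambda>z. df x (vec_init z) + z $ None *\<^sub>R \<xi> x"
  have lin: "linear ?T"
    using linear_compose_add[OF linear_compose[OF linear_vec_init linear_df[OF x]]
        linear_compose[OF linear_vec_nth linear_scaleR_left]] unfolding o_def .
  have "inj ?T"
  proof (rule injI)
    fix z z' assume eq: "?T z = ?T z'"
    have "z = snoc (vec_init z) (z $ None)" by (rule snoc_vec_init[symmetric])
    also have "\<dots> = snoc (vec_init z') (z' $ None)"
      using decomposition_unique[OF x eq] by (simp only:)
    also have "\<dots> = z'" by (rule snoc_vec_init)
    finally show "z = z'" .
  qed
  then have "surj ?T" by (rule linear_injective_imp_surjective[OF lin]) (rule refl)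
  then obtain z where "w = ?T z" by (rule surjE)
  then show ?thesis by (rule that)
qed

text \<open>\<open>conn\<close> and \<open>h\<close> are definite descriptions; this evaluates them
  from any decomposition found by hand.\<close>

lemma gaussI:
  assumes x: "x \<in> \<Omega>" and eq: "flat_D f x X Y = df x Z + a *\<^sub>R \<xi> x"
  shows "conn x X Y = Z" "h x X Y = a"
proof -
  show "conn x X Y = Z"
    unfolding induced_conn_def
  proof (rule the_equality)
    show "\<exists>a. flat_D f x X Y = df x Z + a *\<^sub>R \<xi> x" using eq by blast
    fix Z' assume "\<exists>a. flat_D f x X Y = df x Z' + a *\<^sub>R \<xi> x"
    then obtain a' where "flat_D f x X Y = df x Z' + a' *\<^sub>R \<xi> x" by blast
    then have "df x Z' + a' *\<^sub>R \<xi> x = df x Z + a *\<^sub>R \<xi> x" using eq by (simp only:)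
    then show "Z' = Z" by (rule decomposition_unique(1)[OF x])
  qed
  show "h x X Y = a"
    unfolding affine_form_def
  proof (rule the_equality)
    show "\<exists>Z. flat_D f x X Y = df x Z + a *\<^sub>R \<xi> x" using eq by blast
    fix a' assume "\<exists>Z. flat_D f x X Y = df x Z + a' *\<^sub>R \<xi> x"
    then obtain Z' where "flat_D f x X Y = df x Z' + a' *\<^sub>R \<xi> x" by blast
    then have "df x Z' + a' *\<^sub>R \<xi> x = df x Z + a *\<^sub>R \<xi> x" using eq by (simp only:)
    then show "a' = a" by (rule decomposition_unique(2)[OF x])
  qed
qed

lemma gauss: 
  assumes x: "x \<in> \<Omega>"
  shows "flat_D f x X Y = df x (conn x X Y) + h x X Y *\<^sub>R \<xi> x"
proof -
  obtain Z a where eq: "flat_D f x X Y = df x Z + a *\<^sub>R \<xi> x"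
    by (rule decomposition_exists[OF x])
  show ?thesis unfolding gaussI[OF x eq] by (rule eq)
qed

lemma flat_D_sym: "x \<in> \<Omega> \<Longrightarrow> flat_D f x X Y = flat_D f x Y X"
  unfolding flat_D_def by (rule second_derivative_symmetric[OF open_dom smooth_f])

lemma has_derivative_df: "x \<in> \<Omega> \<Longrightarrow> ((\<lambda>y. df y Y) has_derivative (\<lambda>X. flat_D f x X Y)) (at x)"
  unfolding flat_D_def by (rule smooth_on_has_derivative[OF smooth_on_frechet_derivative[OF smooth_f]])

lemma linear_flat_D: "x \<in> \<Omega> \<Longrightarrow> linear (\<lambda>X. flat_D f x X Y)"
  by (rule has_derivative_linear[OF has_derivative_df])

lemma conn_sym: "x \<in> \<Omega> \<Longrightarrow> conn x X Y = conn x Y X"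
  by (simp only: induced_conn_def flat_D_sym[of x X Y])

lemma form_sym: "x \<in> \<Omega> \<Longrightarrow> h x X Y = h x Y X"
  by (simp only: affine_form_def flat_D_sym[of x X Y])

lemma linear_conn_form:
  assumes x: "x \<in> \<Omega>"
  shows "linear (\<lambda>X. conn x X Y)" "linear (\<lambda>X. h x X Y)"
proof -
  have add: "flat_D f x (X + X') Y = df x (conn x X Y + conn x X' Y) + (h x X Y + h x X' Y) *\<^sub>R \<xi> x" for X X'
    unfolding linear_add[OF linear_flat_D[OF x]] gauss[OF x, of X Y] gauss[OF x, of X' Y]
    by (simp add: linear_add[OF linear_df[OF x]] scaleR_add_left)
  have scale: "flat_D f x (c *\<^sub>R X) Y = df x (c *\<^sub>R conn x X Y) + (c * h x X Y) *\<^sub>R \<xi> x" for c X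
    unfolding linear_cmul[OF linear_flat_D[OF x]] gauss[OF x, of X Y]
    by (simp add: linear_cmul[OF linear_df[OF x]] scaleR_add_right)
  show "linear (\<lambda>X. conn x X Y)" "linear (\<lambda>X. h x X Y)"
    using gaussI[OF x add] gaussI[OF x scale] by (simp_all add: linear_iff)
qed

lemma posdef_h: 
  assumes x: "x \<in> \<Omega>"
  shows "posdef_form (h x)"
proof (rule posdef_form.intro)
  have "linear (h x X)" for X
  proof -
    have eq: "h x X = (\<lambda>Y. h x Y X)" by (rule ext) (rule form_sym[OF x])
    show ?thesis unfolding eq by (rule linear_conn_form(2)[OF x])
  qed
  then show "bilinear (h x)"
    using linear_conn_form(2)[OF x] by (simp add: bilinear_def)
  show "h x u v = h x v u" for u v by (rule form_sym[OF x])
  show "0 < h x u u" if "u \<noteq> 0" for u by (rule convex[OF x that])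
qed

text \<open>The vanishing shape operator removes only the tangential part. The factor left over is
  the value of the form \<open>\<tau>\<close>, and removing it takes the volume form.\<close>

lemma normal_derivative_parallel:
  assumes x: "x \<in> \<Omega>"
  obtains a where "frechet_derivative \<xi> (at x) X = a *\<^sub>R \<xi> x"
proof -
  obtain Z a where eq: "frechet_derivative \<xi> (at x) X = df x Z + a *\<^sub>R \<xi> x"
    by (rule decomposition_exists[OF x])
  have "shape_op f \<xi> x X = - Z"
    unfolding shape_op_def
  proof (rule the_equality)
    show "\<exists>a. frechet_derivative \<xi> (at x) X = - df x (- Z) + a *\<^sub>R \<xi> x"
      using eq by (auto simp: linear_neg[OF linear_df[OF x]])
    fix Z' assume "\<exists>a. frechet_derivative \<xi> (at x) X = - df x Z' + a *\<^sub>R \<xi> x"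
    then obtain a' where "frechet_derivative \<xi> (at x) X = - df x Z' + a' *\<^sub>R \<xi> x" by blast
    then have eq': "df x (- Z') + a' *\<^sub>R \<xi> x = df x Z + a *\<^sub>R \<xi> x"
      using eq by (simp only: linear_neg[OF linear_df[OF x]])
    have "- (- Z') = - Z" by (rule arg_cong[OF decomposition_unique(1)[OF x eq']])
    then show "Z' = - Z" by (simp only: minus_minus)
  qed
  then have "Z = 0" using improper[OF x] by simp
  then have "frechet_derivative \<xi> (at x) X = a *\<^sub>R \<xi> x"
    using eq by (simp add: linear_0[OF linear_df[OF x]])
  then show ?thesis by (rule that)
qed

lemma vol_frame:
  assumes x: "x \<in> \<Omega>" and E: "orthonormal_frame (h x) E"
  shows "(induced_vol f \<xi> x (\<chi> i. E i))\<^sup>2 = 1"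
proof -
  have "(\<chi> i j. h x (E i) (E j)) = mat 1"
    by (simp add: mat_def orthonormal_frame.orthonormal[OF E])
  then show ?thesis
    using normal x unfolding affine_normal_on_def by simp
qed

lemma vol_derivative:
  assumes x: "x \<in> \<Omega>"
  shows "((\<lambda>y. induced_vol f \<xi> y X) has_derivative
    (\<lambda>v. \<Sum>m\<in>UNIV. det (\<chi> k. if k = m then snoc (\<chi> i. flat_D f x v (X $ i)) (frechet_derivative \<xi> (at x) v) $ m
       else snoc (\<chi> i. df x (X $ i)) (\<xi> x) $ k))) (at x)"
  unfolding induced_vol_def
proof (rule has_derivative_det)
  fix i j
  show "((\<lambda>y. snoc (\<chi> i. df y (X $ i)) (\<xi> y) $ i $ j) has_derivative
     (\<lambda>v. snoc (\<chi> i. flat_D f x v (X $ i)) (frechet_derivative \<xi> (at x) v) $ i $ j)) (at x)"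
  proof (cases i)
    case None
    have "((\<lambda>y. \<xi> y $ j) has_derivative (\<lambda>v. frechet_derivative \<xi> (at x) v $ j)) (at x)"
      by (rule has_derivative_linear_comp[OF linear_vec_nth smooth_on_has_derivative[OF smooth_normal x]])
    then show ?thesis unfolding None snoc_nth .
  next
    case (Some k)
    have "((\<lambda>y. df y (X $ k) $ j) has_derivative (\<lambda>v. flat_D f x v (X $ k) $ j)) (at x)"
      by (rule has_derivative_linear_comp[OF linear_vec_nth has_derivative_df[OF x]])
    then show ?thesis unfolding Some snoc_nth vec_lambda_beta .
  qed
qed

lemma vol_parallel:
  "x \<in> \<Omega> \<Longrightarrow> frechet_derivative (\<lambda>y. induced_vol f \<xi> y X) (at x) v =
    (\<Sum>i\<in>UNIV. induced_vol f \<xi> x (\<chi> j. if j = i then conn x v (X $ i) else X $ j))"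
  using normal unfolding affine_normal_on_def by blast

text \<open>Here \<open>\<tau> = 0\<close> is extracted from the parallel volume form.
  Differentiating the determinant row by row gives the terms of \<open>vol_parallel\<close> and one
  more, from the row of \<open>\<xi>\<close>: the value of \<open>\<tau>\<close> times the volume.
  The volume of an orthonormal frame is not zero.\<close>

lemma normal_derivative_zero:
  assumes x: "x \<in> \<Omega>"
  shows "frechet_derivative \<xi> (at x) v = 0"
proof -
  obtain a where a: "frechet_derivative \<xi> (at x) v = a *\<^sub>R \<xi> x"
    by (rule normal_derivative_parallel[OF x])
  obtain E where E: "orthonormal_frame (h x) E"
    by (rule orthonormal_frame_exists'[OF posdef_h[OF x]])
  define X :: "real ^ 'n ^ 'n" where "X = (\<chi> i. E i)"
  let ?M = "snoc (\<chi> i. df x (X $ i)) (\<xi> x)"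
  have none: "det (\<chi> k. if k = None then a *\<^sub>R \<xi> x else ?M $ k) = a * induced_vol f \<xi> x X"
  proof -
    have "(\<chi> k. if k = None then \<xi> x else ?M $ k) = ?M"
      by (simp add: vec_eq_iff)
    then show ?thesis
      using det_row_mul[of None a "\<lambda>_. \<xi> x" "\<lambda>k. ?M $ k"]
      unfolding scalar_mult_eq_scaleR induced_vol_def by simp
  qed
  \<comment> \<open>The normal part of a differentiated tangent row is a multiple of the last row
    and drops out of the determinant.\<close>
  have some: "det (\<chi> k. if k = Some i then df x Z + c *\<^sub>R \<xi> x else ?M $ k) =
      induced_vol f \<xi> x (\<chi> j. if j = i then Z else X $ j)" for i Z c
  proof -
    have "det (\<chi> k. if k = Some i then \<xi> x else ?M $ k) = 0"
      by (rule det_identical_rows[of "Some i" None]) (simp_all add: row_def vec_eq_iff)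
    then have "det (\<chi> k. if k = Some i then c *\<^sub>R \<xi> x else ?M $ k) = 0"
      using det_row_mul[of "Some i" c "\<lambda>_. \<xi> x" "\<lambda>k. ?M $ k"]
      unfolding scalar_mult_eq_scaleR by simp
    moreover have "(\<chi> k. if k = Some i then df x Z else ?M $ k) =
        snoc (\<chi> j. df x ((\<chi> j. if j = i then Z else X $ j) $ j)) (\<xi> x)"
    proof (rule vec_eq_iff[THEN iffD2], rule allI)
      fix k
      show "(\<chi> k. if k = Some i then df x Z else ?M $ k) $ k =
        snoc (\<chi> j. df x ((\<chi> j. if j = i then Z else X $ j) $ j)) (\<xi> x) $ k"
        by (cases k) simp_all
    qed
    ultimately show ?thesis
      using det_row_add[of "Some i" "\<lambda>_. df x Z" "\<lambda>_. c *\<^sub>R \<xi> x" "\<lambda>k. ?M $ k"]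
      unfolding induced_vol_def by simp
  qed
  have "frechet_derivative (\<lambda>y. induced_vol f \<xi> y X) (at x) v =
    (\<Sum>m\<in>UNIV. det (\<chi> k. if k = m then snoc (\<chi> i. flat_D f x v (X $ i)) (frechet_derivative \<xi> (at x) v) $ m
       else ?M $ k))"
    using frechet_derivative_at[OF vol_derivative[OF x, of X]] by (simp add: fun_eq_iff)
  also have "\<dots> = a * induced_vol f \<xi> x X +
      (\<Sum>i\<in>UNIV. induced_vol f \<xi> x (\<chi> j. if j = i then conn x v (X $ i) else X $ j))"
    unfolding sum_UNIV_option snoc_nth vec_lambda_beta a none gauss[OF x] some ..
  finally have "a * induced_vol f \<xi> x X = 0"
    using vol_parallel[OF x, of X v] by simp
  moreover have "induced_vol f \<xi> x X \<noteq> 0"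
    using vol_frame[OF x E] unfolding X_def by auto
  ultimately show ?thesis using a by simp
qed

text \<open>By Cramer's rule only one coefficient of \<open>w\<close> survives. Summed over the
  frame, this turns the right side of \<open>vol_parallel\<close> into the trace of
  \<open>conn\<close>.\<close>

lemma vol_replace:
  assumes x: "x \<in> \<Omega>" and E: "orthonormal_frame (h x) E"
  shows "induced_vol f \<xi> x (\<chi> j. if j = i then w else E j) = h x w (E i) * induced_vol f \<xi> x (\<chi> j. E j)"
proof -
  interpret orthonormal_frame "h x" E by fact
  let ?M = "snoc (\<chi> i. df x (E i)) (\<xi> x)"
  let ?c = "snoc (\<chi> j. h x w (E j)) 0"
  have row: "row k A = A $ k" for k and A :: "real ^ 'n option ^ 'n option"
    by (simp add: row_def)
  have "df x w = df x (\<Sum>j\<in>UNIV. h x w (E j) *\<^sub>R E j)" using expansion[of w] by simp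
  then have s: "(\<Sum>m\<in>UNIV. ?c $ m *s row m ?M) = df x w"
    unfolding row sum_UNIV_option
    by (simp add: scalar_mult_eq_scaleR linear_sum[OF linear_df[OF x]] linear_cmul[OF linear_df[OF x]])
  have "(\<chi> k. if k = Some i then df x w else ?M $ k) =
        snoc (\<chi> j. df x ((\<chi> j. if j = i then w else E j) $ j)) (\<xi> x)"
  proof (rule vec_eq_iff[THEN iffD2], rule allI)
    fix k
    show "(\<chi> k. if k = Some i then df x w else ?M $ k) $ k =
      snoc (\<chi> j. df x ((\<chi> j. if j = i then w else E j) $ j)) (\<xi> x) $ k"
      by (cases k) simp_all
  qed
  then show ?thesis
    using cramer_lemma_transpose[of "Some i" ?c ?M, unfolded s, unfolded row] unfolding induced_vol_def by simp
qed

text \<open>The equation between squared volume and Gram determinant is differentiated at an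
  orthonormal frame. On one side the parallel volume form yields the trace of \<open>conn\<close>,
  on the other the Gram determinant yields the trace of \<open>Hd\<close>. The sum in the conclusion
  is the trace of the covariant derivative of \<open>h\<close>.\<close>

lemma apolarity:
  assumes x: "x \<in> \<Omega>" and E: "orthonormal_frame (h x) E"
    and H: "\<And>X Y. ((\<lambda>y. h y X Y) has_derivative Hd X Y) (at x)"
  shows "(\<Sum>i\<in>UNIV. Hd (E i) (E i) v - 2 * h x (conn x v (E i)) (E i)) = 0"
proof -
  let ?w = "\<lambda>y. induced_vol f \<xi> y (\<chi> i. E i)"
  let ?G = "\<lambda>y. det (\<chi> i j. h y (E i) (E j))"
  have mat1: "(\<chi> i j. h x (E i) (E j)) = mat 1"
    by (simp add: mat_def orthonormal_frame.orthonormal[OF E])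
  define dw where "dw = frechet_derivative ?w (at x)"
  have "?w differentiable (at x)"
    by (rule differentiableI[OF vol_derivative[OF x]])
  then have w: "(?w has_derivative dw) (at x)"
    unfolding dw_def by (simp add: frechet_derivative_works)
  have "(?G has_derivative (\<lambda>v. \<Sum>i\<in>UNIV. det (\<chi> k. if k = i then (\<chi> i j. Hd (E i) (E j) v) $ i
      else (\<chi> i j. h x (E i) (E j)) $ k))) (at x)"
    by (rule has_derivative_det) (simp add: H)
  then have G: "(?G has_derivative (\<lambda>v. \<Sum>i\<in>UNIV. Hd (E i) (E i) v)) (at x)"
    unfolding mat1 det_replace_row_mat_1 by simp
  \<comment> \<open>Passing to the fourth power replaces the absolute value of the Gram determinant
    by its square, which can be differentiated.\<close>
  have "((\<lambda>y. ?w y ^ 4) has_derivative (\<lambda>v. of_nat 4 * dw v * ?w x ^ (4 - 1))) (at x)"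
    by (rule has_derivative_power[OF w])
  moreover have "((\<lambda>y. ?w y ^ 4) has_derivative
      (\<lambda>v. of_nat 2 * (\<Sum>i\<in>UNIV. Hd (E i) (E i) v) * ?G x ^ (2 - 1))) (at x)"
  proof (rule has_derivative_transform_within_open[OF has_derivative_power[OF G] open_dom x])
    fix y assume "y \<in> \<Omega>"
    then have "(?w y)\<^sup>2 = \<bar>?G y\<bar>"
      using normal unfolding affine_normal_on_def by simp
    then have "((?w y)\<^sup>2)\<^sup>2 = (?G y)\<^sup>2" by simp
    then show "(?G y)\<^sup>2 = ?w y ^ 4" by simp
  qed
  ultimately have "(\<lambda>v. of_nat 4 * dw v * ?w x ^ (4 - 1)) =
      (\<lambda>v. of_nat 2 * (\<Sum>i\<in>UNIV. Hd (E i) (E i) v) * ?G x ^ (2 - 1))"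
    by (rule has_derivative_unique)
  from fun_cong[OF this, of v]
  have eq: "4 * dw v * ?w x ^ 3 = 2 * (\<Sum>i\<in>UNIV. Hd (E i) (E i) v)"
    unfolding mat1 by simp
  have "dw v = (\<Sum>i\<in>UNIV. h x (conn x v (E i)) (E i)) * ?w x"
    unfolding dw_def vol_parallel[OF x] vec_lambda_beta vol_replace[OF x E] by (simp add: sum_distrib_right)
  then have "dw v * ?w x ^ 3 = (\<Sum>i\<in>UNIV. h x (conn x v (E i)) (E i)) * ((?w x)\<^sup>2)\<^sup>2"
    by (simp add: power2_eq_square power3_eq_cube)
  also have "\<dots> = (\<Sum>i\<in>UNIV. h x (conn x v (E i)) (E i))"
    unfolding vol_frame[OF x E] by simp
  finally have "2 * (\<Sum>i\<in>UNIV. h x (conn x v (E i)) (E i)) = (\<Sum>i\<in>UNIV. Hd (E i) (E i) v)"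
    using eq by simp
  then show ?thesis by (simp add: sum_subtractf sum_distrib_left)
qed

end

text \<open>\<open>axis_rotation\<close> asks for an isometry on the complement of \<open>e\<close>;
  splitting off the \<open>e\<close>-component extends this to all vectors.\<close>

lemma axis_rotation_isometry:
  assumes h: "posdef_form h" and e: "h e e = 1" and rot: "axis_rotation h e g"
  shows "h (g u) (g v) = h u v"
proof -
  interpret posdef_form h by (rule h)
  have g: "linear g" "g e = e" "\<And>Y. h e Y = 0 \<Longrightarrow> h e (g Y) = 0"
    "\<And>Y Z. h e Y = 0 \<Longrightarrow> h e Z = 0 \<Longrightarrow> h (g Y) (g Z) = h Y Z"
    using rot unfolding axis_rotation_def by blast+
  define p where "p w = w - h e w *\<^sub>R e" for w
  have p: "h e (p w) = 0" for w by (simp add: p_def e)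
  have dec: "w = h e w *\<^sub>R e + p w" for w by (simp add: p_def)
  have gd: "g w = h e w *\<^sub>R e + g (p w)" for w
    by (subst dec[of w]) (simp only: linear_add[OF g(1)] linear_cmul[OF g(1)] g(2))
  have "h (g u) (g v) = h e u * h e v + h (p u) (p v)"
    unfolding gd[of u] gd[of v]
    using g(3)[OF p[of u]] g(3)[OF p[of v]] g(4)[OF p[of u] p[of v]] sym[of "g (p u)" e] e
    by simp
  also have "\<dots> = h u v"
    by (subst (3) dec[of u], subst (3) dec[of v]) (simp add: p sym[of "p u" e] e)
  finally show ?thesis .
qed

text \<open>An expression in three vectors that is symmetric in one pair and skew in an overlapping
  pair vanishes. For the difference of two torsion-free metric connections this is the uniqueness of
  the Levi-Civita connection.\<close>

lemma (in posdef_form) metric_skew_zero: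
  assumes sym12: "\<And>X Y. S X Y = S Y X" and skew: "\<And>X Y Z. h (S Z X) Y + h X (S Z Y) = 0"
  shows "S X Y = 0"
proof -
  have sk: "h (S Z X) Y = - h (S Z Y) X" for X Y Z
    using skew[of Z X Y] sym[of X "S Z Y"] by simp
  have "h (S Z X) Y = 0" for X Y Z
    using sk[of Z X Y] sk[of Y Z X] sk[of X Y Z] sym12[of Z Y] sym12[of Y X] sym12[of X Z] by simp
  then show ?thesis using eq_0_iff by blast
qed

text \<open>All that is retained of the symmetry and of the condition on \<open>r\<close>: the
  number \<open>a\<close> is 2 r, and the coefficient n + 2 makes \<open>C\<close>
  trace-free.\<close>

definition axial_jet :: "(real ^ 'n \<Rightarrow> real ^ 'n \<Rightarrow> real) \<Rightarrow> (real ^ 'n \<Rightarrow> real ^ 'n \<Rightarrow> real ^ 'n \<Rightarrow> real) \<Rightarrow> bool" where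
  "axial_jet h C \<longleftrightarrow> (\<exists>e a. a \<noteq> 0 \<and> h e e = 1 \<and>
     (\<forall>u v w. C u v w = a * (h e u * h v w + h e v * h u w + h e w * h u v)
        - (real CARD('n) + 2) * a * h e u * h e v * h e w))"

section \<open>The hypersurface as a graph with vertical affine normal\<close>

locale graph_chart = convex_improper_chart \<Omega> f \<xi>
  for \<Omega> :: "(real ^ 'n) set" and f \<xi> +
  fixes U V :: "(real ^ 'n) set" and y :: "real ^ 'n \<Rightarrow> real ^ 'n" and \<phi> :: "real ^ 'n \<Rightarrow> real"
    and L :: "real ^ 'n option \<Rightarrow> real ^ 'n option"
  assumes U: "open U" "U \<subseteq> \<Omega>" and V: "open V" and y_in: "x \<in> U \<Longrightarrow> y x \<in> V"
    and smooth_y: "smooth_on U y" and smooth_\<phi>: "smooth_on V \<phi>"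
    and L: "linear L" "inj L" and graph: "x \<in> U \<Longrightarrow> L (f x) = snoc (y x) (\<phi> (y x))"
    and vertical: "x \<in> U \<Longrightarrow> L (\<xi> x) = axis None 1"
begin

definition "P w = vec_init (L w)"
definition "H w = L w $ None"
abbreviation "dy x \<equiv> frechet_derivative y (at x)"

lemma in_dom: "x \<in> U \<Longrightarrow> x \<in> \<Omega>"
  using U(2) by blast

lemma linear_P: "linear P"
  using linear_compose[OF L(1) linear_vec_init] unfolding P_def[abs_def] o_def .

lemma linear_H: "linear H"
  using linear_compose[OF L(1) linear_vec_nth] unfolding H_def[abs_def] o_def .

lemma P_normal: "x \<in> U \<Longrightarrow> P (\<xi> x) = 0" and H_normal: "x \<in> U \<Longrightarrow> H (\<xi> x) = 1"
  by (simp_all add: P_def H_def vertical vec_init_def vec_eq_iff axis_def)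

lemma dy_eq: 
  assumes x: "x \<in> U" shows "dy x X = P (df x X)"
proof -
  have "((\<lambda>x. P (f x)) has_derivative (\<lambda>X. P (df x X))) (at x)"
    by (rule has_derivative_linear_comp[OF linear_P smooth_on_has_derivative[OF smooth_f in_dom[OF x]]])
  then have "(y has_derivative (\<lambda>X. P (df x X))) (at x)"
    by (rule has_derivative_transform_within_open[OF _ U(1) x]) (simp add: P_def graph)
  from frechet_derivative_at[OF this] show ?thesis by metis
qed

lemma has_derivative_dy:
  assumes x: "x \<in> U"
  shows "((\<lambda>x. dy x Y) has_derivative (\<lambda>X. P (flat_D f x X Y))) (at x)"
proof -
  have "((\<lambda>x. P (df x Y)) has_derivative (\<lambda>X. P (flat_D f x X Y))) (at x)"
    by (rule has_derivative_linear_comp[OF linear_P has_derivative_df[OF in_dom[OF x]]])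
  then show ?thesis
    by (rule has_derivative_transform_within_open[OF _ U(1) x]) (rule dy_eq[symmetric])
qed

lemma has_derivative_y: "x \<in> U \<Longrightarrow> (y has_derivative dy x) (at x)"
  by (rule smooth_on_has_derivative[OF smooth_y])

lemma linear_dy: "x \<in> U \<Longrightarrow> linear (dy x)"
  by (rule linear_frechet_derivative[OF smooth_y])

lemma dy_eq_0:
  assumes x: "x \<in> U" and "dy x X = 0"
  shows "X = 0"
proof -
  have "P (df x X) = 0" using assms(2) dy_eq[OF x] by simp
  then have "L (df x X) = snoc 0 (H (df x X))"
    using snoc_vec_init[of "L (df x X)"] by (simp add: P_def H_def)
  also have "\<dots> = H (df x X) *\<^sub>R axis None 1"
    by (simp add: vec_eq_iff snoc_def axis_def split: option.split)
  also have "\<dots> = L (H (df x X) *\<^sub>R \<xi> x)"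
    by (simp add: linear_cmul[OF L(1)] vertical[OF x])
  finally have "df x X = H (df x X) *\<^sub>R \<xi> x"
    using L(2) by (simp add: inj_eq)
  then have "df x X + 0 *\<^sub>R \<xi> x = df x 0 + H (df x X) *\<^sub>R \<xi> x"
    by (simp add: linear_0[OF linear_df[OF in_dom[OF x]]])
  then show ?thesis by (rule decomposition_unique(1)[OF in_dom[OF x]])
qed

lemma surj_dy:
  assumes x: "x \<in> U"
  shows "surj (dy x)"
proof -
  have "inj (dy x)"
    using dy_eq_0[OF x] linear_injective_0[OF linear_dy[OF x]] by blast
  then show ?thesis using linear_injective_imp_surjective[OF linear_dy[OF x]] by simp
qed

lemma P_flat: "x \<in> U \<Longrightarrow> P (flat_D f x X Y) = dy x (conn x X Y)"
  by (simp add: gauss[OF in_dom] linear_add[OF linear_P] linear_cmul[OF linear_P] P_normal dy_eq)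

lemma H_df:
  assumes x: "x \<in> U"
  shows "H (df x Y) = frechet_derivative \<phi> (at (y x)) (dy x Y)"
proof -
  have "((\<lambda>x. H (f x)) has_derivative (\<lambda>Y. H (df x Y))) (at x)"
    by (rule has_derivative_linear_comp[OF linear_H smooth_on_has_derivative[OF smooth_f in_dom[OF x]]])
  then have "((\<lambda>x. \<phi> (y x)) has_derivative (\<lambda>Y. H (df x Y))) (at x)"
    by (rule has_derivative_transform_within_open[OF _ U(1) x]) (simp add: H_def graph)
  moreover have "((\<lambda>x. \<phi> (y x)) has_derivative (\<lambda>Y. frechet_derivative \<phi> (at (y x)) (dy x Y))) (at x)"
    by (rule has_derivative_compose[OF has_derivative_y[OF x] smooth_on_has_derivative[OF smooth_\<phi> y_in[OF x]]])
  ultimately have "(\<lambda>Y. H (df x Y)) = (\<lambda>Y. frechet_derivative \<phi> (at (y x)) (dy x Y))"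
    by (rule has_derivative_unique)
  from fun_cong[OF this, of Y] show ?thesis .
qed

text \<open>Differentiating \<open>H_df\<close> once more gives the Hessian of \<open>\<phi>\<close>
  and a first order term in the horizontal part of \<open>flat_D\<close>. As \<open>P\<close> kills
  the normal, that term is the height of the tangential part; as \<open>H\<close> is 1 on the
  normal, the Hessian is what remains for \<open>h\<close>.\<close>

lemma form_eq:
  assumes x: "x \<in> U"
  shows "h x X Y = d2 \<phi> (y x) (dy x X) (dy x Y)"
proof -
  have "((\<lambda>x. H (df x Y)) has_derivative (\<lambda>X. H (flat_D f x X Y))) (at x)"
    by (rule has_derivative_linear_comp[OF linear_H has_derivative_df[OF in_dom[OF x]]])
  then have "((\<lambda>x. frechet_derivative \<phi> (at (y x)) (dy x Y)) has_derivative (\<lambda>X. H (flat_D f x X Y))) (at x)"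
    by (rule has_derivative_transform_within_open[OF _ U(1) x]) (rule H_df)
  moreover have "((\<lambda>x. frechet_derivative \<phi> (at (y x)) (dy x Y)) has_derivative
      (\<lambda>X. d2 \<phi> (y x) (dy x X) (dy x Y) + frechet_derivative \<phi> (at (y x)) (P (flat_D f x X Y)))) (at x)"
    by (rule has_derivative_apply[where A="\<lambda>z. frechet_derivative \<phi> (at z)" and A'="\<lambda>u w. d2 \<phi> (y x) w u",
          OF U(1) x linear_frechet_derivative[OF smooth_\<phi> y_in] has_derivative_d1[OF V smooth_\<phi> y_in[OF x]]
          linear_d2_right[OF V smooth_\<phi> y_in[OF x]] has_derivative_y[OF x] has_derivative_dy[OF x]])
  ultimately have "(\<lambda>X. H (flat_D f x X Y)) =
      (\<lambda>X. d2 \<phi> (y x) (dy x X) (dy x Y) + frechet_derivative \<phi> (at (y x)) (P (flat_D f x X Y)))"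
    by (rule has_derivative_unique)
  from fun_cong[OF this, of X]
  have "H (flat_D f x X Y) = d2 \<phi> (y x) (dy x X) (dy x Y) + H (df x (conn x X Y))"
    unfolding P_flat[OF x] H_df[OF x] .
  moreover have "H (flat_D f x X Y) = H (df x (conn x X Y)) + h x X Y"
    by (simp add: gauss[OF in_dom[OF x]] linear_add[OF linear_H] linear_cmul[OF linear_H] H_normal[OF x])
  ultimately show ?thesis by simp
qed

definition "C x X Y Z = d3 \<phi> (y x) (dy x X) (dy x Y) (dy x Z)"

lemma cubic_C: 
  assumes x: "x \<in> U"
  shows "symmetric_cubic_form (C x)"
proof -
  interpret d3: symmetric_cubic_form "d3 \<phi> (y x)"
    by (rule d3_cubic[OF V smooth_\<phi> y_in[OF x]])
  show ?thesis
  proof (rule symmetric_cubic_form.intro)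
    show "linear (\<lambda>X. C x X Y Z)" for Y Z
      using linear_compose[OF linear_dy[OF x] d3.linear1] unfolding C_def o_def .
    show "C x X Y Z = C x Y X Z" "C x X Y Z = C x X Z Y" for X Y Z
      unfolding C_def by (rule d3.swap12, rule d3.swap23)
  qed
qed

text \<open>By \<open>P_flat\<close>, \<open>conn\<close> is the flat connection of the coordinates
  \<open>y\<close>. Hence the covariant derivative of \<open>h\<close> is the third derivative of
  \<open>\<phi>\<close>, pulled back as \<open>C\<close>.\<close>

lemma has_derivative_form:
  assumes x: "x \<in> U"
  shows "((\<lambda>x. h x X Y) has_derivative (\<lambda>Z. C x X Y Z + h x (conn x Z X) Y + h x X (conn x Z Y))) (at x)"
proof -
  interpret d3: symmetric_cubic_form "d3 \<phi> (y x)"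
    by (rule d3_cubic[OF V smooth_\<phi> y_in[OF x]])
  have 1: "((\<lambda>z. d2 \<phi> (y z) u (dy z Y)) has_derivative
      (\<lambda>Z. d3 \<phi> (y x) u (dy x Y) (dy x Z) + d2 \<phi> (y x) u (P (flat_D f x Z Y)))) (at x)" for u
    by (rule has_derivative_apply[where A="\<lambda>z. d2 \<phi> z u" and A'="\<lambda>w. d3 \<phi> (y x) u w",
          OF U(1) x linear_d2_right[OF V smooth_\<phi> y_in] has_derivative_d2[OF V smooth_\<phi> y_in[OF x]]
          d3.linear2 has_derivative_y[OF x] has_derivative_dy[OF x]])
  let ?A' = "\<lambda>u Z. d3 \<phi> (y x) u (dy x Y) (dy x Z) + d2 \<phi> (y x) u (P (flat_D f x Z Y))"
  have lin: "linear (\<lambda>u. ?A' u Z)" for Z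
    by (rule linear_compose_add[OF d3.linear1 linear_d2_left[OF V smooth_\<phi> y_in[OF x]]])
  have "((\<lambda>z. d2 \<phi> (y z) (dy z X) (dy z Y)) has_derivative
      (\<lambda>Z. ?A' (dy x X) Z + d2 \<phi> (y x) (P (flat_D f x Z X)) (dy x Y))) (at x)"
    by (rule has_derivative_apply[where A="\<lambda>z u. d2 \<phi> (y z) u (dy z Y)" and A'="?A'" and y="\<lambda>z. z",
          OF U(1) x linear_d2_left[OF V smooth_\<phi> y_in] 1 lin has_derivative_ident has_derivative_dy[OF x]])
  then have "((\<lambda>z. h z X Y) has_derivative
      (\<lambda>Z. ?A' (dy x X) Z + d2 \<phi> (y x) (P (flat_D f x Z X)) (dy x Y))) (at x)"
    by (rule has_derivative_transform_within_open[OF _ U(1) x]) (rule form_eq[symmetric])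
  moreover have "(\<lambda>Z. ?A' (dy x X) Z + d2 \<phi> (y x) (P (flat_D f x Z X)) (dy x Y)) =
      (\<lambda>Z. C x X Y Z + h x (conn x Z X) Y + h x X (conn x Z Y))"
    by (rule ext) (simp only: P_flat[OF x] form_eq[OF x] C_def add.assoc add.commute)
  ultimately show ?thesis by (simp only:)
qed

lemma apolar_C:
  assumes x: "x \<in> U" and E: "orthonormal_frame (h x) E"
  shows "(\<Sum>i\<in>UNIV. C x (E i) (E i) w) = 0"
proof -
  have "(\<Sum>i\<in>UNIV. C x (E i) (E i) w + h x (conn x w (E i)) (E i) + h x (E i) (conn x w (E i))
      - 2 * h x (conn x w (E i)) (E i)) = 0"
    by (rule apolarity[OF in_dom[OF x] E has_derivative_form[OF x]])
  then show ?thesis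
    unfolding form_sym[OF in_dom[OF x], of "E _" "conn x w (E _)"] by simp
qed

text \<open>The covariant derivative \<open>C\<close> of \<open>h\<close> is totally symmetric, so
  adding half of its dual \<open>G\<close> to \<open>conn\<close> keeps the connection torsion free
  and makes it metric. This is the Levi-Civita connection, and \<open>K\<close> is minus half of
  \<open>G\<close>.\<close>

lemma diff_tensor_eq:
  assumes x: "x \<in> U"
  shows "h x (diff_tensor f \<xi> x X Y) Z = - C x X Y Z / 2"
proof -
  interpret posdef_form "h x" by (rule posdef_h[OF in_dom[OF x]])
  obtain E where E: "orthonormal_frame (h x) E"
    by (rule orthonormal_frame_exists'[OF posdef_h[OF in_dom[OF x]]])
  interpret orthonormal_frame "h x" E by (rule E)
  interpret C: symmetric_cubic_form "C x" by (rule cubic_C[OF x])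
  define G where "G X Y = (\<Sum>i\<in>UNIV. C x X Y (E i) *\<^sub>R E i)" for X Y
  have G: "h x (G X Y) Z = C x X Y Z" for X Y Z
    unfolding G_def by (rule riesz[OF C.linear3])
  have Gsym: "G X Y = G Y X" for X Y
    unfolding G_def by (rule sum.cong) (simp_all add: C.swap12[of X Y])
  define B where "B X Y = conn x X Y + (1/2) *\<^sub>R G X Y" for X Y
  have hB: "h x (B X Y) Z = h x (conn x X Y) Z + C x X Y Z / 2" for X Y Z
    by (simp add: B_def G)
  have hB': "h x Z (B X Y) = h x Z (conn x X Y) + C x X Y Z / 2" for X Y Z
    using hB[of X Y Z] sym[of Z] by simp
  have Bsym: "B X Y = B Y X" for X Y
    by (simp only: B_def Gsym[of X Y] conn_sym[OF in_dom[OF x], of X Y])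
  have Blin: "linear (\<lambda>X. B X Y)" for Y
  proof -
    have "linear (\<lambda>X. G X Y)"
    proof (rule linearI)
      show "G (X + X') Y = G X Y + G X' Y" for X X'
        unfolding G_def by (simp only: linear_add[OF C.linear1] scaleR_add_left sum.distrib)
      show "G (c *\<^sub>R X) Y = c *\<^sub>R G X Y" for c X
        unfolding G_def by (simp only: linear_cmul[OF C.linear1] real_scaleR_def scaleR_scaleR[symmetric] scaleR_sum_right)
    qed
    then show ?thesis
      unfolding B_def by (intro linear_compose_add linear_conn_form(1)[OF in_dom[OF x]] linear_compose_scale_right)
  qed
  have Bbil: "bilinear B"
    unfolding bilinear_def
  proof (intro conjI allI)
    show "linear (\<lambda>X. B X Y)" for Y by (rule Blin)
    show "linear (B X)" for X
    proof -
      have eq: "B X = (\<lambda>Y. B Y X)" by (rule ext) (rule Bsym)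
      show ?thesis unfolding eq by (rule Blin)
    qed
  qed
  have fd: "frechet_derivative (\<lambda>y. h y X Y) (at x) Z = C x X Y Z + h x (conn x Z X) Y + h x X (conn x Z Y)" for X Y Z
    by (rule fun_cong[OF frechet_derivative_at[OF has_derivative_form[OF x]], symmetric])
  have "levi_civita h x = B"
    unfolding levi_civita_def
  proof (rule the_equality, intro conjI allI)
    show "bilinear B" by (rule Bbil)
    show "B X Y = B Y X" for X Y by (rule Bsym)
    show "frechet_derivative (\<lambda>y. h y X Y) (at x) Z = h x (B Z X) Y + h x X (B Z Y)" for X Y Z
      unfolding fd hB hB'
      using C.swap12[of Z X Y] C.swap23[of X Z Y] C.swap12[of Z Y X] C.swap23[of Y Z X] C.swap12[of Y X Z] by simp
  next
    fix B' assume B': "bilinear B' \<and> (\<forall>X Y. B' X Y = B' Y X) \<and>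
      (\<forall>X Y Z. frechet_derivative (\<lambda>y. h y X Y) (at x) Z = h x (B' Z X) Y + h x X (B' Z Y))"
    have "B' X Y - B X Y = 0" for X Y
    proof (rule metric_skew_zero[where S="\<lambda>X Y. B' X Y - B X Y"])
      show "B' X Y - B X Y = B' Y X - B Y X" for X Y
      proof -
        have "B' X Y = B' Y X" using B' by blast
        then show ?thesis by (simp only: Bsym[of X Y])
      qed
      fix X Y Z
      have "frechet_derivative (\<lambda>y. h y X Y) (at x) Z = h x (B' Z X) Y + h x X (B' Z Y)"
        using B' by blast
      moreover have "frechet_derivative (\<lambda>y. h y X Y) (at x) Z = h x (B Z X) Y + h x X (B Z Y)"
        unfolding fd hB hB'
        using C.swap12[of Z X Y] C.swap23[of X Z Y] C.swap12[of Z Y X] C.swap23[of Y Z X] C.swap12[of Y X Z] by simp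
      ultimately show "h x (B' Z X - B Z X) Y + h x X (B' Z Y - B Z Y) = 0" by simp
    qed
    then have "B' X Y = B X Y" for X Y by (simp only: right_minus_eq)
    then show "B' = B" by (intro ext)
  qed
  then have "diff_tensor f \<xi> x X Y = - ((1/2) *\<^sub>R G X Y)"
    unfolding diff_tensor_def by (simp add: B_def)
  then show ?thesis by (simp add: G)
qed

text \<open>A rotation about the axis is an isometry and commutes with \<open>K\<close>, hence it
  preserves \<open>C\<close>, and \<open>axially_symmetric_cubic_form\<close> applies. Comparison
  with the frame equations shows that \<open>r\<close> is \<open>a / 2\<close>.\<close>

lemma axial_jet_at:
  assumes x: "x \<in> U" and card: "CARD('n) \<ge> 3"
    and axis: "symmetry_axis f \<xi> x e" and r: "r_at f \<xi> x e \<noteq> 0"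
  shows "axial_jet (d2 \<phi> (y x)) (d3 \<phi> (y x))"
proof -
  interpret posdef_form "h x" by (rule posdef_h[OF in_dom[OF x]])
  interpret C: symmetric_cubic_form "C x" by (rule cubic_C[OF x])
  have e: "h x e e = 1" using axis unfolding symmetry_axis_def by blast
  have inv: "C x (g u) (g v) (g w) = C x u v w" if g: "axis_rotation (h x) e g" for g u v w
  proof -
    have "diff_tensor f \<xi> x (g u) (g v) = g (diff_tensor f \<xi> x u v)"
      using axis g unfolding symmetry_axis_def by blast
    then have "h x (diff_tensor f \<xi> x (g u) (g v)) (g w) = h x (diff_tensor f \<xi> x u v) w"
      using axis_rotation_isometry[OF posdef_h[OF in_dom[OF x]] e g] by simp
    then show ?thesis unfolding diff_tensor_eq[OF x] by simp
  qed
  have "\<exists>a. \<forall>u v w. C x u v w = a * (h x e u * h x v w + h x e v * h x u w + h x e w * h x u v)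
    - (real CARD('n) + 2) * a * h x e u * h x e v * h x e w"
  proof (rule axially_symmetric_cubic_form[OF posdef_h[OF in_dom[OF x]] cubic_C[OF x] card e inv apolar_C[OF x]])
    fix a assume "\<And>u v w. C x u v w = a * (h x e u * h x v w + h x e v * h x u w + h x e w * h x u v)
      - (real CARD('n) + 2) * a * h x e u * h x e v * h x e w"
    then show ?thesis by blast
  qed
  then obtain a where a: "\<And>u v w. C x u v w = a * (h x e u * h x v w + h x e v * h x u w + h x e w * h x u v)
    - (real CARD('n) + 2) * a * h x e u * h x e v * h x e w"
    by blast
  let ?K = "diff_tensor f \<xi> x"
  have K: "h x (?K u v) w = - (a * (h x e u * h x v w + h x e v * h x u w + h x e w * h x u v)
    - (real CARD('n) + 2) * a * h x e u * h x e v * h x e w) / 2" for u v w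
    unfolding diff_tensor_eq[OF x] a ..
  have K1: "?K e e = ((real CARD('n) - 1) * (a / 2)) *\<^sub>R e"
    by (rule eqI) (simp add: K e algebra_simps)
  have K2: "?K e Y = (- (a / 2)) *\<^sub>R Y" if "h x e Y = 0" for Y
    by (rule eqI) (simp add: K e that)
  have K3: "?K Y Z = (- (a / 2) * h x Y Z) *\<^sub>R e" if "h x e Y = 0" "h x e Z = 0" for Y Z
    by (rule eqI) (simp add: K that)
  obtain i0 :: 'n where True by blast
  obtain E where E0: "E i0 = e" and E: "\<And>i j. h x (E i) (E j) = (if i = j then 1 else 0)"
    by (rule orthonormal_frame_exists[OF posdef_h[OF in_dom[OF x]] e, of i0]) blast
  \<comment> \<open>A unit vector orthogonal to the axis makes \<open>r\<close> unique in the frame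
    equations.\<close>
  obtain i1 where i1: "i1 \<noteq> i0"
  proof -
    have "\<not> (UNIV :: 'n set) \<subseteq> {i0}"
    proof
      assume "(UNIV :: 'n set) \<subseteq> {i0}"
      then have "CARD('n) \<le> card {i0}" by (intro card_mono) simp_all
      then show False using card by simp
    qed
    then show ?thesis using that by blast
  qed
  have "r_at f \<xi> x e = a / 2"
    unfolding r_at_def
  proof (rule the_equality)
    show "?K e e = ((real CARD('n) - 1) * (a / 2)) *\<^sub>R e \<and>
      (\<forall>Y. h x e Y = 0 \<longrightarrow> ?K e Y = (- (a / 2)) *\<^sub>R Y) \<and>
      (\<forall>Y Z. h x e Y = 0 \<longrightarrow> h x e Z = 0 \<longrightarrow> ?K Y Z = (- (a / 2) * h x Y Z) *\<^sub>R e)"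
      using K1 K2 K3 by blast
    fix r assume r: "?K e e = ((real CARD('n) - 1) * r) *\<^sub>R e \<and>
      (\<forall>Y. h x e Y = 0 \<longrightarrow> ?K e Y = (- r) *\<^sub>R Y) \<and>
      (\<forall>Y Z. h x e Y = 0 \<longrightarrow> h x e Z = 0 \<longrightarrow> ?K Y Z = (- r * h x Y Z) *\<^sub>R e)"
    have e1: "h x e (E i1) = 0" using E[of i0 i1] i1 by (simp add: E0)
    have "?K e (E i1) = (- r) *\<^sub>R E i1" using r e1 by blast
    then have "(- r) *\<^sub>R E i1 = (- (a / 2)) *\<^sub>R E i1" unfolding K2[OF e1] by (rule HOL.sym)
    then have "h x ((- r) *\<^sub>R E i1) (E i1) = h x ((- (a / 2)) *\<^sub>R E i1) (E i1)" by (rule arg_cong)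
    then show "r = a / 2" by (simp add: E)
  qed
  then have a0: "a \<noteq> 0" using r by simp
  show ?thesis
    unfolding axial_jet_def
  proof (intro exI conjI allI)
    show "a \<noteq> 0" by (rule a0)
    show "d2 \<phi> (y x) (dy x e) (dy x e) = 1" using e by (simp add: form_eq[OF x])
    fix u v w
    obtain u' where u: "u = dy x u'" using surj_dy[OF x] by (rule surjE)
    obtain v' where v: "v = dy x v'" using surj_dy[OF x] by (rule surjE)
    obtain w' where w: "w = dy x w'" using surj_dy[OF x] by (rule surjE)
    show "d3 \<phi> (y x) u v w = a * (d2 \<phi> (y x) (dy x e) u * d2 \<phi> (y x) v w
      + d2 \<phi> (y x) (dy x e) v * d2 \<phi> (y x) u w + d2 \<phi> (y x) (dy x e) w * d2 \<phi> (y x) u v)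
      - (real CARD('n) + 2) * a * d2 \<phi> (y x) (dy x e) u * d2 \<phi> (y x) (dy x e) v * d2 \<phi> (y x) (dy x e) w"
      using a[of u' v' w'] unfolding u v w C_def form_eq[OF x] .
  qed
qed

lemma posdef_hessian:
  assumes x: "x \<in> U"
  shows "posdef_form (d2 \<phi> (y x))"
proof (rule posdef_form.intro)
  show "bilinear (d2 \<phi> (y x))"
    using linear_d2_right[OF V smooth_\<phi> y_in[OF x]] linear_d2_left[OF V smooth_\<phi> y_in[OF x]]
    by (simp add: bilinear_def)
  show "d2 \<phi> (y x) u v = d2 \<phi> (y x) v u" for u v by (rule d2_sym[OF V smooth_\<phi> y_in[OF x]])
  fix u :: "real ^ 'n" assume u: "u \<noteq> 0"
  obtain u' where u': "u = dy x u'" using surj_dy[OF x] by (rule surjE)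
  then have "u' \<noteq> 0" using u linear_0[OF linear_dy[OF x]] by blast
  then show "0 < d2 \<phi> (y x) u u"
    using convex[OF in_dom[OF x]] by (simp add: u' form_eq[OF x, symmetric])
qed

end

lemma vertical_linear_map:
  fixes c :: "real ^ ('n::finite) option"
  assumes "c \<noteq> 0"
  obtains L :: "real ^ 'n option \<Rightarrow> real ^ 'n option" where "linear L" "bij L" "L c = axis None 1"
proof -
  obtain T :: "real ^ 'n option \<Rightarrow> real ^ 'n option"
    where T: "orthogonal_transformation T" "T c = norm c *\<^sub>R axis None 1"
    by (rule orthogonal_transformation_exists[of c "norm c *\<^sub>R axis None 1"]) auto
  have lin: "linear (\<lambda>w. (1 / norm c) *\<^sub>R T w)"
    by (rule linear_compose_scale_right[OF orthogonal_transformation_linear[OF T(1)]])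
  have "inj (\<lambda>w. (1 / norm c) *\<^sub>R T w)"
    using orthogonal_transformation_inj[OF T(1)] assms by (simp add: inj_def)
  then have "bij (\<lambda>w. (1 / norm c) *\<^sub>R T w)"
    using linear_injective_imp_surjective[OF lin] by (simp add: bij_def)
  moreover have "(1 / norm c) *\<^sub>R T c = axis None 1"
    using assms by (simp add: T(2))
  ultimately show ?thesis using lin that by blast
qed

text \<open>The affine normal is constant on a ball, so one linear map makes it vertical there. The
  horizontal part \<open>y\<close> then has injective derivative because the normal is transversal,
  and its local inverse turns the hypersurface into a graph.\<close>

theorem (in convex_improper_chart) local_graph:
  assumes card: "CARD('n) \<ge> 3" and x0: "x0 \<in> \<Omega>"
    and axis: "\<And>x. x \<in> \<Omega> \<Longrightarrow> \<exists>e. symmetry_axis f \<xi> x e"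
    and r: "\<And>x e. x \<in> \<Omega> \<Longrightarrow> symmetry_axis f \<xi> x e \<Longrightarrow> r_at f \<xi> x e \<noteq> 0"
  obtains U V :: "(real ^ 'n) set" and y g \<phi> and L :: "real ^ 'n option \<Rightarrow> real ^ 'n option"
    where "open U" "U \<subseteq> \<Omega>" "x0 \<in> U" "open V" "homeomorphism U V y g"
    "smooth_on U y" "smooth_on V g" "smooth_on V \<phi>" "linear L" "bij L"
    "\<And>z. z \<in> V \<Longrightarrow> f (g z) = L (snoc z (\<phi> z))"
    "\<And>z. z \<in> V \<Longrightarrow> posdef_form (d2 \<phi> z)" "\<And>z. z \<in> V \<Longrightarrow> axial_jet (d2 \<phi> z) (d3 \<phi> z)"
proof -
  obtain d where d: "d > 0" "ball x0 d \<subseteq> \<Omega>" using open_dom x0 openE by blast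
  let ?B = "ball x0 d"
  have in\<Omega>: "x \<in> \<Omega>" if "x \<in> ?B" for x using d(2) that by blast
  have const: "\<xi> x = \<xi> x0" if "x \<in> ?B" for x
  proof (rule has_derivative_zero_unique[OF convex_ball _ that])
    fix z assume z: "z \<in> ?B"
    have "frechet_derivative \<xi> (at z) = (\<lambda>_. 0)"
      by (rule ext) (rule normal_derivative_zero[OF in\<Omega>[OF z]])
    then have "(\<xi> has_derivative (\<lambda>_. 0)) (at z)"
      using smooth_on_has_derivative[OF smooth_normal in\<Omega>[OF z]] by (simp only:)
    then show "(\<xi> has_derivative (\<lambda>_. 0)) (at z within ?B)" by (rule has_derivative_at_withinI)
  qed (use d in simp)
  have "\<xi> x0 \<noteq> 0"
  proof
    assume "\<xi> x0 = 0"
    then have "\<xi> x0 = df x0 0" by (simp add: linear_0[OF linear_df[OF x0]])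
    then show False using transversal[OF x0] by blast
  qed
  then obtain L :: "real ^ 'n option \<Rightarrow> real ^ 'n option"
    where L: "linear L" "bij L" "L (\<xi> x0) = axis None 1"
    by (rule vertical_linear_map)
  define y where "y x = vec_init (L (f x))" for x
  have smB: "smooth_on ?B f" by (rule smooth_on_subset[OF smooth_f d(2)])
  have linP: "linear (\<lambda>w. vec_init (L w))"
    using linear_compose[OF L(1) linear_vec_init] unfolding o_def .
  have smy: "smooth_on ?B y"
    unfolding y_def[abs_def] by (rule smooth_on_linear[OF open_ball linP smB])
  have dy: "frechet_derivative y (at x) X = vec_init (L (df x X))" if x: "x \<in> ?B" for x X
  proof -
    have "(y has_derivative (\<lambda>X. vec_init (L (df x X)))) (at x)"
      unfolding y_def[abs_def]
      by (rule has_derivative_linear_comp[OF linP smooth_on_has_derivative[OF smB x]])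
    from frechet_derivative_at[OF this] show ?thesis by metis
  qed
  have injy: "inj (frechet_derivative y (at x))" if x: "x \<in> ?B" for x
  proof -
    have "X = 0" if "frechet_derivative y (at x) X = 0" for X
    proof -
      have "vec_init (L (df x X)) = 0" using that dy[OF x] by simp
      then have "L (df x X) = snoc 0 (L (df x X) $ None)"
        using snoc_vec_init[of "L (df x X)"] by simp
      also have "\<dots> = L (df x X) $ None *\<^sub>R axis None 1"
        by (simp add: vec_eq_iff snoc_def axis_def split: option.split)
      also have "\<dots> = L ((L (df x X) $ None) *\<^sub>R \<xi> x)"
        by (simp add: linear_cmul[OF L(1)] const[OF x] L(3))
      finally have "df x X = (L (df x X) $ None) *\<^sub>R \<xi> x"
        using bij_is_inj[OF L(2)] by (simp only: inj_eq)
      then have "df x X + 0 *\<^sub>R \<xi> x = df x 0 + (L (df x X) $ None) *\<^sub>R \<xi> x"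
        by (simp add: linear_0[OF linear_df[OF in\<Omega>[OF x]]])
      then show ?thesis by (rule decomposition_unique(1)[OF in\<Omega>[OF x]])
    qed
    then show ?thesis
      using linear_injective_0[OF linear_frechet_derivative[OF smy x]] by blast
  qed
  have x0B: "x0 \<in> ?B" using d by simp
  obtain U V g where UV: "open U" "U \<subseteq> ?B" "x0 \<in> U" "open V" "y x0 \<in> V" "homeomorphism U V y g" "smooth_on V g"
    by (rule smooth_local_inverse[OF open_ball smy injy x0B])
  have gU: "g z \<in> U" "y (g z) = z" if "z \<in> V" for z
    using UV(6) that unfolding homeomorphism_def by blast+
  have yV: "y x \<in> V" "g (y x) = x" if "x \<in> U" for x
    using UV(6) that unfolding homeomorphism_def by blast+
  have U\<Omega>: "U \<subseteq> \<Omega>" using UV(2) d(2) by blast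
  define \<phi> where "\<phi> z = L (f (g z)) $ None" for z
  have "smooth_on V (\<lambda>z. f (g z))"
    by (rule smooth_on_compose[OF UV(4,1) smooth_on_subset[OF smooth_f U\<Omega>] UV(7) gU(1)])
  then have sm\<phi>: "smooth_on V \<phi>"
    unfolding \<phi>_def[abs_def]
    by (intro smooth_on_vec_nth UV(4) smooth_on_linear[OF UV(4) L(1)])
  have graph: "L (f x) = snoc (y x) (\<phi> (y x))" if "x \<in> U" for x
    using snoc_vec_init[of "L (f x)"] yV[OF that] by (simp add: y_def \<phi>_def)
  have smyU: "smooth_on U y" by (rule smooth_on_subset[OF smy UV(2)])
  interpret gc: graph_chart \<Omega> f \<xi> U V y \<phi> L
  proof unfold_locales
    show "L (\<xi> x) = axis None 1" if "x \<in> U" for x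
      using const[of x] UV(2) that L(3) by auto
  qed (use UV U\<Omega> yV smyU sm\<phi> L bij_is_inj graph linear_add[OF L(1)] linear_cmul[OF L(1)] in auto)
  show ?thesis
  \<comment> \<open>The exported map leads from the graph back to the hypersurface, hence the
    inverse.\<close>
  proof (rule that[of U V y g \<phi> "inv L"])
    show "linear (inv L)"
      using inj_linear_imp_inv_bounded_linear[OF L(1)[unfolded linear_conv_bounded_linear] bij_is_inj[OF L(2)]]
      unfolding linear_conv_bounded_linear .
    show "bij (inv L)" by (rule bij_imp_bij_inv[OF L(2)])
    fix z assume z: "z \<in> V"
    have "L (f (g z)) = snoc z (\<phi> z)" using graph[OF gU(1)[OF z]] by (simp only: gU(2)[OF z])
    then show "f (g z) = inv L (snoc z (\<phi> z))"
      using inv_f_f[OF bij_is_inj[OF L(2)], of "f (g z)"] by simp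
    show "posdef_form (d2 \<phi> z)"
      using gc.posdef_hessian[OF gU(1)[OF z]] by (simp only: gU(2)[OF z])
    obtain e where e: "symmetry_axis f \<xi> (g z) e"
      using axis[of "g z"] gU(1)[OF z] U\<Omega> by blast
    have "r_at f \<xi> (g z) e \<noteq> 0" using r[of "g z" e] gU(1)[OF z] U\<Omega> e by blast
    from gc.axial_jet_at[OF gU(1)[OF z] card e this]
    show "axial_jet (d2 \<phi> z) (d3 \<phi> z)" by (simp only: gU(2)[OF z])
  qed (use UV U\<Omega> smyU sm\<phi> in simp_all)
qed

section \<open>The third order equation for the graph function\<close>

lemma Ck_on_local:
  assumes "open S" "\<And>x. x \<in> S \<Longrightarrow> \<exists>T. open T \<and> x \<in> T \<and> Ck_on k T f"
  shows "Ck_on k S f"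
  using assms(2)
proof (induction k arbitrary: f)
  case 0
  show ?case
    unfolding Ck_on.simps(1)
  proof (rule continuous_at_imp_continuous_on, rule ballI)
    fix x assume "x \<in> S"
    then obtain T where "open T" "x \<in> T" "continuous_on T f"
      using 0 unfolding Ck_on.simps(1) by blast
    then show "isCont f x"
      using continuous_on_interior[of T f x] interior_open[of T] by simp
  qed
next
  case (Suc k)
  show ?case
    unfolding Ck_on.simps(2)
  proof (intro conjI ballI allI)
    fix x assume "x \<in> S"
    then obtain T where "x \<in> T" "Ck_on (Suc k) T f" using Suc.prems by blast
    then show "f differentiable (at x)" by simp
  next
    fix v
    show "Ck_on k S (\<lambda>x. frechet_derivative f (at x) v)"
    proof (rule Suc.IH)
      fix x assume "x \<in> S"
      then obtain T where "open T" "x \<in> T" "Ck_on (Suc k) T f" using Suc.prems by blast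
      then show "\<exists>T. open T \<and> x \<in> T \<and> Ck_on k T (\<lambda>x. frechet_derivative f (at x) v)"
        by auto
    qed
  qed
qed

text \<open>\<open>\<alpha>\<close> and \<open>\<mu>\<close> will be written as quotients whose
  denominators are known to be nonzero only near a given point, with another quotient at each
  point.\<close>

lemma smooth_on_local:
  assumes "open S" "\<And>x. x \<in> S \<Longrightarrow> \<exists>T. open T \<and> x \<in> T \<and> smooth_on T f"
  shows "smooth_on S f"
proof (rule smooth_onI, rule Ck_on_local[OF assms(1)])
  fix k x assume "x \<in> S"
  then obtain T where "open T" "x \<in> T" "smooth_on T f" using assms(2) by blast
  then show "\<exists>T. open T \<and> x \<in> T \<and> Ck_on k T f" using smooth_onD by blast
qed

lemma open_nonzero_set:
  fixes f :: "'a::euclidean_space \<Rightarrow> real"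
  assumes "open S" "smooth_on S f"
  shows "open {x \<in> S. f x \<noteq> 0}"
proof -
  have "open (S \<inter> f -` (- {0}))"
    by (rule continuous_open_preimage[OF smooth_on_continuous[OF assms(2)] assms(1)]) (simp add: open_Compl)
  moreover have "S \<inter> f -` (- {0}) = {x \<in> S. f x \<noteq> 0}" by blast
  ultimately show ?thesis by (simp only:)
qed

text \<open>The left side is the trace of the rank-one map
  \<open>\<lambda>x. p x *\<^sub>R v\<close>; the traces below are sums of such terms and of
  multiples of the trace of the identity.\<close>

lemma sum_functional_axis:
  assumes "linear (p :: real ^ 'n \<Rightarrow> real)"
  shows "(\<Sum>i\<in>UNIV. p (axis i 1) * v $ i) = p v"
proof -
  have "v = (\<Sum>i\<in>UNIV. v $ i *\<^sub>R axis i 1)"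
    using basis_expansion[of v] unfolding scalar_mult_eq_scaleR by (rule HOL.sym)
  then have "p v = p (\<Sum>i\<in>UNIV. v $ i *\<^sub>R axis i 1)" by (rule arg_cong)
  also have "\<dots> = (\<Sum>i\<in>UNIV. v $ i * p (axis i 1))"
    by (simp add: linear_sum[OF assms] linear_cmul[OF assms])
  finally show ?thesis by (simp add: mult.commute)
qed

locale hessian_pde =
  fixes \<Omega> :: "(real ^ 'n) set" and \<phi> :: "real ^ 'n \<Rightarrow> real" and n :: real
  assumes n_def: "n = real CARD('n)" and open_dom: "open \<Omega>" and smooth: "smooth_on \<Omega> \<phi>"
    and pos: "x \<in> \<Omega> \<Longrightarrow> posdef_form (d2 \<phi> x)"
    and jet: "x \<in> \<Omega> \<Longrightarrow> axial_jet (d2 \<phi> x) (d3 \<phi> x)"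
    and card: "CARD('n) \<ge> 3"
begin

abbreviation "h \<equiv> d2 \<phi>"
abbreviation "T \<equiv> d3 \<phi>"

lemma n: "n \<ge> 3"
  using card by (simp add: n_def)

text \<open>\<open>Z\<close> is \<open>2 r X\<^sub>1\<close>, \<open>\<alpha>\<close> the dual one-form and \<open>N\<close> its squared length.\<close>

definition Z :: "real ^ 'n \<Rightarrow> real ^ 'n" where
  "Z x = (SOME Z. h x Z Z > 0 \<and> (\<forall>u v w. T x u v w =
     h x Z u * h x v w + h x Z v * h x u w + h x Z w * h x u v
       - (n + 2) / h x Z Z * h x Z u * h x Z v * h x Z w))"

definition \<alpha> :: "real ^ 'n \<Rightarrow> real ^ 'n \<Rightarrow> real" where "\<alpha> x u = h x (Z x) u"

definition N :: "real ^ 'n \<Rightarrow> real" where "N x = h x (Z x) (Z x)"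

lemma Z_props:
  assumes x: "x \<in> \<Omega>"
  shows "N x > 0"
    and "T x u v w = \<alpha> x u * h x v w + \<alpha> x v * h x u w + \<alpha> x w * h x u v
       - (n + 2) / N x * \<alpha> x u * \<alpha> x v * \<alpha> x w"
proof -
  interpret P: posdef_form "h x" by (rule pos[OF x])
  obtain e a where a: "a \<noteq> 0" and e: "h x e e = 1"
    and T: "\<And>u v w. T x u v w = a * (h x e u * h x v w + h x e v * h x u w + h x e w * h x u v)
        - (n + 2) * a * h x e u * h x e v * h x e w"
    using jet[OF x] unfolding axial_jet_def n_def by blast
  have "\<exists>Z. h x Z Z > 0 \<and> (\<forall>u v w. T x u v w =
     h x Z u * h x v w + h x Z v * h x u w + h x Z w * h x u v
       - (n + 2) / h x Z Z * h x Z u * h x Z v * h x Z w)"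
  \<comment> \<open>Scaling the unit axis by \<open>a\<close> gives \<open>N = a\<^sup>2\<close>, so
    that the coefficient \<open>a\<close> of the last term becomes \<open>a ^ 3 / N\<close>.\<close>
  proof (rule exI[of _ "a *\<^sub>R e"], intro conjI allI)
    have aa: "h x (a *\<^sub>R e) (a *\<^sub>R e) = a * a" by (simp add: e)
    show "h x (a *\<^sub>R e) (a *\<^sub>R e) > 0"
      unfolding aa using a by (simp add: zero_less_mult_iff) linarith
    fix u v w
    show "T x u v w = h x (a *\<^sub>R e) u * h x v w + h x (a *\<^sub>R e) v * h x u w + h x (a *\<^sub>R e) w * h x u v
       - (n + 2) / h x (a *\<^sub>R e) (a *\<^sub>R e) * h x (a *\<^sub>R e) u * h x (a *\<^sub>R e) v * h x (a *\<^sub>R e) w"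
      unfolding T aa unfolding P.left_simps using a by (simp add: field_simps)
  qed
  from someI_ex[OF this]
  have *: "h x (Z x) (Z x) > 0 \<and> (\<forall>u v w. T x u v w =
     h x (Z x) u * h x v w + h x (Z x) v * h x u w + h x (Z x) w * h x u v
       - (n + 2) / h x (Z x) (Z x) * h x (Z x) u * h x (Z x) v * h x (Z x) w)"
    unfolding Z_def .
  then show "N x > 0" unfolding N_def by blast
  show "T x u v w = \<alpha> x u * h x v w + \<alpha> x v * h x u w + \<alpha> x w * h x u v
       - (n + 2) / N x * \<alpha> x u * \<alpha> x v * \<alpha> x w"
    unfolding N_def \<alpha>_def using * by blast
qed

lemma linear_\<alpha>: "x \<in> \<Omega> \<Longrightarrow> linear (\<alpha> x)"
  unfolding \<alpha>_def[abs_def] by (rule linear_d2_right[OF open_dom smooth])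

lemma \<alpha>_Z: "\<alpha> x (Z x) = N x"
  by (simp add: \<alpha>_def N_def)

section \<open>Smoothness of the axis data\<close>

lemma smooth_h: "smooth_on \<Omega> (\<lambda>x. h x u v)"
  by (rule smooth_on_d2[OF open_dom smooth])

lemma smooth_T: "smooth_on \<Omega> (\<lambda>x. T x u v w)"
  by (rule smooth_on_d3[OF open_dom smooth])

text \<open>The dual vector solves a linear system with the Gram matrix of the coordinate basis,
  which is invertible because \<open>h\<close> is definite.\<close>

lemma smooth_dual:
  assumes b: "\<And>u. smooth_on \<Omega> (\<lambda>x. b x u)" and w: "\<And>x u. x \<in> \<Omega> \<Longrightarrow> h x (w x) u = b x u"
  shows "smooth_on \<Omega> w"
proof (rule smooth_on_cramer[OF open_dom, where M="\<lambda>x. \<chi> i j. h x (axis j 1) (axis i 1)" and b="\<lambda>x. \<chi> i. b x (axis i 1)"])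
  show "smooth_on \<Omega> (\<lambda>x. (\<chi> i j. h x (axis j 1) (axis i 1)) $ i $ j)" for i j
    unfolding vec_lambda_beta by (rule smooth_h)
  show "smooth_on \<Omega> (\<lambda>x. (\<chi> i. b x (axis i 1)) $ i)" for i
    unfolding vec_lambda_beta by (rule b)
  fix x assume x: "x \<in> \<Omega>"
  interpret P: posdef_form "h x" by (rule pos[OF x])
  let ?M = "\<chi> i j. h x (axis j 1) (axis i 1) :: real ^ 'n ^ 'n"
  have M: "?M *v z = (\<chi> i. h x z (axis i 1))" for z
  proof (rule vec_eq_iff[THEN iffD2], rule allI)
    fix i
    show "(?M *v z) $ i = (\<chi> i. h x z (axis i 1)) $ i"
      using sum_functional_axis[OF P.linear_left[of "axis i 1"], of z]
      by (simp add: matrix_vector_mult_def)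
  qed
  show "?M *v w x = (\<chi> i. b x (axis i 1))"
    unfolding M w[OF x] ..
  have "inj ((*v) ?M)"
  proof (rule injI)
    fix z z' assume "?M *v z = ?M *v z'"
    then have "(\<chi> i. h x z (axis i 1)) $ i = (\<chi> i. h x z' (axis i 1)) $ i" for i
      unfolding M by (rule arg_cong)
    then have eq: "h x (z - z') (axis i 1) = 0" for i by simp
    have "h x (z - z') u = 0" for u
      using sum_functional_axis[OF P.linear_right[of "z - z'"], of u] unfolding eq by simp
    then show "z = z'" using P.eq_0_iff[of "z - z'"] by simp
  qed
  then show "det ?M \<noteq> 0"
    using det_nz_iff_inj[OF matrix_vector_mul_linear[of ?M]] by simp
qed

text \<open>\<open>W x w\<close> is the \<open>h\<close>-self-adjoint operator of the bilinear form \<open>T x w\<close>. The traces of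
  \<open>W x w \<circ> W x w'\<close> are smooth, and they determine \<open>N\<close> and the products \<open>\<alpha> w * \<alpha> w'\<close>.\<close>

definition W :: "real ^ 'n \<Rightarrow> real ^ 'n \<Rightarrow> real ^ 'n \<Rightarrow> real ^ 'n" where
  "W x w v = \<alpha> x w *\<^sub>R v + \<alpha> x v *\<^sub>R w + (h x w v - (n + 2) / N x * \<alpha> x w * \<alpha> x v) *\<^sub>R Z x"

definition trace_form :: "real ^ 'n \<Rightarrow> real ^ 'n \<Rightarrow> real ^ 'n \<Rightarrow> real" where
  "trace_form x w w' = (\<Sum>i\<in>UNIV. W x w (W x w' (axis i 1)) $ i)"

lemma smooth_W: "smooth_on \<Omega> (\<lambda>x. W x w v)"
proof (rule smooth_dual[OF smooth_T])
  fix x u assume x: "x \<in> \<Omega>"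
  interpret P: posdef_form "h x" by (rule pos[OF x])
  show "h x (W x w v) u = T x w v u"
    unfolding Z_props(2)[OF x] W_def P.left_simps by (simp add: \<alpha>_def algebra_simps)
qed

lemma linear_W:
  assumes x: "x \<in> \<Omega>" shows "linear (W x w)"
proof -
  interpret P: posdef_form "h x" by (rule pos[OF x])
  have "linear (\<lambda>v. h x w v - (n + 2) / N x * \<alpha> x w * \<alpha> x v)"
    using linear_compose_sub[OF P.linear_right linear_compose_scale_right[OF linear_\<alpha>[OF x], of "(n + 2) / N x * \<alpha> x w"]]
    by simp
  then show ?thesis
    unfolding W_def[abs_def]
    by (intro linear_compose_add linear_compose_scale_right[of "\<lambda>v. v"] linear_id[unfolded id_def]
        linear_compose[OF _ linear_scaleR_left, unfolded o_def] linear_\<alpha>[OF x])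
qed

lemma smooth_trace_form: "smooth_on \<Omega> (\<lambda>x. trace_form x w w')"
proof -
  have "smooth_on \<Omega> (\<lambda>x. \<Sum>i\<in>UNIV. \<Sum>j\<in>UNIV. W x w (axis j 1) $ i * W x w' (axis i 1) $ j)"
    by (intro smooth_on_sum smooth_on_mult smooth_on_vec_nth smooth_W open_dom)
  then show ?thesis
  proof (rule smooth_on_open_cong[OF _ open_dom])
    fix x assume x: "x \<in> \<Omega>"
    have l: "linear (\<lambda>v. W x w v $ i)" for i
      using linear_compose[OF linear_W[OF x] linear_vec_nth] unfolding o_def .
    show "(\<Sum>i\<in>UNIV. \<Sum>j\<in>UNIV. W x w (axis j 1) $ i * W x w' (axis i 1) $ j) = trace_form x w w'"
      unfolding trace_form_def sum_functional_axis[OF l] ..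
  qed
qed

lemma trace_form_eq:
  assumes x: "x \<in> \<Omega>"
  shows "trace_form x w w' = 2 * N x * h x w w' + (n\<^sup>2 - n - 2) * (\<alpha> x w * \<alpha> x w')"
proof -
  interpret P: posdef_form "h x" by (rule pos[OF x])
  have Nx: "N x \<noteq> 0" using Z_props(1)[OF x] by simp
  let ?s = "\<alpha> x w" and ?s' = "\<alpha> x w'" and ?B = "(n + 2) / N x"
  have BN: "?B * N x = n + 2" using Nx by simp
  have aY: "\<alpha> x (W x w' X) = (2 * ?s' - ?B * N x * ?s') * \<alpha> x X + N x * h x w' X" for X
    unfolding W_def linear_add[OF linear_\<alpha>[OF x]] linear_cmul[OF linear_\<alpha>[OF x]] \<alpha>_Z
    by (simp add: algebra_simps)
  have hY: "h x w (W x w' X) = ?s' * h x w X + (h x w w' - ?B * ?s' * ?s) * \<alpha> x X + ?s * h x w' X" for X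
    unfolding W_def P.right_simps using P.sym[of w "Z x"] by (simp add: \<alpha>_def algebra_simps)
  \<comment> \<open>The composition is a multiple of the identity plus rank-one maps with values
    along \<open>w'\<close>, \<open>w\<close> and \<open>Z x\<close>. The functional
    \<open>p1\<close> belongs to \<open>w\<close>, and \<open>p2\<close>, \<open>p3\<close> belong
    to \<open>Z x\<close>, so that each trace becomes an evaluation.\<close>
  define p1 where "p1 X = \<alpha> x (W x w' X)" for X
  define p2 where "p2 X = h x w (W x w' X) - ?B * ?s * \<alpha> x (W x w' X)" for X
  define p3 where "p3 X = ?s * (h x w' X - ?B * ?s' * \<alpha> x X)" for X
  have l1: "linear p1"
    using linear_compose[OF linear_W[OF x] linear_\<alpha>[OF x]] unfolding p1_def[abs_def] o_def .
  have l2: "linear p2"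
  proof -
    have "linear (\<lambda>X. h x w (W x w' X))"
      using linear_compose[OF linear_W[OF x] P.linear_right] unfolding o_def .
    then show ?thesis
      using linear_compose_sub[OF _ linear_compose_scale_right[OF l1, of "?B * ?s"]]
      unfolding p2_def[abs_def] p1_def by simp
  qed
  have l3: "linear p3"
    using linear_compose_scale_right[OF linear_compose_sub[OF P.linear_right[of w']
        linear_compose_scale_right[OF linear_\<alpha>[OF x], of "?B * ?s'"]], of ?s]
    unfolding p3_def[abs_def] by simp
  have dec: "W x w (W x w' (axis i 1)) $ i = ?s * ?s' + ?s * \<alpha> x (axis i 1) * w' $ i
      + p3 (axis i 1) * Z x $ i + p1 (axis i 1) * w $ i + p2 (axis i 1) * Z x $ i" for i
  proof -
    have "W x w (W x w' (axis i 1)) = ?s *\<^sub>R W x w' (axis i 1) + p1 (axis i 1) *\<^sub>R w + p2 (axis i 1) *\<^sub>R Z x"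
      unfolding W_def[of x w] p1_def p2_def ..
    then have "W x w (W x w' (axis i 1)) $ i = ?s * W x w' (axis i 1) $ i + p1 (axis i 1) * w $ i + p2 (axis i 1) * Z x $ i"
      by simp
    moreover have "W x w' (axis i 1) $ i = ?s' + \<alpha> x (axis i 1) * w' $ i + (h x w' (axis i 1) - ?B * ?s' * \<alpha> x (axis i 1)) * Z x $ i"
      unfolding W_def by simp
    ultimately show ?thesis by (simp add: p3_def algebra_simps)
  qed
  have "trace_form x w w' = n * (?s * ?s') + ?s * (\<Sum>i\<in>UNIV. \<alpha> x (axis i 1) * w' $ i)
      + (\<Sum>i\<in>UNIV. p3 (axis i 1) * Z x $ i) + (\<Sum>i\<in>UNIV. p1 (axis i 1) * w $ i) + (\<Sum>i\<in>UNIV. p2 (axis i 1) * Z x $ i)"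
    unfolding trace_form_def dec sum.distrib by (simp add: sum_distrib_left mult.assoc n_def)
  also have "\<dots> = n * (?s * ?s') + ?s * ?s' + p3 (Z x) + p1 w + p2 (Z x)"
    unfolding sum_functional_axis[OF linear_\<alpha>[OF x]] sum_functional_axis[OF l1] sum_functional_axis[OF l2]
      sum_functional_axis[OF l3] ..
  also have "p3 (Z x) = ?s * ?s' - ?s * ?s' * (?B * N x)"
    unfolding p3_def \<alpha>_Z using P.sym[of w' "Z x"] by (simp add: \<alpha>_def algebra_simps)
  also have "p1 w = (2 * ?s' - ?B * N x * ?s') * ?s + N x * h x w' w"
    unfolding p1_def aY ..
  also have "p2 (Z x) = ?s' * ?s + (h x w w' - ?B * ?s' * ?s) * N x + ?s * ?s'
      - ?B * ?s * ((2 * ?s' - ?B * N x * ?s') * N x + N x * ?s')"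
    unfolding p2_def hY aY \<alpha>_Z using P.sym[of w "Z x"] P.sym[of w' "Z x"] by (simp add: \<alpha>_def)
  also have "\<dots> = 2 * ?s' * ?s + h x w w' * N x - (?B * N x) * (?s' * ?s)
      - (?B * N x) * (?s * ?s') * (3 - ?B * N x)"
    by (simp only: algebra_simps)
  finally show ?thesis
    unfolding BN using P.sym[of w w'] by (simp add: power2_eq_square algebra_simps)
qed

text \<open>The polynomial is \<open>(n - 2) * (n + 1)\<close>. Its positivity allows the products
  of values of \<open>\<alpha>\<close> to be solved for in \<open>trace_form_eq\<close>.\<close>

lemma trace_coefficient_pos: "n\<^sup>2 - n - 2 > 0"
proof -
  have "n * 3 \<le> n * n" using n by (intro mult_left_mono) simp_all
  then show ?thesis using n unfolding power2_eq_square by linarith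
qed

text \<open>The operator \<open>R\<close> dual to the trace form is smooth by
  \<open>smooth_dual\<close>, and its trace is \<open>(n + 2) * (n - 1) * N x\<close>.\<close>

lemma smooth_N: "smooth_on \<Omega> N"
proof -
  define R where "R x w = (2 * N x) *\<^sub>R w + ((n\<^sup>2 - n - 2) * \<alpha> x w) *\<^sub>R Z x" for x w
  have smR: "smooth_on \<Omega> (\<lambda>x. R x w)" for w
  proof (rule smooth_dual[OF smooth_trace_form])
    fix x u assume x: "x \<in> \<Omega>"
    interpret P: posdef_form "h x" by (rule pos[OF x])
    show "h x (R x w) u = trace_form x w u"
      unfolding trace_form_eq[OF x] R_def P.left_simps by (simp add: \<alpha>_def algebra_simps)
  qed
  have "smooth_on \<Omega> (\<lambda>x. (\<Sum>i\<in>UNIV. R x (axis i 1) $ i) / ((n + 2) * (n - 1)))"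
    using n by (intro smooth_on_divide smooth_on_sum smooth_on_vec_nth smR smooth_on_const open_dom) simp_all
  then show ?thesis
  proof (rule smooth_on_open_cong[OF _ open_dom])
    fix x assume x: "x \<in> \<Omega>"
    have "(\<Sum>i\<in>UNIV. R x (axis i 1) $ i) = (\<Sum>i\<in>UNIV. 2 * N x + (n\<^sup>2 - n - 2) * (\<alpha> x (axis i 1) * Z x $ i))"
      unfolding R_def by (simp add: mult.assoc)
    also have "\<dots> = n * (2 * N x) + (n\<^sup>2 - n - 2) * N x"
      unfolding sum.distrib sum_distrib_left[symmetric] sum_functional_axis[OF linear_\<alpha>[OF x]] \<alpha>_Z by (simp add: n_def)
    also have "\<dots> = ((n + 2) * (n - 1)) * N x"
      by (simp add: power2_eq_square algebra_simps)
    finally show "(\<Sum>i\<in>UNIV. R x (axis i 1) $ i) / ((n + 2) * (n - 1)) = N x"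
      using n by simp
  qed
qed

lemma smooth_\<alpha>_mult: "smooth_on \<Omega> (\<lambda>x. \<alpha> x w * \<alpha> x w')"
proof -
  have "smooth_on \<Omega> (\<lambda>x. (trace_form x w w' - 2 * (N x * h x w w')) / (n\<^sup>2 - n - 2))"
    using trace_coefficient_pos
    by (intro smooth_on_divide smooth_on_diff smooth_on_mult smooth_on_const smooth_trace_form smooth_N smooth_h open_dom) simp_all
  then show ?thesis
    by (rule smooth_on_open_cong[OF _ open_dom]) (use trace_form_eq trace_coefficient_pos in simp)
qed

text \<open>Products of two values leave the sign of \<open>\<alpha>\<close> open. The cubic form,
  odd in \<open>\<alpha>\<close>, decides it: for a fixed vector v, \<open>T x v v v\<close> is
  \<open>\<alpha> x v\<close> times the smooth function \<open>?d\<close>, which does not vanish at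
  \<open>p\<close> for \<open>v = Z p\<close>. Near \<open>p\<close> one may then divide by
  \<open>\<alpha> x v\<close>.\<close>

lemma smooth_\<alpha>: "smooth_on \<Omega> (\<lambda>x. \<alpha> x w)"
proof (rule smooth_on_local[OF open_dom])
  fix p assume p: "p \<in> \<Omega>"
  let ?v = "Z p"
  let ?d = "\<lambda>x. 3 * h x ?v ?v - (n + 2) / N x * (\<alpha> x ?v * \<alpha> x ?v)"
  have smd: "smooth_on \<Omega> ?d"
    by (intro smooth_on_diff smooth_on_mult smooth_on_divide smooth_on_const smooth_h smooth_N smooth_\<alpha>_mult open_dom)
       (use Z_props(1) in force)
  let ?S = "{x \<in> \<Omega>. ?d x \<noteq> 0}"
  have S: "open ?S" by (rule open_nonzero_set[OF open_dom smd])
  have "smooth_on ?S (\<lambda>x. T x ?v ?v ?v / ?d x)"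
    by (rule smooth_on_divide[OF S smooth_on_subset[OF smooth_T] smooth_on_subset[OF smd]]) auto
  then have smv: "smooth_on ?S (\<lambda>x. \<alpha> x ?v)"
  proof (rule smooth_on_open_cong[OF _ S])
    fix x assume "x \<in> ?S"
    then have x: "x \<in> \<Omega>" "?d x \<noteq> 0" by auto
    have "T x ?v ?v ?v = \<alpha> x ?v * ?d x"
      unfolding Z_props(2)[OF x(1)] by (simp add: algebra_simps)
    then show "T x ?v ?v ?v / ?d x = \<alpha> x ?v" using x(2) by simp
  qed
  let ?S' = "{x \<in> ?S. \<alpha> x ?v \<noteq> 0}"
  have S': "open ?S'" by (rule open_nonzero_set[OF S smv])
  have "smooth_on ?S' (\<lambda>x. (\<alpha> x w * \<alpha> x ?v) / \<alpha> x ?v)"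
    by (rule smooth_on_divide[OF S' smooth_on_subset[OF smooth_\<alpha>_mult] smooth_on_subset[OF smv]]) auto
  then have "smooth_on ?S' (\<lambda>x. \<alpha> x w)"
    by (rule smooth_on_open_cong[OF _ S']) simp
  moreover have "p \<in> ?S'"
  proof -
    have Np: "N p > 0" by (rule Z_props(1)[OF p])
    then have "(n + 2) / N p * (N p * N p) = (n + 2) * N p" by simp
    then have "?d p = (1 - n) * N p"
      unfolding \<alpha>_Z N_def[symmetric] by (simp add: algebra_simps)
    moreover have "(1 - n) * N p \<noteq> 0" using n Np by simp
    ultimately have "?d p \<noteq> 0" by (simp only: not_False_eq_True)
    moreover have "\<alpha> p ?v \<noteq> 0" using Np by (simp add: \<alpha>_Z)
    ultimately show ?thesis using p by blast
  qed
  ultimately show "\<exists>S. open S \<and> p \<in> S \<and> smooth_on S (\<lambda>x. \<alpha> x w)" using S' by blast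
qed

end

lemma (in posdef_form) cauchy_schwarz: "h u v * h u v \<le> h u u * h v v"
proof (cases "u = 0")
  case False
  define w where "w = h u u *\<^sub>R v - h u v *\<^sub>R u"
  have "h w w = h u u * (h u u * h v v - h u v * h u v)"
    unfolding w_def using sym[of v u] by (simp add: algebra_simps)
  then have "0 \<le> h u u * (h u u * h v v - h u v * h u v)" using nonneg[of w] by simp
  then show ?thesis using pos[OF False] by (simp add: zero_le_mult_iff)
qed simp

section \<open>Integrability and the derivatives of alpha, N and mu\<close>

context hessian_pde
begin

definition A :: "real ^ 'n \<Rightarrow> real ^ 'n \<Rightarrow> real ^ 'n \<Rightarrow> real" where
  "A x u z = frechet_derivative (\<lambda>y. \<alpha> y u) (at x) z"

lemma has_derivative_\<alpha>': "x \<in> \<Omega> \<Longrightarrow> ((\<lambda>y. \<alpha> y u) has_derivative A x u) (at x)"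
  using smooth_on_has_derivative[OF smooth_\<alpha>] unfolding A_def[abs_def] .

lemma has_derivative_h: "x \<in> \<Omega> \<Longrightarrow> ((\<lambda>y. h y u v) has_derivative T x u v) (at x)"
  by (rule has_derivative_d2[OF open_dom smooth])

lemma smooth_A: "smooth_on \<Omega> (\<lambda>x. A x u z)"
  unfolding A_def by (rule smooth_on_frechet_derivative[OF smooth_\<alpha>])

lemma linear_A_right: "x \<in> \<Omega> \<Longrightarrow> linear (A x u)"
  by (rule has_derivative_linear[OF has_derivative_\<alpha>'])

lemma linear_A_left:
  assumes x: "x \<in> \<Omega>" shows "linear (\<lambda>u. A x u z)"
proof (rule linearI)
  fix u u'
  have "((\<lambda>y. \<alpha> y (u + u')) has_derivative (\<lambda>z. A x u z + A x u' z)) (at x)"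
  proof (rule has_derivative_transform_within_open[OF has_derivative_add open_dom x])
    show "((\<lambda>y. \<alpha> y u) has_derivative A x u) (at x)" "((\<lambda>y. \<alpha> y u') has_derivative A x u') (at x)"
      by (rule has_derivative_\<alpha>'[OF x])+
    show "\<alpha> y u + \<alpha> y u' = \<alpha> y (u + u')" if "y \<in> \<Omega>" for y
      by (rule linear_add[OF linear_\<alpha>[OF that], symmetric])
  qed
  from fun_cong[OF has_derivative_unique[OF has_derivative_\<alpha>'[OF x] this], of z]
  show "A x (u + u') z = A x u z + A x u' z" .
next
  fix c u
  have "((\<lambda>y. \<alpha> y (c *\<^sub>R u)) has_derivative (\<lambda>z. c * A x u z)) (at x)"
  proof (rule has_derivative_transform_within_open[OF has_derivative_mult_right open_dom x])
    show "((\<lambda>y. \<alpha> y u) has_derivative A x u) (at x)"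
      by (rule has_derivative_\<alpha>'[OF x])
    show "c * \<alpha> y u = \<alpha> y (c *\<^sub>R u)" if "y \<in> \<Omega>" for y
      using linear_cmul[OF linear_\<alpha>[OF that], of c u] by simp
  qed
  from fun_cong[OF has_derivative_unique[OF has_derivative_\<alpha>'[OF x] this], of z]
  show "A x (c *\<^sub>R u) z = c *\<^sub>R A x u z" by simp
qed

definition dB :: "real ^ 'n \<Rightarrow> real ^ 'n \<Rightarrow> real" where
  "dB x z = frechet_derivative (\<lambda>y. (n + 2) / N y) (at x) z"

lemma has_derivative_B: "x \<in> \<Omega> \<Longrightarrow> ((\<lambda>y. (n + 2) / N y) has_derivative dB x) (at x)"
proof -
  assume x: "x \<in> \<Omega>"
  have "smooth_on \<Omega> (\<lambda>y. (n + 2) / N y)"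
    by (rule smooth_on_divide[OF open_dom smooth_on_const[OF open_dom] smooth_N])
       (use Z_props(1) in force)
  from smooth_on_has_derivative[OF this x] show ?thesis unfolding dB_def[abs_def] .
qed

definition dT :: "real ^ 'n \<Rightarrow> real ^ 'n \<Rightarrow> real ^ 'n \<Rightarrow> real ^ 'n \<Rightarrow> real ^ 'n \<Rightarrow> real" where
  "dT x u v w z = (\<alpha> x u * T x v w z + A x u z * h x v w) + (\<alpha> x v * T x u w z + A x v z * h x u w)
     + (\<alpha> x w * T x u v z + A x w z * h x u v)
     - ((n + 2) / N x * \<alpha> x u * \<alpha> x v * A x w z + ((n + 2) / N x * \<alpha> x u * A x v z
         + ((n + 2) / N x * A x u z + dB x z * \<alpha> x u) * \<alpha> x v) * \<alpha> x w)"

lemma has_derivative_T: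
  assumes x: "x \<in> \<Omega>"
  shows "((\<lambda>y. T y u v w) has_derivative dT x u v w) (at x)"
proof (rule has_derivative_transform_within_open[OF _ open_dom x])
  show "((\<lambda>y. \<alpha> y u * h y v w + \<alpha> y v * h y u w + \<alpha> y w * h y u v
       - (n + 2) / N y * \<alpha> y u * \<alpha> y v * \<alpha> y w) has_derivative dT x u v w) (at x)"
    unfolding dT_def[abs_def]
    by (intro has_derivative_diff has_derivative_add has_derivative_mult has_derivative_\<alpha>'[OF x]
        has_derivative_h[OF x] has_derivative_B[OF x])
qed (rule Z_props(2)[symmetric])

text \<open>Fourth derivatives of \<open>\<phi>\<close> commute; the form of the derivative of
  \<open>\<alpha>\<close> is drawn from this alone.\<close>

lemma integrability:
  assumes x: "x \<in> \<Omega>"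
  shows "dT x u v w z = dT x u v z w"
proof -
  have "frechet_derivative (\<lambda>y. T y u v w) (at x) z = frechet_derivative (\<lambda>y. T y u v z) (at x) w"
    unfolding d3_def by (rule second_derivative_symmetric[OF open_dom smooth_h x])
  then show ?thesis
    unfolding frechet_derivative_at[OF has_derivative_T[OF x], symmetric] .
qed

lemma adapted_frame_at:
  assumes x: "x \<in> \<Omega>"
  obtains E where "orthonormal_frame (h x) E" "Z x = sqrt (N x) *\<^sub>R E i0"
    "\<And>i. i \<noteq> i0 \<Longrightarrow> \<alpha> x (E i) = 0"
proof -
  interpret P: posdef_form "h x" by (rule pos[OF x])
  have N: "N x > 0" by (rule Z_props(1)[OF x])
  define e where "e = (1 / sqrt (N x)) *\<^sub>R Z x"
  have e: "h x e e = 1" using N by (simp add: e_def N_def[symmetric])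
  obtain E where E: "E i0 = e" "\<And>i j. h x (E i) (E j) = (if i = j then 1 else 0)"
    by (rule orthonormal_frame_exists[OF pos[OF x] e, of i0]) blast
  have Z: "Z x = sqrt (N x) *\<^sub>R E i0" using N by (simp add: E(1) e_def)
  show ?thesis
  proof (rule that[of E])
    show "Z x = sqrt (N x) *\<^sub>R E i0" by (rule Z)
    show "orthonormal_frame (h x) E"
      by (rule orthonormal_frame.intro[OF pos[OF x]]) (rule orthonormal_frame_axioms.intro, rule E(2))
    fix i assume "i \<noteq> i0"
    then show "\<alpha> x (E i) = 0" using E(2)[of i0 i] unfolding \<alpha>_def Z by simp
  qed
qed

lemma adapted_frame:
  assumes x: "x \<in> \<Omega>"
  obtains E i0 where "orthonormal_frame (h x) E" "Z x = sqrt (N x) *\<^sub>R E i0"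
    "\<And>i. i \<noteq> i0 \<Longrightarrow> \<alpha> x (E i) = 0"
  using adapted_frame_at[OF x, of undefined] that by blast

lemma other_index: "\<exists>j. j \<noteq> i \<and> j \<noteq> (i' :: 'n)"
proof (rule ccontr)
  assume "\<not> ?thesis"
  then have "(UNIV :: 'n set) \<subseteq> {i, i'}" by auto
  then have "CARD('n) \<le> card {i, i'}" by (rule card_mono[rotated]) simp
  also have "\<dots> \<le> 2" by (simp add: card_insert_if)
  finally show False using card by simp
qed

lemma bilinear_frame_zero:
  assumes "orthonormal_frame (h x) E" and "\<And>v. linear (\<lambda>u. D u v)" "\<And>u. linear (D u)"
    and "\<And>i j. D (E i) (E j) = (0::real)"
  shows "D u v = 0"
proof -
  interpret F: orthonormal_frame "h x" E by fact
  have "D u (E j) = 0" for u j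
    by (rule F.linear_eq_0[where g="\<lambda>u. D u (E j)"], rule assms(2), rule assms(4))
  then show ?thesis
    by (rule F.linear_eq_0[where g="D u", OF assms(3)])
qed

text \<open>\<open>integrability\<close> is tested on a frame adapted to \<open>Z\<close>.
  Off-diagonal entries of \<open>A\<close> and those mixed with \<open>Z\<close> vanish, and the
  diagonal entries orthogonal to \<open>Z\<close> agree; their common value is the required number.
  Then \<open>A x (Z x) (Z x)\<close> is forced, and the coefficient of the last term is the one
  that fits it. The symmetry of \<open>A\<close> is a result.\<close>

lemma hessian_\<alpha>_exists:
  assumes x: "x \<in> \<Omega>"
  shows "\<exists>\<mu>. \<forall>u z. A x u z = \<mu> * h x u z + (1 - (n + 2) * \<mu> / N x) * \<alpha> x u * \<alpha> x z"
proof -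
  interpret P: posdef_form "h x" by (rule pos[OF x])
  have N: "N x > 0" by (rule Z_props(1)[OF x])
  obtain E i0 where E: "orthonormal_frame (h x) E" and ZE: "Z x = sqrt (N x) *\<^sub>R E i0"
    and aE: "\<And>i. i \<noteq> i0 \<Longrightarrow> \<alpha> x (E i) = 0"
    by (rule adapted_frame[OF x]) blast
  have hE: "h x (E i) (E j) = (if i = j then 1 else 0)" for i j
    by (rule orthonormal_frame.orthonormal[OF E])
  have hZ: "h x (Z x) (E i) = 0" "h x (E i) (Z x) = 0" if "i \<noteq> i0" for i
    using that unfolding ZE by (simp_all add: hE)
  have hZZ: "h x (Z x) (Z x) = N x" by (simp add: N_def)
  note T = Z_props(2)[OF x]
  have pq: "A x (E i) (E j) = 0" if "i \<noteq> i0" "j \<noteq> i0" "i \<noteq> j" for i j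
  proof -
    \<comment> \<open>Three equal arguments produce the factor 3. With the roles of \<open>i\<close>
      and \<open>j\<close> exchanged, each entry is 9 times itself.\<close>
    have "3 * A x (E i) (E j) = A x (E j) (E i)" if "i \<noteq> i0" "j \<noteq> i0" "i \<noteq> j" for i j
      using integrability[OF x, of "E i" "E i" "E i" "E j"] that
      unfolding dT_def T by (simp add: aE hE)
    from this[of i j] this[of j i] that show ?thesis by simp
  qed
  have pp: "A x (E i) (E i) = A x (E j) (E j)" if "i \<noteq> i0" "j \<noteq> i0" for i j
    using integrability[OF x, of "E i" "E j" "E i" "E j"] that
    unfolding dT_def T by (cases "i = j") (simp_all add: aE hE)
  have Zp3: "A x (Z x) (E i) = 3 * A x (E i) (Z x)" if "i \<noteq> i0" for i
    using integrability[OF x, of "E i" "E i" "Z x" "E i"] that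
    unfolding dT_def T by (simp add: aE hE hZ)
  \<comment> \<open>A second index orthogonal to \<open>Z\<close>, available since n >= 3, gives the
    same relation without the factor 3.\<close>
  have Zp1: "A x (Z x) (E i) = A x (E i) (Z x)" if i: "i \<noteq> i0" for i
  proof -
    obtain j where "j \<noteq> i0" "j \<noteq> i" using other_index by blast
    then show ?thesis
      using integrability[OF x, of "E j" "E j" "Z x" "E i"] i
      unfolding dT_def T by (simp add: aE hE hZ)
  qed
  have Zp: "A x (Z x) (E i) = 0" "A x (E i) (Z x) = 0" if "i \<noteq> i0" for i
    using Zp3[OF that] Zp1[OF that] by simp_all
  obtain i1 where i1: "i1 \<noteq> i0" using other_index by blast
  define \<mu> where "\<mu> = A x (E i1) (E i1)"
  have diag: "A x (E i) (E i) = \<mu>" if "i \<noteq> i0" for i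
    unfolding \<mu>_def by (rule pp[OF that i1])
  have ZZ: "A x (Z x) (Z x) = (N x)\<^sup>2 - (n + 1) * \<mu> * N x"
  proof -
    have "A x (Z x) (Z x) + N x * N x = N x * N x + \<mu> * N x + N x * N x - (n + 2) / N x * N x * \<mu> * N x"
      using integrability[OF x, of "Z x" "E i1" "Z x" "E i1"] i1
      unfolding dT_def T by (simp add: aE hE hZ hZZ \<alpha>_Z diag Zp)
    moreover have "(n + 2) / N x * N x * \<mu> * N x = (n + 2) * \<mu> * N x" using N by simp
    ultimately show ?thesis by (simp add: power2_eq_square algebra_simps)
  qed
  define c where "c = 1 - (n + 2) * \<mu> / N x"
  define D where "D u z = A x u z - (\<mu> * h x u z + c * \<alpha> x u * \<alpha> x z)" for u z
  have lin1: "linear (\<lambda>u. D u z)" for z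
    unfolding D_def
    by (rule linearI) (simp_all add: linear_add[OF linear_A_left[OF x]] linear_cmul[OF linear_A_left[OF x]]
        linear_add[OF linear_\<alpha>[OF x]] linear_cmul[OF linear_\<alpha>[OF x]] algebra_simps)
  have lin2: "linear (D u)" for u
    unfolding D_def[abs_def]
    by (rule linearI) (simp_all add: linear_add[OF linear_A_right[OF x]] linear_cmul[OF linear_A_right[OF x]]
        linear_add[OF linear_\<alpha>[OF x]] linear_cmul[OF linear_\<alpha>[OF x]] algebra_simps)
  have E0: "E i0 = (1 / sqrt (N x)) *\<^sub>R Z x" using N unfolding ZE by simp
  have DZZ: "D (Z x) (Z x) = 0"
    unfolding D_def c_def ZZ hZZ \<alpha>_Z using N by (simp add: field_simps power2_eq_square)
  have DZ: "D (Z x) (E i) = 0" "D (E i) (Z x) = 0" if "i \<noteq> i0" for i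
    unfolding D_def using that by (simp_all add: Zp hZ aE)
  have DE: "D (E i) (E j) = 0" for i j
  proof (cases "i = i0")
    case i: True
    show ?thesis
    proof (cases "j = i0")
      case True
      then show ?thesis unfolding i True E0 linear_cmul[OF lin1] linear_cmul[OF lin2] DZZ by simp
    next
      case False
      then show ?thesis unfolding i E0 linear_cmul[OF lin1] DZ(1)[OF False] by simp
    qed
  next
    case i: False
    show ?thesis
    proof (cases "j = i0")
      case True
      then show ?thesis unfolding True E0 linear_cmul[OF lin2] DZ(2)[OF i] by simp
    next
      case False
      then show ?thesis using i pq diag unfolding D_def by (cases "i = j") (simp_all add: aE hE)
    qed
  qed
  have "D u z = 0" for u z by (rule bilinear_frame_zero[OF E lin1 lin2 DE])
  then have "A x u z = \<mu> * h x u z + (1 - (n + 2) * \<mu> / N x) * \<alpha> x u * \<alpha> x z" for u z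
    unfolding D_def c_def using eq_iff_diff_eq_0 by blast
  then show ?thesis by blast
qed

definition \<mu> :: "real ^ 'n \<Rightarrow> real" where
  "\<mu> x = (SOME \<mu>. \<forall>u z. A x u z = \<mu> * h x u z + (1 - (n + 2) * \<mu> / N x) * \<alpha> x u * \<alpha> x z)"

lemma A_eq:
  assumes x: "x \<in> \<Omega>"
  shows "A x u z = \<mu> x * h x u z + (1 - (n + 2) * \<mu> x / N x) * \<alpha> x u * \<alpha> x z"
  using someI_ex[OF hessian_\<alpha>_exists[OF x]] unfolding \<mu>_def by blast

text \<open>On a fixed vector the formula for \<open>A\<close> can be solved for
  \<open>\<mu>\<close>. A unit vector orthogonal to \<open>Z p\<close> makes the denominator 1 at
  \<open>p\<close>, hence nonzero nearby.\<close>

lemma smooth_\<mu>: "smooth_on \<Omega> \<mu>"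
proof (rule smooth_on_local[OF open_dom])
  fix p assume p: "p \<in> \<Omega>"
  obtain E i0 where E: "orthonormal_frame (h p) E" and aE: "\<And>i. i \<noteq> i0 \<Longrightarrow> \<alpha> p (E i) = 0"
    by (rule adapted_frame[OF p]) blast
  obtain i1 where i1: "i1 \<noteq> i0" using other_index by blast
  let ?v = "E i1"
  let ?d = "\<lambda>x. h x ?v ?v - (n + 2) / N x * (\<alpha> x ?v * \<alpha> x ?v)"
  have smd: "smooth_on \<Omega> ?d"
    by (intro smooth_on_diff smooth_on_mult smooth_on_divide smooth_on_const smooth_h smooth_N smooth_\<alpha>_mult open_dom)
       (use Z_props(1) in force)
  let ?S = "{x \<in> \<Omega>. ?d x \<noteq> 0}"
  have S: "open ?S" by (rule open_nonzero_set[OF open_dom smd])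
  have smn: "smooth_on \<Omega> (\<lambda>x. A x ?v ?v - \<alpha> x ?v * \<alpha> x ?v)"
    by (intro smooth_on_diff smooth_A smooth_\<alpha>_mult open_dom)
  have "smooth_on ?S (\<lambda>x. (A x ?v ?v - \<alpha> x ?v * \<alpha> x ?v) / ?d x)"
    by (rule smooth_on_divide[OF S smooth_on_subset[OF smn] smooth_on_subset[OF smd]]) auto
  then have "smooth_on ?S \<mu>"
  proof (rule smooth_on_open_cong[OF _ S])
    fix x assume "x \<in> ?S"
    then have x: "x \<in> \<Omega>" "?d x \<noteq> 0" by auto
    have "A x ?v ?v - \<alpha> x ?v * \<alpha> x ?v = \<mu> x * ?d x"
      unfolding A_eq[OF x(1)] by (simp add: algebra_simps)
    then show "(A x ?v ?v - \<alpha> x ?v * \<alpha> x ?v) / ?d x = \<mu> x" using x(2) by simp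
  qed
  moreover have "p \<in> ?S"
    using p aE[OF i1] orthonormal_frame.orthonormal[OF E, of i1 i1] by simp
  ultimately show "\<exists>S. open S \<and> p \<in> S \<and> smooth_on S \<mu>" using S by blast
qed

text \<open>By the Cauchy-Schwarz inequality, \<open>N y * h y u u - (\<alpha> y u)\<^sup>2\<close> has a minimum at \<open>y = x\<close> if \<open>u = Z x\<close>.
  This gives the derivative of \<open>N\<close> without differentiating \<open>Z\<close>.\<close>

lemma has_derivative_N:
  assumes x: "x \<in> \<Omega>"
  shows "(N has_derivative (\<lambda>z. (n + 1) * (N x - 2 * \<mu> x) * \<alpha> x z)) (at x)"
proof -
  have N: "N x > 0" by (rule Z_props(1)[OF x])
  define dN where "dN = frechet_derivative N (at x)"
  have dN: "(N has_derivative dN) (at x)"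
    unfolding dN_def by (rule smooth_on_has_derivative[OF smooth_N x])
  let ?u = "Z x"
  let ?G = "\<lambda>y. N y * h y ?u ?u - \<alpha> y ?u * \<alpha> y ?u"
  have hZZ: "h x (Z x) (Z x) = N x" by (simp add: N_def)
  have G: "(?G has_derivative (\<lambda>z. (N x * T x ?u ?u z + dN z * h x ?u ?u)
      - (\<alpha> x ?u * A x ?u z + A x ?u z * \<alpha> x ?u))) (at x)"
    by (intro has_derivative_diff has_derivative_mult dN has_derivative_h[OF x] has_derivative_\<alpha>'[OF x])
  have "(\<lambda>z. (N x * T x ?u ?u z + dN z * h x ?u ?u) - (\<alpha> x ?u * A x ?u z + A x ?u z * \<alpha> x ?u)) = (\<lambda>v. 0)"
  proof (rule differential_zero_maxmin[OF x open_dom G], rule disjI2, rule ballI)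
    fix y assume y: "y \<in> \<Omega>"
    have "\<alpha> y ?u * \<alpha> y ?u \<le> N y * h y ?u ?u"
      unfolding \<alpha>_def N_def by (rule posdef_form.cauchy_schwarz[OF pos[OF y]])
    then show "?G x \<le> ?G y" by (simp add: \<alpha>_Z hZZ)
  qed
  from fun_cong[OF this]
  have eq: "N x * T x ?u ?u z + dN z * N x - 2 * N x * A x ?u z = 0" for z
    unfolding hZZ \<alpha>_Z by (simp add: algebra_simps)
  have "dN z = (n + 1) * (N x - 2 * \<mu> x) * \<alpha> x z" for z
  proof -
    have "N x * dN z = N x * (2 * A x ?u z - T x ?u ?u z)"
      using eq[of z] by (simp add: algebra_simps)
    then have "dN z = 2 * A x ?u z - T x ?u ?u z" using N by simp
    also have "A x ?u z = (N x - (n + 1) * \<mu> x) * \<alpha> x z"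
      unfolding A_eq[OF x] \<alpha>_Z unfolding \<alpha>_def[symmetric] using N by (simp add: field_simps)
    also have "T x ?u ?u z = (1 - n) * N x * \<alpha> x z"
      unfolding Z_props(2)[OF x] \<alpha>_Z hZZ unfolding \<alpha>_def[symmetric] using N by (simp add: field_simps)
    finally show ?thesis by (simp add: algebra_simps)
  qed
  then have "dN = (\<lambda>z. (n + 1) * (N x - 2 * \<mu> x) * \<alpha> x z)" by (rule ext)
  then show ?thesis using dN by (simp only:)
qed

text \<open>Second derivatives of \<open>\<alpha>\<close> commute. Two distinct frame vectors
  orthogonal to \<open>Z\<close> show that \<open>\<mu>\<close> is stationary in these directions;
  one such vector together with \<open>Z\<close> gives the derivative along
  \<open>Z\<close>.\<close>

lemma has_derivative_\<mu>:
  assumes x: "x \<in> \<Omega>"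
  shows "(\<mu> has_derivative (\<lambda>z. \<mu> x * (1 - (n + 2) * \<mu> x / N x) * \<alpha> x z)) (at x)"
proof -
  interpret P: posdef_form "h x" by (rule pos[OF x])
  have N: "N x > 0" by (rule Z_props(1)[OF x])
  define d\<mu> where "d\<mu> = frechet_derivative \<mu> (at x)"
  have d\<mu>: "(\<mu> has_derivative d\<mu>) (at x)"
    unfolding d\<mu>_def by (rule smooth_on_has_derivative[OF smooth_\<mu> x])
  define c where "c y = 1 - (n + 2) * \<mu> y / N y" for y
  have "smooth_on \<Omega> c"
    unfolding c_def[abs_def]
    by (intro smooth_on_diff smooth_on_divide smooth_on_mult smooth_on_const smooth_\<mu> smooth_N open_dom)
       (use Z_props(1) in force)
  \<comment> \<open>An unspecified derivative of \<open>c\<close> suffices: \<open>dc\<close> occurs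
    with the factor \<open>\<alpha> x u\<close>, and \<open>u\<close> is orthogonal to
    \<open>Z\<close> in both tests.\<close>
  from smooth_on_has_derivative[OF this x]
  obtain dc where dc: "(c has_derivative dc) (at x)" by blast
  let ?dA = "\<lambda>u z w. (\<mu> x * T x u z w + d\<mu> w * h x u z)
    + (c x * \<alpha> x u * A x z w + (c x * A x u w + dc w * \<alpha> x u) * \<alpha> x z)"
  have dA: "((\<lambda>y. A y u z) has_derivative ?dA u z) (at x)" for u z
  proof (rule has_derivative_transform_within_open[OF _ open_dom x])
    show "((\<lambda>y. \<mu> y * h y u z + c y * \<alpha> y u * \<alpha> y z) has_derivative ?dA u z) (at x)"
      by (intro has_derivative_add has_derivative_mult d\<mu> dc has_derivative_h[OF x] has_derivative_\<alpha>'[OF x])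
    show "\<mu> y * h y u z + c y * \<alpha> y u * \<alpha> y z = A y u z" if "y \<in> \<Omega>" for y
      unfolding c_def A_eq[OF that] ..
  qed
  have symm: "?dA u z w = ?dA u w z" for u z w
  proof -
    have "frechet_derivative (\<lambda>y. A y u z) (at x) w = frechet_derivative (\<lambda>y. A y u w) (at x) z"
      unfolding A_def by (rule second_derivative_symmetric[OF open_dom smooth_\<alpha> x])
    then show ?thesis unfolding frechet_derivative_at[OF dA, symmetric] .
  qed
  obtain E i0 where E: "orthonormal_frame (h x) E" and ZE: "Z x = sqrt (N x) *\<^sub>R E i0"
    and aE: "\<And>i. i \<noteq> i0 \<Longrightarrow> \<alpha> x (E i) = 0"
    by (rule adapted_frame[OF x]) blast
  interpret F: orthonormal_frame "h x" E by (rule E)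
  have hE: "h x (E i) (E j) = (if i = j then 1 else 0)" for i j
    by (rule F.orthonormal)
  have hZ: "h x (Z x) (E i) = 0" "h x (E i) (Z x) = 0" if "i \<noteq> i0" for i
    using that unfolding ZE by (simp_all add: hE)
  have A': "A x u z = \<mu> x * h x u z + c x * \<alpha> x u * \<alpha> x z" for u z
    unfolding c_def by (rule A_eq[OF x])
  note T = Z_props(2)[OF x]
  have q: "d\<mu> (E j) = 0" if j: "j \<noteq> i0" for j
  proof -
    obtain i where "i \<noteq> i0" "i \<noteq> j" using other_index by blast
    then show ?thesis
      using symm[of "E i" "E i" "E j"] j unfolding T A' by (simp add: aE hE)
  qed
  obtain i1 where i1: "i1 \<noteq> i0" using other_index by blast
  have Z: "d\<mu> (Z x) = \<mu> x * c x * N x"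
    using symm[of "E i1" "E i1" "Z x"] i1 unfolding T A' by (simp add: aE hE hZ \<alpha>_Z)
  have lin: "linear d\<mu>" by (rule has_derivative_linear[OF d\<mu>])
  have "d\<mu> z - \<mu> x * c x * \<alpha> x z = 0" for z
  proof (rule F.linear_eq_0[where g="\<lambda>z. d\<mu> z - \<mu> x * c x * \<alpha> x z"])
    show "linear (\<lambda>z. d\<mu> z - \<mu> x * c x * \<alpha> x z)"
      using linear_compose_sub[OF lin linear_compose_scale_right[OF linear_\<alpha>[OF x], of "\<mu> x * c x"]] by simp
    fix i
    show "d\<mu> (E i) - \<mu> x * c x * \<alpha> x (E i) = 0"
    proof (cases "i = i0")
      case True
      have "E i0 = (1 / sqrt (N x)) *\<^sub>R Z x" using N unfolding ZE by simp
      then show ?thesis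
        unfolding True by (simp add: linear_cmul[OF lin] linear_cmul[OF linear_\<alpha>[OF x]] Z \<alpha>_Z)
    next
      case False
      then show ?thesis by (simp add: q aE)
    qed
  qed
  then have "d\<mu> = (\<lambda>z. \<mu> x * c x * \<alpha> x z)" by (intro ext) simp
  then show ?thesis using d\<mu> unfolding c_def by (simp only:)
qed

end

section \<open>Central and parabolic leaves\<close>

definition smooth_coordinates ::
  "'a::euclidean_space set \<Rightarrow> ('a \<Rightarrow> 'b::euclidean_space) \<Rightarrow> 'b set \<Rightarrow> bool" where
  "smooth_coordinates D X S \<longleftrightarrow> open D \<and> smooth_on D X \<and> X ` D \<subseteq> S \<and> open (X ` D) \<and>
     (\<exists>Y. smooth_on (X ` D) Y \<and> (\<forall>d\<in>D. Y (X d) = d))"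

text \<open>The image is open because it is the preimage of \<open>D\<close> under \<open>Y\<close>
  inside \<open>V\<close>.\<close>

lemma smooth_coordinatesI:
  assumes D: "open D" and X: "smooth_on D X" and S: "X ` D \<subseteq> S"
    and V: "open V" "X ` D \<subseteq> V" and Y: "smooth_on V Y" and YX: "\<And>d. d \<in> D \<Longrightarrow> Y (X d) = d"
    and XY: "\<And>x. x \<in> V \<Longrightarrow> Y x \<in> D \<Longrightarrow> X (Y x) = x"
  shows "smooth_coordinates D X S"
proof -
  have "X ` D = V \<inter> Y -` D"
  proof
    show "X ` D \<subseteq> V \<inter> Y -` D" using V(2) YX by auto
    show "V \<inter> Y -` D \<subseteq> X ` D"
    proof
      fix x assume "x \<in> V \<inter> Y -` D"
      then have "x = X (Y x)" "Y x \<in> D" using XY by auto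
      then show "x \<in> X ` D" by (rule image_eqI)
    qed
  qed
  moreover have "open (V \<inter> Y -` D)"
    by (rule continuous_open_preimage[OF smooth_on_continuous[OF Y] V(1) D])
  ultimately have "open (X ` D)" by (simp only:)
  then show ?thesis
    unfolding smooth_coordinates_def
    using D X S YX smooth_on_subset[OF Y V(2)] by blast
qed

lemma open_product_box:
  fixes S :: "(real \<times> 'a::euclidean_space) set"
  assumes S: "open S" "(a, b) \<in> S"
  obtains d where "d > 0" "{a - d<..<a + d} \<times> ball b d \<subseteq> S"
proof -
  obtain A B where AB: "open A" "open B" "a \<in> A" "b \<in> B" "A \<times> B \<subseteq> S"
    by (rule open_prod_elim[OF S]) blast
  obtain d1 where d1: "d1 > 0" "ball a d1 \<subseteq> A" by (rule openE[OF AB(1,3)])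
  obtain d2 where d2: "d2 > 0" "ball b d2 \<subseteq> B" by (rule openE[OF AB(2,4)])
  show ?thesis
  proof (rule that[of "min d1 d2"])
    show "min d1 d2 > 0" using d1 d2 by simp
    have "{a - min d1 d2<..<a + min d1 d2} \<subseteq> ball a d1" by (auto simp: dist_real_def)
    then have 1: "{a - min d1 d2<..<a + min d1 d2} \<subseteq> A" using d1(2) by (rule subset_trans)
    have "ball b (min d1 d2) \<subseteq> ball b d2" by (rule subset_ball) simp
    then have 2: "ball b (min d1 d2) \<subseteq> B" using d2(2) by (rule subset_trans)
    show "{a - min d1 d2<..<a + min d1 d2} \<times> ball b (min d1 d2) \<subseteq> S"
      by (rule subset_trans[OF Sigma_mono[OF 1 2] AB(5)])
  qed
qed

lemma product_neighbourhood:
  fixes S :: "(real \<times> 'a::euclidean_space) set" and X :: "real \<times> 'a \<Rightarrow> 'b::euclidean_space"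
  assumes S: "open S" "(a, b) \<in> S" and X: "smooth_on S X" and V: "open V" "X (a, b) \<in> V"
  obtains d where "d > 0" "{a - d<..<a + d} \<times> ball b d \<subseteq> S" "X ` ({a - d<..<a + d} \<times> ball b d) \<subseteq> V"
proof -
  have "open (S \<inter> X -` V)"
    by (rule continuous_open_preimage[OF smooth_on_continuous[OF X] S(1) V(1)])
  moreover have "(a, b) \<in> S \<inter> X -` V" using S V by simp
  ultimately obtain d where "d > 0" "{a - d<..<a + d} \<times> ball b d \<subseteq> S \<inter> X -` V"
    by (rule open_product_box)
  then have "d > 0" "{a - d<..<a + d} \<times> ball b d \<subseteq> S" "X ` ({a - d<..<a + d} \<times> ball b d) \<subseteq> V"
    by auto
  then show ?thesis by (rule that)
qed

lemma snoc_add: "snoc (u + u') (b + b') = snoc u b + snoc u' (b' :: real)"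
  by (simp add: vec_eq_iff snoc_def split: option.split)

text \<open>These maps carry vertical lines to vertical lines. The summand \<open>l\<close> restores
  the linear function that is split off from \<open>\<phi>\<close> when a leaf is brought to normal
  form.\<close>

lemma graph_affine_map:
  fixes M :: "real ^ ('n::finite) \<Rightarrow> real ^ 'n" and l :: "real ^ 'n \<Rightarrow> real"
  assumes M: "linear M" "inj M" and l: "linear l" and a: "a \<noteq> 0"
  shows "linear (\<lambda>w. snoc (M (vec_init w)) (a * w $ None + l (vec_init w)))" (is "linear ?L")
    and "bij (\<lambda>w. snoc (M (vec_init w)) (a * w $ None + l (vec_init w)))"
proof -
  have snoc_scale: "snoc (c *\<^sub>R u) (c * b) = c *\<^sub>R snoc u b" for u :: "real ^ 'n" and b c
    by (simp add: vec_eq_iff snoc_def split: option.split)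
  show lin: "linear ?L"
  proof (rule linearI)
    fix w w' :: "real ^ 'n option"
    show "?L (w + w') = ?L w + ?L w'"
      unfolding snoc_add[symmetric] linear_add[OF linear_vec_init] linear_add[OF M(1)] linear_add[OF l]
      by (simp add: algebra_simps)
  next
    fix c and w :: "real ^ 'n option"
    show "?L (c *\<^sub>R w) = c *\<^sub>R ?L w"
      unfolding snoc_scale[symmetric] linear_cmul[OF linear_vec_init] linear_cmul[OF M(1)] linear_cmul[OF l]
      by (simp add: algebra_simps)
  qed
  have "inj ?L"
  proof (rule injI)
    fix w w' :: "real ^ 'n option" assume eq: "?L w = ?L w'"
    have "M (vec_init w) = M (vec_init w')"
      using arg_cong[OF eq, of vec_init] by simp
    then have 1: "vec_init w = vec_init w'" using M(2) by (simp only: inj_eq)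
    have "a * w $ None + l (vec_init w) = a * w' $ None + l (vec_init w')"
      using arg_cong[OF eq, of "\<lambda>v. v $ None"] by simp
    then have 2: "w $ None = w' $ None" unfolding 1 using a by simp
    have "w = snoc (vec_init w) (w $ None)" by (rule snoc_vec_init[symmetric])
    also have "\<dots> = snoc (vec_init w') (w' $ None)" by (simp only: 1 2)
    also have "\<dots> = w'" by (rule snoc_vec_init)
    finally show "w = w'" .
  qed
  moreover from this have "surj ?L" by (rule linear_injective_imp_surjective[OF lin]) (rule refl)
  ultimately show "bij ?L" by (simp only: bij_def)
qed

lemma norm_vec_square: "(norm (u :: real ^ 'n))\<^sup>2 = (\<Sum>j\<in>UNIV. u $ j * u $ j)"
  unfolding power2_norm_eq_inner by (simp add: inner_vec_def)

lemma smooth_on_norm_square: "open S \<Longrightarrow> smooth_on S g \<Longrightarrow> smooth_on S (\<lambda>x. (norm (g x :: real ^ 'n))\<^sup>2)"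
  unfolding norm_vec_square by (intro smooth_on_sum smooth_on_mult smooth_on_vec_nth)

lemma smooth_on_vec_init: "open S \<Longrightarrow> smooth_on S g \<Longrightarrow> smooth_on S (\<lambda>x. vec_init (g x) :: real ^ 'n)"
  by (rule smooth_on_linear[OF _ linear_vec_init])

text \<open>The first integrals of the leaf equations are all obtained by this rule, each from a
  derivative that cancels identically.\<close>

lemma constant_of_zero_derivative:
  assumes "convex S" "open S" "x \<in> S" "y \<in> S" "\<And>z. z \<in> S \<Longrightarrow> (g has_derivative (\<lambda>_. 0)) (at z)"
  shows "g x = g y"
  by (rule has_derivative_zero_unique[OF assms(1) _ assms(3,4)])
     (rule has_derivative_at_withinI[OF assms(5)])

section \<open>First integrals where mu does not vanish\<close>

text \<open>\<open>E None\<close> points along \<open>Z p\<close>, and the other frame vectors span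
  the kernel of \<open>\<alpha> p\<close>. The unit vector \<open>v0\<close> of this kernel serves
  to read off the scalar factor \<open>\<kappa>\<close>, which becomes 1 at
  \<open>p\<close>.\<close>

locale quadric_leaves = hessian_pde \<Omega> \<phi> n
  for \<Omega> :: "(real ^ ('k::finite) option) set" and \<phi> n +
  fixes p :: "real ^ 'k option" and E :: "'k option \<Rightarrow> real ^ 'k option" and v0 :: "real ^ 'k option"
  assumes convex_dom: "convex \<Omega>" and p: "p \<in> \<Omega>" and \<mu>_nz: "x \<in> \<Omega> \<Longrightarrow> \<mu> x \<noteq> 0"
    and E: "orthonormal_frame (h p) E" and ZE: "Z p = sqrt (N p) *\<^sub>R E None"
    and \<alpha>E: "\<alpha> p (E (Some j)) = 0"
    and v0: "h p v0 v0 = 1" "\<alpha> p v0 = 0"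
    and \<kappa>_pos0: "x \<in> \<Omega> \<Longrightarrow> h x v0 v0 - \<alpha> x v0 * \<alpha> x v0 / \<mu> x > 0"
begin

text \<open>It turns out that \<open>k x = \<kappa> x *\<^sub>R B\<close> and that \<open>\<theta>\<close> is an affine function of the point with derivative
  \<open>B\<close>; this makes \<open>\<kappa>\<close> a function of a quadratic polynomial with Hessian \<open>B\<close>.\<close>

definition "k x u v = h x u v - \<alpha> x u * \<alpha> x v / \<mu> x"
definition "\<kappa> x = k x v0 v0"
definition "B u v = k p u v"
definition "\<theta> x u = \<alpha> x u / (\<mu> x * \<kappa> x)"

lemma \<kappa>_pos: "x \<in> \<Omega> \<Longrightarrow> \<kappa> x > 0"
  unfolding \<kappa>_def k_def by (rule \<kappa>_pos0)

lemma \<kappa>_p: "\<kappa> p = 1"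
  by (simp add: \<kappa>_def k_def v0)

lemma N_pos: "x \<in> \<Omega> \<Longrightarrow> N x > 0"
  by (rule Z_props(1))

text \<open>The correction by \<open>\<alpha> \<otimes> \<alpha> / \<mu>\<close> cancels every term
  of the third derivative in which \<open>z\<close> is paired with \<open>u\<close> or
  \<open>v\<close>. So \<open>k\<close> changes only by a scalar factor, and \<open>k_eq\<close>
  integrates this.\<close>

lemma has_derivative_k:
  assumes x: "x \<in> \<Omega>"
  shows "((\<lambda>y. k y u v) has_derivative (\<lambda>z. \<alpha> x z * k x u v)) (at x)"
proof -
  have m: "\<mu> x \<noteq> 0" by (rule \<mu>_nz[OF x])
  have "((\<lambda>y. k y u v) has_derivative (\<lambda>z. T x u v z -
     ((\<alpha> x u * A x v z + A x u z * \<alpha> x v) * \<mu> x - (\<alpha> x u * \<alpha> x v) * (\<mu> x * (1 - (n + 2) * \<mu> x / N x) * \<alpha> x z))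
       / (\<mu> x * \<mu> x))) (at x)"
    unfolding k_def
    by (rule has_derivative_diff[OF has_derivative_h[OF x]
        has_derivative_divide'[OF has_derivative_mult[OF has_derivative_\<alpha>'[OF x] has_derivative_\<alpha>'[OF x]] has_derivative_\<mu>[OF x] m]])
  moreover have "T x u v z -
     ((\<alpha> x u * A x v z + A x u z * \<alpha> x v) * \<mu> x - (\<alpha> x u * \<alpha> x v) * (\<mu> x * (1 - (n + 2) * \<mu> x / N x) * \<alpha> x z))
       / (\<mu> x * \<mu> x) = \<alpha> x z * k x u v" for z
    unfolding A_eq[OF x] Z_props(2)[OF x] k_def using m N_pos[OF x] by (simp add: field_simps)
  ultimately show ?thesis by (simp only:)
qed

lemma has_derivative_\<kappa>: "x \<in> \<Omega> \<Longrightarrow> (\<kappa> has_derivative (\<lambda>z. \<alpha> x z * \<kappa> x)) (at x)"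
  using has_derivative_k[of x v0 v0] unfolding \<kappa>_def[abs_def] .

lemma k_eq:
  assumes x: "x \<in> \<Omega>" shows "k x u v = \<kappa> x * B u v"
proof -
  have "k x u v / \<kappa> x = k p u v / \<kappa> p"
  proof (rule constant_of_zero_derivative[OF convex_dom open_dom x p])
    fix z assume z: "z \<in> \<Omega>"
    have nz: "\<kappa> z \<noteq> 0" using \<kappa>_pos[OF z] by simp
    have "((\<lambda>y. k y u v / \<kappa> y) has_derivative
       (\<lambda>w. ((\<alpha> z w * k z u v) * \<kappa> z - k z u v * (\<alpha> z w * \<kappa> z)) / (\<kappa> z * \<kappa> z))) (at z)"
      by (rule has_derivative_divide'[OF has_derivative_k[OF z] has_derivative_\<kappa>[OF z] nz])
    then show "((\<lambda>y. k y u v / \<kappa> y) has_derivative (\<lambda>_. 0)) (at z)"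
      by (simp add: mult.commute mult.left_commute)
  qed
  then show ?thesis using \<kappa>_pos[OF x] by (simp add: \<kappa>_p B_def field_simps)
qed

text \<open>Differentiating the factor \<open>\<mu> x * \<kappa> x\<close> changes the
  \<open>\<alpha> \<otimes> \<alpha>\<close> part of \<open>A\<close> to that of \<open>k\<close>,
  and \<open>k / \<kappa>\<close> is the constant form \<open>B\<close>. Hence
  \<open>\<theta>\<close> is affine in the point.\<close>

lemma has_derivative_\<theta>:
  assumes x: "x \<in> \<Omega>"
  shows "((\<lambda>y. \<theta> y u) has_derivative (\<lambda>z. B u z)) (at x)"
proof -
  have m: "\<mu> x \<noteq> 0" "\<kappa> x \<noteq> 0" "N x \<noteq> 0" using \<mu>_nz[OF x] \<kappa>_pos[OF x] N_pos[OF x] by simp_all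
  then have mk: "\<mu> x * \<kappa> x \<noteq> 0" by simp
  have "((\<lambda>y. \<theta> y u) has_derivative (\<lambda>z. (A x u z * (\<mu> x * \<kappa> x) - \<alpha> x u *
      (\<mu> x * (\<alpha> x z * \<kappa> x) + (\<mu> x * (1 - (n + 2) * \<mu> x / N x) * \<alpha> x z) * \<kappa> x)) / ((\<mu> x * \<kappa> x) * (\<mu> x * \<kappa> x)))) (at x)"
    unfolding \<theta>_def
    by (rule has_derivative_divide'[OF has_derivative_\<alpha>'[OF x] has_derivative_mult[OF has_derivative_\<mu>[OF x] has_derivative_\<kappa>[OF x]] mk])
  moreover have "(A x u z * (\<mu> x * \<kappa> x) - \<alpha> x u *
      (\<mu> x * (\<alpha> x z * \<kappa> x) + (\<mu> x * (1 - (n + 2) * \<mu> x / N x) * \<alpha> x z) * \<kappa> x)) / ((\<mu> x * \<kappa> x) * (\<mu> x * \<kappa> x)) = B u z" for z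
  proof -
    have Bz: "B u z = k x u z / \<kappa> x" using k_eq[OF x, of u z] m by simp
    show ?thesis unfolding Bz A_eq[OF x] k_def using m by (simp add: field_simps)
  qed
  ultimately show ?thesis by (simp only:)
qed

lemma linear_B: "linear (B u)" "linear (\<lambda>u. B u v)"
proof -
  interpret P: posdef_form "h p" by (rule pos[OF p])
  show "linear (B u)"
    unfolding B_def k_def
    by (rule linearI) (simp_all add: linear_add[OF linear_\<alpha>[OF p]] linear_cmul[OF linear_\<alpha>[OF p]]
        add_divide_distrib algebra_simps)
  show "linear (\<lambda>u. B u v)"
    unfolding B_def k_def
    by (rule linearI) (simp_all add: linear_add[OF linear_\<alpha>[OF p]] linear_cmul[OF linear_\<alpha>[OF p]]
        add_divide_distrib algebra_simps)
qed

lemma B_sym: "B u v = B v u"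
  using posdef_form.sym[OF pos[OF p], of u v] by (simp add: B_def k_def mult.commute)

lemma \<theta>_eq:
  assumes x: "x \<in> \<Omega>" shows "\<theta> x u = \<theta> p u + B u (x - p)"
proof -
  have "\<theta> x u - B u x = \<theta> p u - B u p"
  proof (rule constant_of_zero_derivative[OF convex_dom open_dom x p])
    fix z assume z: "z \<in> \<Omega>"
    have "((\<lambda>y. B u y) has_derivative (\<lambda>z. B u z)) (at z)"
      by (rule has_derivative_linear_comp[OF linear_B(1) has_derivative_ident])
    from has_derivative_diff[OF has_derivative_\<theta>[OF z, of u] this]
    show "((\<lambda>y. \<theta> y u - B u y) has_derivative (\<lambda>_. 0)) (at z)" by simp
  qed
  then show ?thesis by (simp add: linear_diff[OF linear_B(1)])
qed

text \<open>The derivative of \<open>\<alpha> / \<mu>\<close> is \<open>h\<close>, so the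
  differential of \<open>\<phi>\<close> differs from it by a constant covector, namely
  \<open>l\<close>.\<close>

definition "l u = frechet_derivative \<phi> (at p) u - \<alpha> p u / \<mu> p"
definition "f x = \<phi> x - l x"

lemma linear_l: "linear l"
proof -
  have "linear (frechet_derivative \<phi> (at p))" by (rule linear_frechet_derivative[OF smooth p])
  then show ?thesis
    unfolding l_def[abs_def]
    by (intro linearI) (simp_all add: linear_add linear_cmul linear_add[OF linear_\<alpha>[OF p]] linear_cmul[OF linear_\<alpha>[OF p]]
        add_divide_distrib algebra_simps)
qed

text \<open>Without \<open>l\<close>, the differential of \<open>\<phi>\<close> is
  \<open>\<alpha> / \<mu>\<close>, a multiple of \<open>\<theta>\<close>. Therefore \<open>f\<close>
  is locally constant on the level sets of a quadratic polynomial with differential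
  \<open>\<theta>\<close>.\<close>

lemma has_derivative_f:
  assumes x: "x \<in> \<Omega>"
  shows "(f has_derivative (\<lambda>u. \<kappa> x * \<theta> x u)) (at x)"
proof -
  have "frechet_derivative \<phi> (at x) u - \<alpha> x u / \<mu> x = frechet_derivative \<phi> (at p) u - \<alpha> p u / \<mu> p" for u
  proof (rule constant_of_zero_derivative[OF convex_dom open_dom x p])
    fix z assume z: "z \<in> \<Omega>"
    have m: "\<mu> z \<noteq> 0" "N z \<noteq> 0" using \<mu>_nz[OF z] N_pos[OF z] by simp_all
    have "((\<lambda>y. frechet_derivative \<phi> (at y) u - \<alpha> y u / \<mu> y) has_derivative
       (\<lambda>w. h z w u - (A z u w * \<mu> z - \<alpha> z u * (\<mu> z * (1 - (n + 2) * \<mu> z / N z) * \<alpha> z w)) / (\<mu> z * \<mu> z))) (at z)"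
      by (rule has_derivative_diff[OF has_derivative_d1[OF open_dom smooth z]
          has_derivative_divide'[OF has_derivative_\<alpha>'[OF z] has_derivative_\<mu>[OF z] m(1)]])
    moreover have "h z w u - (A z u w * \<mu> z - \<alpha> z u * (\<mu> z * (1 - (n + 2) * \<mu> z / N z) * \<alpha> z w)) / (\<mu> z * \<mu> z) = 0" for w
      unfolding A_eq[OF z] using m d2_sym[OF open_dom smooth z, of w u] by (simp add: field_simps)
    ultimately show "((\<lambda>y. frechet_derivative \<phi> (at y) u - \<alpha> y u / \<mu> y) has_derivative (\<lambda>_. 0)) (at z)"
      by (simp only:)
  qed
  then have d: "frechet_derivative \<phi> (at x) u - l u = \<kappa> x * \<theta> x u" for u
    using \<kappa>_pos[OF x] unfolding l_def \<theta>_def by (simp add: algebra_simps)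
  have "(l has_derivative l) (at x)"
    by (rule has_derivative_linear_comp[OF linear_l has_derivative_ident])
  from has_derivative_diff[OF smooth_on_has_derivative[OF smooth x] this]
  show ?thesis unfolding f_def[abs_def] d .
qed

lemma smooth_f: "smooth_on \<Omega> f"
  unfolding f_def[abs_def]
  by (intro smooth_on_diff smooth smooth_on_linear[OF open_dom linear_l] smooth_on_id open_dom)

lemma smooth_\<kappa>: "smooth_on \<Omega> \<kappa>"
  unfolding \<kappa>_def[abs_def] k_def
  by (intro smooth_on_diff smooth_on_divide smooth_\<alpha>_mult smooth_h smooth_\<mu> open_dom \<mu>_nz)

lemma \<alpha>_eq: "x \<in> \<Omega> \<Longrightarrow> \<alpha> x u = \<mu> x * \<kappa> x * \<theta> x u"
  using \<mu>_nz[of x] \<kappa>_pos[of x] by (simp add: \<theta>_def)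

lemma h_eq: "x \<in> \<Omega> \<Longrightarrow> h x u v = \<kappa> x * B u v + \<alpha> x u * \<alpha> x v / \<mu> x"
  using k_eq[of x u v] by (simp add: k_def)

lemma \<alpha>_E_None: "\<alpha> p (E None) = sqrt (N p)"
proof -
  have "h p (E None) (E None) = 1" using orthonormal_frame.orthonormal[OF E, of None None] by simp
  then show ?thesis
    unfolding \<alpha>_def ZE using posdef_form.left_simps(4)[OF pos[OF p]] by simp
qed

lemma B_E: "B (E i) (E j) = (if i = j then if i = None then 1 - N p / \<mu> p else 1 else 0)"
proof -
  have "h p (E i) (E j) = (if i = j then 1 else 0)" by (rule orthonormal_frame.orthonormal[OF E])
  moreover have "sqrt (N p) * sqrt (N p) = N p" using N_pos[OF p] by simp
  ultimately show ?thesis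
    unfolding B_def k_def by (cases i; cases j) (simp_all add: \<alpha>E \<alpha>_E_None)
qed

lemma \<theta>_E: "\<theta> p (E (Some j)) = 0" "\<theta> p (E None) = sqrt (N p) / \<mu> p"
  unfolding \<theta>_def by (simp_all add: \<alpha>E \<alpha>_E_None \<kappa>_p)

end

section \<open>Quadrics as graphs and coordinates of a frame\<close>

lemma model_quadric_iff:
  assumes "\<epsilon> \<in> {1, -1}" "x $ None > 0"
  shows "x \<in> model_quadric \<epsilon> \<longleftrightarrow> (x $ None)\<^sup>2 = 1 - \<epsilon> * (norm (vec_init x))\<^sup>2"
proof -
  have s: "(\<Sum>j\<in>UNIV. (x $ Some j)\<^sup>2) = (norm (vec_init x))\<^sup>2"
    unfolding norm_vec_square by (simp add: vec_init_def power2_eq_square)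
  have "(norm x)\<^sup>2 = (norm (vec_init x))\<^sup>2 + (x $ None)\<^sup>2"
    unfolding norm_vec_square sum_UNIV_option by (simp add: vec_init_def power2_eq_square)
  moreover have "norm x = 1 \<longleftrightarrow> (norm x)\<^sup>2 = 1"
    using power2_eq_1_iff[of "norm x"] norm_ge_zero[of x] by auto
  ultimately show ?thesis
    using assms unfolding model_quadric_def by (auto simp: s)
qed

text \<open>One formula covers the upper half sphere and the hyperboloid sheet;
  \<open>d \<le> 1\<close> keeps the radicand positive. The left inverse \<open>vec_init\<close>
  makes the derivative injective.\<close>

lemma quadric_immersion_graph:
  fixes d :: real
  assumes \<epsilon>: "\<epsilon> \<in> {1, -1}" and d: "d \<le> 1"
  shows "quadric_immersion \<epsilon> (ball (0 :: real ^ 'k::finite) d) (\<lambda>u. snoc u (sqrt (1 - \<epsilon> * (norm u)\<^sup>2)))"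
    (is "quadric_immersion \<epsilon> ?W ?\<psi>")
proof -
  have pos: "1 - \<epsilon> * (norm u)\<^sup>2 > 0" if "u \<in> ?W" for u
  proof -
    have "norm u < 1" using that d by simp
    then have "(norm u)\<^sup>2 < 1" using power_strict_mono[of "norm u" 1 2] by simp
    moreover have "- 1 < (norm u)\<^sup>2" by (rule less_le_trans[of _ 0]) simp_all
    ultimately show ?thesis using \<epsilon> by auto
  qed
  have sm: "smooth_on ?W ?\<psi>"
    by (intro smooth_on_snoc smooth_on_id smooth_on_sqrt smooth_on_diff smooth_on_mult smooth_on_const
        smooth_on_norm_square open_ball pos)
  have inj: "inj (frechet_derivative ?\<psi> (at u))" if u: "u \<in> ?W" for u
  proof -
    have "((\<lambda>u. vec_init (?\<psi> u)) has_derivative (\<lambda>v. vec_init (frechet_derivative ?\<psi> (at u) v))) (at u)"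
      by (rule has_derivative_linear_comp[OF linear_vec_init smooth_on_has_derivative[OF sm u]])
    then have "((\<lambda>u. u) has_derivative (\<lambda>v. vec_init (frechet_derivative ?\<psi> (at u) v))) (at u)"
      by (simp only: vec_init_snoc)
    then have "(\<lambda>v. vec_init (frechet_derivative ?\<psi> (at u) v)) = (\<lambda>v. v)"
      by (rule has_derivative_unique[OF _ has_derivative_ident])
    then have "vec_init (frechet_derivative ?\<psi> (at u) v) = v" for v by (rule fun_cong)
    then show ?thesis by (rule inj_on_inverseI)
  qed
  have "?\<psi> ` ?W = model_quadric \<epsilon> \<inter> {x. x $ None > 0 \<and> vec_init x \<in> ?W}"
  proof
    show "?\<psi> ` ?W \<subseteq> model_quadric \<epsilon> \<inter> {x. x $ None > 0 \<and> vec_init x \<in> ?W}"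
    proof
      fix x assume "x \<in> ?\<psi> ` ?W"
      then obtain u where u: "u \<in> ?W" and x: "x = ?\<psi> u" by (rule imageE)
      have x0: "x $ None > 0" using pos[OF u] by (simp add: x)
      moreover have "(x $ None)\<^sup>2 = 1 - \<epsilon> * (norm (vec_init x))\<^sup>2"
        using pos[OF u] by (simp add: x)
      ultimately show "x \<in> model_quadric \<epsilon> \<inter> {x. x $ None > 0 \<and> vec_init x \<in> ?W}"
        using model_quadric_iff[OF \<epsilon> x0] u by (simp add: x)
    qed
    show "model_quadric \<epsilon> \<inter> {x. x $ None > 0 \<and> vec_init x \<in> ?W} \<subseteq> ?\<psi> ` ?W"
    proof
      fix x assume "x \<in> model_quadric \<epsilon> \<inter> {x. x $ None > 0 \<and> vec_init x \<in> ?W}"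
      then have x: "x \<in> model_quadric \<epsilon>" "x $ None > 0" "vec_init x \<in> ?W" by auto
      then have "(x $ None)\<^sup>2 = 1 - \<epsilon> * (norm (vec_init x))\<^sup>2"
        using model_quadric_iff[OF \<epsilon>] by blast
      then have "sqrt (1 - \<epsilon> * (norm (vec_init x))\<^sup>2) = x $ None"
        using x(2) real_sqrt_unique[of "x $ None"] by simp
      then have "x = ?\<psi> (vec_init x)" by (simp only: snoc_vec_init)
      then show "x \<in> ?\<psi> ` ?W" using x(3) by (rule image_eqI)
    qed
  qed
  moreover have "open {x :: real ^ 'k option. x $ None > 0 \<and> vec_init x \<in> ?W}"
  proof -
    have "continuous_on UNIV (\<lambda>x :: real ^ 'k option. vec_init x :: real ^ 'k)"
      by (rule smooth_on_continuous[OF smooth_on_vec_init[OF open_UNIV smooth_on_id[OF open_UNIV]]])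
    then have "open ((\<lambda>x :: real ^ 'k option. vec_init x) -` ?W)"
      using open_vimage[OF open_ball] by blast
    moreover have "open {x :: real ^ 'k option. x $ None > 0}"
      by (rule open_Collect_less) (auto intro: continuous_intros)
    ultimately have "open ({x :: real ^ 'k option. x $ None > 0} \<inter> (\<lambda>x. vec_init x) -` ?W)"
      by (rule open_Int[rotated])
    moreover have "{x :: real ^ 'k option. x $ None > 0} \<inter> (\<lambda>x. vec_init x) -` ?W =
        {x. x $ None > 0 \<and> vec_init x \<in> ?W}" by blast
    ultimately show ?thesis by (simp only:)
  qed
  ultimately have "openin (top_of_set (model_quadric \<epsilon>)) (?\<psi> ` ?W)"
    unfolding openin_open by blast
  then have "det (mat 1 :: real ^ 'k option ^ 'k option) = 1 \<and>
      openin (top_of_set ((\<lambda>x. mat 1 *v x) ` model_quadric \<epsilon>)) (?\<psi> ` ?W)"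
    by (simp only: matrix_vector_mul_lid image_ident det_I)
  then show ?thesis
    unfolding quadric_immersion_def immersion_on_def using \<epsilon> sm inj by blast
qed

lemma has_real_derivative_line:
  assumes "(G has_derivative D) (at (a + t *\<^sub>R w))"
  shows "((\<lambda>t. G (a + t *\<^sub>R w)) has_real_derivative D w) (at t)"
proof -
  have "((\<lambda>t. a + t *\<^sub>R w) has_derivative (\<lambda>d. d *\<^sub>R w)) (at t)"
    by (auto intro!: derivative_eq_intros)
  from has_derivative_compose[OF this assms]
  have "((\<lambda>t. G (a + t *\<^sub>R w)) has_derivative (\<lambda>d. D (d *\<^sub>R w))) (at t)" .
  moreover have "(\<lambda>d. D (d *\<^sub>R w)) = (*) (D w)"
    by (intro ext) (simp add: linear_cmul[OF has_derivative_linear[OF assms]])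
  ultimately show ?thesis unfolding has_field_derivative_def by (simp only:)
qed

text \<open>Coordinates of a frame whose axis \<open>E None\<close> is rescaled by \<open>c\<close>;
  the choice of \<open>c\<close> will normalise the model at hand.\<close>

definition frame_map :: "('k::finite option \<Rightarrow> real ^ 'k option) \<Rightarrow> real \<Rightarrow> real ^ 'k option \<Rightarrow> real ^ 'k option" where
  "frame_map E c z = (\<Sum>j\<in>UNIV. snoc (vec_init z) (c * z $ None) $ j *\<^sub>R E j)"

lemma frame_map_eq:
  "frame_map E c z = (c * z $ None) *\<^sub>R E None + (\<Sum>j\<in>UNIV. z $ Some j *\<^sub>R E (Some j))"
  unfolding frame_map_def sum_UNIV_option by (simp add: vec_init_def)

lemma linear_frame_map: "linear (frame_map E c)"
  by (rule linearI)
     (simp_all add: frame_map_eq algebra_simps scaleR_add_left sum.distrib scaleR_sum_right)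

lemma inj_frame_map:
  assumes E: "orthonormal_frame h E" and "c \<noteq> 0" shows "inj (frame_map E c)"
proof (rule injI)
  fix z z' assume "frame_map E c z = frame_map E c z'"
  then have eq: "snoc (vec_init z) (c * z $ None) = snoc (vec_init z') (c * z' $ None)"
    using orthonormal_frame.bij_frame[OF E, THEN bij_is_inj] unfolding frame_map_def inj_def by blast
  have 1: "vec_init z = vec_init z'" using arg_cong[OF eq, of vec_init] by simp
  have 2: "z $ None = z' $ None" using arg_cong[OF eq, of "\<lambda>v. v $ None"] assms(2) by simp
  have "z = snoc (vec_init z) (z $ None)" by (rule snoc_vec_init[symmetric])
  also have "\<dots> = snoc (vec_init z') (z' $ None)" by (simp only: 1 2)
  also have "\<dots> = z'" by (rule snoc_vec_init)
  finally show "z = z'" .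
qed

lemma surj_frame_map: "orthonormal_frame h E \<Longrightarrow> c \<noteq> 0 \<Longrightarrow> surj (frame_map E c)"
  by (rule linear_injective_imp_surjective[OF linear_frame_map inj_frame_map]) (simp_all)

section \<open>Parametrization by central quadrics and by paraboloids\<close>

context quadric_leaves
begin

abbreviation "M \<equiv> frame_map E"

lemmas M_eq = frame_map_eq[of E]
lemmas linear_M = linear_frame_map[of E]
lemmas inj_M = inj_frame_map[OF E]
lemmas surj_M = surj_frame_map[OF E]

lemma B_M_E: "B (M c z) (E None) = c * (1 - N p / \<mu> p) * z $ None" "B (M c z) (E (Some j)) = z $ Some j"
proof -
  have s: "B (\<Sum>j\<in>UNIV. z $ Some j *\<^sub>R E (Some j)) v = (\<Sum>j\<in>UNIV. z $ Some j * B (E (Some j)) v)" for v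
    by (simp add: linear_sum[OF linear_B(2)] linear_cmul[OF linear_B(2)])
  have c: "B ((c * z $ None) *\<^sub>R E None) v = (c * z $ None) * B (E None) v" for v
    by (simp add: linear_cmul[OF linear_B(2)])
  show "B (M c z) (E None) = c * (1 - N p / \<mu> p) * z $ None" "B (M c z) (E (Some j)) = z $ Some j"
    unfolding M_eq linear_add[OF linear_B(2)] s c B_E by (simp_all add: if_distrib cong: if_cong)
qed

lemma B_M: "B (M c z) (M c z') = c\<^sup>2 * (1 - N p / \<mu> p) * z $ None * z' $ None + (\<Sum>j\<in>UNIV. z $ Some j * z' $ Some j)"
proof -
  have "B (M c z) (M c z') = (c * z' $ None) * B (M c z) (E None) + (\<Sum>j\<in>UNIV. z' $ Some j * B (M c z) (E (Some j)))"
    unfolding M_eq[of c z'] linear_add[OF linear_B(1)]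
    by (simp add: linear_sum[OF linear_B(1)] linear_cmul[OF linear_B(1)])
  then show ?thesis
    unfolding B_M_E by (simp add: power2_eq_square algebra_simps)
qed

lemma bounded_bilinear_B: "bounded_bilinear B"
  unfolding bilinear_conv_bounded_bilinear[symmetric] bilinear_def using linear_B by blast

text \<open>For \<open>N p \<noteq> \<mu> p\<close> the form \<open>B\<close> is non-degenerate, so
  the affine form \<open>\<theta>\<close> vanishes at one point \<open>x0\<close> and is
  \<open>B\<close> applied to \<open>x - x0\<close>. Hence \<open>f\<close> is constant on the
  quadrics of \<open>B\<close> centred at \<open>x0\<close>. The parameter of the ray from
  \<open>x0\<close> through \<open>p\<close> is taken as first profile function, which is why
  \<open>\<lambda>t. t\<close> occurs, and \<open>\<gamma>\<^sub>2\<close> is \<open>f\<close> along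
  that ray.\<close>

theorem central_leaves:
  assumes ne: "N p \<noteq> \<mu> p"
  shows "\<exists>I W X \<epsilon> \<psi> \<gamma>\<^sub>2 c L b. open I \<and> is_interval I \<and> open W \<and> smooth_coordinates (I \<times> W) X \<Omega> \<and>
    p \<in> X ` (I \<times> W) \<and> linear L \<and> bij L \<and>
    quadric_immersion \<epsilon> (W :: (real ^ 'k) set) \<psi> \<and> smooth_on I (\<lambda>t :: real. t) \<and> smooth_on I \<gamma>\<^sub>2 \<and> c \<noteq> 0 \<and>
    (\<forall>t\<in>I. c * deriv (\<lambda>t. t) t ^ (CARD('k option) + 2) * t ^ (CARD('k option) - 1) =
       deriv \<gamma>\<^sub>2 t ^ (CARD('k option) - 1) *
       (deriv (deriv (\<lambda>t. t)) t * deriv \<gamma>\<^sub>2 t - deriv (deriv \<gamma>\<^sub>2) t * deriv (\<lambda>t. t) t)) \<and>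
    (\<forall>t\<in>I. \<forall>u\<in>W. snoc (X (t, u)) (\<phi> (X (t, u))) = L (snoc (t *\<^sub>R \<psi> u) (\<gamma>\<^sub>2 t)) + b)"
proof -
  \<comment> \<open>\<open>\<beta>\<close> is the value of \<open>B\<close> on
    \<open>E None\<close>, and \<open>\<epsilon>\<close> its sign. \<open>c0\<close> solves
    \<open>c0 * \<beta> = \<theta> p (E None)\<close>, which puts the zero of
    \<open>\<theta>\<close> at \<open>x0\<close>. The factor \<open>cs\<close> rescales the axis so
    that \<open>B\<close> becomes diagonal with entries 1 and \<open>\<epsilon>\<close>, oriented so
    that \<open>p\<close> has the positive parameter \<open>tp\<close>.\<close>
  define \<beta> where "\<beta> = 1 - N p / \<mu> p"
  define c0 where "c0 = sqrt (N p) / (\<mu> p - N p)"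
  define \<epsilon> where "\<epsilon> = sgn \<beta>"
  define cs where "cs = sgn c0 / sqrt \<bar>\<beta>\<bar>"
  define tp where "tp = \<bar>c0\<bar> * sqrt \<bar>\<beta>\<bar>"
  define x0 where "x0 = p - c0 *\<^sub>R E None"
  have m: "\<mu> p \<noteq> 0" by (rule \<mu>_nz[OF p])
  have Np: "N p > 0" by (rule N_pos[OF p])
  have \<beta>: "\<beta> \<noteq> 0" using ne m by (simp add: \<beta>_def)
  have c0: "c0 \<noteq> 0" using ne Np by (simp add: c0_def)
  have c0\<beta>: "c0 * \<beta> = sqrt (N p) / \<mu> p"
    using ne m by (simp add: c0_def \<beta>_def divide_simps)
  have \<epsilon>: "\<epsilon> \<in> {1, -1}" using \<beta> by (auto simp: \<epsilon>_def sgn_if)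
  then have \<epsilon>\<epsilon>: "\<epsilon> * \<epsilon> = 1" by auto
  have sq: "sqrt \<bar>\<beta>\<bar> > 0" using \<beta> by simp
  have cs: "cs \<noteq> 0" using c0 sq by (simp add: cs_def sgn_if)
  have cs\<beta>: "cs\<^sup>2 * \<beta> = \<epsilon>"
  proof -
    have "cs\<^sup>2 = 1 / \<bar>\<beta>\<bar>" using c0 by (simp add: cs_def power_divide sgn_if)
    then show ?thesis using \<beta> by (simp add: \<epsilon>_def sgn_if abs_if)
  qed
  have tp: "tp > 0" using c0 sq by (simp add: tp_def)
  have tpcs: "cs * tp = c0"
    using sq by (simp add: cs_def tp_def sgn_if abs_if)
  have BM: "B (M cs z) (M cs z') = \<epsilon> * z $ None * z' $ None + (\<Sum>j\<in>UNIV. z $ Some j * z' $ Some j)" for z z'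
    using B_M[of cs z z'] cs\<beta> by (simp add: \<beta>_def)
  have \<theta>x: "\<theta> x u = B u (x - x0)" if x: "x \<in> \<Omega>" for x u
  proof -
    have "\<theta> p u - c0 * B u (E None) = 0"
    proof (rule orthonormal_frame.linear_eq_0[OF E, where g="\<lambda>u. \<theta> p u - c0 * B u (E None)"])
      have "linear (\<lambda>u. (1 / \<mu> p) *\<^sub>R \<alpha> p u - c0 *\<^sub>R B u (E None))"
        by (intro linear_compose_sub linear_compose_scale_right linear_\<alpha>[OF p] linear_B(2))
      then show "linear (\<lambda>u. \<theta> p u - c0 * B u (E None))"
        unfolding \<theta>_def \<kappa>_p by simp
      show "\<theta> p (E i) - c0 * B (E i) (E None) = 0" for i
        using c0\<beta> by (cases i) (simp_all add: \<theta>_E B_E \<beta>_def)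
    qed
    moreover have "B u (x - x0) = B u (x - p) + c0 * B u (E None)"
      by (simp add: x0_def linear_add[OF linear_B(1)] linear_diff[OF linear_B(1)] linear_cmul[OF linear_B(1)])
    ultimately show ?thesis using \<theta>_eq[OF x, of u] by simp
  qed
  define \<psi> :: "real ^ 'k \<Rightarrow> real ^ 'k option" where "\<psi> u = snoc u (sqrt (1 - \<epsilon> * (norm u)\<^sup>2))" for u
  define X where "X d = x0 + M cs (fst d *\<^sub>R \<psi> (snd d))" for d :: "real \<times> (real ^ 'k)"
  have psi_pos: "1 - \<epsilon> * (norm u)\<^sup>2 > 0" if "u \<in> ball 0 1" for u :: "real ^ 'k"
  proof -
    have "norm u < 1" using that by simp
    then have "(norm u)\<^sup>2 < 1" using power_strict_mono[of "norm u" 1 2] by simp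
    moreover have "- 1 < (norm u)\<^sup>2" by (rule less_le_trans[of _ 0]) simp_all
    ultimately show ?thesis using \<epsilon> by auto
  qed
  let ?D0 = "{0<..} \<times> ball 0 1 :: (real \<times> (real ^ 'k)) set"
  have D0: "open ?D0" by (intro open_Times open_greaterThan open_ball)
  have smX: "smooth_on ?D0 X"
    unfolding X_def[abs_def] \<psi>_def
    by (intro smooth_on_add smooth_on_const smooth_on_linear[OF D0 linear_M] smooth_on_scaleR smooth_on_snoc
        smooth_on_sqrt smooth_on_diff smooth_on_mult smooth_on_norm_square smooth_on_fst smooth_on_snd D0)
       (use psi_pos in auto)
  have psi0: "\<psi> 0 = snoc 0 1" by (simp add: \<psi>_def)
  have Xp: "X (tp, 0) = p"
  proof -
    have "M cs (tp *\<^sub>R snoc 0 1) = (cs * tp) *\<^sub>R E None"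
      by (simp add: M_eq)
    then show ?thesis unfolding X_def fst_conv snd_conv psi0 tpcs by (simp add: x0_def)
  qed
  have "(tp, 0) \<in> ?D0" using tp by simp
  moreover have "X (tp, 0) \<in> \<Omega>" unfolding Xp by (rule p)
  ultimately obtain d where d: "d > 0" "{tp - d<..<tp + d} \<times> ball 0 d \<subseteq> ?D0"
      "X ` ({tp - d<..<tp + d} \<times> ball 0 d) \<subseteq> \<Omega>"
    using product_neighbourhood[OF D0 _ smX open_dom] by blast
  define I where "I = {tp - d<..<tp + d}"
  define W where "W = ball (0 :: real ^ 'k) d"
  have IW: "I \<times> W \<subseteq> ?D0" "X ` (I \<times> W) \<subseteq> \<Omega>" using d by (simp_all add: I_def W_def)
  have I: "open I" "is_interval I" "convex I" and W: "open W" "convex W"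
    by (simp_all add: I_def W_def is_interval_oo convex_real_interval)
  have tpI: "tp \<in> I" and W0: "0 \<in> W" using d by (simp_all add: I_def W_def)
  have I_pos: "t > 0" if "t \<in> I" for t using IW(1) W0 that by auto
  have W1: "u \<in> ball 0 1" if "u \<in> W" for u using IW(1) tpI that by auto
  have d1: "d \<le> 1"
  proof (rule ccontr)
    assume "\<not> d \<le> 1"
    obtain j :: 'k where True by blast
    have "axis j 1 \<in> W" using \<open>\<not> d \<le> 1\<close> by (simp add: W_def)
    from W1[OF this] show False by simp
  qed
  have XD: "X (t, u) = x0 + M cs (t *\<^sub>R \<psi> u)" for t u by (simp add: X_def)
  have X\<Omega>: "X (t, u) \<in> \<Omega>" if "t \<in> I" "u \<in> W" for t u using IW(2) that by blast
  have nrm: "\<epsilon> * (norm (vec_init (t *\<^sub>R \<psi> u)))\<^sup>2 + ((t *\<^sub>R \<psi> u) $ None)\<^sup>2 = t\<^sup>2" if "u \<in> W" for t u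
  proof -
    have "vec_init (t *\<^sub>R \<psi> u) = t *\<^sub>R u" by (simp add: \<psi>_def vec_init_def vec_eq_iff)
    moreover have "((t *\<^sub>R \<psi> u) $ None)\<^sup>2 = t\<^sup>2 * (1 - \<epsilon> * (norm u)\<^sup>2)"
      using psi_pos[OF W1[OF that]] by (simp add: \<psi>_def power_mult_distrib)
    ultimately show ?thesis by (simp add: power_mult_distrib algebra_simps)
  qed
  define zz where "zz x = inv (M cs) (x - x0)" for x
  have zzX: "zz (x0 + M cs z) = z" for z unfolding zz_def using inv_f_f[OF inj_M[OF cs]] by simp
  have Mzz: "x0 + M cs (zz x) = x" for x unfolding zz_def using surj_f_inv_f[OF surj_M[OF cs]] by simp
  have lininv: "linear (inv (M cs))"
    using inj_linear_imp_inv_bounded_linear[OF linear_M[unfolded linear_conv_bounded_linear] inj_M[OF cs]]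
    unfolding linear_conv_bounded_linear .
  have smzz: "smooth_on S zz" if "open S" for S
    unfolding zz_def[abs_def] by (intro smooth_on_linear[OF that lininv] smooth_on_diff smooth_on_id smooth_on_const that)
  \<comment> \<open>Up to the sign \<open>\<epsilon>\<close> this is the quadratic form of
    \<open>B\<close> on \<open>x - x0\<close>. It equals \<open>t\<^sup>2\<close> on the
    parametrized part and so provides the inverse coordinates.\<close>
  define r where "r x = \<epsilon> * (norm (vec_init (zz x)))\<^sup>2 + (zz x $ None)\<^sup>2" for x
  have smr: "smooth_on S r" if "open S" for S
    unfolding r_def[abs_def]
    by (intro smooth_on_add smooth_on_mult smooth_on_const smooth_on_norm_square smooth_on_vec_init smooth_on_power
        smooth_on_vec_nth smzz that)
  define Vx where "Vx = {x. r x > 0 \<and> zz x $ None > 0}"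
  have Vx: "open Vx"
  proof -
    have c: "continuous_on UNIV r" "continuous_on UNIV (\<lambda>x. zz x $ None)"
      by (rule smooth_on_continuous[OF smr[OF open_UNIV]],
          rule smooth_on_continuous[OF smooth_on_vec_nth[OF open_UNIV smzz[OF open_UNIV]]])
    have "open {x. 0 < r x}" "open {x. 0 < zz x $ None}"
      by (rule open_Collect_less[OF continuous_on_const c(1)], rule open_Collect_less[OF continuous_on_const c(2)])
    then have "open ({x. 0 < r x} \<inter> {x. 0 < zz x $ None})" by (rule open_Int)
    moreover have "{x. 0 < r x} \<inter> {x. 0 < zz x $ None} = Vx" by (auto simp: Vx_def)
    ultimately show ?thesis by (simp only:)
  qed
  define Y where "Y x = (sqrt (r x), (1 / sqrt (r x)) *\<^sub>R vec_init (zz x))" for x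
  have smY: "smooth_on Vx Y"
  proof -
    have "smooth_on Vx (\<lambda>x. sqrt (r x))" by (rule smooth_on_sqrt[OF Vx smr[OF Vx]]) (simp add: Vx_def)
    then show ?thesis
      unfolding Y_def[abs_def]
      by (intro smooth_on_Pair smooth_on_scaleR smooth_on_divide smooth_on_const smooth_on_vec_init smzz Vx)
         (simp_all add: Vx_def)
  qed
  have rX: "r (X (t, u)) = t\<^sup>2" if "u \<in> W" for t u
    unfolding r_def XD zzX by (rule nrm[OF that])
  have coords: "smooth_coordinates (I \<times> W) X \<Omega>"
  proof (rule smooth_coordinatesI[OF open_Times[OF I(1) W(1)] smooth_on_subset[OF smX IW(1)] IW(2) Vx _ smY])
    show "X ` (I \<times> W) \<subseteq> Vx"
    proof (clarify)
      fix t u assume tu: "t \<in> I" "u \<in> W"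
      have "zz (X (t, u)) $ None > 0"
        unfolding XD zzX using I_pos[OF tu(1)] psi_pos[OF W1[OF tu(2)]] by (simp add: \<psi>_def)
      then show "X (t, u) \<in> Vx"
        using rX[OF tu(2), of t] I_pos[OF tu(1)] by (simp add: Vx_def)
    qed
    show "Y (X dd) = dd" if dd: "dd \<in> I \<times> W" for dd
    proof -
      obtain t u where tu: "dd = (t, u)" "t \<in> I" "u \<in> W" using dd by blast
      have "sqrt (r (X (t, u))) = t" using rX[OF tu(3), of t] I_pos[OF tu(2)] by simp
      moreover have "vec_init (zz (X (t, u))) = t *\<^sub>R u"
        unfolding XD zzX by (simp add: \<psi>_def vec_init_def vec_eq_iff)
      ultimately show ?thesis unfolding Y_def tu(1) using I_pos[OF tu(2)] by simp
    qed
    show "X (Y x) = x" if x: "x \<in> Vx" "Y x \<in> I \<times> W" for x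
    proof -
      let ?t = "sqrt (r x)"
      have r: "r x > 0" "zz x $ None > 0" using x(1) by (simp_all add: Vx_def)
      have t: "?t > 0" using r by simp
      let ?u = "(1 / ?t) *\<^sub>R vec_init (zz x)"
      have "(norm ?u)\<^sup>2 = (norm (vec_init (zz x)))\<^sup>2 / r x"
        using r by (simp add: power_divide)
      then have "1 - \<epsilon> * (norm ?u)\<^sup>2 = (zz x $ None)\<^sup>2 / r x"
        using r by (simp add: r_def field_simps)
      then have "sqrt (1 - \<epsilon> * (norm ?u)\<^sup>2) = zz x $ None / ?t"
        using r by (simp add: real_sqrt_divide)
      then have "?t *\<^sub>R \<psi> ?u = snoc (vec_init (zz x)) (zz x $ None)"
        using t unfolding \<psi>_def by (simp add: vec_eq_iff snoc_def split: option.split)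
      also have "\<dots> = zz x" by (rule snoc_vec_init)
      finally show ?thesis unfolding Y_def XD using Mzz[of x] by simp
    qed
  qed
  define e where "e = M cs (snoc 0 1)"
  have Xt0: "X (t, 0) = x0 + t *\<^sub>R e" for t
    unfolding XD psi0 e_def by (simp add: linear_cmul[OF linear_M])
  have Bee: "B e e = \<epsilon>" unfolding e_def BM by simp
  define \<gamma>\<^sub>2 where "\<gamma>\<^sub>2 t = f (x0 + t *\<^sub>R e)" for t
  have line: "x0 + t *\<^sub>R e \<in> \<Omega>" if "t \<in> I" for t
    using X\<Omega>[OF that W0] unfolding Xt0 .
  \<comment> \<open>For fixed \<open>t\<close> the point moves on a quadric of \<open>B\<close>; its
    velocity is \<open>B\<close>-orthogonal to \<open>x - x0\<close>, so the differential of
    \<open>f\<close>, a multiple of \<open>\<theta>\<close>, vanishes on it.\<close>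
  have fX: "f (X (t, u)) = \<gamma>\<^sub>2 t" if t: "t \<in> I" and u: "u \<in> W" for t u
  proof -
    have "f (X (t, u)) = f (X (t, 0))"
    proof (rule constant_of_zero_derivative[OF W(2,1) u W0, where g="\<lambda>u. f (X (t, u))"])
      fix w assume w: "w \<in> W"
      have "smooth_on W (\<lambda>u. X (t, u))"
        by (rule smooth_on_compose[OF W(1) D0 smX smooth_on_Pair[OF W(1) smooth_on_const[OF W(1)] smooth_on_id[OF W(1)]]])
           (use IW(1) t in blast)
      from smooth_on_has_derivative[OF this w]
      obtain X' where X': "((\<lambda>u. X (t, u)) has_derivative X') (at w)" by blast
      let ?a = "\<lambda>u. X (t, u) - x0"
      have a: "(?a has_derivative X') (at w)"
        using has_derivative_diff[OF X' has_derivative_const[of x0]] by simp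
      have "((\<lambda>u. B (?a u) (?a u)) has_derivative (\<lambda>v. B (?a w) (X' v) + B (X' v) (?a w))) (at w)"
        by (rule bounded_bilinear.FDERIV[OF bounded_bilinear_B a a])
      moreover have "((\<lambda>u. B (?a u) (?a u)) has_derivative (\<lambda>_. 0)) (at w)"
      proof (rule has_derivative_transform_within_open[OF has_derivative_const W(1) w])
        fix u assume "u \<in> W"
        have "B (?a u) (?a u) = \<epsilon> * (((t *\<^sub>R \<psi> u) $ None)\<^sup>2 + \<epsilon> * (norm (vec_init (t *\<^sub>R \<psi> u)))\<^sup>2)"
        proof -
          have nv: "(norm (vec_init z))\<^sup>2 = (\<Sum>j\<in>UNIV. z $ Some j * z $ Some j)" for z :: "real ^ 'k option"
            unfolding norm_vec_square by (simp add: vec_init_def)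
          have gen: "\<epsilon> * x * x + s = \<epsilon> * (x\<^sup>2 + \<epsilon> * s)" for x s
            using \<epsilon>\<epsilon> by (simp add: power2_eq_square distrib_left mult.assoc[symmetric])
          show ?thesis unfolding XD add_diff_cancel_left' BM nv by (rule gen)
        qed
        then show "\<epsilon> * t\<^sup>2 = B (?a u) (?a u)"
          using nrm[OF \<open>u \<in> W\<close>, of t] by (simp add: add.commute)
      qed
      ultimately have fn: "(\<lambda>v. B (?a w) (X' v) + B (X' v) (?a w)) = (\<lambda>_. 0)"
        by (rule has_derivative_unique)
      have z: "B (X' v) (?a w) = 0" for v
        using fun_cong[OF fn, of v] B_sym[of "?a w" "X' v"] by simp
      have "((\<lambda>u. f (X (t, u))) has_derivative (\<lambda>v. \<kappa> (X (t, w)) * \<theta> (X (t, w)) (X' v))) (at w)"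
        by (rule has_derivative_compose[OF X' has_derivative_f[OF X\<Omega>[OF t w]]])
      then show "((\<lambda>u. f (X (t, u))) has_derivative (\<lambda>_. 0)) (at w)"
        unfolding \<theta>x[OF X\<Omega>[OF t w]] z by simp
    qed
    then show ?thesis unfolding Xt0 \<gamma>\<^sub>2_def .
  qed
  have sm\<gamma>: "smooth_on I \<gamma>\<^sub>2"
    unfolding \<gamma>\<^sub>2_def[abs_def]
    by (rule smooth_on_compose[OF I(1) open_dom smooth_f])
       (intro smooth_on_add smooth_on_const smooth_on_scaleR smooth_on_id I(1), rule line)
  define ka where "ka t = \<kappa> (x0 + t *\<^sub>R e)" for t
  define mu where "mu t = \<mu> (x0 + t *\<^sub>R e)" for t
  define Na where "Na t = N (x0 + t *\<^sub>R e)" for t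
  define al where "al t = \<alpha> (x0 + t *\<^sub>R e) e" for t
  have th: "\<theta> (x0 + t *\<^sub>R e) e = \<epsilon> * t" if "t \<in> I" for t
    using \<theta>x[OF line[OF that], of e] Bee by (simp add: linear_cmul[OF linear_B(1)])
  have al: "al t = mu t * ka t * (\<epsilon> * t)" if "t \<in> I" for t
    unfolding al_def mu_def ka_def \<alpha>_eq[OF line[OF that]] th[OF that] ..
  have dka: "(ka has_real_derivative al t * ka t) (at t)" if "t \<in> I" for t
    unfolding ka_def[abs_def] al_def by (rule has_real_derivative_line[OF has_derivative_\<kappa>[OF line[OF that]]])
  have dmu: "(mu has_real_derivative mu t * (1 - (n + 2) * mu t / Na t) * al t) (at t)" if "t \<in> I" for t
    unfolding mu_def[abs_def] al_def Na_def by (rule has_real_derivative_line[OF has_derivative_\<mu>[OF line[OF that]]])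
  have dg: "(\<gamma>\<^sub>2 has_real_derivative ka t * (\<epsilon> * t)) (at t)" if t: "t \<in> I" for t
    using has_real_derivative_line[OF has_derivative_f[OF line[OF t]]]
    unfolding \<gamma>\<^sub>2_def[abs_def] ka_def th[OF t] .
  \<comment> \<open>On the ray, \<open>s\<close> is the value of \<open>\<alpha>\<close> on
    \<open>x - x0\<close>. Both \<open>B\<close> and \<open>\<alpha> \<otimes> \<alpha>\<close>
    applied to \<open>x - x0\<close> are multiples of \<open>\<alpha>\<close>, so
    \<open>x - x0\<close> is a multiple of \<open>Z\<close>; comparing the values of
    \<open>\<alpha>\<close> gives \<open>rel\<close>.\<close>
  define s where "s t = mu t * ka t * (\<epsilon> * t\<^sup>2)" for t
  have rel: "Na t * (1 + s t) = mu t * s t" if t: "t \<in> I" for t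
  proof -
    let ?x = "x0 + t *\<^sub>R e" and ?y = "t *\<^sub>R e"
    interpret P: posdef_form "h ?x" by (rule pos[OF line[OF t]])
    have ay: "\<alpha> ?x ?y = s t"
      using al[OF t] by (simp add: linear_cmul[OF linear_\<alpha>[OF line[OF t]]] al_def[symmetric] s_def power2_eq_square)
    have m: "mu t \<noteq> 0" unfolding mu_def by (rule \<mu>_nz[OF line[OF t]])
    have "?y = ((1 + s t) / mu t) *\<^sub>R Z ?x"
    proof (rule P.eqI)
      fix u
      have "\<kappa> ?x * B ?y u = \<alpha> ?x u / mu t"
      proof -
        have "\<alpha> ?x u = mu t * (\<kappa> ?x * B ?y u)"
          unfolding \<alpha>_eq[OF line[OF t]] \<theta>x[OF line[OF t]] mu_def using B_sym[of u ?y] by simp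
        then show ?thesis using m by simp
      qed
      then have "h ?x ?y u = \<alpha> ?x u / mu t + s t * \<alpha> ?x u / mu t"
        using h_eq[OF line[OF t], of ?y u] unfolding ay mu_def by simp
      also have "\<dots> = (1 + s t) / mu t * \<alpha> ?x u" by (simp add: add_divide_distrib distrib_right)
      finally show "h ?x ?y u = h ?x (((1 + s t) / mu t) *\<^sub>R Z ?x) u"
        by (simp add: \<alpha>_def)
    qed
    then have "\<alpha> ?x ?y = \<alpha> ?x (((1 + s t) / mu t) *\<^sub>R Z ?x)" by (rule arg_cong)
    then have "s t = (1 + s t) / mu t * Na t"
      unfolding ay by (simp add: linear_cmul[OF linear_\<alpha>[OF line[OF t]]] \<alpha>_Z Na_def)
    then show ?thesis using m by (simp add: field_simps)
  qed
  have s1: "1 + s t \<noteq> 0" if t: "t \<in> I" for t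
  proof
    assume "1 + s t = 0"
    then have "mu t * s t = 0" using rel[OF t] by simp
    moreover have "mu t \<noteq> 0" unfolding mu_def by (rule \<mu>_nz[OF line[OF t]])
    ultimately show False using \<open>1 + s t = 0\<close> by simp
  qed
  let ?m = "CARD('k option)"
  have m1: "?m \<ge> 1" using card by simp
  \<comment> \<open>The first integral behind the profile equation: \<open>\<kappa>\<close> has
    logarithmic derivative \<open>al t\<close> along the ray, and by \<open>rel\<close> the factor
    \<open>1 + s t\<close> has logarithmic derivative \<open>- n * al t\<close>.\<close>
  define C where "C t = ka t ^ ?m * (1 + s t)" for t
  have Cconst: "C t = C tp" if t: "t \<in> I" for t
  proof (rule constant_of_zero_derivative[OF I(3,1) t tpI])
    fix t assume t: "t \<in> I"
    have kp: "ka t > 0" unfolding ka_def by (rule \<kappa>_pos[OF line[OF t]])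
    have Np: "Na t > 0" unfolding Na_def by (rule N_pos[OF line[OF t]])
    have dsq: "((\<lambda>t. \<epsilon> * t\<^sup>2) has_real_derivative \<epsilon> * (2 * t)) (at t)"
      by (auto intro!: derivative_eq_intros)
    have ds: "(s has_real_derivative (mu t * (al t * ka t) + (mu t * (1 - (n + 2) * mu t / Na t) * al t) * ka t) * (\<epsilon> * t\<^sup>2)
        + mu t * ka t * (\<epsilon> * (2 * t))) (at t)"
      unfolding s_def[abs_def]
      by (rule DERIV_cong[OF DERIV_mult[OF DERIV_mult[OF dmu[OF t] dka[OF t]] dsq]]) (simp only: ac_simps)
    have eq: "(mu t * (al t * ka t) + (mu t * (1 - (n + 2) * mu t / Na t) * al t) * ka t) * (\<epsilon> * t\<^sup>2)
        + mu t * ka t * (\<epsilon> * (2 * t)) = al t * (2 + 2 * s t - (n + 2) * (1 + s t))"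
    proof -
      have 1: "mu t * ka t * (\<epsilon> * (2 * t)) = 2 * al t" using al[OF t] by simp
      have 2: "(mu t * (al t * ka t) + (mu t * (1 - (n + 2) * mu t / Na t) * al t) * ka t) * (\<epsilon> * t\<^sup>2)
          = al t * (s t + s t * (1 - (n + 2) * mu t / Na t))"
        unfolding s_def by (simp only: algebra_simps)
      have "mu t * s t / Na t = 1 + s t"
        unfolding rel[OF t, symmetric] using Np by simp
      moreover have "s t * ((n + 2) * mu t / Na t) = (n + 2) * (mu t * s t / Na t)" by simp
      ultimately have 3: "s t * ((n + 2) * mu t / Na t) = (n + 2) * (1 + s t)" by (simp only:)
      have "al t * (s t + s t * (1 - (n + 2) * mu t / Na t)) + 2 * al t =
          al t * (2 + 2 * s t - s t * ((n + 2) * mu t / Na t))"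
        by (simp add: right_diff_distrib distrib_left)
      then show ?thesis unfolding 1 2 3 .
    qed
    have dk: "((\<lambda>t. ka t ^ ?m) has_real_derivative n * al t * ka t ^ ?m) (at t)"
    proof (rule DERIV_cong[OF DERIV_power[OF dka[OF t]]])
      obtain j where j: "?m = Suc j" using m1 by (cases ?m) auto
      show "real ?m * (al t * ka t * ka t ^ (?m - Suc 0)) = n * al t * ka t ^ ?m"
        unfolding n_def j by simp
    qed
    have "(C has_real_derivative (n * al t * ka t ^ ?m) * (1 + s t)
       + (0 + al t * (2 + 2 * s t - (n + 2) * (1 + s t))) * ka t ^ ?m) (at t)"
      unfolding C_def[abs_def] by (rule DERIV_mult[OF dk DERIV_add[OF DERIV_const ds[unfolded eq]]])
    moreover have "(n * al t * ka t ^ ?m) * (1 + s t)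
       + (0 + al t * (2 + 2 * s t - (n + 2) * (1 + s t))) * ka t ^ ?m = 0"
    proof -
      have "(n * a * b) * (1 + d) + (0 + a * (2 + 2 * d - (n + 2) * (1 + d))) * b = 0" for a b d
        by (simp add: algebra_simps)
      then show ?thesis .
    qed
    ultimately have "(C has_real_derivative 0) (at t)" by (simp only:)
    moreover have "(*) (0::real) = (\<lambda>_. 0)" by (intro ext) simp
    ultimately show "(C has_derivative (\<lambda>_. 0)) (at t)" unfolding has_field_derivative_def by (simp only:)
  qed
  \<comment> \<open>As the first profile function is \<open>t\<close>, the equation involves only
    the first two derivatives of \<open>\<gamma>\<^sub>2\<close>, which are
    \<open>\<epsilon> * ka t * t\<close> and \<open>\<epsilon> * ka t * (1 + s t)\<close>. Their
    combination gives this value, the minus sign coming from the second derivative.\<close>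
  define c where "c = - (\<epsilon> ^ ?m * C tp)"
  have c: "c \<noteq> 0"
  proof -
    have "ka tp > 0" unfolding ka_def by (rule \<kappa>_pos[OF line[OF tpI]])
    then show ?thesis using s1[OF tpI] \<epsilon> by (auto simp: c_def C_def)
  qed
  have d1id: "deriv (\<lambda>t::real. t) = (\<lambda>_. 1)" by (rule ext) (rule DERIV_imp_deriv[OF DERIV_ident])
  have d2id: "deriv (deriv (\<lambda>t::real. t)) t = 0" for t
    unfolding d1id by (rule DERIV_imp_deriv[OF DERIV_const])
  have d1g: "deriv \<gamma>\<^sub>2 t = ka t * (\<epsilon> * t)" if "t \<in> I" for t
    by (rule DERIV_imp_deriv[OF dg[OF that]])
  have d2g: "deriv (deriv \<gamma>\<^sub>2) t = \<epsilon> * ka t * (1 + s t)" if t: "t \<in> I" for t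
  proof (rule DERIV_imp_deriv)
    have "((\<lambda>t. ka t * (\<epsilon> * t)) has_real_derivative (al t * ka t) * (\<epsilon> * t) + ka t * \<epsilon>) (at t)"
      by (rule DERIV_cong[OF DERIV_mult[OF dka[OF t] DERIV_cmult_Id]]) (simp only: ac_simps)
    moreover have "(al t * ka t) * (\<epsilon> * t) + ka t * \<epsilon> = \<epsilon> * ka t * (1 + s t)"
      unfolding al[OF t] s_def power2_eq_square by (simp only: algebra_simps)
    ultimately have "((\<lambda>t. ka t * (\<epsilon> * t)) has_real_derivative \<epsilon> * ka t * (1 + s t)) (at t)" by simp
    then show "(deriv \<gamma>\<^sub>2 has_real_derivative \<epsilon> * ka t * (1 + s t)) (at t)"
      by (rule has_field_derivative_transform_within_open[OF _ I(1) t]) (rule d1g[symmetric])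
  qed
  have ode: "c * deriv (\<lambda>t. t) t ^ (?m + 2) * t ^ (?m - 1) =
       deriv \<gamma>\<^sub>2 t ^ (?m - 1) *
       (deriv (deriv (\<lambda>t. t)) t * deriv \<gamma>\<^sub>2 t - deriv (deriv \<gamma>\<^sub>2) t * deriv (\<lambda>t. t) t)" if t: "t \<in> I" for t
  proof -
    obtain j where j: "?m = Suc j" using m1 by (cases ?m) auto
    have ct: "C tp = ka t ^ ?m * (1 + s t)"
      using Cconst[OF t] unfolding C_def[of t] by (rule HOL.sym)
    show ?thesis
      unfolding d2id d1g[OF t] d2g[OF t] unfolding d1id c_def ct j
      by (simp add: power_mult_distrib algebra_simps)
  qed
  let ?L = "\<lambda>w. snoc (M cs (vec_init w)) (1 * w $ None + l (M cs (vec_init w)))"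
  have linlM: "linear (\<lambda>z. l (M cs z))"
    using linear_compose[OF linear_M linear_l] unfolding o_def .
  have L: "linear ?L" "bij ?L"
    by (rule graph_affine_map(1)[OF linear_M inj_M[OF cs] linlM one_neq_zero],
        rule graph_affine_map(2)[OF linear_M inj_M[OF cs] linlM one_neq_zero])
  have final: "snoc (X (t, u)) (\<phi> (X (t, u))) = ?L (snoc (t *\<^sub>R \<psi> u) (\<gamma>\<^sub>2 t)) + snoc x0 (l x0)"
    if "t \<in> I" "u \<in> W" for t u
  proof -
    have "\<phi> (X (t, u)) = \<gamma>\<^sub>2 t + (l x0 + l (M cs (t *\<^sub>R \<psi> u)))"
      using fX[OF that] unfolding f_def XD by (simp add: linear_add[OF linear_l])
    then have "snoc (X (t, u)) (\<phi> (X (t, u))) =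
        snoc (M cs (t *\<^sub>R \<psi> u) + x0) ((1 * \<gamma>\<^sub>2 t + l (M cs (t *\<^sub>R \<psi> u))) + l x0)"
      by (simp add: XD add_ac)
    then show ?thesis unfolding snoc_add vec_init_snoc snoc_nth .
  qed
  have qi: "quadric_immersion \<epsilon> W \<psi>"
    using quadric_immersion_graph[OF \<epsilon> d1] unfolding W_def \<psi>_def[abs_def] .
  have pX: "p \<in> X ` (I \<times> W)"
    by (rule image_eqI[of _ _ "(tp, 0)"]) (simp_all add: Xp tpI W0)
  show ?thesis
    by (rule exI[of _ I], rule exI[of _ W], rule exI[of _ X], rule exI[of _ \<epsilon>], rule exI[of _ \<psi>],
        rule exI[of _ \<gamma>\<^sub>2], rule exI[of _ c], rule exI[of _ ?L], rule exI[of _ "snoc x0 (l x0)"])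
       (intro conjI ballI I W coords pX L qi smooth_on_id sm\<gamma> c ode final)
qed

text \<open>For \<open>N p = \<mu> p\<close> the axis \<open>E None\<close> lies in the radical of
  \<open>B\<close>, and \<open>\<theta>\<close> is a nonzero constant on it. The polynomial
  \<open>q\<close> with differential \<open>\<theta>\<close> is linear in the axis coordinate, so
  its level sets are translates of a paraboloid. With n the dimension, \<open>\<kappa> ^ n\<close>
  is affine in \<open>q\<close> and \<open>\<kappa> ^ (n + 1)\<close> is affine in \<open>f\<close>,
  hence \<open>\<kappa>\<close> is taken as the parameter \<open>t\<close>.\<close>

theorem parabolic_leaves:
  assumes eq: "N p = \<mu> p"
  shows "\<exists>I W X c L b. open I \<and> is_interval I \<and> open W \<and> smooth_coordinates (I \<times> W) X \<Omega> \<and>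
    p \<in> X ` (I \<times> W) \<and> linear L \<and> bij L \<and> c \<noteq> (0::real) \<and>
    (\<forall>t\<in>I. \<forall>u\<in>(W :: (real ^ 'k) set). snoc (X (t, u)) (\<phi> (X (t, u))) =
      L (snoc (snoc u ((norm u)\<^sup>2 / 2 + c * t ^ CARD('k option))) (t ^ (CARD('k option) + 1))) + b)"
proof -
  let ?m = "CARD('k option)"
  have m1: "?m \<ge> 1" using card by simp
  define b0 where "b0 = sqrt (N p) / \<mu> p"
  define M0 where "M0 = \<mu> p"
  have Np: "N p > 0" by (rule N_pos[OF p])
  have b0: "b0 \<noteq> 0" using Np eq by (simp add: b0_def)
  have M0: "M0 > 0" using Np eq by (simp add: M0_def)
  have B0: "B (E None) u = 0" for u
  proof (rule orthonormal_frame.linear_eq_0[OF E linear_B(1)])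
    fix i show "B (E None) (E i) = 0" using eq \<mu>_nz[OF p] by (simp add: B_E)
  qed
  have \<theta>0: "\<theta> x (E None) = b0" if "x \<in> \<Omega>" for x
    using \<theta>_eq[OF that, of "E None"] by (simp add: B0 \<theta>_E b0_def)
  have lin\<theta>: "linear (\<theta> p)"
    using linear_compose_scale_right[OF linear_\<alpha>[OF p], of "1 / (\<mu> p * \<kappa> p)"] unfolding \<theta>_def[abs_def] by simp
  define q where "q x = \<theta> p (x - p) + B (x - p) (x - p) / 2" for x
  have dq: "(q has_derivative \<theta> x) (at x)" if x: "x \<in> \<Omega>" for x
  proof -
    have d: "((\<lambda>x. x - p) has_derivative (\<lambda>v. v)) (at x)"
      using has_derivative_diff[OF has_derivative_ident has_derivative_const[of p]] by simp
    have "((\<lambda>x. B (x - p) (x - p)) has_derivative (\<lambda>v. B (x - p) v + B v (x - p))) (at x)"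
      by (rule bounded_bilinear.FDERIV[OF bounded_bilinear_B d d])
    from has_derivative_add[OF has_derivative_linear_comp[OF lin\<theta> d] has_derivative_mult_left[OF this, of "1/2"]]
    have "(q has_derivative (\<lambda>v. \<theta> p v + (B (x - p) v + B v (x - p)) * (1/2))) (at x)"
      unfolding q_def[abs_def] by simp
    moreover have "\<theta> p v + (B (x - p) v + B v (x - p)) * (1/2) = \<theta> x v" for v
      using \<theta>_eq[OF x, of v] B_sym[of "x - p" v] by simp
    ultimately show ?thesis by (simp only:)
  qed
  \<comment> \<open>The equality at \<open>p\<close> propagates: \<open>h\<close> applied to
    \<open>E None\<close> is a multiple of \<open>\<alpha>\<close>, so \<open>E None\<close> is a
    multiple of \<open>Z x\<close>, and comparing the values of \<open>\<alpha>\<close> gives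
    \<open>\<mu> = N\<close>.\<close>
  have \<mu>N: "\<mu> x = N x" if x: "x \<in> \<Omega>" for x
  proof -
    interpret P: posdef_form "h x" by (rule pos[OF x])
    have m: "\<mu> x \<noteq> 0" "\<kappa> x \<noteq> 0" using \<mu>_nz[OF x] \<kappa>_pos[OF x] by simp_all
    have a: "\<alpha> x (E None) = \<mu> x * \<kappa> x * b0" using \<alpha>_eq[OF x, of "E None"] \<theta>0[OF x] by simp
    have "E None = (\<kappa> x * b0) *\<^sub>R Z x"
    proof (rule P.eqI)
      fix u
      have "h x (E None) u = \<kappa> x * b0 * \<alpha> x u"
        using h_eq[OF x, of "E None" u] m by (simp add: B0 a)
      then show "h x (E None) u = h x ((\<kappa> x * b0) *\<^sub>R Z x) u" by (simp add: \<alpha>_def)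
    qed
    then have "\<alpha> x (E None) = \<alpha> x ((\<kappa> x * b0) *\<^sub>R Z x)" by (rule arg_cong)
    then have "\<mu> x * \<kappa> x * b0 = \<kappa> x * b0 * N x"
      unfolding a linear_cmul[OF linear_\<alpha>[OF x]] \<alpha>_Z by simp
    then show ?thesis using m b0 by simp
  qed
  have d\<mu>: "(\<mu> has_derivative (\<lambda>z. - (n + 1) * \<mu> x * \<alpha> x z)) (at x)" if x: "x \<in> \<Omega>" for x
  proof -
    have "\<mu> x * (1 - (n + 2) * \<mu> x / N x) * \<alpha> x z = - (n + 1) * \<mu> x * \<alpha> x z" for z
    proof -
      have e: "(n + 2) * \<mu> x / N x = n + 2" using \<mu>N[OF x] N_pos[OF x] by simp
      show ?thesis unfolding e by (simp add: algebra_simps)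
    qed
    then show ?thesis using has_derivative_\<mu>[OF x] by (simp only:)
  qed
  have dpow: "((\<lambda>y. \<kappa> y ^ j) has_derivative (\<lambda>z. real j * \<kappa> x ^ j * \<alpha> x z)) (at x)"
    if x: "x \<in> \<Omega>" and j: "j \<ge> 1" for x j
  proof -
    obtain i where i: "j = Suc i" using j by (cases j) auto
    have "real j * (\<alpha> x z * \<kappa> x) * \<kappa> x ^ (j - 1) = real j * \<kappa> x ^ j * \<alpha> x z" for z
      unfolding i by simp
    then show ?thesis using has_derivative_power[OF has_derivative_\<kappa>[OF x], of j] by (simp only:)
  qed
  have nm: "real (?m + 1) = n + 1" "real ?m = n" by (simp_all add: n_def)
  \<comment> \<open>For \<open>\<mu> = N\<close> the logarithmic derivative of \<open>\<mu>\<close>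
    is \<open>- (n + 1) * \<alpha>\<close>, which dictates the exponent.\<close>
  have Mc: "\<kappa> x ^ (?m + 1) * \<mu> x = M0" if x: "x \<in> \<Omega>" for x
  proof -
    have "\<kappa> x ^ (?m + 1) * \<mu> x = \<kappa> p ^ (?m + 1) * \<mu> p"
    proof (rule constant_of_zero_derivative[OF convex_dom open_dom x p])
      fix z assume z: "z \<in> \<Omega>"
      have "((\<lambda>x. \<kappa> x ^ (?m + 1) * \<mu> x) has_derivative
         (\<lambda>w. \<kappa> z ^ (?m + 1) * (- (n + 1) * \<mu> z * \<alpha> z w) + real (?m + 1) * \<kappa> z ^ (?m + 1) * \<alpha> z w * \<mu> z)) (at z)"
        by (rule has_derivative_mult[OF dpow[OF z] d\<mu>[OF z]]) simp
      moreover have "\<kappa> z ^ (?m + 1) * (- (n + 1) * \<mu> z * \<alpha> z w) + real (?m + 1) * \<kappa> z ^ (?m + 1) * \<alpha> z w * \<mu> z = 0" for w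
        unfolding nm by (simp only: mult_minus_left mult_minus_right mult.assoc mult.commute mult.left_commute left_minus)
      ultimately show "((\<lambda>x. \<kappa> x ^ (?m + 1) * \<mu> x) has_derivative (\<lambda>_. 0)) (at z)" by (simp only:)
    qed
    then show ?thesis by (simp add: \<kappa>_p M0_def)
  qed
  have ka: "\<kappa> x ^ (?m + 1) * \<alpha> x w = M0 * (\<kappa> x * \<theta> x w)" if x: "x \<in> \<Omega>" for x w
  proof -
    have "\<kappa> x ^ (?m + 1) * \<alpha> x w = (\<kappa> x ^ (?m + 1) * \<mu> x) * (\<kappa> x * \<theta> x w)"
      unfolding \<alpha>_eq[OF x] by (simp only: mult.assoc)
    then show ?thesis unfolding Mc[OF x] .
  qed
  have ka': "\<kappa> x ^ ?m * \<alpha> x w = M0 * \<theta> x w" if x: "x \<in> \<Omega>" for x w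
  proof -
    have "\<kappa> x * (\<kappa> x ^ ?m * \<alpha> x w) = \<kappa> x * (M0 * \<theta> x w)"
      using ka[OF x, of w] by (simp add: mult.assoc mult.left_commute)
    then show ?thesis using \<kappa>_pos[OF x] by simp
  qed
  have kq: "\<kappa> x ^ ?m = 1 + n * M0 * q x" if x: "x \<in> \<Omega>" for x
  proof -
    have "\<kappa> x ^ ?m - n * M0 * q x = \<kappa> p ^ ?m - n * M0 * q p"
    proof (rule constant_of_zero_derivative[OF convex_dom open_dom x p])
      fix z assume z: "z \<in> \<Omega>"
      have "((\<lambda>x. \<kappa> x ^ ?m - n * M0 * q x) has_derivative
          (\<lambda>w. real ?m * \<kappa> z ^ ?m * \<alpha> z w - n * M0 * \<theta> z w)) (at z)"
        by (rule has_derivative_diff[OF dpow[OF z m1] has_derivative_mult_right[OF dq[OF z]]])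
      moreover have "real ?m * \<kappa> z ^ ?m * \<alpha> z w - n * M0 * \<theta> z w = 0" for w
        using ka'[OF z, of w] unfolding nm by (simp add: mult.assoc)
      ultimately show "((\<lambda>x. \<kappa> x ^ ?m - n * M0 * q x) has_derivative (\<lambda>_. 0)) (at z)" by (simp only:)
    qed
    moreover have "q p = 0" by (simp add: q_def linear_0[OF lin\<theta>] linear_0[OF linear_B(1)])
    ultimately show ?thesis by (simp add: \<kappa>_p)
  qed
  have kf: "\<kappa> x ^ (?m + 1) = 1 + (n + 1) * M0 * (f x - f p)" if x: "x \<in> \<Omega>" for x
  proof -
    have "\<kappa> x ^ (?m + 1) - (n + 1) * M0 * f x = \<kappa> p ^ (?m + 1) - (n + 1) * M0 * f p"
    proof (rule constant_of_zero_derivative[OF convex_dom open_dom x p])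
      fix z assume z: "z \<in> \<Omega>"
      have "((\<lambda>x. \<kappa> x ^ (?m + 1) - (n + 1) * M0 * f x) has_derivative
          (\<lambda>w. real (?m + 1) * \<kappa> z ^ (?m + 1) * \<alpha> z w - (n + 1) * M0 * (\<kappa> z * \<theta> z w))) (at z)"
        by (rule has_derivative_diff[OF dpow[OF z] has_derivative_mult_right[OF has_derivative_f[OF z]]]) simp
      moreover have "real (?m + 1) * \<kappa> z ^ (?m + 1) * \<alpha> z w - (n + 1) * M0 * (\<kappa> z * \<theta> z w) = 0" for w
        unfolding nm mult.assoc[of "n + 1"] ka[OF z] by simp
      ultimately show "((\<lambda>x. \<kappa> x ^ (?m + 1) - (n + 1) * M0 * f x) has_derivative (\<lambda>_. 0)) (at z)" by (simp only:)
    qed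
    then show ?thesis by (simp add: \<kappa>_p right_diff_distrib)
  qed
  have nM: "n * M0 > 0" using n M0 by simp
  have qM: "q (p + M 1 z) = z $ None * b0 + (norm (vec_init z))\<^sup>2 / 2" for z
  proof -
    have "\<theta> p (M 1 z) = z $ None * b0"
      unfolding M_eq linear_add[OF lin\<theta>] linear_cmul[OF lin\<theta>] linear_sum[OF lin\<theta>] \<theta>_E b0_def by simp
    moreover have "B (M 1 z) (M 1 z) = (norm (vec_init z))\<^sup>2"
      unfolding B_M norm_vec_square using eq \<mu>_nz[OF p] by (simp add: vec_init_def)
    ultimately show ?thesis by (simp add: q_def)
  qed
  \<comment> \<open>This solves \<open>kq\<close> with \<open>\<kappa> = t\<close> for the axis
    coordinate, which enters \<open>q\<close> linearly with slope \<open>b0\<close>.\<close>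
  define w where "w t u = ((t ^ ?m - 1) / (n * M0) - (norm u)\<^sup>2 / 2) / b0" for t and u :: "real ^ 'k"
  define X where "X d = p + M 1 (snoc (snd d) (w (fst d) (snd d)))" for d :: "real \<times> (real ^ 'k)"
  have XD: "X (t, u) = p + M 1 (snoc u (w t u))" for t u by (simp add: X_def)
  let ?D0 = "{0<..} \<times> UNIV :: (real \<times> (real ^ 'k)) set"
  have D0: "open ?D0" by (intro open_Times open_greaterThan open_UNIV)
  have smX: "smooth_on ?D0 X"
    unfolding X_def[abs_def] w_def
    by (intro smooth_on_add smooth_on_const smooth_on_linear[OF D0 linear_M] smooth_on_snoc smooth_on_divide
        smooth_on_diff smooth_on_power smooth_on_norm_square smooth_on_fst smooth_on_snd D0)
       (use n M0 b0 in auto)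
  have Xp: "X (1, 0) = p"
    unfolding XD w_def M_eq by simp
  have "(1, 0) \<in> ?D0" by simp
  moreover have "X (1, 0) \<in> \<Omega>" unfolding Xp by (rule p)
  ultimately obtain d where d: "d > 0" "{1 - d<..<1 + d} \<times> ball 0 d \<subseteq> ?D0"
      "X ` ({1 - d<..<1 + d} \<times> ball 0 d) \<subseteq> \<Omega>"
    using product_neighbourhood[OF D0 _ smX open_dom] by blast
  define I where "I = {1 - d<..<1 + d}"
  define W where "W = ball (0 :: real ^ 'k) d"
  have IW: "I \<times> W \<subseteq> ?D0" "X ` (I \<times> W) \<subseteq> \<Omega>" using d by (simp_all add: I_def W_def)
  have I: "open I" "is_interval I" and W: "open W"
    by (simp_all add: I_def W_def is_interval_oo)
  have I1: "1 \<in> I" and W0: "0 \<in> W" using d by (simp_all add: I_def W_def)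
  have I_pos: "t > 0" if "t \<in> I" for t using IW(1) W0 that by auto
  have X\<Omega>: "X (t, u) \<in> \<Omega>" if "t \<in> I" "u \<in> W" for t u using IW(2) that by blast
  have \<kappa>X: "\<kappa> (X (t, u)) = t" if t: "t \<in> I" and u: "u \<in> W" for t u
  proof -
    have "n * M0 * q (X (t, u)) = t ^ ?m - 1"
      unfolding XD qM snoc_nth vec_init_snoc w_def using b0 M0 n by simp
    then have "\<kappa> (X (t, u)) ^ ?m = t ^ ?m" using kq[OF X\<Omega>[OF t u]] by simp
    then show ?thesis
      using power_eq_imp_eq_base[of "\<kappa> (X (t, u))" ?m t] \<kappa>_pos[OF X\<Omega>[OF t u]] I_pos[OF t] m1 by simp
  qed
  have inj1: "inj (M 1)" and surj1: "surj (M 1)" by (simp_all add: inj_M surj_M)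
  define zz where "zz x = inv (M 1) (x - p)" for x
  have zzX: "zz (p + M 1 z) = z" for z unfolding zz_def using inv_f_f[OF inj1] by simp
  have Mzz: "p + M 1 (zz x) = x" for x unfolding zz_def using surj_f_inv_f[OF surj1] by simp
  have lininv: "linear (inv (M 1))"
    using inj_linear_imp_inv_bounded_linear[OF linear_M[unfolded linear_conv_bounded_linear] inj1]
    unfolding linear_conv_bounded_linear .
  define Y where "Y x = (\<kappa> x, vec_init (zz x))" for x
  have smY: "smooth_on \<Omega> Y"
    unfolding Y_def[abs_def] zz_def
    by (intro smooth_on_Pair smooth_\<kappa> smooth_on_vec_init smooth_on_linear[OF open_dom lininv] smooth_on_diff
        smooth_on_id smooth_on_const open_dom)
  have coords: "smooth_coordinates (I \<times> W) X \<Omega>"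
  proof (rule smooth_coordinatesI[OF open_Times[OF I(1) W(1)] smooth_on_subset[OF smX IW(1)] IW(2) open_dom IW(2) smY])
    show "Y (X dd) = dd" if dd: "dd \<in> I \<times> W" for dd
    proof -
      obtain t u where tu: "dd = (t, u)" "t \<in> I" "u \<in> W" using dd by blast
      have "zz (X (t, u)) = snoc u (w t u)" unfolding XD zzX ..
      then show ?thesis unfolding Y_def tu(1) \<kappa>X[OF tu(2,3)] by simp
    qed
    show "X (Y x) = x" if x: "x \<in> \<Omega>" "Y x \<in> I \<times> W" for x
    proof -
      have "q x = zz x $ None * b0 + (norm (vec_init (zz x)))\<^sup>2 / 2"
        using qM[of "zz x"] unfolding Mzz .
      then have "w (\<kappa> x) (vec_init (zz x)) = zz x $ None"
        unfolding w_def kq[OF x(1)] using b0 M0 n by simp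
      then show ?thesis unfolding Y_def XD snoc_vec_init using Mzz[of x] by (simp only: snoc_vec_init)
    qed
  qed
  \<comment> \<open>By \<open>cb\<close> and \<open>c\<close> the coordinate \<open>w\<close>
    becomes \<open>cb\<close> times the model entry, up to a constant that is moved into
    \<open>x1\<close>. The factor \<open>a\<close> is read off from \<open>kf\<close>.\<close>
  define c where "c = - 1 / (n * M0)"
  define a where "a = 1 / ((n + 1) * M0)"
  define cb where "cb = - 1 / b0"
  have c: "c \<noteq> 0" using n M0 by (simp add: c_def)
  have n1: "(n + 1) * M0 \<noteq> 0" using n M0 by simp
  then have a: "a \<noteq> 0" by (simp add: a_def)
  have cb: "cb \<noteq> 0" using b0 by (simp add: cb_def)
  define x1 where "x1 = p - (1 / (n * M0 * b0)) *\<^sub>R E None"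
  let ?L = "\<lambda>v. snoc (M cb (vec_init v)) (a * v $ None + l (M cb (vec_init v)))"
  have linlM: "linear (\<lambda>z. l (M cb z))"
    using linear_compose[OF linear_M linear_l] unfolding o_def .
  have L: "linear ?L" "bij ?L"
    by (rule graph_affine_map(1)[OF linear_M inj_M[OF cb] linlM a], rule graph_affine_map(2)[OF linear_M inj_M[OF cb] linlM a])
  have final: "snoc (X (t, u)) (\<phi> (X (t, u))) =
      ?L (snoc (snoc u ((norm u)\<^sup>2 / 2 + c * t ^ ?m)) (t ^ (?m + 1))) + snoc x1 (l x1 + f p - a)"
    if t: "t \<in> I" and u: "u \<in> W" for t u
  proof -
    let ?s = "(norm u)\<^sup>2 / 2 + c * t ^ ?m"
    have "w t u = cb * ?s - 1 / (n * M0 * b0)"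
      unfolding w_def cb_def c_def using b0 M0 n by (simp add: field_simps)
    then have X: "X (t, u) = x1 + M cb (snoc u ?s)"
      unfolding XD M_eq x1_def by (simp add: scaleR_diff_left)
    have "(n + 1) * M0 * (f (X (t, u)) - f p) = t ^ (?m + 1) - 1"
      using kf[OF X\<Omega>[OF t u]] unfolding \<kappa>X[OF t u] by simp
    then have "f (X (t, u)) - f p = (t ^ (?m + 1) - 1) / ((n + 1) * M0)"
      using n1 by (simp add: nonzero_eq_divide_eq mult.commute)
    then have "f (X (t, u)) = a * t ^ (?m + 1) - a + f p"
      unfolding a_def by (simp add: diff_divide_distrib)
    then have "\<phi> (X (t, u)) = a * t ^ (?m + 1) - a + f p + (l x1 + l (M cb (snoc u ?s)))"
      unfolding f_def[of "X (t, u)"] using X linear_add[OF linear_l, of x1 "M cb (snoc u ?s)"] by simp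
    then have e: "\<phi> (X (t, u)) = (a * t ^ (?m + 1) + l (M cb (snoc u ?s))) + (l x1 + f p - a)"
      by linarith
    have "snoc (X (t, u)) (\<phi> (X (t, u))) =
        snoc (M cb (snoc u ?s) + x1) ((a * t ^ (?m + 1) + l (M cb (snoc u ?s))) + (l x1 + f p - a))"
      unfolding e unfolding X by (simp only: add.commute[of x1])
    then show ?thesis unfolding snoc_add vec_init_snoc snoc_nth .
  qed
  have pX: "p \<in> X ` (I \<times> W)"
    by (rule image_eqI[of _ _ "(1, 0)"]) (simp_all add: Xp I1 W0)
  show ?thesis
    by (rule exI[of _ I], rule exI[of _ W], rule exI[of _ X], rule exI[of _ c], rule exI[of _ ?L],
        rule exI[of _ "snoc x1 (l x1 + f p - a)"])
       (intro conjI ballI I W coords pX L c final)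
qed

end

section \<open>Conical leaves\<close>

text \<open>Gronwall along the segment from \<open>p\<close> to \<open>x\<close>, as \<open>d\<mu>\<close> is a multiple of \<open>\<mu>\<close>.\<close>

lemma (in hessian_pde) \<mu>_vanishes:
  assumes ball: "ball p d \<subseteq> \<Omega>" and x: "x \<in> ball p d" and zero: "\<mu> p = 0"
  shows "\<mu> x = 0"
proof -
  let ?P = "\<lambda>s. p + s *\<^sub>R (x - p)"
  have in\<Omega>: "?P s \<in> \<Omega>" if "0 \<le> s" "s \<le> 1" for s
  proof -
    have "dist p (?P s) = s * dist p x"
      using that(1) by (simp add: dist_norm norm_minus_commute)
    also have "\<dots> \<le> 1 * dist p x" by (rule mult_right_mono[OF that(2)]) simp
    also have "\<dots> < d" using x by simp
    finally show ?thesis using ball by auto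
  qed
  define g where "g s = \<mu> (?P s)" for s
  define c where "c s = (1 - (n + 2) * \<mu> (?P s) / N (?P s)) * \<alpha> (?P s) (x - p)" for s
  have dg: "(g has_real_derivative g s * c s) (at s)" if "0 \<le> s" "s \<le> 1" for s
    using has_real_derivative_line[OF has_derivative_\<mu>[OF in\<Omega>[OF that]]]
    unfolding g_def[abs_def] c_def by (simp add: mult.assoc)
  have "smooth_on \<Omega> (\<lambda>y. (1 - (n + 2) * \<mu> y / N y) * \<alpha> y (x - p))"
    by (intro smooth_on_mult smooth_on_diff smooth_on_divide smooth_on_const smooth_\<mu> smooth_N smooth_\<alpha> open_dom)
       (use Z_props(1) in force)
  then have "continuous_on {0..1} c"
    unfolding c_def[abs_def]
    by (rule continuous_on_compose2[OF smooth_on_continuous]) (auto intro!: continuous_intros in\<Omega>)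
  then have "compact (c ` {0..1})" by (rule compact_continuous_image) simp
  then have "bounded (c ` {0..1})" by (rule compact_imp_bounded)
  then obtain K where "\<forall>y\<in>c ` {0..1}. norm y \<le> K"
    unfolding bounded_iff by blast
  then have K: "\<bar>c s\<bar> \<le> K" if "s \<in> {0..1}" for s
    using that by simp
  let ?G = "\<lambda>s. (g s * g s) * exp (- (2 * K) * s)"
  have "?G 1 \<le> ?G 0"
  proof (rule DERIV_nonpos_imp_nonincreasing[of 0 1 ?G])
    fix s :: real assume s: "0 \<le> s" "s \<le> 1"
    have "((\<lambda>s. exp (- (2 * K) * s)) has_real_derivative exp (- (2 * K) * s) * (- (2 * K))) (at s)"
      by (auto intro!: derivative_eq_intros)
    from DERIV_mult[OF DERIV_mult[OF dg[OF s] dg[OF s]] this]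
    have "(?G has_real_derivative (2 * (g s * g s) * exp (- (2 * K) * s)) * (c s - K)) (at s)"
      by (rule DERIV_cong) (simp add: algebra_simps)
    moreover have "(2 * (g s * g s) * exp (- (2 * K) * s)) * (c s - K) \<le> 0"
    proof (rule mult_nonneg_nonpos)
      show "c s - K \<le> 0" using K[of s] s by auto
    qed simp
    ultimately show "\<exists>y. (?G has_real_derivative y) (at s) \<and> y \<le> 0" by blast
  qed simp
  moreover have "?G 0 = 0" by (simp add: g_def zero)
  ultimately have "g 1 * g 1 * exp (- (2 * K) * 1) \<le> 0" by simp
  then have "g 1 * g 1 \<le> 0" by (simp add: mult_le_0_iff)
  then have "g 1 * g 1 = 0" using zero_le_square[of "g 1"] by linarith
  then have "g 1 = 0" by simp
  then show ?thesis by (simp add: g_def)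
qed

section \<open>First integrals where mu vanishes\<close>

locale conical_leaves = hessian_pde \<Omega> \<phi> n
  for \<Omega> :: "(real ^ ('k::finite) option) set" and \<phi> n +
  fixes p :: "real ^ 'k option" and E :: "'k option \<Rightarrow> real ^ 'k option"
  assumes convex_dom: "convex \<Omega>" and p: "p \<in> \<Omega>" and \<mu>_0: "x \<in> \<Omega> \<Longrightarrow> \<mu> x = 0"
    and E: "orthonormal_frame (h p) E" and ZE: "Z p = sqrt (N p) *\<^sub>R E None"
    and \<alpha>E: "\<alpha> p (E (Some j)) = 0"
    and \<alpha>_pos: "x \<in> \<Omega> \<Longrightarrow> \<alpha> x (E None) > 0"
begin

text \<open>Sign and size of \<open>cs\<close> are such that \<open>\<alpha> p e = - 1\<close>. Then
  the affine function \<open>\<tau>\<close> is 1 at \<open>p\<close> and 0 at \<open>x0\<close>, the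
  point from which the rays of the parametrization start.\<close>

definition "cs = - 1 / sqrt (N p)"
definition "e = cs *\<^sub>R E None"
definition "\<tau> x = 1 - \<alpha> p (x - p)"
definition "x0 = p - e"
text \<open>This is the part of \<open>h\<close> orthogonal to \<open>Z x\<close>; its kernel
  contains \<open>Z x\<close>.\<close>

definition "k x u v = h x u v - \<alpha> x u * \<alpha> x v / N x"

abbreviation "M \<equiv> frame_map E cs"

lemma N_pos: "x \<in> \<Omega> \<Longrightarrow> N x > 0"
  by (rule Z_props(1))

lemma sqrtN: "sqrt (N p) > 0"
  using N_pos[OF p] by simp

lemma cs: "cs \<noteq> 0"
  using sqrtN by (simp add: cs_def)

lemma \<alpha>_E_None: "\<alpha> p (E None) = sqrt (N p)"
proof -
  have "h p (E None) (E None) = 1" using orthonormal_frame.orthonormal[OF E, of None None] by simp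
  then show ?thesis
    unfolding \<alpha>_def ZE using posdef_form.left_simps(4)[OF pos[OF p]] by simp
qed

lemma \<alpha>_e: "\<alpha> p e = - 1"
  unfolding e_def linear_cmul[OF linear_\<alpha>[OF p]] \<alpha>_E_None cs_def using sqrtN by simp

lemma A0: "x \<in> \<Omega> \<Longrightarrow> A x u z = \<alpha> x u * \<alpha> x z"
  by (simp add: A_eq \<mu>_0)

lemma \<alpha>e_neg: "x \<in> \<Omega> \<Longrightarrow> \<alpha> x e < 0"
  unfolding e_def linear_cmul[OF linear_\<alpha>] real_scaleR_def
  by (rule mult_neg_pos[OF _ \<alpha>_pos]) (use sqrtN in \<open>simp_all add: cs_def\<close>)

text \<open>For \<open>\<mu> = 0\<close> the derivative of \<open>\<alpha> x u\<close> is its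
  product with \<open>\<alpha> x\<close>, so all values of \<open>\<alpha>\<close> share one
  logarithmic derivative and their quotients are constant. In particular the kernel of
  \<open>\<alpha> x\<close> does not depend on \<open>x\<close>.\<close>

lemma \<alpha>_ratio:
  assumes x: "x \<in> \<Omega>" shows "\<alpha> x u = - \<alpha> p u * \<alpha> x e"
proof -
  have "\<alpha> x u / \<alpha> x e = \<alpha> p u / \<alpha> p e"
  proof (rule constant_of_zero_derivative[OF convex_dom open_dom x p])
    fix z assume z: "z \<in> \<Omega>"
    have "\<alpha> z e \<noteq> 0" using \<alpha>e_neg[OF z] by simp
    from has_derivative_divide'[OF has_derivative_\<alpha>'[OF z, of u] has_derivative_\<alpha>'[OF z, of e] this]
    show "((\<lambda>x. \<alpha> x u / \<alpha> x e) has_derivative (\<lambda>_. 0)) (at z)"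
      unfolding A0[OF z] by (simp add: mult.commute mult.left_commute)
  qed
  then show ?thesis using \<alpha>e_neg[OF x] by (simp add: \<alpha>_e field_simps)
qed

lemma has_derivative_\<tau>: "(\<tau> has_derivative (\<lambda>z. - \<alpha> p z)) (at x)"
proof -
  have d: "((\<lambda>x. x - p) has_derivative (\<lambda>v. v)) (at x)"
    using has_derivative_diff[OF has_derivative_ident has_derivative_const[of p]] by simp
  from has_derivative_diff[OF has_derivative_const[of 1] has_derivative_linear_comp[OF linear_\<alpha>[OF p] d]]
  show ?thesis unfolding \<tau>_def[abs_def] by simp
qed

lemma \<tau>_p: "\<tau> p = 1"
  by (simp add: \<tau>_def linear_0[OF linear_\<alpha>[OF p]])

text \<open>The derivative of \<open>\<alpha> x e\<close> is quadratic in \<open>\<alpha>\<close>,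
  as in a Riccati equation, so its reciprocal is affine.\<close>

lemma \<tau>_eq:
  assumes x: "x \<in> \<Omega>" shows "\<tau> x = - 1 / \<alpha> x e"
proof -
  have "\<tau> x - - 1 / \<alpha> x e = \<tau> p - - 1 / \<alpha> p e"
  proof (rule constant_of_zero_derivative[OF convex_dom open_dom x p])
    fix z assume z: "z \<in> \<Omega>"
    have nz: "\<alpha> z e \<noteq> 0" using \<alpha>e_neg[OF z] by simp
    from has_derivative_diff[OF has_derivative_\<tau>
        has_derivative_divide'[OF has_derivative_const[of "- 1"] has_derivative_\<alpha>'[OF z, of e] nz]]
    have "((\<lambda>x. \<tau> x - - 1 / \<alpha> x e) has_derivative
       (\<lambda>w. - \<alpha> p w - (0 * \<alpha> z e - - 1 * A z e w) / (\<alpha> z e * \<alpha> z e))) (at z)" .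
    moreover have "- \<alpha> p w - (0 * \<alpha> z e - - 1 * A z e w) / (\<alpha> z e * \<alpha> z e) = 0" for w
      unfolding A0[OF z] \<alpha>_ratio[OF z, of w] using nz by simp
    ultimately show "((\<lambda>x. \<tau> x - - 1 / \<alpha> x e) has_derivative (\<lambda>_. 0)) (at z)" by (simp only:)
  qed
  then show ?thesis by (simp add: \<tau>_p \<alpha>_e)
qed

lemma \<tau>_pos: "x \<in> \<Omega> \<Longrightarrow> \<tau> x > 0"
  using \<tau>_eq[of x] \<alpha>e_neg[of x] by (simp add: divide_neg_neg)

lemma \<alpha>_eq:
  assumes x: "x \<in> \<Omega>" shows "\<tau> x * \<alpha> x u = \<alpha> p u"
  unfolding \<tau>_eq[OF x] \<alpha>_ratio[OF x, of u] using \<alpha>e_neg[OF x] by simp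

lemma has_derivative_N0: "x \<in> \<Omega> \<Longrightarrow> (N has_derivative (\<lambda>z. (n + 1) * N x * \<alpha> x z)) (at x)"
  using has_derivative_N[of x] by (simp add: \<mu>_0)

lemma k_sym: "x \<in> \<Omega> \<Longrightarrow> k x u v = k x v u"
  using posdef_form.sym[OF pos, of x u v] by (simp add: k_def mult.commute)

lemma linear_k: "x \<in> \<Omega> \<Longrightarrow> linear (\<lambda>u. k x u v)"
proof -
  assume x: "x \<in> \<Omega>"
  interpret P: posdef_form "h x" by (rule pos[OF x])
  show ?thesis
    unfolding k_def
    by (rule linearI) (simp_all add: linear_add[OF linear_\<alpha>[OF x]] linear_cmul[OF linear_\<alpha>[OF x]]
        add_divide_distrib algebra_simps)
qed

lemma has_derivative_k:
  assumes x: "x \<in> \<Omega>"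
  shows "((\<lambda>y. k y u v) has_derivative (\<lambda>z. \<alpha> x u * k x v z + \<alpha> x v * k x u z + \<alpha> x z * k x u v)) (at x)"
proof -
  have Nz: "N x \<noteq> 0" using N_pos[OF x] by simp
  have "((\<lambda>y. k y u v) has_derivative (\<lambda>z. T x u v z -
     ((\<alpha> x u * A x v z + A x u z * \<alpha> x v) * N x - (\<alpha> x u * \<alpha> x v) * ((n + 1) * N x * \<alpha> x z)) / (N x * N x))) (at x)"
    unfolding k_def
    by (rule has_derivative_diff[OF has_derivative_h[OF x]
        has_derivative_divide'[OF has_derivative_mult[OF has_derivative_\<alpha>'[OF x] has_derivative_\<alpha>'[OF x]] has_derivative_N0[OF x] Nz]])
  moreover have "T x u v z -
     ((\<alpha> x u * A x v z + A x u z * \<alpha> x v) * N x - (\<alpha> x u * \<alpha> x v) * ((n + 1) * N x * \<alpha> x z)) / (N x * N x)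
     = \<alpha> x u * k x v z + \<alpha> x v * k x u z + \<alpha> x z * k x u v" for z
    unfolding A0[OF x] Z_props(2)[OF x] k_def using Nz by (simp add: field_simps)
  ultimately show ?thesis by (simp only:)
qed

lemma k_Z: "x \<in> \<Omega> \<Longrightarrow> k x (Z x) u = 0"
  using N_pos[of x] by (simp add: k_def \<alpha>_Z) (simp add: \<alpha>_def)

lemma e_Z: "e = (- 1 / N p) *\<^sub>R Z p"
proof -
  have "sqrt (N p) * sqrt (N p) = N p" using N_pos[OF p] by simp
  then show ?thesis using sqrtN unfolding ZE e_def cs_def by (simp add: field_simps)
qed

text \<open>The leaves are cones: \<open>x - x0\<close> spans the kernel of \<open>k\<close>.\<close>

lemma k_radial_leaf:
  assumes x: "x \<in> \<Omega>" and w: "\<alpha> p w = 0"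
  shows "k x (x - x0) w = 0"
proof -
  have w0: "\<alpha> y w = 0" if "y \<in> \<Omega>" for y using \<alpha>_ratio[OF that, of w] w by simp
  have y1: "\<tau> y * \<alpha> y (y - x0) = - \<tau> y" if "y \<in> \<Omega>" for y
  proof -
    have "\<alpha> p (y - x0) = \<alpha> p (y - p) + \<alpha> p e"
      by (simp add: x0_def linear_add[OF linear_\<alpha>[OF p]] linear_diff[OF linear_\<alpha>[OF p]])
    then show ?thesis unfolding \<alpha>_eq[OF that] \<alpha>_e unfolding \<tau>_def by simp
  qed
  have y2: "\<alpha> y (y - x0) = - 1" if "y \<in> \<Omega>" for y
  proof -
    have 1: "\<tau> y * \<alpha> y (y - x0) = \<tau> y * - 1" using y1[OF that] by (simp only: mult_minus1_right)
    have 2: "\<tau> y \<noteq> 0" using \<tau>_pos[OF that] by simp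
    show ?thesis by (rule iffD1[OF mult_left_cancel[OF 2] 1])
  qed
  \<comment> \<open>The constant is found at \<open>p\<close>, where \<open>p - x0 = e\<close> is a
    multiple of \<open>Z p\<close> and so lies in the kernel of \<open>k p\<close>.\<close>
  have "\<tau> x * k x (x - x0) w = \<tau> p * k p (p - x0) w"
  proof (rule constant_of_zero_derivative[OF convex_dom open_dom x p])
    fix z assume z: "z \<in> \<Omega>"
    let ?A' = "\<lambda>u v. \<alpha> z u * k z w v + \<alpha> z w * k z u v + \<alpha> z v * k z u w"
    have d: "((\<lambda>x. x - x0) has_derivative (\<lambda>v. v)) (at z)"
      using has_derivative_diff[OF has_derivative_ident has_derivative_const[of x0]] by simp
    have lin: "linear (\<lambda>u. ?A' u v)" for v
      by (rule linearI) (simp_all add: linear_add[OF linear_\<alpha>[OF z]] linear_cmul[OF linear_\<alpha>[OF z]]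
          linear_add[OF linear_k[OF z]] linear_cmul[OF linear_k[OF z]] algebra_simps)
    have "((\<lambda>x. k x (x - x0) w) has_derivative (\<lambda>v. ?A' (z - x0) v + k z v w)) (at z)"
      by (rule has_derivative_apply[where y="\<lambda>x. x" and A="\<lambda>x u. k x u w" and A'="?A'",
            OF open_dom z linear_k has_derivative_k[OF z] lin has_derivative_ident d])
    from has_derivative_mult[OF has_derivative_\<tau> this]
    have "((\<lambda>x. \<tau> x * k x (x - x0) w) has_derivative
        (\<lambda>v. \<tau> z * (?A' (z - x0) v + k z v w) + - \<alpha> p v * k z (z - x0) w)) (at z)" .
    moreover have "\<tau> z * (?A' (z - x0) v + k z v w) + - \<alpha> p v * k z (z - x0) w = 0" for v
      unfolding y2[OF z] w0[OF z] \<alpha>_eq[OF z, of v, symmetric] k_sym[OF z, of w v] by (simp add: algebra_simps)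
    ultimately show "((\<lambda>x. \<tau> x * k x (x - x0) w) has_derivative (\<lambda>_. 0)) (at z)" by (simp only:)
  qed
  moreover have "k p (p - x0) w = 0"
    unfolding x0_def e_Z using k_Z[OF p, of w] linear_cmul[OF linear_k[OF p], of "- 1 / N p" "Z p" w] by simp
  ultimately show ?thesis using \<tau>_pos[OF x] by simp
qed

lemma \<alpha>_radial:
  assumes x: "x \<in> \<Omega>" shows "\<alpha> x (x - x0) = - 1"
proof -
  have "\<alpha> p (x - x0) = \<alpha> p (x - p) + \<alpha> p e"
    by (simp add: x0_def linear_add[OF linear_\<alpha>[OF p]] linear_diff[OF linear_\<alpha>[OF p]])
  then have 1: "\<tau> x * \<alpha> x (x - x0) = \<tau> x * - 1" unfolding \<alpha>_eq[OF x] \<alpha>_e unfolding \<tau>_def by simp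
  have 2: "\<tau> x \<noteq> 0" using \<tau>_pos[OF x] by simp
  show ?thesis by (rule iffD1[OF mult_left_cancel[OF 2] 1])
qed

text \<open>\<open>w\<close> is the component of \<open>x - x0\<close> in the kernel of
  \<open>\<alpha> x\<close>. By \<open>k_radial_leaf\<close> it is null for \<open>k\<close>, hence
  for \<open>h\<close>, so it is zero and \<open>x - x0\<close> is a multiple of
  \<open>Z x\<close>.\<close>

lemma k_radial:
  assumes x: "x \<in> \<Omega>" shows "k x (x - x0) u = 0"
proof -
  interpret P: posdef_form "h x" by (rule pos[OF x])
  have Nx: "N x \<noteq> 0" using N_pos[OF x] by simp
  define w where "w = (x - x0) + (1 / N x) *\<^sub>R Z x"
  have aw: "\<alpha> x w = 0"
    unfolding w_def linear_add[OF linear_\<alpha>[OF x]] linear_cmul[OF linear_\<alpha>[OF x]] \<alpha>_radial[OF x] \<alpha>_Z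
    using Nx by simp
  then have "\<alpha> p w = 0" using \<alpha>_eq[OF x, of w] by simp
  then have "k x (x - x0) w = 0" by (rule k_radial_leaf[OF x])
  then have "k x w w = 0"
    using linear_add[OF linear_k[OF x], of "x - x0" "(1 / N x) *\<^sub>R Z x" w]
      linear_cmul[OF linear_k[OF x], of "1 / N x" "Z x" w] k_Z[OF x, of w]
    unfolding w_def[symmetric] by simp
  then have "h x w w = 0" unfolding k_def aw by simp
  then have "w = 0" by (simp only: P.eq_0_iff)
  then have "x - x0 = (- 1 / N x) *\<^sub>R Z x" unfolding w_def by (simp add: add_eq_0_iff2)
  then show ?thesis using linear_cmul[OF linear_k[OF x], of "- 1 / N x" "Z x" u] k_Z[OF x, of u] by simp
qed

text \<open>On leaf directions the derivative of \<open>k\<close> reduces to \<open>\<alpha>\<close>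
  times \<open>k\<close>, and that of \<open>\<tau>\<close> is \<open>- \<tau> * \<alpha>\<close>,
  so the product is constant.\<close>

lemma k_leaf:
  assumes x: "x \<in> \<Omega>" and w: "\<alpha> p w = 0" "\<alpha> p w' = 0"
  shows "\<tau> x * k x w w' = h p w w'"
proof -
  have "\<tau> x * k x w w' = \<tau> p * k p w w'"
  proof (rule constant_of_zero_derivative[OF convex_dom open_dom x p])
    fix z assume z: "z \<in> \<Omega>"
    have w0: "\<alpha> z w = 0" "\<alpha> z w' = 0" using \<alpha>_ratio[OF z, of w] \<alpha>_ratio[OF z, of w'] w by simp_all
    have "\<tau> z * (\<alpha> z w * k z w' v + \<alpha> z w' * k z w v + \<alpha> z v * k z w w') + - \<alpha> p v * k z w w' = 0" for v
      unfolding w0 \<alpha>_eq[OF z, of v, symmetric] by (simp add: algebra_simps)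
    then show "((\<lambda>x. \<tau> x * k x w w') has_derivative (\<lambda>_. 0)) (at z)"
      using has_derivative_mult[OF has_derivative_\<tau> has_derivative_k[OF z, of w w']] by (simp only:)
  qed
  then show ?thesis by (simp add: \<tau>_p k_def w)
qed

lemma N_eq:
  assumes x: "x \<in> \<Omega>"
  shows "N x * \<tau> x ^ (CARD('k option) + 1) = N p"
proof -
  let ?j = "CARD('k option) + 1"
  have "N x * \<tau> x ^ ?j = N p * \<tau> p ^ ?j"
  proof (rule constant_of_zero_derivative[OF convex_dom open_dom x p])
    fix z assume z: "z \<in> \<Omega>"
    have dp: "((\<lambda>x. \<tau> x ^ ?j) has_derivative (\<lambda>v. real ?j * - \<alpha> p v * \<tau> z ^ (?j - 1))) (at z)"
      by (rule has_derivative_power[OF has_derivative_\<tau>])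
    have "N z * (real ?j * - \<alpha> p v * \<tau> z ^ (?j - 1)) + (n + 1) * N z * \<alpha> z v * \<tau> z ^ ?j = 0" for v
    proof -
      have "real ?j = n + 1" by (simp add: n_def)
      moreover have "\<tau> z ^ ?j = \<tau> z * \<tau> z ^ (?j - 1)" by simp
      moreover have "a * (b * - (t * c) * d) + b * a * c * (t * d) = 0" for a b c d t :: real
        by (simp add: algebra_simps)
      ultimately show ?thesis unfolding \<alpha>_eq[OF z, of v, symmetric] by (simp only:)
    qed
    then show "((\<lambda>x. N x * \<tau> x ^ ?j) has_derivative (\<lambda>_. 0)) (at z)"
      using has_derivative_mult[OF has_derivative_N0[OF z] dp] by (simp only:)
  qed
  then show ?thesis by (simp add: \<tau>_p)
qed

section \<open>Explicit integration and parametrization for vanishing mu\<close>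

text \<open>\<open>k\<close> is known on leaf directions and vanishes on \<open>x - x0\<close>, and
  \<open>N\<close> is a power of \<open>\<tau>\<close>. Together these give the Hessian of
  \<open>\<phi>\<close> explicitly in the coordinates \<open>zz\<close>, and two integrations yield
  \<open>f0\<close> up to an affine function.\<close>

theorem conical_leaves:
  shows "\<exists>I W X c L b. open I \<and> is_interval I \<and> open W \<and> smooth_coordinates (I \<times> W) X \<Omega> \<and>
    p \<in> X ` (I \<times> W) \<and> linear L \<and> bij L \<and> c \<noteq> (0::real) \<and>
    (\<forall>t\<in>I. \<forall>u\<in>(W :: (real ^ 'k) set). snoc (X (t, u)) (\<phi> (X (t, u))) =
      L (snoc (snoc (t *\<^sub>R u) (t * ((norm u)\<^sup>2 / 2) + c * t ^ (CARD('k option) + 1))) t) + b)"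
proof -
  let ?m = "CARD('k option)"
  let ?w = "\<lambda>j. E (Some j)"
  have Np: "N p > 0" by (rule N_pos[OF p])
  have injM: "inj M" and surjM: "surj M"
    by (rule inj_frame_map[OF E cs], rule surj_frame_map[OF E cs])
  have linM: "linear M" by (rule linear_frame_map)
  have M: "M z = z $ None *\<^sub>R e + (\<Sum>j\<in>UNIV. z $ Some j *\<^sub>R ?w j)" for z
    by (simp add: frame_map_eq e_def mult.commute)
  define iM where "iM = inv M"
  have lini: "linear iM"
    using inj_linear_imp_inv_bounded_linear[OF linM[unfolded linear_conv_bounded_linear] injM]
    unfolding iM_def linear_conv_bounded_linear .
  have iMM: "iM (M z) = z" for z unfolding iM_def by (rule inv_f_f[OF injM])
  have MiM: "M (iM v) = v" for v unfolding iM_def by (rule surj_f_inv_f[OF surjM])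
  define zz where "zz x = iM (x - x0)" for x
  define s where "s x = (norm (vec_init (zz x)))\<^sup>2" for x
  have s_sum: "s x = (\<Sum>j\<in>UNIV. zz x $ Some j * zz x $ Some j)" for x
    unfolding s_def norm_vec_square by (simp add: vec_init_def)
  have zzX: "zz (x0 + M z) = z" for z unfolding zz_def by (simp add: iMM)
  have Mzz: "x0 + M (zz x) = x" for x unfolding zz_def by (simp add: MiM)
  have \<alpha>M: "\<alpha> p (M z) = - z $ None" for z
    unfolding M linear_add[OF linear_\<alpha>[OF p]] linear_cmul[OF linear_\<alpha>[OF p]] linear_sum[OF linear_\<alpha>[OF p]]
    by (simp add: \<alpha>E \<alpha>_e)
  have \<tau>zz: "\<tau> x = zz x $ None" for x
  proof -
    have "x - p = M (zz x) - e" using Mzz[of x] by (simp add: x0_def algebra_simps)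
    then show ?thesis unfolding \<tau>_def by (simp add: linear_diff[OF linear_\<alpha>[OF p]] \<alpha>M \<alpha>_e)
  qed
  have d_nth: "((\<lambda>x. zz x $ i) has_derivative (\<lambda>v. iM v $ i)) (at x)" for i x
  proof -
    have d: "((\<lambda>x. x - x0) has_derivative (\<lambda>v. v)) (at x)"
      using has_derivative_diff[OF has_derivative_ident has_derivative_const[of x0]] by simp
    show ?thesis
      unfolding zz_def by (rule has_derivative_linear_comp[OF linear_vec_nth has_derivative_linear_comp[OF lini d]])
  qed
  have d\<tau>: "(\<tau> has_derivative (\<lambda>v. iM v $ None)) (at x)" for x
  proof -
    have "\<tau> = (\<lambda>x. zz x $ None)" by (rule ext) (rule \<tau>zz)
    then show ?thesis using d_nth[of None x] by (simp only:)
  qed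
  have ds: "(s has_derivative (\<lambda>v. 2 * (\<Sum>j\<in>UNIV. zz x $ Some j * iM v $ Some j))) (at x)" for x
  proof -
    have "((\<lambda>x. \<Sum>j\<in>UNIV. zz x $ Some j * zz x $ Some j) has_derivative
        (\<lambda>v. \<Sum>j\<in>UNIV. zz x $ Some j * iM v $ Some j + iM v $ Some j * zz x $ Some j)) (at x)"
      by (rule has_derivative_sum, rule has_derivative_mult[OF d_nth d_nth])
    moreover have "(\<Sum>j\<in>UNIV. zz x $ Some j * iM v $ Some j + iM v $ Some j * zz x $ Some j) =
        2 * (\<Sum>j\<in>UNIV. zz x $ Some j * iM v $ Some j)" for v
      unfolding sum_distrib_left by (rule sum.cong) simp_all
    ultimately show ?thesis unfolding s_sum[abs_def] by (simp only:)
  qed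
  have w0: "\<alpha> p (?w j) = 0" for j by (rule \<alpha>E)
  have hw: "h p (?w i) (?w j) = (if i = j then 1 else 0)" for i j
    using orthonormal_frame.orthonormal[OF E, of "Some i" "Some j"] by simp
  have tk: "\<tau> x * k x (?w i) (?w j) = (if i = j then 1 else 0)" if x: "x \<in> \<Omega>" for x i j
    unfolding k_leaf[OF x w0 w0] by (rule hw)
  have kww: "k x (?w i) (?w j) = (if i = j then 1 / \<tau> x else 0)" if x: "x \<in> \<Omega>" for x i j
    using tk[OF x, of i j] \<tau>_pos[OF x] by (auto simp: field_simps split: if_splits)
  have kM: "k x (M z) v = z $ None * k x e v + (\<Sum>j\<in>UNIV. z $ Some j * k x (?w j) v)" if x: "x \<in> \<Omega>" for x z v
    unfolding M linear_add[OF linear_k[OF x]] linear_cmul[OF linear_k[OF x]] linear_sum[OF linear_k[OF x]] by simp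
  have kzz: "k x (M (zz x)) v = 0" if x: "x \<in> \<Omega>" for x v
  proof -
    have "M (zz x) = x - x0" using Mzz[of x] by (simp add: algebra_simps)
    then show ?thesis using k_radial[OF x, of v] by simp
  qed
  \<comment> \<open>Expanding \<open>x - x0\<close> in \<open>e\<close> and the leaf directions, the
    vanishing of \<open>k\<close> on it determines the entries of \<open>k\<close> that involve
    \<open>e\<close>.\<close>
  have kew: "k x e (?w j) = - (zz x $ Some j) / (\<tau> x)\<^sup>2" if x: "x \<in> \<Omega>" for x j
  proof -
    have t: "\<tau> x > 0" by (rule \<tau>_pos[OF x])
    have "\<tau> x * k x e (?w j) + zz x $ Some j / \<tau> x = 0"
      using kzz[OF x, of "?w j"] unfolding kM[OF x] kww[OF x] \<tau>zz[symmetric]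
      by (simp add: if_distrib cong: if_cong)
    then show ?thesis using t by (simp add: field_simps power2_eq_square)
  qed
  have kee: "k x e e = s x / \<tau> x ^ 3" if x: "x \<in> \<Omega>" for x
  proof -
    have t: "\<tau> x > 0" by (rule \<tau>_pos[OF x])
    have "(\<Sum>j\<in>UNIV. zz x $ Some j * k x (?w j) e) = - s x / (\<tau> x)\<^sup>2"
      unfolding k_sym[OF x, of "?w _" e] kew[OF x] s_sum by (simp add: sum_divide_distrib sum_negf)
    then have "\<tau> x * k x e e - s x / (\<tau> x)\<^sup>2 = 0"
      using kzz[OF x, of e] unfolding kM[OF x] \<tau>zz[symmetric] by simp
    then show ?thesis using t by (simp add: field_simps power2_eq_square power3_eq_cube)
  qed
  \<comment> \<open>The Hessian along \<open>e\<close> contains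
    \<open>\<tau> x ^ (n - 1) / N p\<close>; two integrations bring in the factors n and n + 1. The
    index \<open>i\<close> below stands for n - 1.\<close>
  define c where "c = 1 / (N p * n * (n + 1))"
  have c: "c \<noteq> 0" using Np n by (simp add: c_def)
  have invN: "1 / N x = \<tau> x ^ (?m + 1) / N p" if x: "x \<in> \<Omega>" for x
  proof -
    have "\<tau> x ^ (?m + 1) / N p = \<tau> x ^ (?m + 1) / (N x * \<tau> x ^ (?m + 1))"
      unfolding N_eq[OF x] ..
    also have "\<dots> = 1 / N x" using \<tau>_pos[OF x] N_pos[OF x] by simp
    finally show ?thesis by (rule HOL.sym)
  qed
  obtain i where m: "?m = Suc i" by (cases ?m) simp_all
  have hxw: "h x v (?w j) = k x v (?w j)" if x: "x \<in> \<Omega>" for x v j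
  proof -
    have "\<alpha> x (?w j) = 0" using \<alpha>_ratio[OF x, of "?w j"] by (simp add: w0)
    then show ?thesis by (simp add: k_def)
  qed
  have hxe: "h x v e = k x v e + iM v $ None * \<tau> x ^ i / N p" if x: "x \<in> \<Omega>" for x v
  proof -
    have t: "\<tau> x > 0" by (rule \<tau>_pos[OF x])
    have "\<alpha> p v = - iM v $ None" using \<alpha>M[of "iM v"] unfolding MiM .
    then have av: "\<alpha> x v = - iM v $ None / \<tau> x" using \<alpha>_eq[OF x, of v] t by (simp add: field_simps)
    have ae: "\<alpha> x e = - 1 / \<tau> x" using \<alpha>_eq[OF x, of e] t by (simp add: \<alpha>_e field_simps)
    have "h x v e = k x v e + \<alpha> x v * \<alpha> x e * (1 / N x)" by (simp add: k_def)
    also have "\<alpha> x v * \<alpha> x e * (1 / N x) = iM v $ None * \<tau> x ^ i / N p"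
      unfolding invN[OF x] av ae m using t by (simp add: field_simps)
    finally show ?thesis .
  qed
  \<comment> \<open>\<open>G\<close> and \<open>G0\<close> are the derivatives of the function
    \<open>f0\<close> below along \<open>?w j\<close> and \<open>e\<close>; \<open>gradw\<close> and
    \<open>grade\<close> show that those of \<open>\<phi>\<close> differ from them by
    constants.\<close>
  define G where "G x j = zz x $ Some j / \<tau> x" for x j
  define G0 where "G0 x = (n + 1) * c * \<tau> x ^ ?m - s x / (2 * (\<tau> x)\<^sup>2)" for x
  have hvw: "h x v (?w j) = (iM v $ Some j * \<tau> x - zz x $ Some j * iM v $ None) / (\<tau> x * \<tau> x)" if x: "x \<in> \<Omega>" for x v j
  proof -
    have t: "\<tau> x > 0" by (rule \<tau>_pos[OF x])
    have "k x v (?w j) = k x (M (iM v)) (?w j)" unfolding MiM ..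
    also have "\<dots> = - iM v $ None * zz x $ Some j / (\<tau> x)\<^sup>2 + iM v $ Some j / \<tau> x"
      unfolding kM[OF x] kew[OF x] kww[OF x] by (simp add: if_distrib cong: if_cong)
    finally show ?thesis unfolding hxw[OF x] using t by (simp add: field_simps power2_eq_square)
  qed
  have hve: "h x v e = (\<Sum>j\<in>UNIV. zz x $ Some j * iM v $ Some j) * (- 1 / (\<tau> x)\<^sup>2) + iM v $ None * (s x / \<tau> x ^ 3)
      + iM v $ None * \<tau> x ^ i / N p" if x: "x \<in> \<Omega>" for x v
  proof -
    have "k x v e = k x (M (iM v)) e" unfolding MiM ..
    also have "\<dots> = iM v $ None * (s x / \<tau> x ^ 3) + (\<Sum>j\<in>UNIV. iM v $ Some j * (- (zz x $ Some j) / (\<tau> x)\<^sup>2))"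
      unfolding kM[OF x] kee[OF x] k_sym[OF x, of "?w _" e] kew[OF x] ..
    also have "(\<Sum>j\<in>UNIV. iM v $ Some j * (- (zz x $ Some j) / (\<tau> x)\<^sup>2)) =
        (\<Sum>j\<in>UNIV. zz x $ Some j * iM v $ Some j) * (- 1 / (\<tau> x)\<^sup>2)"
      unfolding sum_distrib_right by (rule sum.cong) simp_all
    finally show ?thesis unfolding hxe[OF x] by simp
  qed
  have gradw: "frechet_derivative \<phi> (at x) (?w j) - G x j = frechet_derivative \<phi> (at p) (?w j) - G p j"
    if x: "x \<in> \<Omega>" for x j
  proof (rule constant_of_zero_derivative[OF convex_dom open_dom x p])
    fix y assume y: "y \<in> \<Omega>"
    have t: "\<tau> y \<noteq> 0" using \<tau>_pos[OF y] by simp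
    have "((\<lambda>x. frechet_derivative \<phi> (at x) (?w j) - G x j) has_derivative
       (\<lambda>v. h y v (?w j) - (iM v $ Some j * \<tau> y - zz y $ Some j * iM v $ None) / (\<tau> y * \<tau> y))) (at y)"
      unfolding G_def
      by (rule has_derivative_diff[OF has_derivative_d1[OF open_dom smooth y] has_derivative_divide'[OF d_nth d\<tau> t]])
    then show "((\<lambda>x. frechet_derivative \<phi> (at x) (?w j) - G x j) has_derivative (\<lambda>_. 0)) (at y)"
      unfolding hvw[OF y] by simp
  qed
  have grade: "frechet_derivative \<phi> (at x) e - G0 x = frechet_derivative \<phi> (at p) e - G0 p"
    if x: "x \<in> \<Omega>" for x
  proof (rule constant_of_zero_derivative[OF convex_dom open_dom x p])
    fix y assume y: "y \<in> \<Omega>"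
    have t: "\<tau> y \<noteq> 0" using \<tau>_pos[OF y] by simp
    let ?S = "\<lambda>v. \<Sum>j\<in>UNIV. zz y $ Some j * iM v $ Some j"
    have t2: "2 * (\<tau> y)\<^sup>2 \<noteq> 0" using t by simp
    have dt2: "((\<lambda>x. 2 * (\<tau> x)\<^sup>2) has_derivative (\<lambda>v. 2 * (of_nat 2 * iM v $ None * \<tau> y ^ (2 - 1)))) (at y)"
      by (rule has_derivative_mult_right[OF has_derivative_power[OF d\<tau>]])
    have dtm: "((\<lambda>x. (n + 1) * c * \<tau> x ^ ?m) has_derivative (\<lambda>v. (n + 1) * c * (of_nat ?m * iM v $ None * \<tau> y ^ (?m - 1)))) (at y)"
      by (rule has_derivative_mult_right[OF has_derivative_power[OF d\<tau>]])
    have "((\<lambda>x. frechet_derivative \<phi> (at x) e - G0 x) has_derivative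
       (\<lambda>v. h y v e - ((n + 1) * c * (of_nat ?m * iM v $ None * \<tau> y ^ (?m - 1))
         - ((2 * ?S v) * (2 * (\<tau> y)\<^sup>2) - s y * (2 * (of_nat 2 * iM v $ None * \<tau> y ^ (2 - 1)))) / ((2 * (\<tau> y)\<^sup>2) * (2 * (\<tau> y)\<^sup>2))))) (at y)"
      unfolding G0_def
      by (rule has_derivative_diff[OF has_derivative_d1[OF open_dom smooth y]
            has_derivative_diff[OF dtm has_derivative_divide'[OF ds dt2 t2]]])
    moreover have "h y v e - ((n + 1) * c * (of_nat ?m * iM v $ None * \<tau> y ^ (?m - 1))
         - ((2 * ?S v) * (2 * (\<tau> y)\<^sup>2) - s y * (2 * (of_nat 2 * iM v $ None * \<tau> y ^ (2 - 1)))) / ((2 * (\<tau> y)\<^sup>2) * (2 * (\<tau> y)\<^sup>2))) = 0" for v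
    proof -
      have "(n + 1) * c * (of_nat ?m * iM v $ None * \<tau> y ^ (?m - 1)) = iM v $ None * \<tau> y ^ i / N p"
      proof -
        have "of_nat ?m = n" by (simp add: n_def)
        moreover have "?m - 1 = i" using m by simp
        moreover have "(n + 1) * c * (n * a * b) = a * b / N p" for a b
        proof -
          have "(n + 1) * c * (n * a * b) * N p = c * (N p * n * (n + 1)) * (a * b)" by (simp only: mult_ac)
          also have "c * (N p * n * (n + 1)) = 1" unfolding c_def using n Np by simp
          finally show ?thesis using Np by (simp add: eq_divide_eq)
        qed
        ultimately show ?thesis by simp
      qed
      moreover have "((2 * a) * (2 * (\<tau> y)\<^sup>2) - s y * (2 * (of_nat 2 * b * \<tau> y ^ (2 - 1)))) / ((2 * (\<tau> y)\<^sup>2) * (2 * (\<tau> y)\<^sup>2))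
          = a / (\<tau> y)\<^sup>2 - b * (s y / \<tau> y ^ 3)" for a b
        using t by (simp add: field_simps power2_eq_square power3_eq_cube)
      ultimately show ?thesis unfolding hve[OF y] by simp
    qed
    ultimately show "((\<lambda>x. frechet_derivative \<phi> (at x) e - G0 x) has_derivative (\<lambda>_. 0)) (at y)"
      by (simp only:)
  qed
  define gw where "gw j = frechet_derivative \<phi> (at p) (?w j) - G p j" for j
  define ge where "ge = frechet_derivative \<phi> (at p) e - G0 p"
  define la where "la v = iM v $ None * ge + (\<Sum>j\<in>UNIV. iM v $ Some j * gw j)" for v
  have linla: "linear la"
    unfolding la_def[abs_def]
    by (rule linearI) (simp_all add: linear_add[OF lini] linear_cmul[OF lini] distrib_right sum.distrib
        sum_distrib_left mult.assoc distrib_left)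
  define f0 where "f0 x = s x / (2 * \<tau> x) + c * \<tau> x ^ (?m + 1)" for x
  define K where "K = \<phi> p - f0 p - la p"
  have \<phi>: "\<phi> x = f0 x + la x + K" if x: "x \<in> \<Omega>" for x
  proof -
    have "\<phi> x - f0 x - la x = \<phi> p - f0 p - la p"
    proof (rule constant_of_zero_derivative[OF convex_dom open_dom x p])
      fix y assume y: "y \<in> \<Omega>"
      have t: "\<tau> y \<noteq> 0" using \<tau>_pos[OF y] by simp
      have t2: "2 * \<tau> y \<noteq> 0" using t by simp
      let ?S = "\<lambda>v. \<Sum>j\<in>UNIV. zz y $ Some j * iM v $ Some j"
      have lin\<phi>: "linear (frechet_derivative \<phi> (at y))" by (rule linear_frechet_derivative[OF smooth y])
      have dtm: "((\<lambda>x. c * \<tau> x ^ (?m + 1)) has_derivative (\<lambda>v. c * (of_nat (?m + 1) * iM v $ None * \<tau> y ^ (?m + 1 - 1)))) (at y)"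
        by (rule has_derivative_mult_right[OF has_derivative_power[OF d\<tau>]])
      have df0: "(f0 has_derivative (\<lambda>v. ((2 * ?S v) * (2 * \<tau> y) - s y * (2 * iM v $ None)) / ((2 * \<tau> y) * (2 * \<tau> y))
          + c * (of_nat (?m + 1) * iM v $ None * \<tau> y ^ (?m + 1 - 1)))) (at y)"
        unfolding f0_def[abs_def]
        by (rule has_derivative_add[OF has_derivative_divide'[OF ds has_derivative_mult_right[OF d\<tau>] t2] dtm])
      have dla: "(la has_derivative la) (at y)"
        by (rule has_derivative_linear_comp[OF linla has_derivative_ident])
      have "((\<lambda>x. \<phi> x - f0 x - la x) has_derivative (\<lambda>v. frechet_derivative \<phi> (at y) v -
         (((2 * ?S v) * (2 * \<tau> y) - s y * (2 * iM v $ None)) / ((2 * \<tau> y) * (2 * \<tau> y))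
          + c * (of_nat (?m + 1) * iM v $ None * \<tau> y ^ (?m + 1 - 1))) - la v)) (at y)"
        by (rule has_derivative_diff[OF has_derivative_diff[OF smooth_on_has_derivative[OF smooth y] df0] dla])
      moreover have "frechet_derivative \<phi> (at y) v -
         (((2 * ?S v) * (2 * \<tau> y) - s y * (2 * iM v $ None)) / ((2 * \<tau> y) * (2 * \<tau> y))
          + c * (of_nat (?m + 1) * iM v $ None * \<tau> y ^ (?m + 1 - 1))) - la v = 0" for v
      proof -
        have "frechet_derivative \<phi> (at y) v = frechet_derivative \<phi> (at y) (M (iM v))" unfolding MiM ..
        also have "\<dots> = iM v $ None * frechet_derivative \<phi> (at y) e
            + (\<Sum>j\<in>UNIV. iM v $ Some j * frechet_derivative \<phi> (at y) (?w j))"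
          unfolding M linear_add[OF lin\<phi>] linear_cmul[OF lin\<phi>] linear_sum[OF lin\<phi>] by simp
        also have "frechet_derivative \<phi> (at y) e = ge + G0 y" using grade[OF y] by (simp add: ge_def)
        also have "(\<lambda>j. frechet_derivative \<phi> (at y) (?w j)) = (\<lambda>j. gw j + G y j)"
          by (rule ext) (simp add: gw_def gradw[OF y, symmetric])
        also have "(\<Sum>j\<in>UNIV. iM v $ Some j * (gw j + G y j)) = (\<Sum>j\<in>UNIV. iM v $ Some j * gw j) + ?S v / \<tau> y"
          unfolding G_def distrib_left sum.distrib sum_divide_distrib by (simp add: mult.commute)
        finally have 1: "frechet_derivative \<phi> (at y) v = la v + iM v $ None * G0 y + ?S v / \<tau> y"
          unfolding la_def by (simp add: distrib_left)
        have 2: "of_nat (?m + 1) = n + 1" "?m + 1 - 1 = ?m" by (simp_all add: n_def)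
        have 3: "((2 * a) * (2 * \<tau> y) - s y * (2 * b)) / ((2 * \<tau> y) * (2 * \<tau> y)) = a / \<tau> y - b * (s y / (2 * (\<tau> y)\<^sup>2))" for a b
          using t by (simp add: field_simps power2_eq_square)
        show ?thesis unfolding 1 2 3 G0_def by (simp add: algebra_simps)
      qed
      ultimately show "((\<lambda>x. \<phi> x - f0 x - la x) has_derivative (\<lambda>_. 0)) (at y)" by (simp only:)
    qed
    then show ?thesis unfolding K_def by simp
  qed
  \<comment> \<open>Scaling \<open>u\<close> by \<open>t\<close> makes \<open>s\<close> equal to
    \<open>t\<^sup>2 * (norm u)\<^sup>2\<close>, so the quotient \<open>s x / (2 * \<tau> x)\<close>
    in \<open>f0\<close> turns into the entry of the model.\<close>
  define X where "X d = x0 + M (snoc (fst d *\<^sub>R snd d) (fst d))" for d :: "real \<times> (real ^ 'k)"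
  have XD: "X (t, u) = x0 + M (snoc (t *\<^sub>R u) t)" for t u by (simp add: X_def)
  have smX: "smooth_on S X" if "open S" for S
    unfolding X_def[abs_def]
    by (intro smooth_on_add smooth_on_const smooth_on_linear[OF that linM] smooth_on_snoc smooth_on_scaleR
        smooth_on_fst smooth_on_snd that)
  have Xp: "X (1, 0) = p"
    unfolding XD M by (simp add: x0_def)
  have X1: "X (1, 0) \<in> \<Omega>" unfolding Xp by (rule p)
  obtain d where d: "d > 0" "X ` ({1 - d<..<1 + d} \<times> ball 0 d) \<subseteq> \<Omega>"
    by (rule product_neighbourhood[OF open_UNIV UNIV_I smX[OF open_UNIV] open_dom X1])
  define I where "I = {1 - d<..<1 + d}"
  define W where "W = ball (0 :: real ^ 'k) d"
  have IW: "X ` (I \<times> W) \<subseteq> \<Omega>" using d by (simp add: I_def W_def)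
  have I: "open I" "is_interval I" and W: "open W"
    by (simp_all add: I_def W_def is_interval_oo)
  have I1: "1 \<in> I" and W0: "0 \<in> W" using d by (simp_all add: I_def W_def)
  have X\<Omega>: "X (t, u) \<in> \<Omega>" if "t \<in> I" "u \<in> W" for t u using IW that by blast
  have \<tau>X: "\<tau> (X (t, u)) = t" for t u unfolding \<tau>zz XD zzX by simp
  have I_pos: "t > 0" if "t \<in> I" for t using \<tau>_pos[OF X\<Omega>[OF that W0]] unfolding \<tau>X .
  define Y where "Y x = (\<tau> x, (1 / \<tau> x) *\<^sub>R vec_init (zz x))" for x
  have sm\<tau>: "smooth_on \<Omega> \<tau>"
    unfolding \<tau>_def[abs_def]
    by (intro smooth_on_diff smooth_on_const smooth_on_linear[OF open_dom linear_\<alpha>[OF p]] smooth_on_id open_dom)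
  have \<tau>nz: "\<tau> x \<noteq> 0" if "x \<in> \<Omega>" for x using \<tau>_pos[OF that] by simp
  have smY: "smooth_on \<Omega> Y"
    unfolding Y_def[abs_def] zz_def
    by (intro smooth_on_Pair sm\<tau> smooth_on_scaleR smooth_on_divide smooth_on_const smooth_on_vec_init
        smooth_on_linear[OF open_dom lini] smooth_on_diff smooth_on_id open_dom \<tau>nz)
  have coords: "smooth_coordinates (I \<times> W) X \<Omega>"
  proof (rule smooth_coordinatesI[OF open_Times[OF I(1) W(1)] smX[OF open_Times[OF I(1) W(1)]] IW open_dom IW smY])
    show "Y (X dd) = dd" if dd: "dd \<in> I \<times> W" for dd
    proof -
      obtain t u where tu: "dd = (t, u)" "t \<in> I" "u \<in> W" using dd by blast
      have "zz (X (t, u)) = snoc (t *\<^sub>R u) t" unfolding XD zzX ..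
      then show ?thesis unfolding Y_def tu(1) \<tau>X using I_pos[OF tu(2)] by simp
    qed
    show "X (Y x) = x" if x: "x \<in> \<Omega>" "Y x \<in> I \<times> W" for x
    proof -
      have "\<tau> x *\<^sub>R ((1 / \<tau> x) *\<^sub>R vec_init (zz x)) = vec_init (zz x)" using \<tau>nz[OF x(1)] by simp
      then have "X (Y x) = x0 + M (snoc (vec_init (zz x)) (zz x $ None))"
        unfolding Y_def XD by (simp add: \<tau>zz)
      then show ?thesis unfolding snoc_vec_init Mzz .
    qed
  qed
  let ?L1 = "\<lambda>v. snoc (M (vec_init v)) (1 * v $ None + la (M (vec_init v)))"
  \<comment> \<open>In the model the coordinate \<open>t\<close> comes last and the height before
    it, in the graph the height comes last; \<open>Sw\<close> exchanges the two.\<close>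
  define Sw where "Sw v = snoc (snoc (vec_init (vec_init v)) (v $ None)) (vec_init v $ None)" for v :: "real ^ 'k option option"
  have linlM: "linear (\<lambda>z. la (M z))"
    using linear_compose[OF linM linla] unfolding o_def .
  have L1: "linear ?L1" "bij ?L1"
    by (rule graph_affine_map(1)[OF linM injM linlM one_neq_zero], rule graph_affine_map(2)[OF linM injM linlM one_neq_zero])
  have linSw: "linear Sw"
    unfolding Sw_def[abs_def]
    by (rule linearI) (simp_all add: vec_eq_iff snoc_def vec_init_def split: option.split)
  have SwSw: "Sw (Sw v) = v" for v
    unfolding Sw_def by (simp only: vec_init_snoc snoc_nth snoc_vec_init)
  have bijSw: "bij Sw" by (rule o_bij[of Sw]) (simp_all add: fun_eq_iff SwSw)
  let ?L = "?L1 \<circ> Sw"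
  have L: "linear ?L" "bij ?L"
    by (rule linear_compose[OF linSw L1(1)], rule bij_comp[OF bijSw L1(2)])
  have final: "snoc (X (t, u)) (\<phi> (X (t, u))) =
      ?L (snoc (snoc (t *\<^sub>R u) (t * ((norm u)\<^sup>2 / 2) + c * t ^ (?m + 1))) t) + snoc x0 (la x0 + K)"
    if t: "t \<in> I" and u: "u \<in> W" for t u
  proof -
    let ?z = "snoc (t *\<^sub>R u) t"
    have "s (X (t, u)) = t\<^sup>2 * (norm u)\<^sup>2"
      unfolding s_def XD zzX vec_init_snoc by (simp add: power_mult_distrib)
    then have "f0 (X (t, u)) = t * ((norm u)\<^sup>2 / 2) + c * t ^ (?m + 1)"
      unfolding f0_def \<tau>X using I_pos[OF t] by (simp add: power2_eq_square)
    moreover have "la (X (t, u)) = la x0 + la (M ?z)" unfolding XD by (rule linear_add[OF linla])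
    ultimately have e: "\<phi> (X (t, u)) = (1 * (t * ((norm u)\<^sup>2 / 2) + c * t ^ (?m + 1)) + la (M ?z)) + (la x0 + K)"
      unfolding \<phi>[OF X\<Omega>[OF t u]] by simp
    have "snoc (X (t, u)) (\<phi> (X (t, u))) =
        snoc (M ?z + x0) ((1 * (t * ((norm u)\<^sup>2 / 2) + c * t ^ (?m + 1)) + la (M ?z)) + (la x0 + K))"
      unfolding e unfolding XD by (simp only: add.commute[of x0])
    then show ?thesis unfolding snoc_add o_def Sw_def vec_init_snoc snoc_nth .
  qed
  have pX: "p \<in> X ` (I \<times> W)"
    by (rule image_eqI[of _ _ "(1, 0)"]) (simp_all add: Xp I1 W0)
  show ?thesis
    by (rule exI[of _ I], rule exI[of _ W], rule exI[of _ X], rule exI[of _ c], rule exI[of _ ?L],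
        rule exI[of _ "snoc x0 (la x0 + K)"])
       (intro conjI ballI I W coords pX L c final)
qed

end

section \<open>Passage to the manifold\<close>

lemma smooth_coordinates_compose:
  assumes X: "smooth_coordinates D X V" and V: "open V" and U: "open U" "U \<subseteq> S"
    and hom: "homeomorphism U V y g" and y: "smooth_on U y" and g: "smooth_on V g"
  shows "smooth_coordinates D (\<lambda>d. g (X d)) S"
proof -
  obtain Y where D: "open D" and sX: "smooth_on D X" and XV: "X ` D \<subseteq> V" and XD: "open (X ` D)"
    and Y: "smooth_on (X ` D) Y" and YX: "\<And>d. d \<in> D \<Longrightarrow> Y (X d) = d"
    using X unfolding smooth_coordinates_def by blast
  let ?U = "U \<inter> y -` (X ` D)"
  have U': "open ?U"
    by (rule continuous_open_preimage[OF smooth_on_continuous[OF y] U(1) XD])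
  have gX: "g (X d) \<in> ?U" "y (g (X d)) = X d" if "d \<in> D" for d
  proof -
    have XdV: "X d \<in> V" using XV that by blast
    show e: "y (g (X d)) = X d" by (rule homeomorphism_apply2[OF hom XdV])
    show "g (X d) \<in> ?U"
      using homeomorphism_image2[OF hom] XdV that by (auto simp: e)
  qed
  show ?thesis
  proof (rule smooth_coordinatesI[where V="?U" and Y="\<lambda>x. Y (y x)"])
    show "smooth_on D (\<lambda>d. g (X d))"
      by (rule smooth_on_compose[OF D V g sX]) (use XV in blast)
    show "(\<lambda>d. g (X d)) ` D \<subseteq> S" "(\<lambda>d. g (X d)) ` D \<subseteq> ?U" using gX(1) U(2) by blast+
    show "smooth_on ?U (\<lambda>x. Y (y x))"
      by (rule smooth_on_compose[OF U' XD Y smooth_on_subset[OF y]]) auto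
    show "Y (y (g (X d))) = d" if "d \<in> D" for d
      using gX(2)[OF that] YX[OF that] by simp
    show "g (X (Y (y x))) = x" if x: "x \<in> ?U" for x
    proof -
      obtain d where d: "d \<in> D" "y x = X d" using x by blast
      have "g (y x) = x" using homeomorphism_apply1[OF hom] x by blast
      then show ?thesis unfolding d(2) YX[OF d(1)] .
    qed
  qed (rule D, rule U')
qed

lemma homeomorphism_image_open:
  assumes hom: "homeomorphism U V f g" and V: "open V" and S: "open S"
  shows "open (f ` (U \<inter> S))"
proof -
  have "f ` (U \<inter> S) = V \<inter> g -` S"
  proof
    show "f ` (U \<inter> S) \<subseteq> V \<inter> g -` S"
      using homeomorphism_image1[OF hom] homeomorphism_apply1[OF hom] by auto
    show "V \<inter> g -` S \<subseteq> f ` (U \<inter> S)"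
    proof
      fix v assume v: "v \<in> V \<inter> g -` S"
      then have "v = f (g v)" "g v \<in> U"
        using homeomorphism_apply2[OF hom] homeomorphism_image2[OF hom] by auto
      with v show "v \<in> f ` (U \<inter> S)" by blast
    qed
  qed
  then show ?thesis
    using continuous_on_open_vimage[OF V, of g] homeomorphism_cont2[OF hom] S by (auto simp: Int_commute)
qed

text \<open>Any other chart is reached through the given one: in one direction by \<open>G\<close>
  followed by a transition map, in the other by a transition map followed by the inverse of
  \<open>G\<close>.\<close>

lemma local_coordinates_in_chart:
  fixes A :: "('m::{t2_space,second_countable_topology}, 'n::finite) chart set"
    and G :: "'d::euclidean_space \<Rightarrow> real ^ 'n"
  assumes atlas: "smooth_atlas A" and chart: "(U, \<phi>) \<in> A"
    and G: "smooth_coordinates D G (\<phi> ` U)"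
  shows "local_coordinates A D (inv_into U \<phi> \<circ> G)"
proof -
  define i where "i = inv_into U \<phi>"
  define \<psi> where "\<psi> = i \<circ> G"
  have charts: "open V" "open (\<beta> ` V)" "homeomorphism V (\<beta> ` V) \<beta> (inv_into V \<beta>)" if "(V, \<beta>) \<in> A" for V \<beta>
    using atlas that unfolding smooth_atlas_def by blast+
  have trans: "smooth_on (\<beta> ` (V \<inter> V')) (\<beta>' \<circ> inv_into V \<beta>)" if "(V, \<beta>) \<in> A" "(V', \<beta>') \<in> A" for V \<beta> V' \<beta>'
    using atlas that unfolding smooth_atlas_def by blast
  note U = charts(1)[OF chart] and \<phi>U = charts(2)[OF chart] and hom = charts(3)[OF chart, folded i_def]
  obtain Y where D: "open D" and sG: "smooth_on D G" and GU: "G ` D \<subseteq> \<phi> ` U" and GD: "open (G ` D)"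
    and Y: "smooth_on (G ` D) Y" and YG: "\<And>d. d \<in> D \<Longrightarrow> Y (G d) = d"
    using G unfolding smooth_coordinates_def by blast
  have \<phi>\<psi>: "\<phi> (\<psi> d) = G d" and \<psi>U: "\<psi> d \<in> U" if "d \<in> D" for d
  proof -
    have d: "G d \<in> \<phi> ` U" using GU that by blast
    show "\<phi> (\<psi> d) = G d" unfolding \<psi>_def o_def by (rule homeomorphism_apply2[OF hom d])
    show "\<psi> d \<in> U" using homeomorphism_image2[OF hom] d unfolding \<psi>_def by auto
  qed
  have Y\<psi>: "Y (\<phi> (\<psi> d)) = d" if "d \<in> D" for d unfolding \<phi>\<psi>[OF that] by (rule YG[OF that])
  have inj: "inj_on \<psi> D" by (rule inj_on_inverseI[of _ "\<lambda>q. Y (\<phi> q)"]) (rule Y\<psi>)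
  have inv: "inv_into D \<psi> q = Y (\<phi> q)" if q: "q \<in> \<psi> ` D" for q
  proof -
    obtain d where "d \<in> D" "q = \<psi> d" using q by blast
    then show ?thesis by (simp add: inv_into_f_f[OF inj] Y\<psi>)
  qed
  have open_chart_preimage: "open (U \<inter> \<phi> -` (G ` D))"
    using continuous_on_open_vimage[OF U, of \<phi>] homeomorphism_cont1[OF hom] GD by (auto simp: Int_commute)
  have im: "\<psi> ` D = U \<inter> \<phi> -` (G ` D)"
  proof
    show "\<psi> ` D \<subseteq> U \<inter> \<phi> -` (G ` D)" using \<phi>\<psi> \<psi>U by auto
    show "U \<inter> \<phi> -` (G ` D) \<subseteq> \<psi> ` D"
    proof
      fix q assume q: "q \<in> U \<inter> \<phi> -` (G ` D)"
      then obtain d where d: "d \<in> D" "\<phi> q = G d" by blast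
      have "i (\<phi> q) = q" using homeomorphism_apply1[OF hom] q by blast
      then have "q = \<psi> d" unfolding d(2) \<psi>_def by simp
      then show "q \<in> \<psi> ` D" using d(1) by blast
    qed
  qed
  have open_im: "open (\<psi> ` D)" unfolding im by (rule open_chart_preimage)
  have cont\<psi>: "continuous_on D \<psi>"
    unfolding \<psi>_def
    by (rule continuous_on_compose[OF smooth_on_continuous[OF sG] continuous_on_subset[OF homeomorphism_cont2[OF hom] GU]])
  have "continuous_on (\<psi> ` D) (\<lambda>q. Y (\<phi> q))"
    by (rule continuous_on_compose2[OF smooth_on_continuous[OF Y] continuous_on_subset[OF homeomorphism_cont1[OF hom]]])
       (auto simp: im)
  then have cont_inv: "continuous_on (\<psi> ` D) (inv_into D \<psi>)"
    by (rule continuous_on_cong[THEN iffD1, rotated -1]) (simp_all add: inv)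
  have hom\<psi>: "homeomorphism D (\<psi> ` D) \<psi> (inv_into D \<psi>)"
    by (rule homeomorphismI[OF cont\<psi> cont_inv]) (auto simp: inv_into_f_f[OF inj])
  have "smooth_on (D \<inter> \<psi> -` V) (\<beta> \<circ> \<psi>) \<and> smooth_on (\<beta> ` (V \<inter> \<psi> ` D)) (inv_into D \<psi> \<circ> inv_into V \<beta>)"
    if V: "(V, \<beta>) \<in> A" for V \<beta>
  proof
    have 1: "open (D \<inter> \<psi> -` V)"
      using continuous_on_open_vimage[OF D, of \<psi>] cont\<psi> charts(1)[OF V] by (auto simp: Int_commute)
    have 2: "open (\<phi> ` (U \<inter> V))"
      by (rule homeomorphism_image_open[OF hom \<phi>U charts(1)[OF V]])
    have 3: "G d \<in> \<phi> ` (U \<inter> V)" if "d \<in> D \<inter> \<psi> -` V" for d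
    proof (rule image_eqI)
      show "G d = \<phi> (\<psi> d)" using \<phi>\<psi> that by simp
      show "\<psi> d \<in> U \<inter> V" using \<psi>U that by simp
    qed
    have "smooth_on (D \<inter> \<psi> -` V) (\<lambda>d. (\<beta> \<circ> i) (G d))"
      by (rule smooth_on_compose[OF 1 2 trans[OF chart V, folded i_def] smooth_on_subset[OF sG Int_lower1] 3])
    then show "smooth_on (D \<inter> \<psi> -` V) (\<beta> \<circ> \<psi>)" unfolding \<psi>_def o_def .
    let ?j = "inv_into V \<beta>"
    let ?Q = "\<beta> ` (V \<inter> \<psi> ` D)"
    have Q: "open ?Q" by (rule homeomorphism_image_open[OF charts(3)[OF V] charts(2)[OF V] open_im])
    have j: "?j z \<in> \<psi> ` D" if z: "z \<in> ?Q" for z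
    proof -
      obtain q where q: "q \<in> V" "q \<in> \<psi> ` D" "z = \<beta> q" using z by blast
      show ?thesis unfolding q(3) homeomorphism_apply1[OF charts(3)[OF V] q(1)] by (rule q(2))
    qed
    have sub: "?Q \<subseteq> \<beta> ` (V \<inter> U)" unfolding im by blast
    have "smooth_on ?Q (\<lambda>z. Y ((\<phi> \<circ> ?j) z))"
    proof (rule smooth_on_compose[OF Q GD Y smooth_on_subset[OF trans[OF V chart] sub]])
      fix z assume "z \<in> ?Q"
      then have "?j z \<in> \<psi> ` D" by (rule j)
      then show "(\<phi> \<circ> ?j) z \<in> G ` D" unfolding im by simp
    qed
    then show "smooth_on ?Q (inv_into D \<psi> \<circ> ?j)"
      by (rule smooth_on_open_cong[OF _ Q]) (simp add: inv[OF j])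
  qed
  then show ?thesis
    unfolding local_coordinates_def i_def[symmetric] \<psi>_def[symmetric]
    using D open_im hom\<psi> by blast
qed

text \<open>The three alternatives are a property of \<open>P\<close> alone, so that the affine maps
  of the successive normalisations can be composed once for all cases.\<close>

definition model_parametrization ::
  "real set \<Rightarrow> (real ^ 'k) set \<Rightarrow> (real \<times> (real ^ 'k) \<Rightarrow> real ^ ('k::finite) option option) \<Rightarrow> bool" where
  "model_parametrization I W P \<longleftrightarrow>
     (\<exists>\<epsilon> \<phi> \<gamma>\<^sub>1 \<gamma>\<^sub>2 c. quadric_immersion \<epsilon> W \<phi> \<and> smooth_on I \<gamma>\<^sub>1 \<and> smooth_on I \<gamma>\<^sub>2 \<and> c \<noteq> 0 \<and>
        (\<forall>t\<in>I. c * deriv \<gamma>\<^sub>1 t ^ (CARD('k option) + 2) * \<gamma>\<^sub>1 t ^ (CARD('k option) - 1) =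
           deriv \<gamma>\<^sub>2 t ^ (CARD('k option) - 1) *
           (deriv (deriv \<gamma>\<^sub>1) t * deriv \<gamma>\<^sub>2 t - deriv (deriv \<gamma>\<^sub>2) t * deriv \<gamma>\<^sub>1 t)) \<and>
        (\<forall>t u. P (t, u) = snoc (\<gamma>\<^sub>1 t *\<^sub>R \<phi> u) (\<gamma>\<^sub>2 t))) \<or>
     (\<exists>c. c \<noteq> 0 \<and> (\<forall>t u. P (t, u) =
        snoc (snoc (t *\<^sub>R u) (t * ((norm u)\<^sup>2 / 2) + c * t ^ (CARD('k option) + 1))) t)) \<or>
     (\<exists>c. c \<noteq> 0 \<and> (\<forall>t u. P (t, u) =
        snoc (snoc u ((norm u)\<^sup>2 / 2 + c * t ^ CARD('k option))) (t ^ (CARD('k option) + 1))))"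

lemma (in hessian_pde) open_subset:
  assumes "open S" "S \<subseteq> \<Omega>"
  shows "hessian_pde S \<phi> n"
proof (rule hessian_pde.intro[OF n_def assms(1) smooth_on_subset[OF smooth assms(2)] _ _ card])
  fix x assume "x \<in> S"
  then have x: "x \<in> \<Omega>" using assms(2) by blast
  show "posdef_form (d2 \<phi> x)" "axial_jet (d2 \<phi> x) (d3 \<phi> x)" by (rule pos[OF x], rule jet[OF x])
qed

text \<open>The case distinction is made at \<open>p\<close> alone. A nonzero \<open>\<mu>\<close>
  persists on a ball by continuity, \<open>\<mu> p = 0\<close> spreads by
  \<open>\<mu>_vanishes\<close>, and the leaf theorems compare \<open>N\<close> with
  \<open>\<mu>\<close> only at \<open>p\<close>.\<close>

lemma graph_model:
  fixes \<Omega> :: "(real ^ ('k::finite) option) set"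
  assumes pde: "hessian_pde \<Omega> \<phi> n" and p: "p \<in> \<Omega>"
  obtains I W X L b and P :: "real \<times> (real ^ 'k) \<Rightarrow> real ^ 'k option option"
    where "open I" "is_interval I" "open W" "smooth_coordinates (I \<times> W) X \<Omega>" "p \<in> X ` (I \<times> W)"
    "linear L" "bij L" "model_parametrization I W P"
    "\<And>t u. t \<in> I \<Longrightarrow> u \<in> W \<Longrightarrow> snoc (X (t, u)) (\<phi> (X (t, u))) = L (P (t, u)) + b"
proof -
  let ?m = "CARD('k option)"
  interpret hessian_pde \<Omega> \<phi> n by (rule pde)
  have coords: "smooth_coordinates D X \<Omega>" if "smooth_coordinates D X S" "S \<subseteq> \<Omega>"
    for D :: "(real \<times> (real ^ 'k)) set" and X S
    using that unfolding smooth_coordinates_def by blast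
  obtain E where E: "orthonormal_frame (h p) E" and ZE: "Z p = sqrt (N p) *\<^sub>R E None"
    and \<alpha>0: "\<And>i. i \<noteq> None \<Longrightarrow> \<alpha> p (E i) = 0"
    by (rule adapted_frame_at[OF p, where ?i0.0=None]) (rule that)
  have \<alpha>E: "\<alpha> p (E (Some j)) = 0" for j by (rule \<alpha>0) simp
  have Enorm: "h p (E i) (E i) = 1" for i
    using orthonormal_frame.orthonormal[OF E, of i i] by simp
  show ?thesis
  proof (cases "\<mu> p = 0")
    case \<mu>p: False
    \<comment> \<open>Any frame vector other than \<open>E None\<close> serves here.\<close>
    define v0 where "v0 = E (Some undefined)"
    have v0: "h p v0 v0 = 1" "\<alpha> p v0 = 0" unfolding v0_def by (rule Enorm, rule \<alpha>E)
    \<comment> \<open>This is the future factor \<open>\<kappa>\<close>; it is 1 at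
      \<open>p\<close>, hence positive on a ball.\<close>
    define q where "q x = h x v0 v0 - \<alpha> x v0 * \<alpha> x v0 / \<mu> x" for x
    let ?S = "{x \<in> \<Omega>. \<mu> x \<noteq> 0}"
    have S: "open ?S" by (rule open_nonzero_set[OF open_dom smooth_\<mu>])
    have S\<Omega>: "?S \<subseteq> \<Omega>" by blast
    have "smooth_on ?S q"
      unfolding q_def[abs_def]
      by (intro smooth_on_diff smooth_on_divide smooth_on_mult S smooth_on_subset[OF smooth_h S\<Omega>]
          smooth_on_subset[OF smooth_\<alpha> S\<Omega>] smooth_on_subset[OF smooth_\<mu> S\<Omega>]) simp
    then have T: "open (?S \<inter> q -` {0<..})"
      by (rule continuous_open_preimage[OF smooth_on_continuous S open_greaterThan])
    have pT: "p \<in> ?S \<inter> q -` {0<..}" using p \<mu>p by (simp add: q_def v0)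
    obtain d where d: "d > 0" "ball p d \<subseteq> ?S \<inter> q -` {0<..}" by (rule openE[OF T pT])
    have B: "ball p d \<subseteq> \<Omega>" using d(2) by blast
    have leaves: "quadric_leaves (ball p d) \<phi> n p E v0"
    proof (rule quadric_leaves.intro[OF open_subset[OF open_ball B]],
        rule quadric_leaves_axioms.intro[OF convex_ball _ _ E ZE \<alpha>E v0])
      show "p \<in> ball p d" using d(1) by simp
      show "\<mu> x \<noteq> 0" "h x v0 v0 - \<alpha> x v0 * \<alpha> x v0 / \<mu> x > 0" if "x \<in> ball p d" for x
        using d(2) that unfolding q_def by auto
    qed
    show ?thesis
    proof (cases "N p = \<mu> p")
      case True
      obtain I W X c L b where IW: "open I" "is_interval I" "open (W :: (real ^ 'k) set)"
        and X: "smooth_coordinates (I \<times> W) X (ball p d)" "p \<in> X ` (I \<times> W)"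
        and L: "linear L" "bij L" and c: "c \<noteq> (0::real)"
        and eq: "\<forall>t\<in>I. \<forall>u\<in>W. snoc (X (t, u)) (\<phi> (X (t, u))) =
          L (snoc (snoc u ((norm u)\<^sup>2 / 2 + c * t ^ ?m)) (t ^ (?m + 1))) + b"
        using quadric_leaves.parabolic_leaves[OF leaves True] by (elim exE conjE) (rule that)
      define P where "P d = snoc (snoc (snd d) ((norm (snd d))\<^sup>2 / 2 + c * fst d ^ ?m)) (fst d ^ (?m + 1))"
        for d :: "real \<times> (real ^ 'k)"
      have P: "P (t, u) = snoc (snoc u ((norm u)\<^sup>2 / 2 + c * t ^ ?m)) (t ^ (?m + 1))" for t u
        unfolding P_def fst_conv snd_conv ..
      show ?thesis
      proof (rule that[OF IW coords[OF X(1) B] X(2) L])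
        show "model_parametrization I W P"
          unfolding model_parametrization_def P using c by blast
        show "snoc (X (t, u)) (\<phi> (X (t, u))) = L (P (t, u)) + b" if "t \<in> I" "u \<in> W" for t u
          unfolding P by (rule eq[rule_format, OF that])
      qed
    next
      case False
      obtain I W X \<epsilon> \<psi> \<gamma>\<^sub>2 c L b where IW: "open I" "is_interval I" "open (W :: (real ^ 'k) set)"
        and X: "smooth_coordinates (I \<times> W) X (ball p d)" "p \<in> X ` (I \<times> W)"
        and L: "linear L" "bij L"
        and \<psi>: "quadric_immersion \<epsilon> W \<psi>" and sm: "smooth_on I (\<lambda>t :: real. t)" "smooth_on I \<gamma>\<^sub>2"
        and c: "c \<noteq> 0"
        and ode: "\<forall>t\<in>I. c * deriv (\<lambda>t. t) t ^ (?m + 2) * t ^ (?m - 1) = deriv \<gamma>\<^sub>2 t ^ (?m - 1) *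
          (deriv (deriv (\<lambda>t. t)) t * deriv \<gamma>\<^sub>2 t - deriv (deriv \<gamma>\<^sub>2) t * deriv (\<lambda>t. t) t)"
        and eq: "\<forall>t\<in>I. \<forall>u\<in>W. snoc (X (t, u)) (\<phi> (X (t, u))) = L (snoc (t *\<^sub>R \<psi> u) (\<gamma>\<^sub>2 t)) + b"
        using quadric_leaves.central_leaves[OF leaves False] by (elim exE conjE) (rule that)
      define P where "P d = snoc (fst d *\<^sub>R \<psi> (snd d)) (\<gamma>\<^sub>2 (fst d))" for d :: "real \<times> (real ^ 'k)"
      have P: "P (t, u) = snoc (t *\<^sub>R \<psi> u) (\<gamma>\<^sub>2 t)" for t u
        unfolding P_def fst_conv snd_conv ..
      show ?thesis
      proof (rule that[OF IW coords[OF X(1) B] X(2) L])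
        show "model_parametrization I W P"
          unfolding model_parametrization_def
          by (rule disjI1, rule exI[of _ \<epsilon>], rule exI[of _ \<psi>], rule exI[of _ "\<lambda>t. t"], rule exI[of _ \<gamma>\<^sub>2], rule exI[of _ c])
             (intro conjI \<psi> sm c ode allI P)
        show "snoc (X (t, u)) (\<phi> (X (t, u))) = L (P (t, u)) + b" if "t \<in> I" "u \<in> W" for t u
          unfolding P by (rule eq[rule_format, OF that])
      qed
    qed
  next
    case \<mu>p: True
    have Np: "N p > 0" by (rule Z_props(1)[OF p])
    have "\<alpha> p (E None) = sqrt (N p) * h p (E None) (E None)"
      unfolding \<alpha>_def ZE using posdef_form.left_simps(4)[OF pos[OF p]] by simp
    then have \<alpha>p: "\<alpha> p (E None) > 0" using Np by (simp add: Enorm)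
    have T: "open (\<Omega> \<inter> (\<lambda>x. \<alpha> x (E None)) -` {0<..})"
      by (rule continuous_open_preimage[OF smooth_on_continuous[OF smooth_\<alpha>] open_dom open_greaterThan])
    have pT: "p \<in> \<Omega> \<inter> (\<lambda>x. \<alpha> x (E None)) -` {0<..}" using p \<alpha>p by simp
    obtain d where d: "d > 0" "ball p d \<subseteq> \<Omega> \<inter> (\<lambda>x. \<alpha> x (E None)) -` {0<..}" by (rule openE[OF T pT])
    have B: "ball p d \<subseteq> \<Omega>" using d(2) by blast
    have leaves: "conical_leaves (ball p d) \<phi> n p E"
    proof (rule conical_leaves.intro[OF open_subset[OF open_ball B]],
        rule conical_leaves_axioms.intro[OF convex_ball _ _ E ZE \<alpha>E])
      show "p \<in> ball p d" using d(1) by simp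
      show "\<mu> x = 0" if "x \<in> ball p d" for x by (rule \<mu>_vanishes[OF B that \<mu>p])
      show "\<alpha> x (E None) > 0" if "x \<in> ball p d" for x using d(2) that by auto
    qed
    obtain I W X c L b where IW: "open I" "is_interval I" "open (W :: (real ^ 'k) set)"
      and X: "smooth_coordinates (I \<times> W) X (ball p d)" "p \<in> X ` (I \<times> W)"
      and L: "linear L" "bij L" and c: "c \<noteq> (0::real)"
      and eq: "\<forall>t\<in>I. \<forall>u\<in>W. snoc (X (t, u)) (\<phi> (X (t, u))) =
        L (snoc (snoc (t *\<^sub>R u) (t * ((norm u)\<^sup>2 / 2) + c * t ^ (?m + 1))) t) + b"
      using conical_leaves.conical_leaves[OF leaves] by (elim exE conjE) (rule that)
    define P where "P d = snoc (snoc (fst d *\<^sub>R snd d) (fst d * ((norm (snd d))\<^sup>2 / 2) + c * fst d ^ (?m + 1))) (fst d)"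
      for d :: "real \<times> (real ^ 'k)"
    have P: "P (t, u) = snoc (snoc (t *\<^sub>R u) (t * ((norm u)\<^sup>2 / 2) + c * t ^ (?m + 1))) t" for t u
      unfolding P_def fst_conv snd_conv ..
    show ?thesis
    proof (rule that[OF IW coords[OF X(1) B] X(2) L])
      show "model_parametrization I W P"
        unfolding model_parametrization_def P using c by blast
      show "snoc (X (t, u)) (\<phi> (X (t, u))) = L (P (t, u)) + b" if "t \<in> I" "u \<in> W" for t u
        unfolding P by (rule eq[rule_format, OF that])
    qed
  qed
qed

text \<open>One chart around \<open>p\<close> is used to write the hypersurface as a graph, which
  \<open>graph_model\<close> brings to normal form; the congruence is the composition of the two
  affine maps.\<close>

theorem local_model:
  fixes A :: "('m::{t2_space,second_countable_topology}, 'k::finite option) chart set"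
    and F \<xi> :: "'m \<Rightarrow> real ^ 'k option option"
  assumes card: "CARD('k option) \<ge> 3" and hyp: "immersed_hypersurface A F"
    and normal: "affine_normal A F \<xi>" and convex: "strictly_locally_convex A F \<xi>"
    and improper: "improper_affine_sphere A F \<xi>" and symm: "pointwise_SO_symmetry A F \<xi>"
    and nonzero: "r_nowhere_zero A F \<xi>"
  obtains I W \<psi> L b and P :: "real \<times> (real ^ 'k) \<Rightarrow> real ^ 'k option option"
    where "open I" "is_interval I" "open W" "local_coordinates A (I \<times> W) \<psi>" "p \<in> \<psi> ` (I \<times> W)"
    "linear L" "bij L" "model_parametrization I W P"
    "\<And>t u. t \<in> I \<Longrightarrow> u \<in> W \<Longrightarrow> F (\<psi> (t, u)) = L (P (t, u)) + b"
proof -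
  let ?m = "CARD('k option)"
  have atlas: "smooth_atlas A" and
    imm: "immersion_on (\<phi> ` U) (F \<circ> inv_into U \<phi>)" if "(U, \<phi>) \<in> A" for U \<phi>
    using hyp that unfolding immersed_hypersurface_def by blast+
  have "(\<Union>(U, \<phi>)\<in>A. U) = UNIV"
    using hyp unfolding immersed_hypersurface_def smooth_atlas_def by (elim conjE)
  then have "p \<in> (\<Union>(U, \<phi>)\<in>A. U)" by simp
  then obtain U \<phi> where chart: "(U, \<phi>) \<in> A" and pU: "p \<in> U" by blast
  define i where "i = inv_into U \<phi>"
  have U: "open (\<phi> ` U)" "homeomorphism U (\<phi> ` U) \<phi> i"
    using atlas[OF chart] chart unfolding smooth_atlas_def i_def by blast+
  interpret C: convex_improper_chart "\<phi> ` U" "F \<circ> i" "\<xi> \<circ> i"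
  proof
    show "open (\<phi> ` U)" by (rule U(1))
    show "immersion_on (\<phi> ` U) (F \<circ> i)" unfolding i_def by (rule imm[OF chart])
    show "affine_normal_on (\<phi> ` U) (F \<circ> i) (\<xi> \<circ> i)"
      using normal chart unfolding affine_normal_def i_def by blast
    fix x X assume x: "x \<in> \<phi> ` U"
    show "affine_form (F \<circ> i) (\<xi> \<circ> i) x X X > 0" if "X \<noteq> 0"
      using convex chart x that unfolding strictly_locally_convex_def i_def by blast
    show "shape_op (F \<circ> i) (\<xi> \<circ> i) x X = 0"
      using improper chart x unfolding improper_affine_sphere_def i_def by blast
  qed
  have axis: "\<exists>e. symmetry_axis (F \<circ> i) (\<xi> \<circ> i) x e" if "x \<in> \<phi> ` U" for x
    using symm chart that unfolding pointwise_SO_symmetry_def i_def by blast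
  have r: "r_at (F \<circ> i) (\<xi> \<circ> i) x e \<noteq> 0" if "x \<in> \<phi> ` U" "symmetry_axis (F \<circ> i) (\<xi> \<circ> i) x e" for x e
    using nonzero chart that unfolding r_nowhere_zero_def i_def by blast
  obtain U' V :: "(real ^ 'k option) set" and y g f and Lg :: "real ^ 'k option option \<Rightarrow> real ^ 'k option option"
    where U': "open U'" "U' \<subseteq> \<phi> ` U" "\<phi> p \<in> U'" and V: "open V" and hom: "homeomorphism U' V y g"
    and y: "smooth_on U' y" and g: "smooth_on V g" and f: "smooth_on V f" and Lg: "linear Lg" "bij Lg"
    and graph: "\<And>z. z \<in> V \<Longrightarrow> (F \<circ> i) (g z) = Lg (snoc z (f z))"
    and pos: "\<And>z. z \<in> V \<Longrightarrow> posdef_form (d2 f z)" and jet: "\<And>z. z \<in> V \<Longrightarrow> axial_jet (d2 f z) (d3 f z)"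
    by (rule C.local_graph[OF card imageI[OF pU] axis r]) (assumption, assumption, assumption, rule that)
  have pde: "hessian_pde V f (real ?m)"
    by (rule hessian_pde.intro[OF refl V f pos jet card])
  have yV: "y (\<phi> p) \<in> V" using homeomorphism_image1[OF hom] U'(3) by blast
  obtain I W X L b and P :: "real \<times> (real ^ 'k) \<Rightarrow> real ^ 'k option option"
    where IW: "open I" "is_interval I" "open W" and X: "smooth_coordinates (I \<times> W) X V" "y (\<phi> p) \<in> X ` (I \<times> W)"
    and L: "linear L" "bij L" and model: "model_parametrization I W P"
    and eq: "\<And>t u. t \<in> I \<Longrightarrow> u \<in> W \<Longrightarrow> snoc (X (t, u)) (f (X (t, u))) = L (P (t, u)) + b"
    by (rule graph_model[OF pde yV]) (rule that)
  have XV: "X d \<in> V" if "d \<in> I \<times> W" for d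
    using X(1) that unfolding smooth_coordinates_def by blast
  define \<psi> where "\<psi> = i \<circ> (\<lambda>d. g (X d))"
  have \<psi>: "local_coordinates A (I \<times> W) \<psi>"
    unfolding \<psi>_def i_def
    by (rule local_coordinates_in_chart[OF atlas[OF chart] chart
        smooth_coordinates_compose[OF X(1) V U'(1,2) hom y g]])
  have p\<psi>: "p \<in> \<psi> ` (I \<times> W)"
  proof -
    obtain d where d: "d \<in> I \<times> W" "y (\<phi> p) = X d" using X(2) by blast
    have "p = i (g (y (\<phi> p)))"
      using homeomorphism_apply1[OF hom U'(3)] homeomorphism_apply1[OF U(2) pU] by simp
    then have "p = \<psi> d" unfolding d(2) \<psi>_def by simp
    then show ?thesis using d(1) by blast
  qed
  let ?L = "Lg \<circ> L"
  have L': "linear ?L" "bij ?L"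
    by (rule linear_compose[OF L(1) Lg(1)], rule bij_comp[OF L(2) Lg(2)])
  have F: "F (\<psi> (t, u)) = ?L (P (t, u)) + Lg b" if t: "t \<in> I" and u: "u \<in> W" for t u
  proof -
    have "F (\<psi> (t, u)) = Lg (snoc (X (t, u)) (f (X (t, u))))"
      using graph[of "X (t, u)"] XV[of "(t, u)"] t u unfolding \<psi>_def by simp
    then show ?thesis unfolding eq[OF t u] linear_add[OF Lg(1)] by simp
  qed
  show ?thesis by (rule that[OF IW \<psi> p\<psi> L' model F])
qed

theorem theorem4p1:
  fixes A :: "('m::{t2_space,second_countable_topology}, 'k::finite option) chart set"
    and F \<xi> :: "'m \<Rightarrow> real ^ 'k option option"
    and n :: nat
  assumes n_def: "n = CARD('k option)" and n_ge: "n \<ge> 3"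
    and "immersed_hypersurface A F"
    and "affine_normal A F \<xi>"
    and "strictly_locally_convex A F \<xi>"
    and "improper_affine_sphere A F \<xi>"
    and "pointwise_SO_symmetry A F \<xi>"
    and "r_nowhere_zero A F \<xi>"
  shows "\<forall>p. \<exists>(I :: real set) (W :: (real ^ 'k) set) \<psi> L b.
    open I \<and> is_interval I \<and> open W \<and>
    local_coordinates A (I \<times> W) \<psi> \<and> p \<in> \<psi> ` (I \<times> W) \<and>
    linear L \<and> bij L \<and>
    ((\<exists>\<epsilon> \<phi> \<gamma>\<^sub>1 \<gamma>\<^sub>2 c. quadric_immersion \<epsilon> W \<phi> \<and> smooth_on I \<gamma>\<^sub>1 \<and> smooth_on I \<gamma>\<^sub>2 \<and> c \<noteq> 0 \<and>
        (\<forall>t\<in>I. c * deriv \<gamma>\<^sub>1 t ^ (n + 2) * \<gamma>\<^sub>1 t ^ (n - 1) =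
           deriv \<gamma>\<^sub>2 t ^ (n - 1) *
           (deriv (deriv \<gamma>\<^sub>1) t * deriv \<gamma>\<^sub>2 t - deriv (deriv \<gamma>\<^sub>2) t * deriv \<gamma>\<^sub>1 t)) \<and>
        (\<forall>t\<in>I. \<forall>u\<in>W. F (\<psi> (t, u)) = L (snoc (\<gamma>\<^sub>1 t *\<^sub>R \<phi> u) (\<gamma>\<^sub>2 t)) + b)) \<or>
     (\<exists>\<gamma>\<^sub>1 \<gamma>\<^sub>2 c. c \<noteq> 0 \<and> (\<forall>t\<in>I. \<gamma>\<^sub>1 t = t \<and> \<gamma>\<^sub>2 t = c * t ^ (n + 1)) \<and>
        (\<forall>t\<in>I. \<forall>u\<in>W. F (\<psi> (t, u)) =
           L (snoc (snoc (\<gamma>\<^sub>1 t *\<^sub>R u) (\<gamma>\<^sub>1 t * ((norm u)\<^sup>2 / 2) + \<gamma>\<^sub>2 t)) (\<gamma>\<^sub>1 t)) + b)) \<or>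
     (\<exists>\<gamma>\<^sub>1 \<gamma>\<^sub>2 c. c \<noteq> 0 \<and> (\<forall>t\<in>I. \<gamma>\<^sub>1 t = c * t ^ n \<and> \<gamma>\<^sub>2 t = t ^ (n + 1)) \<and>
        (\<forall>t\<in>I. \<forall>u\<in>W. F (\<psi> (t, u)) =
           L (snoc (snoc u ((norm u)\<^sup>2 / 2 + \<gamma>\<^sub>1 t)) (\<gamma>\<^sub>2 t)) + b)))"
proof (rule allI, goal_cases)
  case (1 p)
  have card: "CARD('k option) \<ge> 3" using n_ge n_def by (simp only:)
  obtain I W \<psi> L b and P :: "real \<times> (real ^ 'k) \<Rightarrow> real ^ 'k option option"
    where IW: "open I" "is_interval I" "open W" and \<psi>: "local_coordinates A (I \<times> W) \<psi>" "p \<in> \<psi> ` (I \<times> W)"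
    and L: "linear L" "bij L" and model: "model_parametrization I W P"
    and F: "\<And>t u. t \<in> I \<Longrightarrow> u \<in> W \<Longrightarrow> F (\<psi> (t, u)) = L (P (t, u)) + b"
    by (rule local_model[OF card assms(3-8)]) (rule that)
  show ?case
    using model unfolding model_parametrization_def n_def[symmetric]
  proof (elim disjE exE conjE)
    fix \<epsilon> :: real and \<phi> :: "real ^ 'k \<Rightarrow> real ^ 'k option" and \<gamma>\<^sub>1 \<gamma>\<^sub>2 :: "real \<Rightarrow> real" and c :: real
    assume a: "quadric_immersion \<epsilon> W \<phi>" "smooth_on I \<gamma>\<^sub>1" "smooth_on I \<gamma>\<^sub>2" "c \<noteq> 0"
      "\<forall>t\<in>I. c * deriv \<gamma>\<^sub>1 t ^ (n + 2) * \<gamma>\<^sub>1 t ^ (n - 1) = deriv \<gamma>\<^sub>2 t ^ (n - 1) *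
         (deriv (deriv \<gamma>\<^sub>1) t * deriv \<gamma>\<^sub>2 t - deriv (deriv \<gamma>\<^sub>2) t * deriv \<gamma>\<^sub>1 t)"
      and P: "\<forall>t u. P (t, u) = snoc (\<gamma>\<^sub>1 t *\<^sub>R \<phi> u) (\<gamma>\<^sub>2 t)"
    have F': "\<forall>t\<in>I. \<forall>u\<in>W. F (\<psi> (t, u)) = L (snoc (\<gamma>\<^sub>1 t *\<^sub>R \<phi> u) (\<gamma>\<^sub>2 t)) + b"
      using F unfolding P[rule_format] by blast
    show ?case
      by (rule exI[of _ I], rule exI[of _ W], rule exI[of _ \<psi>], rule exI[of _ L], rule exI[of _ b],
          intro conjI IW \<psi> L, rule disjI1, rule exI[of _ \<epsilon>], rule exI[of _ \<phi>], rule exI[of _ \<gamma>\<^sub>1],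
          rule exI[of _ \<gamma>\<^sub>2], rule exI[of _ c])
         (intro conjI a F')
  next
    fix c :: real
    assume c: "c \<noteq> 0" and P: "\<forall>t u. P (t, u) =
      snoc (snoc (t *\<^sub>R u) (t * ((norm u)\<^sup>2 / 2) + c * t ^ (n + 1))) t"
    have F': "\<forall>t\<in>I. \<forall>u\<in>W. F (\<psi> (t, u)) =
        L (snoc (snoc (t *\<^sub>R u) (t * ((norm u)\<^sup>2 / 2) + c * t ^ (n + 1))) t) + b"
      using F unfolding P[rule_format] by blast
    show ?case
      by (rule exI[of _ I], rule exI[of _ W], rule exI[of _ \<psi>], rule exI[of _ L], rule exI[of _ b],
          intro conjI IW \<psi> L, rule disjI2, rule disjI1, rule exI[of _ "\<lambda>t. t"],
          rule exI[of _ "\<lambda>t. c * t ^ (n + 1)"], rule exI[of _ c])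
         (intro conjI ballI refl c F'[rule_format])
  next
    fix c :: real
    assume c: "c \<noteq> 0" and P: "\<forall>t u. P (t, u) =
      snoc (snoc u ((norm u)\<^sup>2 / 2 + c * t ^ n)) (t ^ (n + 1))"
    have F': "\<forall>t\<in>I. \<forall>u\<in>W. F (\<psi> (t, u)) =
        L (snoc (snoc u ((norm u)\<^sup>2 / 2 + c * t ^ n)) (t ^ (n + 1))) + b"
      using F unfolding P[rule_format] by blast
    show ?case
      by (rule exI[of _ I], rule exI[of _ W], rule exI[of _ \<psi>], rule exI[of _ L], rule exI[of _ b],
          intro conjI IW \<psi> L, rule disjI2, rule disjI2, rule exI[of _ "\<lambda>t. c * t ^ n"],
          rule exI[of _ "\<lambda>t. t ^ (n + 1)"], rule exI[of _ c])
         (intro conjI ballI refl c F'[rule_format])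
  qed
qed

end
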